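(* The extension $A(S^7_q)\subset A(Sp_q(2))$ is a faithfully flat $A(Sp_q(1))$-Hopf-Galois extension, with respect to the right coaction $\Delta_R:A(Sp_q(2))\to A(Sp_q(2))\otimes A(Sp_q(1))$, $\Delta_R(T_i^{\,j})=\sum_kT_i^{\,k}\otimes {T'}_k^{\,j}$.
   Context: Fix $q\in\mathbb{R}$, $q\neq 0$; algebras are unital and over $\mathbb{C}$. For $i\in\{1,2,3,4\}$ put $i'=5-i$, $(\varepsilon_1,\varepsilon_2,\varepsilon_3,\varepsilon_4)=(1,1,-1,-1)$, $(\rho_1,\rho_2,\rho_3,\rho_4)=(2,1,-1,-2)$. Let $e_i^{\,j}\in M_4(\mathbb{C})$ be the matrix unit with $1$ in row $i$, column $j$, and let $$R=q\sum_{i}e_i^{\,i}\otimes e_i^{\,i}+\sum_{i\neq j,j'}e_i^{\,i}\otimes e_j^{\,j}+q^{-1}\sum_i e_{i'}^{\,i'}\otimes e_i^{\,i}+(q-q^{-1})\sum_{i>j}e_i^{\,j}\otimes e_j^{\,i}-(q-q^{-1})\sum_{i>j}q^{\rho_i-\rho_j}\varepsilon_i\varepsilon_j\,e_i^{\,j}\otimes e_{i'}^{\,j'},$$ with $i,j$ ranging over $1,\dots,4$. Let $C$ be the matrix $C_i^{\,j}=q^{\rho_j}\varepsilon_i\delta_{ij'}$. $A(Sp_q(2))$ is the algebra generated by the entries $T_i^{\,j}$ (row $i$, column $j$, $1\le i,j\le 4$) of a matrix $T$ with relations $R\,T_1T_2=T_2T_1R$ (where $T_1=T\otimes 1$, $T_2=1\otimes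 T$), and $TCT^tC^{-1}=CT^tC^{-1}T=1$. It is a Hopf $*$-algebra with $\Delta(T_i^{\,j})=\sum_kT_i^{\,k}\otimes T_k^{\,j}$, $\varepsilon(T_i^{\,j})=\delta_{ij}$, $S(T)=CT^tC^{-1}$, i.e. $S(T)_i^{\,j}=-q^{\rho_{i'}+\rho_j}\varepsilon_i\varepsilon_{j'}T_{j'}^{\,i'}$, and antilinear anti-involution (denoted by a bar) $\overline{T}=S(T)^t$, i.e. $\overline{T_i^{\,j}}=S(T)_j^{\,i}$. $A(S^7_q)$ is the subalgebra of $A(Sp_q(2))$ generated by $x_i=T_i^{\,4}$ and $\bar x^i=\overline{x_i}=S(T)_4^{\,i}=q^{2+\rho_i}\varepsilon_{i'}T_{i'}^{\,1}$, $i=1,\dots,4$. Let $I_q\subset A(Sp_q(2))$ be the two-sided $*$-ideal (it is a Hopf ideal) generated by $T_1^{\,1}-1$, $T_4^{\,4}-1$, $T_1^{\,2}$, $T_1^{\,3}$, $T_1^{\,4}$, $T_2^{\,1}$, $T_2^{\,4}$, $T_3^{\,1}$, $T_3^{\,4}$, $T_4^{\,1}$, $T_4^{\,2}$, $T_4^{\,3}$. Here $A(Sp_q(1))\cong A(SU_{q^2}(2))$ is identified with the quotient Hopf algebra $A(Sp_q(2))/I_q$, and $T'=({T'}_i^{\,j})$ is the matrix of classes of the $T_i^{\,j}$ in this quotient; writing $\alpha={T'}_2^{\,2}$, $\gamma={T'}_3^{\,2}$, $$T'=\begin{pmatrix}1&0&0&0\\0&\alpha&-q^2\bar\gamma&0\\0&\gamma&\bar\alpha&0\\0&0&0&1\end{pmatrix}.$$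 Hopf-Galois extension: let $H$ be a Hopf algebra, $P$ a right $H$-comodule algebra with coaction $\Delta_R(p)=p_{(0)}\otimes p_{(1)}$, and $B=\{p\in P:\Delta_R(p)=p\otimes1\}$ its subalgebra of coinvariants. The extension $B\subseteq P$ is $H$-Hopf-Galois if the canonical map $\chi:P\otimes_BP\to P\otimes H$, $\chi(p'\otimes_Bp)=p'p_{(0)}\otimes p_{(1)}$, is bijective. It is faithfully flat if $P$ is faithfully flat as a $B$-module. *)

theory Defs
  imports "HOL-Algebra.Algebra" "HOL-Algebra.Algebraic_Closure_Type" "HOL-Library.Poly_Mapping" Complex_Main
begin

section \<open>Complex algebras\<close>

definition complex_algebra :: "(complex, complex) module" where
  "complex_algebra = ring.extend (ring_of_type_algebra :: complex ring) (module.fields (*))"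

text \<open>The locale \<open>algebra\<close> of the library is for commutative algebras.\<close>

definition unital_algebra :: "(complex, 'a) module \<Rightarrow> bool" where
  "unital_algebra A \<longleftrightarrow> module complex_algebra A \<and> ring A \<and>
     (\<forall>c. \<forall>x\<in>carrier A. \<forall>y\<in>carrier A.
        (c \<odot>\<^bsub>A\<^esub> x) \<otimes>\<^bsub>A\<^esub> y = c \<odot>\<^bsub>A\<^esub> (x \<otimes>\<^bsub>A\<^esub> y) \<and>
        x \<otimes>\<^bsub>A\<^esub> (c \<odot>\<^bsub>A\<^esub> y) = c \<odot>\<^bsub>A\<^esub> (x \<otimes>\<^bsub>A\<^esub> y))"

definition linear_maps :: "('r, 'a) module \<Rightarrow> ('r, 'b) module \<Rightarrow> 'r set \<Rightarrow> ('a \<Rightarrow> 'b) set" where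
  "linear_maps M N K = {f \<in> hom (add_monoid M) (add_monoid N).
     \<forall>c\<in>K. \<forall>x\<in>carrier M. f (c \<odot>\<^bsub>M\<^esub> x) = c \<odot>\<^bsub>N\<^esub> f x}"

definition algebra_maps :: "(complex, 'a) module \<Rightarrow> (complex, 'b) module \<Rightarrow> ('a \<Rightarrow> 'b) set" where
  "algebra_maps A B = ring_hom A B \<inter> linear_maps A B UNIV"

definition generated_subalgebra :: "(complex, 'a) module \<Rightarrow> 'a set \<Rightarrow> 'a set" where
  "generated_subalgebra A S =
     \<Inter>{V. subring V A \<and> (\<forall>c. \<forall>x\<in>V. c \<odot>\<^bsub>A\<^esub> x \<in> V) \<and> S \<subseteq> V}"

text \<open>A map \<open>h\<close> that is constant on the cosets of an ideal (or a subgroup) induces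
  \<open>quot_lift h\<close> on the quotient.\<close>

definition quot_lift :: "('a \<Rightarrow> 'b) \<Rightarrow> 'a set \<Rightarrow> 'b" where
  "quot_lift h U = the_elem (h ` U)"

definition quotient_algebra :: "(complex, 'a) module \<Rightarrow> 'a set \<Rightarrow> (complex, 'a set) module" where
  "quotient_algebra A I =
     ring.extend (A Quot I) (module.fields (\<lambda>c. quot_lift (\<lambda>x. I +>\<^bsub>A\<^esub> (c \<odot>\<^bsub>A\<^esub> x))))"

definition star_ideal :: "(complex, 'a) module \<Rightarrow> ('a \<Rightarrow> 'a) \<Rightarrow> 'a set \<Rightarrow> 'a set" where
  "star_ideal A star S = \<Inter>{J. ideal J A \<and> star ` J \<subseteq> J \<and> S \<subseteq> J}"


section \<open>Free algebras\<close>

text \<open>Words under concatenation, written additively, so that the convolution product of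
  \<^theory>\<open>HOL-Library.Poly_Mapping\<close> is the product of noncommutative polynomials.\<close>

datatype 'g word = Word (letters: "'g list")

instantiation word :: (type) monoid_add
begin
definition "0 = Word []"
definition "v + w = Word (letters v @ letters w)"
instance by standard (simp_all add: zero_word_def plus_word_def)
end

type_synonym 'g ncpoly = "'g word \<Rightarrow>\<^sub>0 complex"

definition nc_const :: "complex \<Rightarrow> 'g ncpoly" where
  "nc_const c = Poly_Mapping.single 0 c"

definition nc_gen :: "'g \<Rightarrow> 'g ncpoly" where
  "nc_gen g = Poly_Mapping.single (Word [g]) 1"

definition free_algebra :: "'g set \<Rightarrow> (complex, 'g ncpoly) module" where
  "free_algebra S =
     \<lparr>carrier = {f. \<forall>w\<in>Poly_Mapping.keys f. set (letters w) \<subseteq> S},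
      monoid.mult = (*), one = 1, ring.zero = 0, add = (+), module.smult = (\<lambda>c f. nc_const c * f)\<rparr>"

definition word_prod :: "('a, 'm) monoid_scheme \<Rightarrow> ('g \<Rightarrow> 'a) \<Rightarrow> 'g list \<Rightarrow> 'a" where
  "word_prod A \<phi> gs = foldr (\<lambda>g x. \<phi> g \<otimes>\<^bsub>A\<^esub> x) gs \<one>\<^bsub>A\<^esub>"

definition free_hom :: "(complex, 'a) module \<Rightarrow> ('g \<Rightarrow> 'a) \<Rightarrow> 'g ncpoly \<Rightarrow> 'a" where
  "free_hom A \<phi> f =
     (\<Oplus>\<^bsub>A\<^esub>w\<in>Poly_Mapping.keys f. Poly_Mapping.lookup f w \<odot>\<^bsub>A\<^esub> word_prod A \<phi> (letters w))"

text \<open>The antimultiplicative extension of \<open>\<phi>\<close>; it is linear for \<open>\<sigma> = id\<close> and antilinear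
  for \<open>\<sigma> = cnj\<close>.\<close>

definition free_antihom ::
    "(complex, 'a) module \<Rightarrow> (complex \<Rightarrow> complex) \<Rightarrow> ('g \<Rightarrow> 'a) \<Rightarrow> 'g ncpoly \<Rightarrow> 'a" where
  "free_antihom A \<sigma> \<phi> f =
     (\<Oplus>\<^bsub>A\<^esub>w\<in>Poly_Mapping.keys f.
        \<sigma> (Poly_Mapping.lookup f w) \<odot>\<^bsub>A\<^esub> word_prod A \<phi> (rev (letters w)))"


section \<open>Modules over a noncommutative ring and their tensor products\<close>

text \<open>Both left and right modules are records of type \<^typ>\<open>('r, 'm) module\<close>, whose
  multiplicative fields are irrelevant; for a right module \<open>r \<odot> x\<close> is to be read as \<open>x r\<close>.\<close>

locale left_module = R?: ring R + M?: abelian_group M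
  for R :: "('r, 'k) ring_scheme" (structure) and M :: "('r, 'm) module" (structure) +
  assumes smult_closed: "a \<in> carrier R \<Longrightarrow> x \<in> carrier M \<Longrightarrow> a \<odot>\<^bsub>M\<^esub> x \<in> carrier M"
    and smult_l_distr: "\<lbrakk>a \<in> carrier R; b \<in> carrier R; x \<in> carrier M\<rbrakk> \<Longrightarrow>
      (a \<oplus>\<^bsub>R\<^esub> b) \<odot>\<^bsub>M\<^esub> x = a \<odot>\<^bsub>M\<^esub> x \<oplus>\<^bsub>M\<^esub> b \<odot>\<^bsub>M\<^esub> x"
    and smult_r_distr: "\<lbrakk>a \<in> carrier R; x \<in> carrier M; y \<in> carrier M\<rbrakk> \<Longrightarrow>
      a \<odot>\<^bsub>M\<^esub> (x \<oplus>\<^bsub>M\<^esub> y) = a \<odot>\<^bsub>M\<^esub> x \<oplus>\<^bsub>M\<^esub> a \<odot>\<^bsub>M\<^esub> y"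
    and smult_one: "x \<in> carrier M \<Longrightarrow> \<one>\<^bsub>R\<^esub> \<odot>\<^bsub>M\<^esub> x = x"
    and smult_assoc: "\<lbrakk>a \<in> carrier R; b \<in> carrier R; x \<in> carrier M\<rbrakk> \<Longrightarrow>
      (a \<otimes>\<^bsub>R\<^esub> b) \<odot>\<^bsub>M\<^esub> x = a \<odot>\<^bsub>M\<^esub> (b \<odot>\<^bsub>M\<^esub> x)"

locale right_module = R?: ring R + M?: abelian_group M
  for R :: "('r, 'k) ring_scheme" (structure) and M :: "('r, 'm) module" (structure) +
  assumes smult_closed: "a \<in> carrier R \<Longrightarrow> x \<in> carrier M \<Longrightarrow> a \<odot>\<^bsub>M\<^esub> x \<in> carrier M"
    and smult_l_distr: "\<lbrakk>a \<in> carrier R; b \<in> carrier R; x \<in> carrier M\<rbrakk> \<Longrightarrow>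
      (a \<oplus>\<^bsub>R\<^esub> b) \<odot>\<^bsub>M\<^esub> x = a \<odot>\<^bsub>M\<^esub> x \<oplus>\<^bsub>M\<^esub> b \<odot>\<^bsub>M\<^esub> x"
    and smult_r_distr: "\<lbrakk>a \<in> carrier R; x \<in> carrier M; y \<in> carrier M\<rbrakk> \<Longrightarrow>
      a \<odot>\<^bsub>M\<^esub> (x \<oplus>\<^bsub>M\<^esub> y) = a \<odot>\<^bsub>M\<^esub> x \<oplus>\<^bsub>M\<^esub> a \<odot>\<^bsub>M\<^esub> y"
    and smult_one: "x \<in> carrier M \<Longrightarrow> \<one>\<^bsub>R\<^esub> \<odot>\<^bsub>M\<^esub> x = x"
    and smult_assoc: "\<lbrakk>a \<in> carrier R; b \<in> carrier R; x \<in> carrier M\<rbrakk> \<Longrightarrow>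
      (a \<otimes>\<^bsub>R\<^esub> b) \<odot>\<^bsub>M\<^esub> x = b \<odot>\<^bsub>M\<^esub> (a \<odot>\<^bsub>M\<^esub> x)"

text \<open>In the following, \<open>M\<close> is a right and \<open>N\<close> a left module over \<open>R\<close>.\<close>

definition tensor_relators ::
    "('r, 'k) ring_scheme \<Rightarrow> ('r, 'm) module \<Rightarrow> ('r, 'n) module \<Rightarrow> ('m \<times> 'n \<Rightarrow>\<^sub>0 int) set" where
  "tensor_relators R M N =
     {frag_of (x \<oplus>\<^bsub>M\<^esub> x', y) - frag_of (x, y) - frag_of (x', y) | x x' y.
        x \<in> carrier M \<and> x' \<in> carrier M \<and> y \<in> carrier N} \<union>
     {frag_of (x, y \<oplus>\<^bsub>N\<^esub> y') - frag_of (x, y) - frag_of (x, y') | x y y'.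
        x \<in> carrier M \<and> y \<in> carrier N \<and> y' \<in> carrier N} \<union>
     {frag_of (r \<odot>\<^bsub>M\<^esub> x, y) - frag_of (x, r \<odot>\<^bsub>N\<^esub> y) | r x y.
        r \<in> carrier R \<and> x \<in> carrier M \<and> y \<in> carrier N}"

definition tensor_null ::
    "('r, 'k) ring_scheme \<Rightarrow> ('r, 'm) module \<Rightarrow> ('r, 'n) module \<Rightarrow> ('m \<times> 'n \<Rightarrow>\<^sub>0 int) set" where
  "tensor_null R M N =
     generate (free_Abelian_group (carrier M \<times> carrier N)) (tensor_relators R M N)"

definition tensor ::
    "('r, 'k) ring_scheme \<Rightarrow> ('r, 'm) module \<Rightarrow> ('r, 'n) module \<Rightarrow> 'm \<Rightarrow> 'n
      \<Rightarrow> ('m \<times> 'n \<Rightarrow>\<^sub>0 int) set" where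
  "tensor R M N x y =
     tensor_null R M N #>\<^bsub>free_Abelian_group (carrier M \<times> carrier N)\<^esub> frag_of (x, y)"

text \<open>Only the additive fields of this record carry information.\<close>

definition tensor_group ::
    "('r, 'k) ring_scheme \<Rightarrow> ('r, 'm) module \<Rightarrow> ('r, 'n) module
      \<Rightarrow> ('m \<times> 'n \<Rightarrow>\<^sub>0 int) set ring" where
  "tensor_group R M N =
     (let G = free_Abelian_group (carrier M \<times> carrier N) Mod tensor_null R M N
      in \<lparr>carrier = carrier G, monoid.mult = undefined, one = undefined,
          ring.zero = \<one>\<^bsub>G\<^esub>, add = (\<otimes>\<^bsub>G\<^esub>)\<rparr>)"

text \<open>The additive map \<open>x \<otimes> y \<mapsto> \<phi> x y\<close> into \<open>Z\<close> induced by a balanced biadditive \<open>\<phi>\<close>.\<close>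

definition tensor_lift ::
    "('z, 'k) ring_scheme \<Rightarrow> ('m \<Rightarrow> 'n \<Rightarrow> 'z) \<Rightarrow> ('m \<times> 'n \<Rightarrow>\<^sub>0 int) set \<Rightarrow> 'z" where
  "tensor_lift Z \<phi> = quot_lift (\<lambda>u.
     \<Oplus>\<^bsub>Z\<^esub>p\<in>Poly_Mapping.keys u. add_pow Z (Poly_Mapping.lookup u p) (\<phi> (fst p) (snd p)))"

definition tensor_map ::
    "('r, 'k) ring_scheme \<Rightarrow> ('r, 'm') module \<Rightarrow> ('r, 'n') module \<Rightarrow> ('m \<Rightarrow> 'm') \<Rightarrow> ('n \<Rightarrow> 'n')
      \<Rightarrow> ('m \<times> 'n \<Rightarrow>\<^sub>0 int) set \<Rightarrow> ('m' \<times> 'n' \<Rightarrow>\<^sub>0 int) set" where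
  "tensor_map R M' N' f g =
     tensor_lift (tensor_group R M' N') (\<lambda>x y. tensor R M' N' (f x) (g y))"


section \<open>Faithful flatness\<close>

definition exact_pair :: "('a, 'k) ring_scheme \<Rightarrow> ('b, 'l) ring_scheme \<Rightarrow> ('c, 'm) ring_scheme
    \<Rightarrow> ('a \<Rightarrow> 'b) \<Rightarrow> ('b \<Rightarrow> 'c) \<Rightarrow> bool" where
  "exact_pair N1 N2 N3 f g \<longleftrightarrow> f ` carrier N1 = {x \<in> carrier N2. g x = \<zero>\<^bsub>N3\<^esub>}"

text \<open>A module is faithfully flat if a sequence \<open>N1 \<rightarrow> N2 \<rightarrow> N3\<close> is exact if and only if the
  tensored one is. The underlying types of the test modules are parameters; in a
  theorem they are type variables, so that test modules of every size are covered.\<close>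

definition faithfully_flat_right :: "'n1 itself \<Rightarrow> 'n2 itself \<Rightarrow> 'n3 itself
    \<Rightarrow> ('r, 'k) ring_scheme \<Rightarrow> ('r, 'm) module \<Rightarrow> bool" where
  "faithfully_flat_right _ _ _ R M \<longleftrightarrow> right_module R M \<and>
     (\<forall>(N1 :: ('r, 'n1) module) (N2 :: ('r, 'n2) module) (N3 :: ('r, 'n3) module) f g.
        left_module R N1 \<and> left_module R N2 \<and> left_module R N3 \<and>
        f \<in> linear_maps N1 N2 (carrier R) \<and> g \<in> linear_maps N2 N3 (carrier R) \<longrightarrow>
        (exact_pair N1 N2 N3 f g \<longleftrightarrow>
         exact_pair (tensor_group R M N1) (tensor_group R M N2) (tensor_group R M N3)
           (tensor_map R M N2 id f) (tensor_map R M N3 id g)))"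

definition faithfully_flat_left :: "'n1 itself \<Rightarrow> 'n2 itself \<Rightarrow> 'n3 itself
    \<Rightarrow> ('r, 'k) ring_scheme \<Rightarrow> ('r, 'm) module \<Rightarrow> bool" where
  "faithfully_flat_left _ _ _ R M \<longleftrightarrow> left_module R M \<and>
     (\<forall>(N1 :: ('r, 'n1) module) (N2 :: ('r, 'n2) module) (N3 :: ('r, 'n3) module) f g.
        right_module R N1 \<and> right_module R N2 \<and> right_module R N3 \<and>
        f \<in> linear_maps N1 N2 (carrier R) \<and> g \<in> linear_maps N2 N3 (carrier R) \<longrightarrow>
        (exact_pair N1 N2 N3 f g \<longleftrightarrow>
         exact_pair (tensor_group R N1 M) (tensor_group R N2 M) (tensor_group R N3 M)
           (tensor_map R N2 M f id) (tensor_map R N3 M g id)))"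

definition left_regular :: "('a, 'k) ring_scheme \<Rightarrow> ('a, 'a) module" where
  "left_regular P = ring.extend (ring.truncate P) (module.fields (\<lambda>b p. b \<otimes>\<^bsub>P\<^esub> p))"

definition right_regular :: "('a, 'k) ring_scheme \<Rightarrow> ('a, 'a) module" where
  "right_regular P = ring.extend (ring.truncate P) (module.fields (\<lambda>b p. p \<otimes>\<^bsub>P\<^esub> b))"


section \<open>Hopf algebras, comodule algebras and Hopf-Galois extensions\<close>

abbreviation ctensor :: "(complex, 'a) module \<Rightarrow> (complex, 'b) module \<Rightarrow> 'a \<Rightarrow> 'b
    \<Rightarrow> ('a \<times> 'b \<Rightarrow>\<^sub>0 int) set" where
  "ctensor \<equiv> tensor complex_algebra"

abbreviation ctensor_map :: "(complex, 'c) module \<Rightarrow> (complex, 'd) module \<Rightarrow> ('a \<Rightarrow> 'c)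
    \<Rightarrow> ('b \<Rightarrow> 'd) \<Rightarrow> ('a \<times> 'b \<Rightarrow>\<^sub>0 int) set \<Rightarrow> ('c \<times> 'd \<Rightarrow>\<^sub>0 int) set" where
  "ctensor_map \<equiv> tensor_map complex_algebra"

definition tensor_algebra :: "(complex, 'a) module \<Rightarrow> (complex, 'b) module
    \<Rightarrow> (complex, ('a \<times> 'b \<Rightarrow>\<^sub>0 int) set) module" where
  "tensor_algebra A B =
     (let Z = tensor_group complex_algebra A B
      in \<lparr>carrier = carrier Z,
          monoid.mult = (\<lambda>U W. tensor_lift Z (\<lambda>a b. tensor_lift Z (\<lambda>a' b'.
            ctensor A B (a \<otimes>\<^bsub>A\<^esub> a') (b \<otimes>\<^bsub>B\<^esub> b')) W) U),
          one = ctensor A B \<one>\<^bsub>A\<^esub> \<one>\<^bsub>B\<^esub>,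
          ring.zero = \<zero>\<^bsub>Z\<^esub>, add = (\<oplus>\<^bsub>Z\<^esub>),
          module.smult = (\<lambda>c. ctensor_map A B (\<lambda>a. c \<odot>\<^bsub>A\<^esub> a) id)\<rparr>)"

definition tensor_assoc :: "(complex, 'a) module \<Rightarrow> (complex, 'b) module \<Rightarrow> (complex, 'c) module
    \<Rightarrow> (('a \<times> 'b \<Rightarrow>\<^sub>0 int) set \<times> 'c \<Rightarrow>\<^sub>0 int) set \<Rightarrow> ('a \<times> ('b \<times> 'c \<Rightarrow>\<^sub>0 int) set \<Rightarrow>\<^sub>0 int) set" where
  "tensor_assoc A B C =
     (let Z = tensor_algebra A (tensor_algebra B C)
      in tensor_lift Z (\<lambda>U c. tensor_lift Z (\<lambda>a b.
           ctensor A (tensor_algebra B C) a (ctensor B C b c)) U))"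

definition hopf_algebra :: "(complex, 'h) module \<Rightarrow> ('h \<Rightarrow> ('h \<times> 'h \<Rightarrow>\<^sub>0 int) set)
    \<Rightarrow> ('h \<Rightarrow> complex) \<Rightarrow> ('h \<Rightarrow> 'h) \<Rightarrow> bool" where
  "hopf_algebra H \<Delta> \<epsilon> S \<longleftrightarrow>
     unital_algebra H \<and>
     \<Delta> \<in> algebra_maps H (tensor_algebra H H) \<and>
     \<epsilon> \<in> algebra_maps H complex_algebra \<and>
     S \<in> linear_maps H H UNIV \<and>
     (\<forall>h\<in>carrier H.
        tensor_assoc H H H (ctensor_map (tensor_algebra H H) H \<Delta> id (\<Delta> h)) =
          ctensor_map H (tensor_algebra H H) id \<Delta> (\<Delta> h) \<and>
        tensor_lift H (\<lambda>a b. \<epsilon> a \<odot>\<^bsub>H\<^esub> b) (\<Delta> h) = h \<and>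
        tensor_lift H (\<lambda>a b. \<epsilon> b \<odot>\<^bsub>H\<^esub> a) (\<Delta> h) = h \<and>
        tensor_lift H (\<lambda>a b. S a \<otimes>\<^bsub>H\<^esub> b) (\<Delta> h) = \<epsilon> h \<odot>\<^bsub>H\<^esub> \<one>\<^bsub>H\<^esub> \<and>
        tensor_lift H (\<lambda>a b. a \<otimes>\<^bsub>H\<^esub> S b) (\<Delta> h) = \<epsilon> h \<odot>\<^bsub>H\<^esub> \<one>\<^bsub>H\<^esub>)"

definition comodule_algebra :: "(complex, 'p) module \<Rightarrow> (complex, 'h) module
    \<Rightarrow> ('h \<Rightarrow> ('h \<times> 'h \<Rightarrow>\<^sub>0 int) set) \<Rightarrow> ('h \<Rightarrow> complex)
    \<Rightarrow> ('p \<Rightarrow> ('p \<times> 'h \<Rightarrow>\<^sub>0 int) set) \<Rightarrow> bool" where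
  "comodule_algebra P H \<Delta> \<epsilon> \<delta> \<longleftrightarrow>
     unital_algebra P \<and>
     \<delta> \<in> algebra_maps P (tensor_algebra P H) \<and>
     (\<forall>p\<in>carrier P.
        tensor_assoc P H H (ctensor_map (tensor_algebra P H) H \<delta> id (\<delta> p)) =
          ctensor_map P (tensor_algebra H H) id \<Delta> (\<delta> p) \<and>
        tensor_lift P (\<lambda>a h. \<epsilon> h \<odot>\<^bsub>P\<^esub> a) (\<delta> p) = p)"

definition coinvariants :: "(complex, 'p) module \<Rightarrow> (complex, 'h) module
    \<Rightarrow> ('p \<Rightarrow> ('p \<times> 'h \<Rightarrow>\<^sub>0 int) set) \<Rightarrow> 'p set" where
  "coinvariants P H \<delta> = {p \<in> carrier P. \<delta> p = ctensor P H p \<one>\<^bsub>H\<^esub>}"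

definition canonical_map :: "(complex, 'p) module \<Rightarrow> (complex, 'h) module
    \<Rightarrow> ('p \<Rightarrow> ('p \<times> 'h \<Rightarrow>\<^sub>0 int) set) \<Rightarrow> ('p \<times> 'p \<Rightarrow>\<^sub>0 int) set \<Rightarrow> ('p \<times> 'h \<Rightarrow>\<^sub>0 int) set" where
  "canonical_map P H \<delta> =
     tensor_lift (tensor_algebra P H)
       (\<lambda>p' p. ctensor P H p' \<one>\<^bsub>H\<^esub> \<otimes>\<^bsub>tensor_algebra P H\<^esub> \<delta> p)"

definition hopf_galois :: "'p set \<Rightarrow> (complex, 'p) module \<Rightarrow> (complex, 'h) module
    \<Rightarrow> ('h \<Rightarrow> ('h \<times> 'h \<Rightarrow>\<^sub>0 int) set) \<Rightarrow> ('h \<Rightarrow> complex) \<Rightarrow> ('h \<Rightarrow> 'h)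
    \<Rightarrow> ('p \<Rightarrow> ('p \<times> 'h \<Rightarrow>\<^sub>0 int) set) \<Rightarrow> bool" where
  "hopf_galois B P H \<Delta> \<epsilon> S \<delta> \<longleftrightarrow>
     hopf_algebra H \<Delta> \<epsilon> S \<and>
     comodule_algebra P H \<Delta> \<epsilon> \<delta> \<and>
     B = coinvariants P H \<delta> \<and>
     bij_betw (canonical_map P H \<delta>)
       (carrier (tensor_group (P\<lparr>carrier := B\<rparr>) (right_regular P) (left_regular P)))
       (carrier (tensor_algebra P H))"


section \<open>The quantum symplectic group\<close>

definition eps_sign :: "nat \<Rightarrow> complex" where
  "eps_sign i = [1, 1, -1, -1] ! (i - 1)"

definition rho_wt :: "nat \<Rightarrow> int" where
  "rho_wt i = [2, 1, -1, -2] ! (i - 1)"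

definition matrix_unit :: "nat \<Rightarrow> nat \<Rightarrow> nat \<Rightarrow> nat \<Rightarrow> complex" where
  "matrix_unit i j a b = (if a = i \<and> b = j then 1 else 0)"

text \<open>\<open>(U \<otimes> W)\<close> has the entry \<open>U i j * W k l\<close> in row \<open>(i, k)\<close>, column \<open>(j, l)\<close>.\<close>

definition kron_prod :: "(nat \<Rightarrow> nat \<Rightarrow> complex) \<Rightarrow> (nat \<Rightarrow> nat \<Rightarrow> complex)
    \<Rightarrow> nat \<times> nat \<Rightarrow> nat \<times> nat \<Rightarrow> complex" where
  "kron_prod U W r c = U (fst r) (fst c) * W (snd r) (snd c)"

definition Rmat :: "real \<Rightarrow> nat \<times> nat \<Rightarrow> nat \<times> nat \<Rightarrow> complex" where
  "Rmat q r c =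
     of_real q * (\<Sum>i=1..4. kron_prod (matrix_unit i i) (matrix_unit i i) r c)
   + (\<Sum>i=1..4. \<Sum>j\<in>{1..4} - {i, 5 - i}. kron_prod (matrix_unit i i) (matrix_unit j j) r c)
   + inverse (of_real q) *
       (\<Sum>i=1..4. kron_prod (matrix_unit (5 - i) (5 - i)) (matrix_unit i i) r c)
   + (of_real q - inverse (of_real q)) *
       (\<Sum>i=1..4. \<Sum>j\<in>{j\<in>{1..4}. i > j}. kron_prod (matrix_unit i j) (matrix_unit j i) r c)
   - (of_real q - inverse (of_real q)) *
       (\<Sum>i=1..4. \<Sum>j\<in>{j\<in>{1..4}. i > j}.
          of_real q powi (rho_wt i - rho_wt j) * eps_sign i * eps_sign j *
          kron_prod (matrix_unit i j) (matrix_unit (5 - i) (5 - j)) r c)"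

definition Cmat :: "real \<Rightarrow> nat \<Rightarrow> nat \<Rightarrow> complex" where
  "Cmat q i j = (if i = 5 - j then of_real q powi rho_wt j * eps_sign i else 0)"

definition Cinv :: "real \<Rightarrow> nat \<Rightarrow> nat \<Rightarrow> complex" where
  "Cinv q i j = - Cmat q i j"

lemma Cmat_Cinv:
  assumes "q \<noteq> 0" "i \<in> {1..4}" "j \<in> {1..4}"
  shows "(\<Sum>k=1..4. Cmat q i k * Cinv q k j) = (if i = j then 1 else 0)"
    and "(\<Sum>k=1..4. Cinv q i k * Cmat q k j) = (if i = j then 1 else 0)"
proof -
  have *: "Cmat q i k * Cmat q k j = (if k = 5 - i then (if i = j then -1 else 0) else 0)"
    if "k \<in> {1..4}" for k
  proof -
    have "i = 1 \<or> i = 2 \<or> i = 3 \<or> i = 4" "j = 1 \<or> j = 2 \<or> j = 3 \<or> j = 4"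
      "k = 1 \<or> k = 2 \<or> k = 3 \<or> k = 4" using assms that by auto
    then show ?thesis using assms(1)
      by (elim disjE; simp add: Cmat_def rho_wt_def eps_sign_def power_int_minus)
  qed
  show "(\<Sum>k=1..4. Cmat q i k * Cinv q k j) = (if i = j then 1 else 0)"
    and "(\<Sum>k=1..4. Cinv q i k * Cmat q k j) = (if i = j then 1 else 0)"
    using assms by (auto simp: Cinv_def * sum_negf)
qed

abbreviation tgen :: "nat \<Rightarrow> nat \<Rightarrow> (nat \<times> nat) ncpoly" where
  "tgen i j \<equiv> nc_gen (i, j)"

text \<open>The matrix \<open>C T\<^sup>t C\<^sup>-\<^sup>1\<close> over the free algebra.\<close>

definition sgen :: "real \<Rightarrow> nat \<Rightarrow> nat \<Rightarrow> (nat \<times> nat) ncpoly" where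
  "sgen q i j = (\<Sum>a=1..4. \<Sum>b=1..4. nc_const (Cmat q i a) * tgen b a * nc_const (Cinv q b j))"

text \<open>The entries in row \<open>(i, k)\<close>, column \<open>(j, l)\<close> of \<open>R T\<^sub>1 T\<^sub>2 - T\<^sub>2 T\<^sub>1 R\<close>, and the entries of
  \<open>T C T\<^sup>t C\<^sup>-\<^sup>1 - 1\<close> and \<open>C T\<^sup>t C\<^sup>-\<^sup>1 T - 1\<close>.\<close>

definition spq_relations :: "real \<Rightarrow> (nat \<times> nat) ncpoly set" where
  "spq_relations q =
     {(\<Sum>a=1..4. \<Sum>b=1..4. nc_const (Rmat q (i, k) (a, b)) * tgen a j * tgen b l)
      - (\<Sum>a=1..4. \<Sum>b=1..4. tgen k b * tgen i a * nc_const (Rmat q (a, b) (j, l)))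
      | i j k l. {i, j, k, l} \<subseteq> {1..4}} \<union>
     {(\<Sum>k=1..4. tgen i k * sgen q k j) - nc_const (if i = j then 1 else 0) | i j. {i, j} \<subseteq> {1..4}} \<union>
     {(\<Sum>k=1..4. sgen q i k * tgen k j) - nc_const (if i = j then 1 else 0) | i j. {i, j} \<subseteq> {1..4}}"

definition FT :: "(complex, (nat \<times> nat) ncpoly) module" where
  "FT = free_algebra ({1..4} \<times> {1..4})"

definition spq_ideal :: "real \<Rightarrow> (nat \<times> nat) ncpoly set" where
  "spq_ideal q = Idl\<^bsub>FT\<^esub> (spq_relations q)"

type_synonym spq = "(nat \<times> nat) ncpoly set"

definition ASp2 :: "real \<Rightarrow> (complex, spq) module" where
  "ASp2 q = quotient_algebra FT (spq_ideal q)"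

definition Tmat :: "real \<Rightarrow> nat \<Rightarrow> nat \<Rightarrow> spq" where
  "Tmat q i j = spq_ideal q +>\<^bsub>FT\<^esub> tgen i j"

definition Smat :: "real \<Rightarrow> nat \<Rightarrow> nat \<Rightarrow> spq" where
  "Smat q i j = spq_ideal q +>\<^bsub>FT\<^esub> sgen q i j"

definition spq_comult :: "real \<Rightarrow> spq \<Rightarrow> (spq \<times> spq \<Rightarrow>\<^sub>0 int) set" where
  "spq_comult q = quot_lift (free_hom (tensor_algebra (ASp2 q) (ASp2 q))
     (\<lambda>(i, j). \<Oplus>\<^bsub>tensor_algebra (ASp2 q) (ASp2 q)\<^esub>k\<in>{1..4}.
        ctensor (ASp2 q) (ASp2 q) (Tmat q i k) (Tmat q k j)))"

definition spq_counit :: "real \<Rightarrow> spq \<Rightarrow> complex" where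
  "spq_counit q = quot_lift (free_hom complex_algebra (\<lambda>(i, j). if i = j then 1 else 0))"

definition spq_antipode :: "real \<Rightarrow> spq \<Rightarrow> spq" where
  "spq_antipode q = quot_lift (free_antihom (ASp2 q) id (\<lambda>(i, j). Smat q i j))"

definition spq_star :: "real \<Rightarrow> spq \<Rightarrow> spq" where
  "spq_star q = quot_lift (free_antihom (ASp2 q) cnj (\<lambda>(i, j). Smat q j i))"


section \<open>The quantum sphere and the quantum group \<open>Sp\<^sub>q(1)\<close>\<close>

definition AS7 :: "real \<Rightarrow> spq set" where
  "AS7 q = generated_subalgebra (ASp2 q)
     ((\<lambda>i. Tmat q i 4) ` {1..4} \<union> (\<lambda>i. spq_star q (Tmat q i 4)) ` {1..4})"

definition I_gens :: "real \<Rightarrow> spq set" where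
  "I_gens q = {Tmat q 1 1 \<ominus>\<^bsub>ASp2 q\<^esub> \<one>\<^bsub>ASp2 q\<^esub>, Tmat q 4 4 \<ominus>\<^bsub>ASp2 q\<^esub> \<one>\<^bsub>ASp2 q\<^esub>,
     Tmat q 1 2, Tmat q 1 3, Tmat q 1 4,
     Tmat q 2 1, Tmat q 2 4, Tmat q 3 1, Tmat q 3 4,
     Tmat q 4 1, Tmat q 4 2, Tmat q 4 3}"

definition Iq :: "real \<Rightarrow> spq set" where
  "Iq q = star_ideal (ASp2 q) (spq_star q) (I_gens q)"

definition ASp1 :: "real \<Rightarrow> (complex, spq set) module" where
  "ASp1 q = quotient_algebra (ASp2 q) (Iq q)"

definition spq_proj :: "real \<Rightarrow> spq \<Rightarrow> spq set" where
  "spq_proj q x = Iq q +>\<^bsub>ASp2 q\<^esub> x"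

definition Tmat1 :: "real \<Rightarrow> nat \<Rightarrow> nat \<Rightarrow> spq set" where
  "Tmat1 q i j = spq_proj q (Tmat q i j)"

definition comult1 :: "real \<Rightarrow> spq set \<Rightarrow> (spq set \<times> spq set \<Rightarrow>\<^sub>0 int) set" where
  "comult1 q = quot_lift (\<lambda>x. ctensor_map (ASp1 q) (ASp1 q)
     (spq_proj q) (spq_proj q) (spq_comult q x))"

definition counit1 :: "real \<Rightarrow> spq set \<Rightarrow> complex" where
  "counit1 q = quot_lift (spq_counit q)"

definition antipode1 :: "real \<Rightarrow> spq set \<Rightarrow> spq set" where
  "antipode1 q = quot_lift (\<lambda>x. spq_proj q (spq_antipode q x))"

definition coaction :: "real \<Rightarrow> spq \<Rightarrow> (spq \<times> spq set \<Rightarrow>\<^sub>0 int) set" where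
  "coaction q = quot_lift (free_hom (tensor_algebra (ASp2 q) (ASp1 q))
     (\<lambda>(i, j). \<Oplus>\<^bsub>tensor_algebra (ASp2 q) (ASp1 q)\<^esub>k\<in>{1..4}.
        ctensor (ASp2 q) (ASp1 q) (Tmat q i k) (Tmat1 q k j)))"

end

theory Submission
  imports Defs
begin

text \<open>
 Write \<open>P = A(Sp\<^sub>q(2))\<close>, \<open>H = A(Sp\<^sub>q(1))\<close> and \<open>B = A(S\<^sup>7\<^sub>q)\<close>. Algebra maps out of \<open>P\<close> are the same as
 matrices that satisfy the defining relations, and such matrices can be multiplied when their
 entries commute; this yields all Hopf algebra and comodule structures by comparing algebra
 maps on generators.

 \<^emph>\<open>The canonical map.\<close> Its inverse must be \<open>p \<otimes> h \<mapsto> p \<tau>(h)\<close>, where \<open>\<tau>\<close> is induced by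
 \<open>\<theta>(x) = S(x\<^sub>1) \<otimes>\<^sub>B x\<^sub>2\<close>. The relations \<open>R T\<^sub>1 T\<^sub>2 = T\<^sub>2 T\<^sub>1 R\<close> show that the elements \<open>\<theta>(T\<^sub>i\<^sup>j)\<close> commute with
 \<open>B\<close> (\<open>transl_inner_commutes\<close>). Then \<open>\<theta>\<close> is multiplicative in the sense of \<open>transl_mult\<close>, its kernel
 is an ideal, and it factors through \<open>H\<close> (\<open>transl_Iq\<close>). Hence the canonical map is bijective
 (\<open>canonical_map_bij\<close>).

 \<^emph>\<open>A projection onto the base.\<close> The quantum algebra dual to \<open>H\<close> acts on \<open>P\<close> by
 twisted derivations \<open>e\<close> and \<open>f\<close>, obtained from an algebra map into upper triangular matrices over \<open>P\<close>.
 They annihilate \<open>B\<close>. The Casimir operator \<open>K = f e + e f\<close> is a map of \<open>B\<close>-bimodules. It is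
 triangular for the filtration of \<open>P\<close> by the number of factors from the columns 2 and 3, and its
 diagonal coefficients in positive degree are positive for every real nonzero \<open>q\<close> (\<open>casimir_nword\<close>, \<open>\<kappa>c_pos\<close>). Therefore \<open>P\<close> is the direct sum of \<open>B\<close> and \<open>K(P)\<close>
 (\<open>casimir_split\<close>), and projecting along \<open>K(P)\<close> is a \<open>B\<close>-bimodule map \<open>E : P \<rightarrow> B\<close> that is the
 identity on \<open>B\<close>.

 \<^emph>\<open>Coinvariants and flatness.\<close> For coinvariant \<open>p\<close> injectivity of the canonical map gives
 \<open>p \<otimes>\<^sub>B 1 = 1 \<otimes>\<^sub>B p\<close>, and \<open>E\<close> turns this into \<open>p \<in> B\<close>. Applying \<open>E\<close> to
 \<open>1 \<otimes>\<^sub>B p = p\<^sub>0 \<tau>(p\<^sub>1)\<close> and expanding \<open>p\<^sub>1\<close> in a basis of \<open>H\<close> gives local dual bases of \<open>P\<close>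
 over \<open>B\<close>, which make \<open>P\<close> flat; \<open>E\<close> makes it faithfully flat (\<open>faithfully_flat_leftI\<close>). The
 antiinvolution exchanges left and right.
\<close>

section \<open>Additive maps and factor groups\<close>

abbreviation additive_maps :: "('a, 'k) ring_scheme \<Rightarrow> ('b, 'l) ring_scheme \<Rightarrow> ('a \<Rightarrow> 'b) set" where
 "additive_maps M N \<equiv> hom (add_monoid M) (add_monoid N)"

lemma additive_mapsI:
 assumes "\<And>x. x \<in> carrier M ==> f x \<in> carrier N"
  and "\<And>x y. [|x \<in> carrier M; y \<in> carrier M|] ==> f (x \<oplus>\<^bsub>M\<^esub> y) = f x \<oplus>\<^bsub>N\<^esub> f y"
 shows "f \<in> additive_maps M N"
 using assms by (auto simp: hom_def)

lemma additive_map_closed: "f \<in> additive_maps M N ==> x \<in> carrier M ==> f x \<in> carrier N"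
 by (auto simp: hom_def)

lemma additive_map_add:
 "[|f \<in> additive_maps M N; x \<in> carrier M; y \<in> carrier M|] ==> f (x \<oplus>\<^bsub>M\<^esub> y) = f x \<oplus>\<^bsub>N\<^esub> f y"
 by (auto simp: hom_def)

lemma additive_group_hom:
 assumes "abelian_group M" "abelian_group N" "f \<in> additive_maps M N"
 shows "group_hom (add_monoid M) (add_monoid N) f"
 using assms by (simp add: group_hom_def group_hom_axioms_def abelian_group.a_group)

lemma additive_map_zero:
 assumes "abelian_group M" "abelian_group N" "f \<in> additive_maps M N"
 shows "f \<zero>\<^bsub>M\<^esub> = \<zero>\<^bsub>N\<^esub>"
 using group_hom.hom_one[OF additive_group_hom[OF assms]] by simp

lemma additive_map_minus:
 assumes "abelian_group M" "abelian_group N" "f \<in> additive_maps M N" "x \<in> carrier M"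
 shows "f (\<ominus>\<^bsub>M\<^esub> x) = \<ominus>\<^bsub>N\<^esub> f x"
 using group_hom.hom_inv[OF additive_group_hom[OF assms(1-3)], of x] assms(4)
 by (simp add: a_inv_def)

lemma additive_map_diff:
 assumes "abelian_group M" "abelian_group N" "f \<in> additive_maps M N" "x \<in> carrier M" "y \<in> carrier M"
 shows "f (x \<ominus>\<^bsub>M\<^esub> y) = f x \<ominus>\<^bsub>N\<^esub> f y"
proof -
 interpret M: abelian_group M by fact
 show ?thesis using assms
  by (simp add: a_minus_def additive_map_add[OF assms(3)] additive_map_minus[OF assms(1-3)])
qed

lemma additive_map_finsum:
 assumes "abelian_group M" "abelian_group N" "f \<in> additive_maps M N" "g \<in> I \<rightarrow> carrier M"
 shows "f (\<Oplus>\<^bsub>M\<^esub>i\<in>I. g i) = (\<Oplus>\<^bsub>N\<^esub>i\<in>I. f (g i))"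
proof -
 interpret M: abelian_group M by fact
 interpret N: abelian_group N by fact
 show ?thesis
 proof (cases "finite I")
  case True
  then show ?thesis using assms(4)
  proof (induction I)
   case empty then show ?case using additive_map_zero[OF assms(1-3)] by simp
  next
   case (insert i I)
   then have "g \<in> I \<rightarrow> carrier M" "g i \<in> carrier M" by auto
   moreover from this have "(\<lambda>i. f (g i)) \<in> I \<rightarrow> carrier N" "f (g i) \<in> carrier N"
    using assms(3) by (auto simp: hom_def)
   ultimately show ?case using insert
    by (simp add: additive_map_add[OF assms(3)] M.finsum_closed)
  qed
 next
  case False then show ?thesis using additive_map_zero[OF assms(1-3)]
   by (simp add: M.finsum_infinite N.finsum_infinite)
 qed
qed

lemma additive_map_compose:
 "[|f \<in> additive_maps M N; g \<in> additive_maps N K|] ==> (\<lambda>x. g (f x)) \<in> additive_maps M K"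
 by (auto simp: hom_def Pi_def)

lemma additive_map_sum:
 assumes "abelian_group N" "f \<in> additive_maps M N" "g \<in> additive_maps M N"
 shows "(\<lambda>x. f x \<oplus>\<^bsub>N\<^esub> g x) \<in> additive_maps M N"
proof -
 interpret N: abelian_group N by fact
 show ?thesis using assms(2,3)
  by (intro additive_mapsI) (auto simp: hom_def Pi_def N.a_ac)
qed

lemma additive_maps_cong:
 "[|f \<in> additive_maps M N; \<And>x. x \<in> carrier M ==> g x = f x; abelian_group M|] ==> g \<in> additive_maps M N"
 by (auto simp: hom_def Pi_def abelian_group.axioms abelian_monoid.a_closed)

lemma (in abelian_monoid) finsum_finsum_swap:
 assumes "finite I" "finite J" "\<And>i j. i \<in> I ==> j \<in> J ==> f i j \<in> carrier G"
 shows "(\<Oplus>i\<in>I. \<Oplus>j\<in>J. f i j) = (\<Oplus>j\<in>J. \<Oplus>i\<in>I. f i j)"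
 using assms(1,3)
proof (induction I)
 case (insert x I)
 have "(\<Oplus>i\<in>insert x I. \<Oplus>j\<in>J. f i j) = (\<Oplus>j\<in>J. f x j) \<oplus> (\<Oplus>i\<in>I. \<Oplus>j\<in>J. f i j)"
  using insert by (intro finsum_insert) (auto intro!: finsum_closed)
 also have "\<dots> = (\<Oplus>j\<in>J. f x j) \<oplus> (\<Oplus>j\<in>J. \<Oplus>i\<in>I. f i j)"
  using insert by simp
 also have "\<dots> = (\<Oplus>j\<in>J. f x j \<oplus> (\<Oplus>i\<in>I. f i j))"
  using insert by (intro finsum_addf[symmetric]) (auto intro!: finsum_closed)
 also have "\<dots> = (\<Oplus>j\<in>J. \<Oplus>i\<in>insert x I. f i j)"
  using insert by (intro finsum_cong') (auto intro!: finsum_closed)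
 finally show ?case .
qed (simp add: finsum_zero)

lemma (in abelian_monoid) finsum_Times:
 assumes "finite I" "finite J" "\<And>i j. i \<in> I ==> j \<in> J ==> f i j \<in> carrier G"
 shows "(\<Oplus>p\<in>I \<times> J. f (fst p) (snd p)) = (\<Oplus>i\<in>I. \<Oplus>j\<in>J. f i j)"
 using assms(1,3)
proof (induction I)
 case (insert x I)
 have "insert x I \<times> J = (Pair x ` J) \<union> (I \<times> J)" by auto
 then have "(\<Oplus>p\<in>insert x I \<times> J. f (fst p) (snd p)) =
   (\<Oplus>p\<in>Pair x ` J. f (fst p) (snd p)) \<oplus> (\<Oplus>p\<in>I \<times> J. f (fst p) (snd p))"
  using insert assms(2) by (simp only:) (rule finsum_Un_disjoint; auto)
 also have "(\<Oplus>p\<in>Pair x ` J. f (fst p) (snd p)) = (\<Oplus>j\<in>J. f x j)"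
  using insert by (subst finsum_reindex) (auto intro: inj_onI)
 finally show ?case using insert by (subst finsum_insert) (auto intro!: finsum_closed)
qed simp

lemma (in abelian_monoid) finsum_single_term:
 assumes "finite I" "i \<in> I" "f i \<in> carrier G" "\<And>j. j \<in> I ==> j \<noteq> i ==> f j = \<zero>"
 shows "(\<Oplus>j\<in>I. f j) = f i"
proof -
 have "(\<Oplus>j\<in>I. f j) = (\<Oplus>j\<in>I. if i = j then f j else \<zero>)"
  using assms by (intro finsum_cong') auto
 also have "\<dots> = (\<Oplus>j\<in>I. if i = j then f i else \<zero>)"
  using assms by (intro finsum_cong') auto
 also have "\<dots> = f i"
  using finsum_singleton[of i I "\<lambda>_. f i"] assms by simp
 finally show ?thesis .
qed

lemma quot_lift_coset:
 assumes "group G" "subgroup K G" "x \<in> carrier G"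
  and "\<And>k. k \<in> K ==> h (k \<otimes>\<^bsub>G\<^esub> x) = h x"
 shows "quot_lift h (K #>\<^bsub>G\<^esub> x) = h x"
proof -
 have "x \<in> K #>\<^bsub>G\<^esub> x"
  using assms group.rcos_self by metis
 then have "h ` (K #>\<^bsub>G\<^esub> x) = {h x}"
  using assms(4) by (auto simp: r_coset_def image_iff)
 then show ?thesis by (simp add: quot_lift_def)
qed

section \<open>Tensor products over a ring\<close>

definition bilinear_balanced :: "('r, 'k) ring_scheme \<Rightarrow> ('r, 'm) module \<Rightarrow> ('r, 'n) module
  \<Rightarrow> ('z, 'l) ring_scheme \<Rightarrow> ('m \<Rightarrow> 'n \<Rightarrow> 'z) \<Rightarrow> bool" where
 "bilinear_balanced R M N Z \<beta> \<longleftrightarrow>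
   (\<forall>x\<in>carrier M. \<forall>y\<in>carrier N. \<beta> x y \<in> carrier Z) \<and>
   (\<forall>x\<in>carrier M. \<forall>x'\<in>carrier M. \<forall>y\<in>carrier N. \<beta> (x \<oplus>\<^bsub>M\<^esub> x') y = \<beta> x y \<oplus>\<^bsub>Z\<^esub> \<beta> x' y) \<and>
   (\<forall>x\<in>carrier M. \<forall>y\<in>carrier N. \<forall>y'\<in>carrier N. \<beta> x (y \<oplus>\<^bsub>N\<^esub> y') = \<beta> x y \<oplus>\<^bsub>Z\<^esub> \<beta> x y') \<and>
   (\<forall>r\<in>carrier R. \<forall>x\<in>carrier M. \<forall>y\<in>carrier N. \<beta> (r \<odot>\<^bsub>M\<^esub> x) y = \<beta> x (r \<odot>\<^bsub>N\<^esub> y))"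

lemma bilinear_balancedI:
 assumes "\<And>x y. [|x \<in> carrier M; y \<in> carrier N|] ==> \<beta> x y \<in> carrier Z"
  "\<And>x x' y. [|x \<in> carrier M; x' \<in> carrier M; y \<in> carrier N|] ==> \<beta> (x \<oplus>\<^bsub>M\<^esub> x') y = \<beta> x y \<oplus>\<^bsub>Z\<^esub> \<beta> x' y"
  "\<And>x y y'. [|x \<in> carrier M; y \<in> carrier N; y' \<in> carrier N|] ==> \<beta> x (y \<oplus>\<^bsub>N\<^esub> y') = \<beta> x y \<oplus>\<^bsub>Z\<^esub> \<beta> x y'"
  "\<And>r x y. [|r \<in> carrier R; x \<in> carrier M; y \<in> carrier N|] ==> \<beta> (r \<odot>\<^bsub>M\<^esub> x) y = \<beta> x (r \<odot>\<^bsub>N\<^esub> y)"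
 shows "bilinear_balanced R M N Z \<beta>"
 using assms unfolding bilinear_balanced_def by blast

lemma bilinear_balancedD:
 assumes "bilinear_balanced R M N Z \<beta>"
 shows "\<And>x y. [|x \<in> carrier M; y \<in> carrier N|] ==> \<beta> x y \<in> carrier Z"
  "\<And>x x' y. [|x \<in> carrier M; x' \<in> carrier M; y \<in> carrier N|] ==> \<beta> (x \<oplus>\<^bsub>M\<^esub> x') y = \<beta> x y \<oplus>\<^bsub>Z\<^esub> \<beta> x' y"
  "\<And>x y y'. [|x \<in> carrier M; y \<in> carrier N; y' \<in> carrier N|] ==> \<beta> x (y \<oplus>\<^bsub>N\<^esub> y') = \<beta> x y \<oplus>\<^bsub>Z\<^esub> \<beta> x y'"
  "\<And>r x y. [|r \<in> carrier R; x \<in> carrier M; y \<in> carrier N|] ==> \<beta> (r \<odot>\<^bsub>M\<^esub> x) y = \<beta> x (r \<odot>\<^bsub>N\<^esub> y)"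
 using assms unfolding bilinear_balanced_def by blast+

definition frag_lift :: "('z, 'k) ring_scheme \<Rightarrow> ('m \<Rightarrow> 'n \<Rightarrow> 'z) \<Rightarrow> ('m \<times> 'n \<Rightarrow>\<^sub>0 int) \<Rightarrow> 'z" where
 "frag_lift Z \<beta> u =
   (\<Oplus>\<^bsub>Z\<^esub>p\<in>Poly_Mapping.keys u. add_pow Z (Poly_Mapping.lookup u p) (\<beta> (fst p) (snd p)))"

lemma tensor_lift_frag_lift: "tensor_lift Z \<beta> = quot_lift (frag_lift Z \<beta>)"
 unfolding tensor_lift_def frag_lift_def[abs_def] ..

lemma frag_lift_hom:
 assumes Z: "abelian_group Z" and \<beta>_closed: "\<And>x y. x \<in> A ==> y \<in> B ==> \<beta> x y \<in> carrier Z"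
 shows "frag_lift Z \<beta> \<in> hom (free_Abelian_group (A \<times> B)) (add_monoid Z)"
proof -
 interpret Z: abelian_group Z by fact
 have \<beta>': "\<beta> (fst p) (snd p) \<in> carrier Z" if "p \<in> A \<times> B" for p using that \<beta>_closed by auto
 have pow: "add_pow Z k (\<beta> (fst p) (snd p)) \<in> carrier Z" if "p \<in> A \<times> B" for p and k :: int
  using that \<beta>' by simp
 have ext: "frag_lift Z \<beta> u = (\<Oplus>\<^bsub>Z\<^esub>p\<in>S. add_pow Z (Poly_Mapping.lookup u p) (\<beta> (fst p) (snd p)))"
  if "finite S" "Poly_Mapping.keys u \<subseteq> S" "S \<subseteq> A \<times> B" for u S
  unfolding frag_lift_def using that pow
  by (intro Z.add.finprod_mono_neutral_cong_left)
    (auto simp: in_keys_iff Pi_def add_pow_def subset_iff)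
 show ?thesis
 proof (rule homI)
  fix u assume "u \<in> carrier (free_Abelian_group (A \<times> B))"
  then show "frag_lift Z \<beta> u \<in> carrier (add_monoid Z)"
   using pow by (auto simp: frag_lift_def intro!: Z.finsum_closed)
 next
  fix u v assume uv: "u \<in> carrier (free_Abelian_group (A \<times> B))" "v \<in> carrier (free_Abelian_group (A \<times> B))"
  define S where "S = Poly_Mapping.keys u \<union> Poly_Mapping.keys v"
  have S: "finite S" "Poly_Mapping.keys u \<subseteq> S" "Poly_Mapping.keys v \<subseteq> S" "Poly_Mapping.keys (u + v) \<subseteq> S" "S \<subseteq> A \<times> B"
   using uv by (auto simp: S_def dest: subsetD[OF Poly_Mapping.keys_add])
  have "frag_lift Z \<beta> (u + v) = (\<Oplus>\<^bsub>Z\<^esub>p\<in>S. add_pow Z (Poly_Mapping.lookup u p) (\<beta> (fst p) (snd p))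
    \<oplus>\<^bsub>Z\<^esub> add_pow Z (Poly_Mapping.lookup v p) (\<beta> (fst p) (snd p)))"
   unfolding ext[OF S(1,4,5)] using S(5) \<beta>' pow
   by (intro Z.finsum_cong') (auto simp: Poly_Mapping.lookup_add Z.add.int_pow_mult)
  also have "\<dots> = frag_lift Z \<beta> u \<oplus>\<^bsub>Z\<^esub> frag_lift Z \<beta> v"
   unfolding ext[OF S(1,2,5)] ext[OF S(1,3,5)] using S(5) pow
   by (intro Z.finsum_addf) (auto simp: subset_iff)
  finally show "frag_lift Z \<beta> (u \<otimes>\<^bsub>free_Abelian_group (A \<times> B)\<^esub> v) =
   frag_lift Z \<beta> u \<otimes>\<^bsub>add_monoid Z\<^esub> frag_lift Z \<beta> v" by simp
 qed
qed

lemma frag_lift_frag_of: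
 assumes "abelian_group Z" "\<beta> x y \<in> carrier Z"
 shows "frag_lift Z \<beta> (frag_of (x, y)) = \<beta> x y"
proof -
 interpret Z: abelian_group Z by fact
 show ?thesis using assms(2) by (simp add: frag_lift_def)
qed

locale tensor_pair =
 fixes R :: "('r, 'k) ring_scheme" and M :: "('r, 'm) module" and N :: "('r, 'n) module"
 assumes right_module_M: "right_module R M" and left_module_N: "left_module R N"
begin

interpretation M: right_module R M by (rule right_module_M)
interpretation N: left_module R N by (rule left_module_N)

abbreviation "frags \<equiv> free_Abelian_group (carrier M \<times> carrier N)"

lemma tensor_relators_subset: "tensor_relators R M N \<subseteq> carrier frags"
proof -
 have "\<And>a b c. [|a \<in> carrier frags; b \<in> carrier frags; c \<in> carrier frags|] ==> a - b - c \<in> carrier frags"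
  "\<And>a b. [|a \<in> carrier frags; b \<in> carrier frags|] ==> a - b \<in> carrier frags"
  by (auto dest!: subsetD[OF keys_diff])
 then show ?thesis unfolding tensor_relators_def
  by (auto simp del: carrier_free_Abelian_group_iff simp: M.smult_closed N.smult_closed)
qed

lemma tensor_null_subgroup: "subgroup (tensor_null R M N) frags"
 unfolding tensor_null_def by (rule group.generate_is_subgroup[OF group_free_Abelian_group tensor_relators_subset])

lemma tensor_null_normal: "tensor_null R M N \<lhd> frags"
 using comm_group.normal_iff_subgroup[OF abelian_free_Abelian_group] tensor_null_subgroup by blast

abbreviation "MN \<equiv> tensor_group R M N"

lemma tensor_group_simps:
 "carrier MN = carrier (frags Mod tensor_null R M N)"
 "\<zero>\<^bsub>MN\<^esub> = \<one>\<^bsub>frags Mod tensor_null R M N\<^esub>"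
 "(\<oplus>\<^bsub>MN\<^esub>) = (\<otimes>\<^bsub>frags Mod tensor_null R M N\<^esub>)"
 by (simp_all add: tensor_group_def Let_def)

lemma add_monoid_tensor_group: "add_monoid MN = frags Mod tensor_null R M N"
 by (simp add: tensor_group_def Let_def FactGroup_def)

lemma tensor_group_abelian: "abelian_group MN"
proof -
 have "comm_group (add_monoid MN)"
  unfolding add_monoid_tensor_group
  by (rule comm_group.abelian_FactGroup[OF abelian_free_Abelian_group tensor_null_subgroup])
 then show ?thesis
  unfolding abelian_group_def abelian_group_axioms_def abelian_monoid_def
  by (blast dest: comm_group.axioms)
qed

interpretation MN: abelian_group MN by (rule tensor_group_abelian)

lemma tensor_proj_hom: "(#>\<^bsub>frags\<^esub>) (tensor_null R M N) \<in> hom frags (add_monoid MN)"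
 unfolding add_monoid_tensor_group by (rule normal.r_coset_hom_Mod[OF tensor_null_normal])

lemma tensor_closed:
 assumes "x \<in> carrier M" "y \<in> carrier N" shows "tensor R M N x y \<in> carrier MN"
 using hom_in_carrier[OF tensor_proj_hom, of "frag_of (x, y)"] assms by (simp add: tensor_def)

lemma tensor_relator_eq:
 assumes "u - v \<in> tensor_null R M N" "u \<in> carrier frags" "v \<in> carrier frags"
 shows "tensor_null R M N #>\<^bsub>frags\<^esub> u = tensor_null R M N #>\<^bsub>frags\<^esub> v"
proof -
 have "(u - v) \<otimes>\<^bsub>frags\<^esub> v = u" by simp
 then have "u \<in> tensor_null R M N #>\<^bsub>frags\<^esub> v"
  using assms(1) by (force simp: r_coset_def)
 then show ?thesis
  using group.repr_independence[OF group_free_Abelian_group _ assms(3) tensor_null_subgroup] by blast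
qed

lemma frags_add: "[|u \<in> carrier frags; v \<in> carrier frags|] ==> u + v \<in> carrier frags"
 using group.is_monoid[OF group_free_Abelian_group[of "carrier M \<times> carrier N"]]
 by (metis monoid.m_closed mult_free_Abelian_group)

lemma tensor_add_left:
 assumes "x \<in> carrier M" "x' \<in> carrier M" "y \<in> carrier N"
 shows "tensor R M N (x \<oplus>\<^bsub>M\<^esub> x') y = tensor R M N x y \<oplus>\<^bsub>MN\<^esub> tensor R M N x' y"
proof -
 have "frag_of (x \<oplus>\<^bsub>M\<^esub> x', y) - (frag_of (x, y) + frag_of (x', y)) \<in> tensor_null R M N"
  unfolding tensor_null_def using assms
  by (intro generate.incl) (force simp: tensor_relators_def diff_diff_eq)
 then have "tensor R M N (x \<oplus>\<^bsub>M\<^esub> x') y =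
   tensor_null R M N #>\<^bsub>frags\<^esub> (frag_of (x, y) + frag_of (x', y))"
  unfolding tensor_def using assms by (intro tensor_relator_eq frags_add) auto
 then show ?thesis
  using hom_mult[OF tensor_proj_hom, of "frag_of (x, y)" "frag_of (x', y)"] assms
  by (simp add: tensor_def)
qed

lemma tensor_add_right:
 assumes "x \<in> carrier M" "y \<in> carrier N" "y' \<in> carrier N"
 shows "tensor R M N x (y \<oplus>\<^bsub>N\<^esub> y') = tensor R M N x y \<oplus>\<^bsub>MN\<^esub> tensor R M N x y'"
proof -
 have "frag_of (x, y \<oplus>\<^bsub>N\<^esub> y') - (frag_of (x, y) + frag_of (x, y')) \<in> tensor_null R M N"
  unfolding tensor_null_def using assms
  by (intro generate.incl) (force simp: tensor_relators_def diff_diff_eq)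
 then have "tensor R M N x (y \<oplus>\<^bsub>N\<^esub> y') =
   tensor_null R M N #>\<^bsub>frags\<^esub> (frag_of (x, y) + frag_of (x, y'))"
  unfolding tensor_def using assms by (intro tensor_relator_eq frags_add) auto
 then show ?thesis
  using hom_mult[OF tensor_proj_hom, of "frag_of (x, y)" "frag_of (x, y')"] assms
  by (simp add: tensor_def)
qed

lemma tensor_balanced:
 assumes "r \<in> carrier R" "x \<in> carrier M" "y \<in> carrier N"
 shows "tensor R M N (r \<odot>\<^bsub>M\<^esub> x) y = tensor R M N x (r \<odot>\<^bsub>N\<^esub> y)"
proof -
 have "frag_of (r \<odot>\<^bsub>M\<^esub> x, y) - frag_of (x, r \<odot>\<^bsub>N\<^esub> y) \<in> tensor_null R M N"
  unfolding tensor_null_def using assms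
  by (intro generate.incl) (auto simp: tensor_relators_def)
 then show ?thesis unfolding tensor_def using assms
  by (intro tensor_relator_eq) (auto simp: M.smult_closed N.smult_closed)
qed

lemma tensor_map_left: "y \<in> carrier N ==> (\<lambda>x. tensor R M N x y) \<in> additive_maps M MN"
 by (intro additive_mapsI tensor_closed tensor_add_left)

lemma tensor_map_right: "x \<in> carrier M ==> tensor R M N x \<in> additive_maps N MN"
 by (intro additive_mapsI tensor_closed tensor_add_right)

lemma tensor_zero_left: "y \<in> carrier N ==> tensor R M N \<zero>\<^bsub>M\<^esub> y = \<zero>\<^bsub>MN\<^esub>"
 using additive_map_zero[OF M.abelian_group_axioms MN.abelian_group_axioms tensor_map_left] by simp

lemma tensor_zero_right: "x \<in> carrier M ==> tensor R M N x \<zero>\<^bsub>N\<^esub> = \<zero>\<^bsub>MN\<^esub>"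
 using additive_map_zero[OF N.abelian_group_axioms MN.abelian_group_axioms tensor_map_right] by simp

lemma tensor_minus_left:
 "x \<in> carrier M ==> y \<in> carrier N ==> tensor R M N (\<ominus>\<^bsub>M\<^esub> x) y = \<ominus>\<^bsub>MN\<^esub> tensor R M N x y"
 using additive_map_minus[OF M.abelian_group_axioms MN.abelian_group_axioms tensor_map_left] by simp

lemma tensor_group_obtain:
 assumes "U \<in> carrier MN"
 obtains u where "u \<in> carrier frags" "U = tensor_null R M N #>\<^bsub>frags\<^esub> u"
 using assms by (auto simp: tensor_group_simps FactGroup_def RCOSETS_def)

text \<open>Negatives need no case of their own, since \<open>- (x \<otimes> y) = (- x) \<otimes> y\<close>.\<close>

lemma tensor_induct [consumes 1, case_names zero tensor add]:
 assumes U: "U \<in> carrier MN"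
  and zero: "P \<zero>\<^bsub>MN\<^esub>"
  and tensor: "\<And>x y. [|x \<in> carrier M; y \<in> carrier N|] ==> P (tensor R M N x y)"
  and add: "\<And>V W. [|V \<in> carrier MN; W \<in> carrier MN; P V; P W|] ==> P (V \<oplus>\<^bsub>MN\<^esub> W)"
 shows "P U"
proof -
 let ?K = "tensor_null R M N"
 obtain u where u: "u \<in> carrier frags" and U_eq: "U = ?K #>\<^bsub>frags\<^esub> u"
  using tensor_group_obtain[OF U] .
 let ?p = "\<lambda>u. ?K #>\<^bsub>frags\<^esub> u"
 have p_add: "?p (v + w) = ?p v \<oplus>\<^bsub>MN\<^esub> ?p w" if "v \<in> carrier frags" "w \<in> carrier frags" for v w
  using hom_mult[OF tensor_proj_hom that] by simp
 have p_closed: "?p v \<in> carrier MN" if "v \<in> carrier frags" for v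
  using hom_in_carrier[OF tensor_proj_hom that] by simp
 have gh: "group_hom frags (add_monoid MN) ?p"
  using tensor_proj_hom MN.a_group by (simp add: group_hom_def group_hom_axioms_def)
 have p_zero: "?p 0 = \<zero>\<^bsub>MN\<^esub>" using group_hom.hom_one[OF gh] by simp
 have p_minus: "?p (- v) = \<ominus>\<^bsub>MN\<^esub> ?p v" if "v \<in> carrier frags" for v
  using group_hom.hom_inv[OF gh that] that by (simp add: a_inv_def)
 have "P (?p u) \<and> P (\<ominus>\<^bsub>MN\<^esub> ?p u)"
 proof (rule free_Abelian_group_induct[OF u[unfolded carrier_free_Abelian_group_iff],
    of "\<lambda>u. P (?p u) \<and> P (\<ominus>\<^bsub>MN\<^esub> ?p u)"])
  have "\<ominus>\<^bsub>MN\<^esub> \<zero>\<^bsub>MN\<^esub> = \<zero>\<^bsub>MN\<^esub>"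
   using MN.minus_equality[of "\<zero>\<^bsub>MN\<^esub>" "\<zero>\<^bsub>MN\<^esub>"] by simp
  then show "P (?p 0) \<and> P (\<ominus>\<^bsub>MN\<^esub> ?p 0)"
   using zero by (simp only: p_zero)
 next
  fix v w assume vw: "Poly_Mapping.keys v \<subseteq> carrier M \<times> carrier N" "Poly_Mapping.keys w \<subseteq> carrier M \<times> carrier N"
   "P (?p v) \<and> P (\<ominus>\<^bsub>MN\<^esub> ?p v)" "P (?p w) \<and> P (\<ominus>\<^bsub>MN\<^esub> ?p w)"
  have c: "v \<in> carrier frags" "w \<in> carrier frags" "- w \<in> carrier frags" using vw(1,2) by simp_all
  have e: "?p (v - w) = ?p v \<oplus>\<^bsub>MN\<^esub> \<ominus>\<^bsub>MN\<^esub> ?p w"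
   using p_add[of v "- w"] c by (simp add: p_minus)
  have e': "\<ominus>\<^bsub>MN\<^esub> ?p (v - w) = ?p w \<oplus>\<^bsub>MN\<^esub> \<ominus>\<^bsub>MN\<^esub> ?p v"
   unfolding e using p_closed[OF c(1)] p_closed[OF c(2)]
   by (simp add: MN.minus_add MN.a_comm)
  have pc: "?p v \<in> carrier MN" "?p w \<in> carrier MN" "\<ominus>\<^bsub>MN\<^esub> ?p v \<in> carrier MN" "\<ominus>\<^bsub>MN\<^esub> ?p w \<in> carrier MN"
   using p_closed[OF c(1)] p_closed[OF c(2)] by simp_all
  show "P (?p (v - w)) \<and> P (\<ominus>\<^bsub>MN\<^esub> ?p (v - w))"
   unfolding e' unfolding e using add[OF pc(1,4)] add[OF pc(2,3)] vw(3,4) by simp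
 next
  fix a assume "a \<in> carrier M \<times> carrier N"
  then obtain x y where a: "a = (x, y)" "x \<in> carrier M" "y \<in> carrier N" by auto
  then have "?p (frag_of a) = tensor R M N x y" by (simp add: tensor_def)
  then show "P (?p (frag_of a)) \<and> P (\<ominus>\<^bsub>MN\<^esub> ?p (frag_of a))"
   using tensor[OF a(2,3)] tensor[of "\<ominus>\<^bsub>M\<^esub> x" y] a(2,3)
   by (simp add: tensor_minus_left)
 qed
 then show ?thesis by (simp add: U_eq)
qed

lemma tensor_maps_eqI:
 assumes "abelian_group Z" "f \<in> additive_maps MN Z" "g \<in> additive_maps MN Z"
  and "\<And>x y. [|x \<in> carrier M; y \<in> carrier N|] ==> f (tensor R M N x y) = g (tensor R M N x y)"
  and "U \<in> carrier MN"
 shows "f U = g U"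
 using assms(5)
proof (induction U rule: tensor_induct)
 case zero then show ?case using additive_map_zero[OF tensor_group_abelian assms(1)] assms(2,3) by metis
next
 case (add V W) then show ?case by (simp add: additive_map_add[OF assms(2)] additive_map_add[OF assms(3)])
qed (rule assms(4))

text \<open>The tensor group is the quotient of a free abelian group by the subgroup that the relators
 generate, so it is enough that a balanced biadditive map sends every relator to zero.\<close>

lemma frag_lift_null:
 assumes Z: "abelian_group Z" and b: "bilinear_balanced R M N Z \<beta>" and k: "k \<in> tensor_null R M N"
 shows "frag_lift Z \<beta> k = \<zero>\<^bsub>Z\<^esub>"
proof -
 note bD = bilinear_balancedD[OF b]
 interpret Z: abelian_group Z by fact
 have hom: "frag_lift Z \<beta> \<in> hom frags (add_monoid Z)" by (rule frag_lift_hom[OF Z bD(1)])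
 then have gh: "group_hom frags (add_monoid Z) (frag_lift Z \<beta>)"
  using Z.a_group by (simp add: group_hom_def group_hom_axioms_def)
 have add: "frag_lift Z \<beta> (u + v) = frag_lift Z \<beta> u \<oplus>\<^bsub>Z\<^esub> frag_lift Z \<beta> v"
  if "u \<in> carrier frags" "v \<in> carrier frags" for u v using hom_mult[OF hom that] by simp
 have minus: "frag_lift Z \<beta> (- v) = \<ominus>\<^bsub>Z\<^esub> frag_lift Z \<beta> v" if "v \<in> carrier frags" for v
  using group_hom.hom_inv[OF gh that] that by (simp add: a_inv_def)
 have diff: "frag_lift Z \<beta> (u - v) = frag_lift Z \<beta> u \<ominus>\<^bsub>Z\<^esub> frag_lift Z \<beta> v"
  if "u \<in> carrier frags" "v \<in> carrier frags" for u v
  using add[of u "- v"] that minus[of v] by (simp add: Z.minus_eq)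
 have carr: "u - v \<in> carrier frags" if "u \<in> carrier frags" "v \<in> carrier frags" for u v
  using that frags_add[of u "- v"] by simp
 have of: "frag_lift Z \<beta> (frag_of (x, y)) = \<beta> x y" if "x \<in> carrier M" "y \<in> carrier N" for x y
  using frag_lift_frag_of[of Z \<beta> x y] Z bD(1)[OF that] by simp
 have "tensor_relators R M N \<subseteq> kernel frags (add_monoid Z) (frag_lift Z \<beta>)"
 proof
  fix k assume kr: "k \<in> tensor_relators R M N"
  then have kc: "k \<in> carrier frags" using tensor_relators_subset by blast
  from kr consider
   (1) x x' y where "k = frag_of (x \<oplus>\<^bsub>M\<^esub> x', y) - frag_of (x, y) - frag_of (x', y)"
    "x \<in> carrier M" "x' \<in> carrier M" "y \<in> carrier N"
   | (2) x y y' where "k = frag_of (x, y \<oplus>\<^bsub>N\<^esub> y') - frag_of (x, y) - frag_of (x, y')"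
    "x \<in> carrier M" "y \<in> carrier N" "y' \<in> carrier N"
   | (3) r x y where "k = frag_of (r \<odot>\<^bsub>M\<^esub> x, y) - frag_of (x, r \<odot>\<^bsub>N\<^esub> y)"
    "r \<in> carrier R" "x \<in> carrier M" "y \<in> carrier N"
   unfolding tensor_relators_def by blast
  then have "frag_lift Z \<beta> k = \<zero>\<^bsub>Z\<^esub>"
  proof cases
   case 1
   then have "frag_lift Z \<beta> k = (\<beta> x y \<oplus>\<^bsub>Z\<^esub> \<beta> x' y) \<ominus>\<^bsub>Z\<^esub> \<beta> x y \<ominus>\<^bsub>Z\<^esub> \<beta> x' y"
    by (simp add: diff carr of bD(2) del: carrier_free_Abelian_group_iff)
   moreover have "\<beta> x y \<in> carrier Z" "\<beta> x' y \<in> carrier Z" using 1 bD(1) by auto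
   ultimately show ?thesis by (simp add: Z.minus_eq Z.a_ac Z.r_neg Z.r_neg1)
  next
   case 2
   then have "frag_lift Z \<beta> k = (\<beta> x y \<oplus>\<^bsub>Z\<^esub> \<beta> x y') \<ominus>\<^bsub>Z\<^esub> \<beta> x y \<ominus>\<^bsub>Z\<^esub> \<beta> x y'"
    by (simp add: diff carr of bD(3) del: carrier_free_Abelian_group_iff)
   moreover have "\<beta> x y \<in> carrier Z" "\<beta> x y' \<in> carrier Z" using 2 bD(1) by auto
   ultimately show ?thesis by (simp add: Z.minus_eq Z.a_ac Z.r_neg Z.r_neg1)
  next
   case 3
   have c: "\<beta> x (r \<odot>\<^bsub>N\<^esub> y) \<in> carrier Z" using 3 bD(1) by (auto simp: N.smult_closed)
   have "frag_lift Z \<beta> k = \<beta> (r \<odot>\<^bsub>M\<^esub> x) y \<ominus>\<^bsub>Z\<^esub> \<beta> x (r \<odot>\<^bsub>N\<^esub> y)"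
    unfolding 3(1) using 3(2-4)
    by (subst diff) (auto simp: of M.smult_closed N.smult_closed)
   then show ?thesis using c 3(2-4) by (simp add: bD(4) Z.minus_eq Z.r_neg)
  qed
  then show "k \<in> kernel frags (add_monoid Z) (frag_lift Z \<beta>)" using kc by (simp add: kernel_def)
 qed
 then have "tensor_null R M N \<subseteq> kernel frags (add_monoid Z) (frag_lift Z \<beta>)"
  unfolding tensor_null_def
  by (rule group.generate_subgroup_incl[OF group_free_Abelian_group _ group_hom.subgroup_kernel[OF gh]])
 then show ?thesis using k by (auto simp: kernel_def)
qed

lemma tensor_lift_coset:
 assumes Z: "abelian_group Z" and b: "bilinear_balanced R M N Z \<beta>" and u: "u \<in> carrier frags"
 shows "tensor_lift Z \<beta> (tensor_null R M N #>\<^bsub>frags\<^esub> u) = frag_lift Z \<beta> u"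
 unfolding tensor_lift_frag_lift
proof (rule quot_lift_coset[OF group_free_Abelian_group tensor_null_subgroup u])
 interpret Z: abelian_group Z by fact
 fix k assume k: "k \<in> tensor_null R M N"
 then have kc: "k \<in> carrier frags" using subgroup.subset[OF tensor_null_subgroup] by blast
 have hom: "frag_lift Z \<beta> \<in> hom frags (add_monoid Z)"
  by (rule frag_lift_hom[OF Z bilinear_balancedD(1)[OF b]])
 show "frag_lift Z \<beta> (k \<otimes>\<^bsub>frags\<^esub> u) = frag_lift Z \<beta> u"
  using hom_mult[OF hom kc u] hom_in_carrier[OF hom u] frag_lift_null[OF Z b k] by simp
qed

lemma tensor_lift_additive:
 assumes Z: "abelian_group Z" and b: "bilinear_balanced R M N Z \<beta>"
 shows "tensor_lift Z \<beta> \<in> additive_maps MN Z"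
proof (rule additive_mapsI)
 have hom: "frag_lift Z \<beta> \<in> hom frags (add_monoid Z)"
  by (rule frag_lift_hom[OF Z bilinear_balancedD(1)[OF b]])
 note coset = tensor_lift_coset[OF Z b]
 fix U assume "U \<in> carrier MN"
 then obtain u where u: "u \<in> carrier frags" "U = tensor_null R M N #>\<^bsub>frags\<^esub> u"
  by (rule tensor_group_obtain)
 show "tensor_lift Z \<beta> U \<in> carrier Z"
  using hom_in_carrier[OF hom u(1)] by (simp add: u(2) coset[OF u(1)])
 fix V assume "V \<in> carrier MN"
 then obtain v where v: "v \<in> carrier frags" "V = tensor_null R M N #>\<^bsub>frags\<^esub> v"
  by (rule tensor_group_obtain)
 have "U \<oplus>\<^bsub>MN\<^esub> V = tensor_null R M N #>\<^bsub>frags\<^esub> (u + v)"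
  using hom_mult[OF tensor_proj_hom u(1) v(1)] by (simp add: u(2) v(2))
 then show "tensor_lift Z \<beta> (U \<oplus>\<^bsub>MN\<^esub> V) = tensor_lift Z \<beta> U \<oplus>\<^bsub>Z\<^esub> tensor_lift Z \<beta> V"
  using hom_mult[OF hom u(1) v(1)]
  by (simp only: u(2) v(2) coset[OF u(1)] coset[OF v(1)] coset[OF frags_add[OF u(1) v(1)]]
    mult_free_Abelian_group monoid.simps)
qed

lemma tensor_lift_tensor:
 assumes "abelian_group Z" "bilinear_balanced R M N Z \<beta>" "x \<in> carrier M" "y \<in> carrier N"
 shows "tensor_lift Z \<beta> (tensor R M N x y) = \<beta> x y"
 unfolding tensor_def using assms bilinear_balancedD(1)[OF assms(2)]
 by (subst tensor_lift_coset) (auto simp: frag_lift_frag_of)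

end

lemma abelian_group_cong:
 assumes "abelian_group Z" "carrier Z' = carrier Z" "\<zero>\<^bsub>Z'\<^esub> = \<zero>\<^bsub>Z\<^esub>" "(\<oplus>\<^bsub>Z'\<^esub>) = (\<oplus>\<^bsub>Z\<^esub>)"
 shows "abelian_group Z'"
proof -
 interpret Z: abelian_group Z by fact
 show ?thesis
  by (intro abelian_groupI) (auto simp: assms(2-4) Z.a_ac intro: Z.l_neg bexI[of _ "\<ominus>\<^bsub>Z\<^esub> _"])
qed

lemma tensor_lift_cong_additive:
 fixes \<beta> :: "'m \<Rightarrow> 'n \<Rightarrow> 'z" and Z :: "('z, 'k) ring_scheme" and Z' :: "('z, 'l) ring_scheme"
 assumes "carrier Z' = carrier Z" "\<zero>\<^bsub>Z'\<^esub> = \<zero>\<^bsub>Z\<^esub>" "(\<oplus>\<^bsub>Z'\<^esub>) = (\<oplus>\<^bsub>Z\<^esub>)"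
 shows "tensor_lift Z' \<beta> = tensor_lift Z \<beta>"
proof -
 have inv: "m_inv (add_monoid Z') = m_inv (add_monoid Z)"
  by (auto simp: m_inv_def assms intro!: ext)
 have "finsum Z' = (finsum Z :: ('m \<times> 'n \<Rightarrow> 'z) \<Rightarrow> _)" "add_pow Z' = (add_pow Z :: int \<Rightarrow> _)"
  using inv by (auto simp: finsum_def finprod_def add_pow_def int_pow_def nat_pow_def Let_def assms intro!: ext)
 then show ?thesis unfolding tensor_lift_def by (simp only:)
qed

locale tensor_pairs2 = A: tensor_pair R M N + B: tensor_pair R M' N'
 for R :: "('r, 'k) ring_scheme" and M :: "('r, 'm) module" and N :: "('r, 'n) module"
  and M' :: "('r, 'm2) module" and N' :: "('r, 'n2) module"
begin

lemma tensor_map_bilinear_balanced: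
 assumes "f \<in> linear_maps M M' (carrier R)" "g \<in> linear_maps N N' (carrier R)"
 shows "bilinear_balanced R M N B.MN (\<lambda>x y. tensor R M' N' (f x) (g y))"
 using assms
 by (intro bilinear_balancedI)
  (auto simp: linear_maps_def hom_def Pi_def B.tensor_add_left B.tensor_add_right
   B.tensor_balanced intro!: B.tensor_closed)

lemma tensor_map_additive:
 assumes "f \<in> linear_maps M M' (carrier R)" "g \<in> linear_maps N N' (carrier R)"
 shows "tensor_map R M' N' f g \<in> additive_maps A.MN B.MN"
 unfolding tensor_map_def
 by (rule A.tensor_lift_additive[OF B.tensor_group_abelian tensor_map_bilinear_balanced[OF assms]])

lemma tensor_map_tensor:
 assumes "f \<in> linear_maps M M' (carrier R)" "g \<in> linear_maps N N' (carrier R)"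
  and "x \<in> carrier M" "y \<in> carrier N"
 shows "tensor_map R M' N' f g (tensor R M N x y) = tensor R M' N' (f x) (g y)"
 unfolding tensor_map_def
 using A.tensor_lift_tensor[OF B.tensor_group_abelian tensor_map_bilinear_balanced[OF assms(1,2)] assms(3,4)] .

end

section \<open>Complex algebras\<close>

lemma complex_algebra_simps [simp]:
 "carrier complex_algebra = UNIV" "\<one>\<^bsub>complex_algebra\<^esub> = 1" "\<zero>\<^bsub>complex_algebra\<^esub> = 0"
 "x \<otimes>\<^bsub>complex_algebra\<^esub> y = x * y" "x \<oplus>\<^bsub>complex_algebra\<^esub> y = x + y" "c \<odot>\<^bsub>complex_algebra\<^esub> x = c * x"
 by (simp_all add: complex_algebra_def ring_of_type_algebra_def ring.defs module.defs)

lemma complex_algebra_cring: "cring complex_algebra"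
proof -
 have "\<exists>y. x + y = 0" for x :: complex by (rule exI[of _ "- x"]) simp
 then show ?thesis
  by unfold_locales (auto simp: algebra_simps Units_def add_eq_0_iff)
qed

lemma unital_algebraI:
 assumes "ring A"
  and "\<And>c x. x \<in> carrier A ==> c \<odot>\<^bsub>A\<^esub> x \<in> carrier A"
  and "\<And>a b x. x \<in> carrier A ==> (a + b) \<odot>\<^bsub>A\<^esub> x = a \<odot>\<^bsub>A\<^esub> x \<oplus>\<^bsub>A\<^esub> b \<odot>\<^bsub>A\<^esub> x"
  and "\<And>a x y. x \<in> carrier A ==> y \<in> carrier A ==> a \<odot>\<^bsub>A\<^esub> (x \<oplus>\<^bsub>A\<^esub> y) = a \<odot>\<^bsub>A\<^esub> x \<oplus>\<^bsub>A\<^esub> a \<odot>\<^bsub>A\<^esub> y"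
  and "\<And>a b x. x \<in> carrier A ==> (a * b) \<odot>\<^bsub>A\<^esub> x = a \<odot>\<^bsub>A\<^esub> (b \<odot>\<^bsub>A\<^esub> x)"
  and "\<And>x. x \<in> carrier A ==> 1 \<odot>\<^bsub>A\<^esub> x = x"
  and "\<And>c x y. x \<in> carrier A ==> y \<in> carrier A ==> (c \<odot>\<^bsub>A\<^esub> x) \<otimes>\<^bsub>A\<^esub> y = c \<odot>\<^bsub>A\<^esub> (x \<otimes>\<^bsub>A\<^esub> y)"
  and "\<And>c x y. x \<in> carrier A ==> y \<in> carrier A ==> x \<otimes>\<^bsub>A\<^esub> (c \<odot>\<^bsub>A\<^esub> y) = c \<odot>\<^bsub>A\<^esub> (x \<otimes>\<^bsub>A\<^esub> y)"
 shows "unital_algebra A"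
proof -
 have "module complex_algebra A"
  using assms ring.is_abelian_group[OF assms(1)] by (intro moduleI complex_algebra_cring) auto
 then show ?thesis using assms by (simp add: unital_algebra_def)
qed

locale ualg =
 fixes A :: "(complex, 'a) module" (structure)
 assumes unital_algebra: "unital_algebra A"
begin

lemma ring_A: "ring A" using unital_algebra by (simp add: unital_algebra_def)

lemma module_A: "module complex_algebra A" using unital_algebra by (simp add: unital_algebra_def)

end

sublocale ualg \<subseteq> ring A by (rule ring_A)

context ualg
begin

lemma smult_closed [simp, intro]: "x \<in> carrier A ==> c \<odot> x \<in> carrier A"
 using module.smult_closed[OF module_A] by simp

lemma smult_l_distr: "x \<in> carrier A ==> (a + b) \<odot> x = a \<odot> x \<oplus> b \<odot> x"
 using module.smult_l_distr[OF module_A] by simp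

lemma smult_r_distr: "x \<in> carrier A ==> y \<in> carrier A ==> a \<odot> (x \<oplus> y) = a \<odot> x \<oplus> a \<odot> y"
 using module.smult_r_distr[OF module_A] by simp

lemma smult_assoc: "x \<in> carrier A ==> a \<odot> (b \<odot> x) = (a * b) \<odot> x"
 using module.smult_assoc1[OF module_A] by simp

lemma smult_one [simp]: "x \<in> carrier A ==> 1 \<odot> x = x"
 using module.smult_one[OF module_A] by simp

lemma smult_mult_left: "x \<in> carrier A ==> y \<in> carrier A ==> (c \<odot> x) \<otimes> y = c \<odot> (x \<otimes> y)"
 using unital_algebra by (simp add: unital_algebra_def)

lemma smult_mult_right: "x \<in> carrier A ==> y \<in> carrier A ==> x \<otimes> (c \<odot> y) = c \<odot> (x \<otimes> y)"
 using unital_algebra by (simp add: unital_algebra_def)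

lemma smult_additive: "(\<lambda>x. c \<odot> x) \<in> additive_maps A A"
 by (intro additive_mapsI) (auto simp: smult_r_distr)

lemma smult_zero_right [simp]: "c \<odot> \<zero> = \<zero>"
 using additive_map_zero[OF abelian_group_axioms abelian_group_axioms smult_additive] .

lemma smult_zero_left [simp]: "x \<in> carrier A ==> 0 \<odot> x = \<zero>"
proof -
 assume x: "x \<in> carrier A"
 have "0 \<odot> x \<oplus> 0 \<odot> x = 0 \<odot> x" using smult_l_distr[OF x, of 0 0] by simp
 then show ?thesis using x by (metis add.r_cancel_one' smult_closed)
qed

lemma smult_minus: "x \<in> carrier A ==> (- c) \<odot> x = \<ominus> (c \<odot> x)"
 using smult_l_distr[of x c "- c"] by (simp add: minus_equality[symmetric] a_comm)

lemma finsum_smult: "f \<in> I \<rightarrow> carrier A ==> c \<odot> (\<Oplus>i\<in>I. f i) = (\<Oplus>i\<in>I. c \<odot> f i)"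
 by (rule additive_map_finsum[OF abelian_group_axioms abelian_group_axioms smult_additive])

lemma mult_left_additive: "x \<in> carrier A ==> (\<lambda>y. x \<otimes> y) \<in> additive_maps A A"
 by (intro additive_mapsI) (auto simp: r_distr)

lemma mult_right_additive: "x \<in> carrier A ==> (\<lambda>y. y \<otimes> x) \<in> additive_maps A A"
 by (intro additive_mapsI) (auto simp: l_distr)

lemma left_module_complex: "left_module complex_algebra A"
 using complex_algebra_cring
 by (intro left_module.intro left_module_axioms.intro)
   (auto simp: cring.axioms smult_l_distr smult_r_distr smult_assoc abelian_group_axioms)

lemma right_module_complex: "right_module complex_algebra A"
 using complex_algebra_cring
 by (intro right_module.intro right_module_axioms.intro)
   (auto simp: cring.axioms smult_l_distr smult_r_distr smult_assoc abelian_group_axioms mult.commute)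

end

lemma ualg_complex: "ualg complex_algebra"
proof (rule ualg.intro, rule unital_algebraI)
 show "ring complex_algebra" using complex_algebra_cring by (rule cring.axioms)
qed (auto simp: algebra_simps)

lemma algebra_mapsI:
 assumes "\<And>x. x \<in> carrier A ==> h x \<in> carrier B"
  and "\<And>x y. x \<in> carrier A ==> y \<in> carrier A ==> h (x \<otimes>\<^bsub>A\<^esub> y) = h x \<otimes>\<^bsub>B\<^esub> h y"
  and "\<And>x y. x \<in> carrier A ==> y \<in> carrier A ==> h (x \<oplus>\<^bsub>A\<^esub> y) = h x \<oplus>\<^bsub>B\<^esub> h y"
  and "h \<one>\<^bsub>A\<^esub> = \<one>\<^bsub>B\<^esub>"
  and "\<And>c x. x \<in> carrier A ==> h (c \<odot>\<^bsub>A\<^esub> x) = c \<odot>\<^bsub>B\<^esub> h x"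
 shows "h \<in> algebra_maps A B"
 using assms by (auto simp: algebra_maps_def linear_maps_def ring_hom_def hom_def)

lemma algebra_mapsD:
 assumes "h \<in> algebra_maps A B"
 shows alg_map_closed: "\<And>x. x \<in> carrier A ==> h x \<in> carrier B"
  and alg_map_mult: "\<And>x y. x \<in> carrier A ==> y \<in> carrier A ==> h (x \<otimes>\<^bsub>A\<^esub> y) = h x \<otimes>\<^bsub>B\<^esub> h y"
  and alg_map_add: "\<And>x y. x \<in> carrier A ==> y \<in> carrier A ==> h (x \<oplus>\<^bsub>A\<^esub> y) = h x \<oplus>\<^bsub>B\<^esub> h y"
  and alg_map_one: "h \<one>\<^bsub>A\<^esub> = \<one>\<^bsub>B\<^esub>"
  and alg_map_smult: "\<And>c x. x \<in> carrier A ==> h (c \<odot>\<^bsub>A\<^esub> x) = c \<odot>\<^bsub>B\<^esub> h x"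
  and alg_map_additive: "h \<in> additive_maps A B"
  and alg_map_linear: "h \<in> linear_maps A B UNIV"
 using assms by (auto simp: algebra_maps_def linear_maps_def ring_hom_def hom_def)

lemma alg_map_id: "id \<in> algebra_maps A A" "(\<lambda>x. x) \<in> algebra_maps A A"
 by (auto intro: algebra_mapsI)

lemma alg_map_compose:
 "f \<in> algebra_maps A B ==> g \<in> algebra_maps B C ==> (\<lambda>x. g (f x)) \<in> algebra_maps A C"
 by (rule algebra_mapsI) (simp_all add: algebra_mapsD)

lemma linear_mapsI:
 assumes "f \<in> additive_maps M N" "\<And>c x. c \<in> K ==> x \<in> carrier M ==> f (c \<odot>\<^bsub>M\<^esub> x) = c \<odot>\<^bsub>N\<^esub> f x"
 shows "f \<in> linear_maps M N K"
 using assms by (simp add: linear_maps_def)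

lemma linear_mapsD:
 assumes "f \<in> linear_maps M N K"
 shows linear_map_additive: "f \<in> additive_maps M N"
  and linear_map_smult: "\<And>c x. c \<in> K ==> x \<in> carrier M ==> f (c \<odot>\<^bsub>M\<^esub> x) = c \<odot>\<^bsub>N\<^esub> f x"
 using assms by (simp_all add: linear_maps_def)

lemma linear_map_id: "id \<in> linear_maps M M K"
 by (auto simp: linear_maps_def hom_def)

text \<open>Reversing the product turns antihomomorphisms into homomorphisms; twisting the scalars
 by complex conjugation does the same for antilinear maps.\<close>

definition opposite_algebra :: "(complex \<Rightarrow> complex) \<Rightarrow> (complex, 'a) module \<Rightarrow> (complex, 'a) module" where
 "opposite_algebra s A = \<lparr>carrier = carrier A, monoid.mult = (\<lambda>x y. y \<otimes>\<^bsub>A\<^esub> x), one = \<one>\<^bsub>A\<^esub>,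
   ring.zero = \<zero>\<^bsub>A\<^esub>, add = (\<oplus>\<^bsub>A\<^esub>), module.smult = (\<lambda>c x. s c \<odot>\<^bsub>A\<^esub> x)\<rparr>"

lemma opposite_algebra_simps [simp]:
 "carrier (opposite_algebra s A) = carrier A"
 "x \<otimes>\<^bsub>opposite_algebra s A\<^esub> y = y \<otimes>\<^bsub>A\<^esub> x"
 "\<one>\<^bsub>opposite_algebra s A\<^esub> = \<one>\<^bsub>A\<^esub>"
 "\<zero>\<^bsub>opposite_algebra s A\<^esub> = \<zero>\<^bsub>A\<^esub>"
 "x \<oplus>\<^bsub>opposite_algebra s A\<^esub> y = x \<oplus>\<^bsub>A\<^esub> y"
 "c \<odot>\<^bsub>opposite_algebra s A\<^esub> x = s c \<odot>\<^bsub>A\<^esub> x"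
 by (simp_all add: opposite_algebra_def)

lemma (in ualg) ualg_opposite:
 assumes "s = id \<or> s = cnj"
 shows "ualg (opposite_algebra s A)"
proof
 have "ring (opposite_algebra s A)"
 proof (rule ringI)
  show "abelian_group (opposite_algebra s A)"
   by (rule abelian_group_cong[OF abelian_group_axioms]) (simp_all add: opposite_algebra_def)
  show "monoid (opposite_algebra s A)"
   by unfold_locales (auto simp: m_assoc)
 qed (auto simp: l_distr r_distr)
 then show "unital_algebra (opposite_algebra s A)"
  using assms by (intro unital_algebraI)
   (auto simp: smult_l_distr smult_r_distr smult_assoc smult_mult_left smult_mult_right)
qed

section \<open>Tensor products of complex algebras\<close>

locale ualg2 = A: ualg A + B: ualg B
 for A :: "(complex, 'a) module" and B :: "(complex, 'b) module"
begin

sublocale tp: tensor_pair complex_algebra A B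
 by (rule tensor_pair.intro[OF A.right_module_complex B.left_module_complex])

abbreviation "AB \<equiv> tensor_algebra A B"

abbreviation tens (infixl "\<otimes>\<^sub>t" 75) where "a \<otimes>\<^sub>t b \<equiv> ctensor A B a b"

lemma tensor_algebra_simps:
 "carrier AB = carrier tp.MN" "\<zero>\<^bsub>AB\<^esub> = \<zero>\<^bsub>tp.MN\<^esub>" "(\<oplus>\<^bsub>AB\<^esub>) = (\<oplus>\<^bsub>tp.MN\<^esub>)" "\<one>\<^bsub>AB\<^esub> = \<one>\<^bsub>A\<^esub> \<otimes>\<^sub>t \<one>\<^bsub>B\<^esub>"
 by (simp_all add: tensor_algebra_def Let_def)

lemma tensor_lift_algebra: "tensor_lift AB \<beta> = tensor_lift tp.MN \<beta>"
 by (rule tensor_lift_cong_additive) (simp_all add: tensor_algebra_simps)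

lemma abelian_group_AB: "abelian_group AB"
 by (rule abelian_group_cong[OF tp.tensor_group_abelian]) (simp_all add: tensor_algebra_simps)

lemma AB_closed [simp, intro]: "a \<in> carrier A ==> b \<in> carrier B ==> a \<otimes>\<^sub>t b \<in> carrier AB"
 by (simp add: tensor_algebra_simps tp.tensor_closed)

lemma AB_induct [consumes 1, case_names zero tensor add]:
 assumes "U \<in> carrier AB"
  and "P \<zero>\<^bsub>AB\<^esub>"
  and "\<And>a b. [|a \<in> carrier A; b \<in> carrier B|] ==> P (a \<otimes>\<^sub>t b)"
  and "\<And>V W. [|V \<in> carrier AB; W \<in> carrier AB; P V; P W|] ==> P (V \<oplus>\<^bsub>AB\<^esub> W)"
 shows "P U"
 using assms unfolding tensor_algebra_simps by (rule tp.tensor_induct)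

lemma additive_maps_AB: "additive_maps AB Z = additive_maps tp.MN Z"
 by (simp add: hom_def tensor_algebra_simps)

lemma AB_maps_eqI:
 assumes "abelian_group Z" "f \<in> additive_maps AB Z" "g \<in> additive_maps AB Z"
  and "\<And>a b. [|a \<in> carrier A; b \<in> carrier B|] ==> f (a \<otimes>\<^sub>t b) = g (a \<otimes>\<^sub>t b)"
  and "U \<in> carrier AB"
 shows "f U = g U"
 by (rule tp.tensor_maps_eqI[OF assms(1) assms(2,3)[unfolded additive_maps_AB] assms(4)])
  (use assms(5) in \<open>simp_all add: tensor_algebra_simps\<close>)

lemma AB_add_left: "[|x \<in> carrier A; x' \<in> carrier A; y \<in> carrier B|] ==>
  (x \<oplus>\<^bsub>A\<^esub> x') \<otimes>\<^sub>t y = x \<otimes>\<^sub>t y \<oplus>\<^bsub>AB\<^esub> x' \<otimes>\<^sub>t y"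
 by (simp add: tensor_algebra_simps tp.tensor_add_left)

lemma AB_add_right: "[|x \<in> carrier A; y \<in> carrier B; y' \<in> carrier B|] ==>
  x \<otimes>\<^sub>t (y \<oplus>\<^bsub>B\<^esub> y') = x \<otimes>\<^sub>t y \<oplus>\<^bsub>AB\<^esub> x \<otimes>\<^sub>t y'"
 by (simp add: tensor_algebra_simps tp.tensor_add_right)

lemma AB_balanced: "[|x \<in> carrier A; y \<in> carrier B|] ==> (c \<odot>\<^bsub>A\<^esub> x) \<otimes>\<^sub>t y = x \<otimes>\<^sub>t (c \<odot>\<^bsub>B\<^esub> y)"
 by (simp add: tp.tensor_balanced)

lemma AB_left_additive: "y \<in> carrier B ==> (\<lambda>x. x \<otimes>\<^sub>t y) \<in> additive_maps A AB"
 by (intro additive_mapsI) (auto simp: AB_add_left)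

lemma AB_right_additive: "x \<in> carrier A ==> (\<lambda>y. x \<otimes>\<^sub>t y) \<in> additive_maps B AB"
 by (intro additive_mapsI) (auto simp: AB_add_right)

lemma AB_zero_left [simp]: "y \<in> carrier B ==> \<zero>\<^bsub>A\<^esub> \<otimes>\<^sub>t y = \<zero>\<^bsub>AB\<^esub>"
 by (simp add: tensor_algebra_simps tp.tensor_zero_left)

lemma AB_zero_right [simp]: "x \<in> carrier A ==> x \<otimes>\<^sub>t \<zero>\<^bsub>B\<^esub> = \<zero>\<^bsub>AB\<^esub>"
 by (simp add: tensor_algebra_simps tp.tensor_zero_right)

lemma AB_lift_additive:
 assumes "abelian_group Z" "bilinear_balanced complex_algebra A B Z \<beta>"
 shows "tensor_lift Z \<beta> \<in> additive_maps AB Z"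
 unfolding additive_maps_AB by (rule tp.tensor_lift_additive[OF assms])

lemmas AB_lift_tensor = tp.tensor_lift_tensor

definition mul_inner :: "'a \<Rightarrow> 'b \<Rightarrow> 'a \<Rightarrow> 'b \<Rightarrow> ('a \<times> 'b \<Rightarrow>\<^sub>0 int) set" where
 "mul_inner a b a' b' = (a \<otimes>\<^bsub>A\<^esub> a') \<otimes>\<^sub>t (b \<otimes>\<^bsub>B\<^esub> b')"

lemma mul_inner_bilinear:
 "[|a \<in> carrier A; b \<in> carrier B|] ==> bilinear_balanced complex_algebra A B AB (mul_inner a b)"
 by (intro bilinear_balancedI)
  (auto simp: mul_inner_def A.r_distr B.r_distr AB_add_left AB_add_right A.smult_mult_right
   B.smult_mult_right AB_balanced)

lemma mul_inner_lift_additive: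
 "[|a \<in> carrier A; b \<in> carrier B|] ==> tensor_lift AB (mul_inner a b) \<in> additive_maps AB AB"
 by (intro AB_lift_additive abelian_group_AB mul_inner_bilinear)

lemma mul_inner_lift_tensor:
 "[|a \<in> carrier A; b \<in> carrier B; a' \<in> carrier A; b' \<in> carrier B|] ==>
  tensor_lift AB (mul_inner a b) (a' \<otimes>\<^sub>t b') = (a \<otimes>\<^bsub>A\<^esub> a') \<otimes>\<^sub>t (b \<otimes>\<^bsub>B\<^esub> b')"
 by (simp add: AB_lift_tensor[OF abelian_group_AB mul_inner_bilinear]) (simp add: mul_inner_def)

lemma mul_outer_bilinear:
 assumes W: "W \<in> carrier AB"
 shows "bilinear_balanced complex_algebra A B AB (\<lambda>a b. tensor_lift AB (mul_inner a b) W)"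
proof (rule bilinear_balancedI)
 interpret abelian_group AB by (rule abelian_group_AB)
 note eq = AB_maps_eqI[OF abelian_group_AB _ _ _ W]
 show "tensor_lift AB (mul_inner x y) W \<in> carrier AB" if "x \<in> carrier A" "y \<in> carrier B" for x y
  using additive_map_closed[OF mul_inner_lift_additive[OF that] W] .
 show "tensor_lift AB (mul_inner (x \<oplus>\<^bsub>A\<^esub> x') y) W =
   tensor_lift AB (mul_inner x y) W \<oplus>\<^bsub>AB\<^esub> tensor_lift AB (mul_inner x' y) W"
  if "x \<in> carrier A" "x' \<in> carrier A" "y \<in> carrier B" for x x' y
  using that by (rule_tac eq[OF mul_inner_lift_additive
    additive_map_sum[OF abelian_group_AB mul_inner_lift_additive mul_inner_lift_additive]])
   (auto simp: mul_inner_lift_tensor A.l_distr AB_add_left)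
 show "tensor_lift AB (mul_inner x (y \<oplus>\<^bsub>B\<^esub> y')) W =
   tensor_lift AB (mul_inner x y) W \<oplus>\<^bsub>AB\<^esub> tensor_lift AB (mul_inner x y') W"
  if "x \<in> carrier A" "y \<in> carrier B" "y' \<in> carrier B" for x y y'
  using that by (rule_tac eq[OF mul_inner_lift_additive
    additive_map_sum[OF abelian_group_AB mul_inner_lift_additive mul_inner_lift_additive]])
   (auto simp: mul_inner_lift_tensor B.l_distr AB_add_right)
 show "tensor_lift AB (mul_inner (r \<odot>\<^bsub>A\<^esub> x) y) W = tensor_lift AB (mul_inner x (r \<odot>\<^bsub>B\<^esub> y)) W"
  if "x \<in> carrier A" "y \<in> carrier B" for x y r
  using that by (rule_tac eq[OF mul_inner_lift_additive mul_inner_lift_additive])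
   (auto simp: mul_inner_lift_tensor A.smult_mult_left B.smult_mult_left AB_balanced)
qed

lemma AB_mult_eq:
 "U \<otimes>\<^bsub>AB\<^esub> W = tensor_lift AB (\<lambda>a b. tensor_lift AB (mul_inner a b) W) U"
 unfolding tensor_lift_algebra mul_inner_def[abs_def] by (simp add: tensor_algebra_def Let_def)

lemma AB_mult_additive_left: "W \<in> carrier AB ==> (\<lambda>U. U \<otimes>\<^bsub>AB\<^esub> W) \<in> additive_maps AB AB"
 unfolding AB_mult_eq by (intro AB_lift_additive abelian_group_AB mul_outer_bilinear)

lemma AB_mult_tensor_left:
 "[|a \<in> carrier A; b \<in> carrier B; W \<in> carrier AB|] ==>
  (a \<otimes>\<^sub>t b) \<otimes>\<^bsub>AB\<^esub> W = tensor_lift AB (mul_inner a b) W"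
 unfolding AB_mult_eq by (simp add: AB_lift_tensor[OF abelian_group_AB mul_outer_bilinear])

lemma AB_mult_tensor [simp]:
 "[|a \<in> carrier A; b \<in> carrier B; a' \<in> carrier A; b' \<in> carrier B|] ==>
  (a \<otimes>\<^sub>t b) \<otimes>\<^bsub>AB\<^esub> (a' \<otimes>\<^sub>t b') = (a \<otimes>\<^bsub>A\<^esub> a') \<otimes>\<^sub>t (b \<otimes>\<^bsub>B\<^esub> b')"
 by (simp add: AB_mult_tensor_left mul_inner_lift_tensor)

lemma AB_mult_closed: "U \<in> carrier AB ==> W \<in> carrier AB ==> U \<otimes>\<^bsub>AB\<^esub> W \<in> carrier AB"
 using additive_map_closed[OF AB_mult_additive_left] .

lemma AB_mult_add_left:
 "[|U \<in> carrier AB; V \<in> carrier AB; W \<in> carrier AB|] ==>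
  (U \<oplus>\<^bsub>AB\<^esub> V) \<otimes>\<^bsub>AB\<^esub> W = U \<otimes>\<^bsub>AB\<^esub> W \<oplus>\<^bsub>AB\<^esub> V \<otimes>\<^bsub>AB\<^esub> W"
 using additive_map_add[OF AB_mult_additive_left] .

lemma AB_mult_zero_left: "W \<in> carrier AB ==> \<zero>\<^bsub>AB\<^esub> \<otimes>\<^bsub>AB\<^esub> W = \<zero>\<^bsub>AB\<^esub>"
 using additive_map_zero[OF abelian_group_AB abelian_group_AB AB_mult_additive_left] .

lemma AB_mult_additive_right: "U \<in> carrier AB ==> (\<lambda>W. U \<otimes>\<^bsub>AB\<^esub> W) \<in> additive_maps AB AB"
proof (induction U rule: AB_induct)
 interpret abelian_group AB by (rule abelian_group_AB)
 case zero then show ?case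
  by (intro additive_mapsI) (auto simp: AB_mult_zero_left)
next
 case (tensor a b) then show ?case
  by (intro additive_maps_cong[OF mul_inner_lift_additive[OF tensor]])
   (auto simp: AB_mult_tensor_left abelian_group_AB)
next
 case (add U V) then show ?case
  by (intro additive_maps_cong[OF additive_map_sum[OF abelian_group_AB add(3,4)]])
   (auto simp: AB_mult_add_left abelian_group_AB)
qed

lemma AB_smult_eq: "c \<odot>\<^bsub>AB\<^esub> U = tensor_lift AB (\<lambda>a b. (c \<odot>\<^bsub>A\<^esub> a) \<otimes>\<^sub>t b) U"
 unfolding tensor_lift_algebra by (simp add: tensor_algebra_def Let_def tensor_map_def)

lemma smult_bilinear: "bilinear_balanced complex_algebra A B AB (\<lambda>a b. (c \<odot>\<^bsub>A\<^esub> a) \<otimes>\<^sub>t b)"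
 by (intro bilinear_balancedI)
  (auto simp: A.smult_r_distr AB_add_left AB_add_right AB_balanced A.smult_assoc
   B.smult_assoc mult.commute)

lemma AB_smult_additive: "(\<lambda>U. c \<odot>\<^bsub>AB\<^esub> U) \<in> additive_maps AB AB"
 unfolding AB_smult_eq by (intro AB_lift_additive abelian_group_AB smult_bilinear)

lemma AB_smult_tensor [simp]:
 "a \<in> carrier A ==> b \<in> carrier B ==> c \<odot>\<^bsub>AB\<^esub> (a \<otimes>\<^sub>t b) = (c \<odot>\<^bsub>A\<^esub> a) \<otimes>\<^sub>t b"
 unfolding AB_smult_eq by (rule AB_lift_tensor[OF abelian_group_AB smult_bilinear])

text \<open>Both sides of each algebra law are additive in every argument, so the laws reduce to
 elementary tensors, where they are the laws of the two factors.\<close>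

lemma ualg_AB: "ualg AB"
proof
 interpret ab: abelian_group AB by (rule abelian_group_AB)
 note sum = additive_map_sum[OF abelian_group_AB]
 note comp = additive_map_compose
 have one: "\<one>\<^bsub>AB\<^esub> = \<one>\<^bsub>A\<^esub> \<otimes>\<^sub>t \<one>\<^bsub>B\<^esub>" by (simp add: tensor_algebra_simps)
 have id: "(\<lambda>U. U) \<in> additive_maps AB AB" by (auto intro: additive_mapsI)
 note [simp, intro] = AB_mult_closed
 have assoc: "(U \<otimes>\<^bsub>AB\<^esub> V) \<otimes>\<^bsub>AB\<^esub> W = U \<otimes>\<^bsub>AB\<^esub> (V \<otimes>\<^bsub>AB\<^esub> W)"
  if U: "U \<in> carrier AB" and V: "V \<in> carrier AB" and W: "W \<in> carrier AB" for U V W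
 proof (rule AB_maps_eqI[OF abelian_group_AB _ _ _ U])
  show "(\<lambda>U. (U \<otimes>\<^bsub>AB\<^esub> V) \<otimes>\<^bsub>AB\<^esub> W) \<in> additive_maps AB AB"
   by (rule comp[OF AB_mult_additive_left[OF V] AB_mult_additive_left[OF W]])
  show "(\<lambda>U. U \<otimes>\<^bsub>AB\<^esub> (V \<otimes>\<^bsub>AB\<^esub> W)) \<in> additive_maps AB AB"
   by (rule AB_mult_additive_left[OF AB_mult_closed[OF V W]])
  fix a b assume ab: "a \<in> carrier A" "b \<in> carrier B"
  show "((a \<otimes>\<^sub>t b) \<otimes>\<^bsub>AB\<^esub> V) \<otimes>\<^bsub>AB\<^esub> W = (a \<otimes>\<^sub>t b) \<otimes>\<^bsub>AB\<^esub> (V \<otimes>\<^bsub>AB\<^esub> W)"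
  proof (rule AB_maps_eqI[OF abelian_group_AB _ _ _ V])
   show "(\<lambda>V. ((a \<otimes>\<^sub>t b) \<otimes>\<^bsub>AB\<^esub> V) \<otimes>\<^bsub>AB\<^esub> W) \<in> additive_maps AB AB"
    by (rule comp[OF AB_mult_additive_right[OF AB_closed[OF ab]] AB_mult_additive_left[OF W]])
   show "(\<lambda>V. (a \<otimes>\<^sub>t b) \<otimes>\<^bsub>AB\<^esub> (V \<otimes>\<^bsub>AB\<^esub> W)) \<in> additive_maps AB AB"
    by (rule comp[OF AB_mult_additive_left[OF W] AB_mult_additive_right[OF AB_closed[OF ab]]])
   fix a' b' assume ab': "a' \<in> carrier A" "b' \<in> carrier B"
   show "((a \<otimes>\<^sub>t b) \<otimes>\<^bsub>AB\<^esub> (a' \<otimes>\<^sub>t b')) \<otimes>\<^bsub>AB\<^esub> W = (a \<otimes>\<^sub>t b) \<otimes>\<^bsub>AB\<^esub> ((a' \<otimes>\<^sub>t b') \<otimes>\<^bsub>AB\<^esub> W)"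
   proof (rule AB_maps_eqI[OF abelian_group_AB _ _ _ W])
    show "(\<lambda>W. ((a \<otimes>\<^sub>t b) \<otimes>\<^bsub>AB\<^esub> (a' \<otimes>\<^sub>t b')) \<otimes>\<^bsub>AB\<^esub> W) \<in> additive_maps AB AB"
     using ab ab' by (rule_tac AB_mult_additive_right) auto
    show "(\<lambda>W. (a \<otimes>\<^sub>t b) \<otimes>\<^bsub>AB\<^esub> ((a' \<otimes>\<^sub>t b') \<otimes>\<^bsub>AB\<^esub> W)) \<in> additive_maps AB AB"
     by (rule comp[OF AB_mult_additive_right[OF AB_closed[OF ab']] AB_mult_additive_right[OF AB_closed[OF ab]]])
   qed (use ab ab' in \<open>auto simp: A.m_assoc B.m_assoc\<close>)
  qed
 qed
 have l_one: "\<one>\<^bsub>AB\<^esub> \<otimes>\<^bsub>AB\<^esub> U = U" if "U \<in> carrier AB" for U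
  using that unfolding one
  by (rule_tac AB_maps_eqI[OF abelian_group_AB AB_mult_additive_right id]) auto
 have r_one: "U \<otimes>\<^bsub>AB\<^esub> \<one>\<^bsub>AB\<^esub> = U" if "U \<in> carrier AB" for U
  using that unfolding one
  by (rule_tac AB_maps_eqI[OF abelian_group_AB AB_mult_additive_left id]) auto
 have ring: "ring AB"
 proof (rule ringI[OF abelian_group_AB])
  show "monoid AB"
   using assoc l_one r_one by (intro monoidI) (auto simp: one)
 qed (auto simp: AB_mult_add_left additive_map_add[OF AB_mult_additive_right])
 show "unital_algebra AB"
 proof (rule unital_algebraI[OF ring])
  show "c \<odot>\<^bsub>AB\<^esub> U \<in> carrier AB" if "U \<in> carrier AB" for c U
   using additive_map_closed[OF AB_smult_additive that] .
  show "(a + b) \<odot>\<^bsub>AB\<^esub> U = a \<odot>\<^bsub>AB\<^esub> U \<oplus>\<^bsub>AB\<^esub> b \<odot>\<^bsub>AB\<^esub> U" if "U \<in> carrier AB" for a b U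
   using that by (rule_tac AB_maps_eqI[OF abelian_group_AB AB_smult_additive sum])
    (auto simp: AB_smult_additive A.smult_l_distr AB_add_left)
  show "a \<odot>\<^bsub>AB\<^esub> (U \<oplus>\<^bsub>AB\<^esub> V) = a \<odot>\<^bsub>AB\<^esub> U \<oplus>\<^bsub>AB\<^esub> a \<odot>\<^bsub>AB\<^esub> V" if "U \<in> carrier AB" "V \<in> carrier AB" for a U V
   using additive_map_add[OF AB_smult_additive that] .
  show "(a * b) \<odot>\<^bsub>AB\<^esub> U = a \<odot>\<^bsub>AB\<^esub> (b \<odot>\<^bsub>AB\<^esub> U)" if "U \<in> carrier AB" for a b U
   using that by (rule_tac AB_maps_eqI[OF abelian_group_AB AB_smult_additive comp[OF AB_smult_additive AB_smult_additive]])
    (auto simp: A.smult_assoc)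
  show "1 \<odot>\<^bsub>AB\<^esub> U = U" if "U \<in> carrier AB" for U
   using that by (rule_tac AB_maps_eqI[OF abelian_group_AB AB_smult_additive id]) auto
  show "(c \<odot>\<^bsub>AB\<^esub> U) \<otimes>\<^bsub>AB\<^esub> W = c \<odot>\<^bsub>AB\<^esub> (U \<otimes>\<^bsub>AB\<^esub> W)" if U: "U \<in> carrier AB" and W: "W \<in> carrier AB" for c U W
  proof (rule AB_maps_eqI[OF abelian_group_AB comp[OF AB_smult_additive AB_mult_additive_left[OF W]]
     comp[OF AB_mult_additive_left[OF W] AB_smult_additive] _ U])
   fix a b assume ab: "a \<in> carrier A" "b \<in> carrier B"
   show "(c \<odot>\<^bsub>AB\<^esub> (a \<otimes>\<^sub>t b)) \<otimes>\<^bsub>AB\<^esub> W = c \<odot>\<^bsub>AB\<^esub> ((a \<otimes>\<^sub>t b) \<otimes>\<^bsub>AB\<^esub> W)"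
    using ab additive_map_closed[OF AB_smult_additive]
    by (rule_tac AB_maps_eqI[OF abelian_group_AB AB_mult_additive_right
       comp[OF AB_mult_additive_right AB_smult_additive] _ W]) (auto simp: A.smult_mult_left)
  qed
  show "U \<otimes>\<^bsub>AB\<^esub> (c \<odot>\<^bsub>AB\<^esub> W) = c \<odot>\<^bsub>AB\<^esub> (U \<otimes>\<^bsub>AB\<^esub> W)" if U: "U \<in> carrier AB" and W: "W \<in> carrier AB" for c U W
  proof (rule AB_maps_eqI[OF abelian_group_AB comp[OF AB_smult_additive AB_mult_additive_right[OF U]]
     comp[OF AB_mult_additive_right[OF U] AB_smult_additive] _ W])
   fix a b assume ab: "a \<in> carrier A" "b \<in> carrier B"
   show "U \<otimes>\<^bsub>AB\<^esub> (c \<odot>\<^bsub>AB\<^esub> (a \<otimes>\<^sub>t b)) = c \<odot>\<^bsub>AB\<^esub> (U \<otimes>\<^bsub>AB\<^esub> (a \<otimes>\<^sub>t b))"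
    using ab additive_map_closed[OF AB_smult_additive]
    by (rule_tac AB_maps_eqI[OF abelian_group_AB AB_mult_additive_left
       comp[OF AB_mult_additive_left AB_smult_additive] _ U]) (auto simp: A.smult_mult_right)
  qed
 qed
qed

sublocale AB: ualg AB by (rule ualg_AB)

lemma AB_one: "\<one>\<^bsub>AB\<^esub> = \<one>\<^bsub>A\<^esub> \<otimes>\<^sub>t \<one>\<^bsub>B\<^esub>" by (simp add: tensor_algebra_simps)

lemma AB_left_hom: "(\<lambda>a. a \<otimes>\<^sub>t \<one>\<^bsub>B\<^esub>) \<in> algebra_maps A AB"
 by (intro algebra_mapsI) (auto simp: AB_one AB_add_left)

lemma AB_right_hom: "(\<lambda>b. \<one>\<^bsub>A\<^esub> \<otimes>\<^sub>t b) \<in> algebra_maps B AB"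
 by (intro algebra_mapsI) (auto simp: AB_one AB_add_right AB_balanced)

text \<open>Algebra maps with commuting images combine to an algebra map on the tensor product; the
 map may be given by any expression \<open>\<beta>\<close> that agrees with their product.\<close>

lemma AB_lift_hom:
 assumes C: "ualg C" and f: "f \<in> algebra_maps A C" and g: "g \<in> algebra_maps B C"
  and comm: "\<And>a b. [|a \<in> carrier A; b \<in> carrier B|] ==> g b \<otimes>\<^bsub>C\<^esub> f a = f a \<otimes>\<^bsub>C\<^esub> g b"
  and \<beta>: "\<And>a b. [|a \<in> carrier A; b \<in> carrier B|] ==> \<beta> a b = f a \<otimes>\<^bsub>C\<^esub> g b"
 shows "tensor_lift C \<beta> \<in> algebra_maps AB C"
  and "\<And>a b. [|a \<in> carrier A; b \<in> carrier B|] ==> tensor_lift C \<beta> (a \<otimes>\<^sub>t b) = \<beta> a b"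
proof -
 interpret C: ualg C by fact
 note fD = algebra_mapsD[OF f] and gD = algebra_mapsD[OF g]
 note comp = additive_map_compose
 have b: "bilinear_balanced complex_algebra A B C \<beta>"
  by (intro bilinear_balancedI)
   (auto simp: \<beta> fD(1-5) gD(1-5) C.l_distr C.r_distr C.smult_mult_left C.smult_mult_right)
 show tens: "tensor_lift C \<beta> (a \<otimes>\<^sub>t b) = \<beta> a b" if "a \<in> carrier A" "b \<in> carrier B" for a b
  by (rule AB_lift_tensor[OF C.abelian_group_axioms b that])
 have add: "tensor_lift C \<beta> \<in> additive_maps AB C"
  by (rule AB_lift_additive[OF C.abelian_group_axioms b])
 have swap: "(f a \<otimes>\<^bsub>C\<^esub> f a') \<otimes>\<^bsub>C\<^esub> (g b \<otimes>\<^bsub>C\<^esub> g b') = (f a \<otimes>\<^bsub>C\<^esub> g b) \<otimes>\<^bsub>C\<^esub> (f a' \<otimes>\<^bsub>C\<^esub> g b')"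
  if "a \<in> carrier A" "b \<in> carrier B" "a' \<in> carrier A" "b' \<in> carrier B" for a b a' b'
  using that comm[of a' b] by (simp add: fD gD C.m_assoc) (simp add: fD gD C.m_assoc[symmetric])
 show "tensor_lift C \<beta> \<in> algebra_maps AB C"
 proof (rule algebra_mapsI)
  show "tensor_lift C \<beta> U \<in> carrier C" if "U \<in> carrier AB" for U
   using additive_map_closed[OF add that] .
  show "tensor_lift C \<beta> (U \<oplus>\<^bsub>AB\<^esub> V) = tensor_lift C \<beta> U \<oplus>\<^bsub>C\<^esub> tensor_lift C \<beta> V"
   if "U \<in> carrier AB" "V \<in> carrier AB" for U V
   using additive_map_add[OF add that] .
  show "tensor_lift C \<beta> \<one>\<^bsub>AB\<^esub> = \<one>\<^bsub>C\<^esub>" by (simp add: AB_one tens \<beta> fD gD)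
  show "tensor_lift C \<beta> (c \<odot>\<^bsub>AB\<^esub> U) = c \<odot>\<^bsub>C\<^esub> tensor_lift C \<beta> U" if "U \<in> carrier AB" for c U
   by (rule AB_maps_eqI[OF C.abelian_group_axioms comp[OF AB_smult_additive add]
      comp[OF add C.smult_additive] _ that])
    (auto simp: tens \<beta> fD gD C.smult_mult_left)
  show "tensor_lift C \<beta> (U \<otimes>\<^bsub>AB\<^esub> V) = tensor_lift C \<beta> U \<otimes>\<^bsub>C\<^esub> tensor_lift C \<beta> V"
   if U: "U \<in> carrier AB" and V: "V \<in> carrier AB" for U V
  proof (rule AB_maps_eqI[OF C.abelian_group_axioms comp[OF AB_mult_additive_left[OF V] add]
     comp[OF add C.mult_right_additive[OF additive_map_closed[OF add V]]] _ U])
   fix a b assume ab: "a \<in> carrier A" "b \<in> carrier B"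
   show "tensor_lift C \<beta> ((a \<otimes>\<^sub>t b) \<otimes>\<^bsub>AB\<^esub> V) = tensor_lift C \<beta> (a \<otimes>\<^sub>t b) \<otimes>\<^bsub>C\<^esub> tensor_lift C \<beta> V"
    by (rule AB_maps_eqI[OF C.abelian_group_axioms
       comp[OF AB_mult_additive_right[OF AB_closed[OF ab]] add]
       comp[OF add C.mult_left_additive[OF additive_map_closed[OF add AB_closed[OF ab]]]] _ V])
     (use ab in \<open>simp add: tens \<beta> fD gD swap\<close>)
  qed
 qed
qed

end

lemma tensor_map_hom:
 assumes "ualg A" "ualg B" "ualg C" "ualg D" "f \<in> algebra_maps A C" "g \<in> algebra_maps B D"
 shows "ctensor_map C D f g \<in> algebra_maps (tensor_algebra A B) (tensor_algebra C D)"
  and "\<And>a b. [|a \<in> carrier A; b \<in> carrier B|] ==>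
   ctensor_map C D f g (ctensor A B a b) = ctensor C D (f a) (g b)"
proof -
 interpret AB: ualg2 A B using assms by (simp add: ualg2_def)
 interpret CD: ualg2 C D using assms by (simp add: ualg2_def)
 note fD = algebra_mapsD[OF assms(5)] and gD = algebra_mapsD[OF assms(6)]
 have eq: "ctensor_map C D f g = tensor_lift CD.AB (\<lambda>x y. ctensor C D (f x) (g y))"
  by (simp add: tensor_map_def CD.tensor_lift_algebra)
 note l = AB.AB_lift_hom[OF CD.ualg_AB alg_map_compose[OF assms(5) CD.AB_left_hom]
   alg_map_compose[OF assms(6) CD.AB_right_hom], of "\<lambda>x y. ctensor C D (f x) (g y)"]
 show "ctensor_map C D f g \<in> algebra_maps (tensor_algebra A B) (tensor_algebra C D)"
  unfolding eq by (rule l(1)) (auto simp: fD gD)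
 show "ctensor_map C D f g (ctensor A B a b) = ctensor C D (f a) (g b)"
  if "a \<in> carrier A" "b \<in> carrier B" for a b
  unfolding eq by (rule l(2)) (use that in \<open>auto simp: fD gD\<close>)
qed

lemma tensor_assoc_hom:
 assumes "ualg A" "ualg B" "ualg C"
 shows "tensor_assoc A B C \<in> algebra_maps (tensor_algebra (tensor_algebra A B) C) (tensor_algebra A (tensor_algebra B C))"
  and "\<And>a b c. [|a \<in> carrier A; b \<in> carrier B; c \<in> carrier C|] ==>
   tensor_assoc A B C (ctensor (tensor_algebra A B) C (ctensor A B a b) c) =
    ctensor A (tensor_algebra B C) a (ctensor B C b c)"
proof -
 interpret AB: ualg2 A B using assms by (simp add: ualg2_def)
 interpret BC: ualg2 B C using assms by (simp add: ualg2_def)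
 interpret X: ualg2 AB.AB C using assms AB.ualg_AB by (simp add: ualg2_def)
 interpret Y: ualg2 A BC.AB using assms BC.ualg_AB by (simp add: ualg2_def)
 define h where "h c U = tensor_lift Y.AB (\<lambda>a b. ctensor A BC.AB a (ctensor B C b c)) U" for c U
 have eq: "tensor_assoc A B C = tensor_lift Y.AB (\<lambda>U c. h c U)"
  by (simp add: tensor_assoc_def Let_def h_def)
 note hC = alg_map_compose[OF BC.AB_right_hom Y.AB_right_hom]
 have bil: "bilinear_balanced complex_algebra A B Y.AB (\<lambda>a b. ctensor A BC.AB a (ctensor B C b c))"
  if "c \<in> carrier C" for c
  using that by (intro bilinear_balancedI)
   (auto simp: Y.AB_add_left Y.AB_add_right BC.AB_add_left Y.AB_balanced)
 have h_tens: "h c (ctensor A B a b) = ctensor A BC.AB a (ctensor B C b c)"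
  if "a \<in> carrier A" "b \<in> carrier B" "c \<in> carrier C" for a b c
  unfolding h_def by (rule AB.AB_lift_tensor[OF Y.abelian_group_AB bil]) (use that in auto)
 have h_add: "h c \<in> additive_maps AB.AB Y.AB" if "c \<in> carrier C" for c
  unfolding h_def by (rule AB.AB_lift_additive[OF Y.abelian_group_AB bil[OF that]])
 have h1: "h \<one>\<^bsub>C\<^esub> \<in> algebra_maps AB.AB Y.AB"
  unfolding h_def
  by (rule AB.AB_lift_hom[OF Y.ualg_AB Y.AB_left_hom alg_map_compose[OF BC.AB_left_hom Y.AB_right_hom]])
    (auto simp: BC.AB_one)
 have split: "h c U = h \<one>\<^bsub>C\<^esub> U \<otimes>\<^bsub>Y.AB\<^esub> ctensor A BC.AB \<one>\<^bsub>A\<^esub> (ctensor B C \<one>\<^bsub>B\<^esub> c)"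
  if U: "U \<in> carrier AB.AB" and c: "c \<in> carrier C" for c U
  by (rule AB.AB_maps_eqI[OF Y.abelian_group_AB h_add[OF c]
     additive_map_compose[OF alg_map_additive[OF h1] Y.AB.mult_right_additive] _ U])
    (use c in \<open>auto simp: h_tens\<close>)
 have comm: "ctensor A BC.AB \<one>\<^bsub>A\<^esub> (ctensor B C \<one>\<^bsub>B\<^esub> c) \<otimes>\<^bsub>Y.AB\<^esub> h \<one>\<^bsub>C\<^esub> U =
   h \<one>\<^bsub>C\<^esub> U \<otimes>\<^bsub>Y.AB\<^esub> ctensor A BC.AB \<one>\<^bsub>A\<^esub> (ctensor B C \<one>\<^bsub>B\<^esub> c)"
  if U: "U \<in> carrier AB.AB" and c: "c \<in> carrier C" for c U
  by (rule AB.AB_maps_eqI[OF Y.abelian_group_AB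
     additive_map_compose[OF alg_map_additive[OF h1] Y.AB.mult_left_additive]
     additive_map_compose[OF alg_map_additive[OF h1] Y.AB.mult_right_additive] _ U])
    (use c in \<open>auto simp: h_tens\<close>)
 note l = X.AB_lift_hom[OF Y.ualg_AB h1 hC comm split, folded eq]
 show "tensor_assoc A B C \<in> algebra_maps X.AB Y.AB" by (rule l(1))
 show "tensor_assoc A B C (ctensor AB.AB C (ctensor A B a b) c) = ctensor A BC.AB a (ctensor B C b c)"
  if "a \<in> carrier A" "b \<in> carrier B" "c \<in> carrier C" for a b c
  using that by (simp add: l(2) h_tens)
qed

section \<open>Free algebras\<close>

lemma free_carrier: "carrier (free_algebra S) = {f. \<forall>w\<in>Poly_Mapping.keys f. set (letters w) \<subseteq> S}"
 by (simp add: free_algebra_def)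

lemma free_algebra_simps [simp]:
 "x \<otimes>\<^bsub>free_algebra S\<^esub> y = x * y" "\<one>\<^bsub>free_algebra S\<^esub> = 1" "\<zero>\<^bsub>free_algebra S\<^esub> = 0"
 "x \<oplus>\<^bsub>free_algebra S\<^esub> y = x + y" "c \<odot>\<^bsub>free_algebra S\<^esub> x = nc_const c * x"
 by (simp_all add: free_algebra_def)

lemma letters_word [simp]: "letters (v + w) = letters v @ letters w" "letters 0 = []"
 by (simp_all add: plus_word_def zero_word_def)

lemma nc_const_simps: "nc_const (a + b) = nc_const a + nc_const b" "nc_const (a * b) = nc_const a * nc_const b"
 "nc_const 1 = 1" "nc_const 0 = 0" "nc_const (- a) = - nc_const a"
 by (simp_all add: nc_const_def single_add mult_single single_uminus)

lemma poly_mapping_sum_single: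
 "f = (\<Sum>w\<in>Poly_Mapping.keys f. Poly_Mapping.single w (Poly_Mapping.lookup f w))"
 by (rule poly_mapping_eqI) (simp add: lookup_sum lookup_single when_def in_keys_iff)

lemma nc_const_commute: "nc_const c * f = f * nc_const c"
proof -
 have "(\<Sum>w\<in>K. Poly_Mapping.single w (Poly_Mapping.lookup f w)) * nc_const c =
   nc_const c * (\<Sum>w\<in>K. Poly_Mapping.single w (Poly_Mapping.lookup f w))" for K
  by (simp add: sum_distrib_left sum_distrib_right nc_const_def mult_single mult.commute)
 then show ?thesis using poly_mapping_sum_single[of f] by metis
qed

lemma free_carrier_closed:
 "1 \<in> carrier (free_algebra S)" "0 \<in> carrier (free_algebra S)" "nc_const c \<in> carrier (free_algebra S)"
 "f \<in> carrier (free_algebra S) ==> g \<in> carrier (free_algebra S) ==> f + g \<in> carrier (free_algebra S)"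
 "f \<in> carrier (free_algebra S) ==> g \<in> carrier (free_algebra S) ==> f - g \<in> carrier (free_algebra S)"
 "f \<in> carrier (free_algebra S) ==> - f \<in> carrier (free_algebra S)"
 "f \<in> carrier (free_algebra S) ==> g \<in> carrier (free_algebra S) ==> f * g \<in> carrier (free_algebra S)"
 "a \<in> S ==> nc_gen a \<in> carrier (free_algebra S)"
proof -
 show "f \<in> carrier (free_algebra S) ==> g \<in> carrier (free_algebra S) ==> f * g \<in> carrier (free_algebra S)"
  using keys_mult[of f g] by (fastforce simp: subset_iff free_carrier)
 show "f \<in> carrier (free_algebra S) ==> g \<in> carrier (free_algebra S) ==> f + g \<in> carrier (free_algebra S)"
  using Poly_Mapping.keys_add[of f g] by (auto simp: free_carrier)
 show "f \<in> carrier (free_algebra S) ==> g \<in> carrier (free_algebra S) ==> f - g \<in> carrier (free_algebra S)"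
  using keys_diff[of f g] by (auto simp: free_carrier)
qed (auto simp: free_carrier nc_const_def nc_gen_def zero_word_def)

lemma single_in_free_carrier: "set (letters w) \<subseteq> S ==> Poly_Mapping.single w c \<in> carrier (free_algebra S)"
 by (auto simp: free_carrier)

lemma free_carrier_sum:
 "(\<And>i. i \<in> I ==> f i \<in> carrier (free_algebra S)) ==> (\<Sum>i\<in>I. f i) \<in> carrier (free_algebra S)"
 by (induction I rule: infinite_finite_induct) (auto intro: free_carrier_closed)

lemma free_carrier_induct [consumes 1, case_names zero single add]:
 assumes f: "f \<in> carrier (free_algebra S)"
  and zero: "P 0"
  and single: "\<And>c w. set (letters w) \<subseteq> S ==> P (Poly_Mapping.single w c)"
  and add: "\<And>f g. [|f \<in> carrier (free_algebra S); g \<in> carrier (free_algebra S); P f; P g|] ==> P (f + g)"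
 shows "P f"
proof -
 let ?s = "\<lambda>w. Poly_Mapping.single w (Poly_Mapping.lookup f w)"
 have "(\<Sum>w\<in>K. ?s w) \<in> carrier (free_algebra S) \<and> P (\<Sum>w\<in>K. ?s w)"
  if "finite K" "K \<subseteq> Poly_Mapping.keys f" for K
  using that
 proof (induction K)
  case (insert w K)
  then have w: "set (letters w) \<subseteq> S" using f by (auto simp: free_carrier)
  then have "?s w \<in> carrier (free_algebra S)" by (rule single_in_free_carrier)
  then show ?case using insert single[OF w] add free_carrier_closed(4)[of "?s w" S] by simp
 qed (simp add: zero free_carrier_closed)
 from this[OF finite_keys subset_refl] show ?thesis using poly_mapping_sum_single[of f] by simp
qed

lemma ualg_free: "ualg (free_algebra S)"
proof
 have "ring (free_algebra S)"
 proof (rule ringI)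
  show "abelian_group (free_algebra S)"
  proof (rule abelian_groupI)
   show "\<exists>y\<in>carrier (free_algebra S). y \<oplus>\<^bsub>free_algebra S\<^esub> x = \<zero>\<^bsub>free_algebra S\<^esub>"
    if "x \<in> carrier (free_algebra S)" for x
    using free_carrier_closed(6)[OF that] by (intro bexI[of _ "- x"]) auto
  qed (auto simp: ac_simps free_carrier_closed)
  show "monoid (free_algebra S)"
   by (intro monoidI) (auto simp: ac_simps free_carrier_closed)
 qed (auto simp: distrib_left distrib_right)
 then show "unital_algebra (free_algebra S)"
 proof (rule unital_algebraI)
  show "x \<otimes>\<^bsub>free_algebra S\<^esub> (c \<odot>\<^bsub>free_algebra S\<^esub> y) = c \<odot>\<^bsub>free_algebra S\<^esub> (x \<otimes>\<^bsub>free_algebra S\<^esub> y)" for c x y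
   by (simp add: mult.assoc[symmetric] nc_const_commute[of c x])
 qed (auto simp: nc_const_simps distrib_left distrib_right mult.assoc free_carrier_closed)
qed

context ualg
begin

lemma word_prod_closed [simp]:
 "(\<And>g. g \<in> set gs ==> \<theta> g \<in> carrier A) ==> word_prod A \<theta> gs \<in> carrier A"
 by (induction gs) (auto simp: word_prod_def)

lemma word_prod_append:
 "(\<And>g. g \<in> set gs \<union> set hs ==> \<theta> g \<in> carrier A) ==>
  word_prod A \<theta> (gs @ hs) = word_prod A \<theta> gs \<otimes> word_prod A \<theta> hs"
proof (induction gs)
 case Nil then show ?case using word_prod_closed[of hs \<theta>] by (simp add: word_prod_def)
next
 case (Cons g gs)
 have "word_prod A \<theta> gs \<in> carrier A" "word_prod A \<theta> hs \<in> carrier A" "\<theta> g \<in> carrier A"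
  using Cons.prems by (auto intro: word_prod_closed)
 moreover have "word_prod A \<theta> (g # ks) = \<theta> g \<otimes> word_prod A \<theta> ks" for ks
  by (simp add: word_prod_def)
 ultimately show ?case using Cons by (simp add: m_assoc)
qed

context
 fixes \<theta> :: "'g \<Rightarrow> 'a" and S :: "'g set"
 assumes \<theta>_closed: "\<And>g. g \<in> S ==> \<theta> g \<in> carrier A"
begin

lemma free_hom_single:
 assumes "set (letters w) \<subseteq> S"
 shows "free_hom A \<theta> (Poly_Mapping.single w c) = c \<odot> word_prod A \<theta> (letters w)"
proof -
 have "word_prod A \<theta> (letters w) \<in> carrier A" using assms \<theta>_closed by (intro word_prod_closed) auto
 then show ?thesis by (simp add: free_hom_def)
qed

lemma free_hom_extend:
 assumes "finite K" "Poly_Mapping.keys f \<subseteq> K" "\<And>w. w \<in> K ==> set (letters w) \<subseteq> S"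
 shows "free_hom A \<theta> f = (\<Oplus>w\<in>K. Poly_Mapping.lookup f w \<odot> word_prod A \<theta> (letters w))"
proof -
 have "word_prod A \<theta> (letters w) \<in> carrier A" if "w \<in> K" for w
  using assms(3)[OF that] \<theta>_closed by (intro word_prod_closed) auto
 then show ?thesis
  unfolding free_hom_def using assms
  by (intro add.finprod_mono_neutral_cong_left) (auto simp: in_keys_iff)
qed

lemma free_hom_add:
 assumes "f \<in> carrier (free_algebra S)" "g \<in> carrier (free_algebra S)"
 shows "free_hom A \<theta> (f + g) = free_hom A \<theta> f \<oplus> free_hom A \<theta> g"
proof -
 let ?K = "Poly_Mapping.keys f \<union> Poly_Mapping.keys g"
 have K: "finite ?K" "\<And>w. w \<in> ?K ==> set (letters w) \<subseteq> S" "Poly_Mapping.keys (f + g) \<subseteq> ?K"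
  using assms Poly_Mapping.keys_add[of f g] by (auto simp: free_carrier)
 have c: "word_prod A \<theta> (letters w) \<in> carrier A" if "w \<in> ?K" for w
  using K(2)[OF that] \<theta>_closed by (intro word_prod_closed) auto
 have ext: "free_hom A \<theta> h = (\<Oplus>w\<in>?K. Poly_Mapping.lookup h w \<odot> word_prod A \<theta> (letters w))"
  if "Poly_Mapping.keys h \<subseteq> ?K" for h
  using free_hom_extend[OF K(1) that] K(2) by blast
 have "free_hom A \<theta> (f + g) = (\<Oplus>w\<in>?K. Poly_Mapping.lookup f w \<odot> word_prod A \<theta> (letters w)
   \<oplus> Poly_Mapping.lookup g w \<odot> word_prod A \<theta> (letters w))"
  unfolding ext[OF K(3)]
  using c by (intro finsum_cong') (auto simp: lookup_add smult_l_distr)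
 also have "\<dots> = free_hom A \<theta> f \<oplus> free_hom A \<theta> g"
  unfolding ext[OF Un_upper1] ext[OF Un_upper2] using c by (intro finsum_addf) auto
 finally show ?thesis .
qed

lemma free_hom_closed: "f \<in> carrier (free_algebra S) ==> free_hom A \<theta> f \<in> carrier A"
 using \<theta>_closed by (auto simp: free_hom_def free_carrier intro!: finsum_closed word_prod_closed)

lemma free_hom_zero: "free_hom A \<theta> 0 = \<zero>" by (simp add: free_hom_def)

lemma free_hom_mult:
 assumes "f \<in> carrier (free_algebra S)" "g \<in> carrier (free_algebra S)"
 shows "free_hom A \<theta> (f * g) = free_hom A \<theta> f \<otimes> free_hom A \<theta> g"
 using assms(1)
proof (induction f rule: free_carrier_induct)
 case zero then show ?case using assms(2) free_hom_closed by (simp add: free_hom_zero)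
next
 case (add f f')
 then show ?case using assms(2)
  by (simp add: distrib_right free_hom_add free_carrier_closed free_hom_closed l_distr)
next
 case (single c v)
 have v: "Poly_Mapping.single v c \<in> carrier (free_algebra S)" using single by (rule single_in_free_carrier)
 have vc: "word_prod A \<theta> (letters v) \<in> carrier A" using single \<theta>_closed by (intro word_prod_closed) auto
 show ?case using assms(2)
 proof (induction g rule: free_carrier_induct)
  case zero then show ?case using free_hom_closed[OF v] by (simp add: free_hom_zero)
 next
  case (add g g')
  then show ?case using v
   by (simp add: distrib_left free_hom_add free_carrier_closed free_hom_closed r_distr)
 next
  case (single d w)
  have wc: "word_prod A \<theta> (letters w) \<in> carrier A" using single \<theta>_closed by (intro word_prod_closed) auto
  have "word_prod A \<theta> (letters v @ letters w) = word_prod A \<theta> (letters v) \<otimes> word_prod A \<theta> (letters w)"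
   using single \<open>set (letters v) \<subseteq> S\<close> \<theta>_closed by (intro word_prod_append) auto
  then show ?case using single \<open>set (letters v) \<subseteq> S\<close> vc wc
   by (simp add: mult_single free_hom_single smult_mult_left smult_mult_right smult_assoc mult.commute)
 qed
qed

lemma free_hom_algebra_map: "free_hom A \<theta> \<in> algebra_maps (free_algebra S) A"
proof (rule algebra_mapsI)
 have one: "(1 :: 'g ncpoly) = Poly_Mapping.single 0 1" by simp
 show "free_hom A \<theta> \<one>\<^bsub>free_algebra S\<^esub> = \<one>"
  by (simp add: one free_hom_single word_prod_def del: single_one)
 fix c f assume f: "f \<in> carrier (free_algebra S)"
 have "free_hom A \<theta> (nc_const c) = c \<odot> \<one>"
  by (simp add: nc_const_def free_hom_single word_prod_def)
 then show "free_hom A \<theta> (c \<odot>\<^bsub>free_algebra S\<^esub> f) = c \<odot> free_hom A \<theta> f"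
  using free_hom_closed[OF f] f free_hom_mult[of "nc_const c" f] free_carrier_closed(3)[of c S]
  by (simp add: smult_mult_left)
qed (simp_all add: free_hom_closed free_hom_mult free_hom_add)

lemma free_hom_gen: "g \<in> S ==> free_hom A \<theta> (nc_gen g) = \<theta> g"
 using \<theta>_closed by (simp add: nc_gen_def free_hom_single word_prod_def)

lemma free_antihom_opposite:
 assumes s: "s = id \<or> s = cnj" and f: "f \<in> carrier (free_algebra S)"
 shows "free_antihom A s \<theta> f = free_hom (opposite_algebra s A) \<theta> f"
proof -
 interpret O: ualg "opposite_algebra s A" by (rule ualg_opposite[OF s])
 have wp: "word_prod A \<theta> (rev gs) = word_prod (opposite_algebra s A) \<theta> gs"
  if "set gs \<subseteq> S" for gs using that
 proof (induction gs)
  case (Cons g gs)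
  then have "word_prod A \<theta> (rev gs @ [g]) = word_prod A \<theta> (rev gs) \<otimes> word_prod A \<theta> [g]"
   using \<theta>_closed by (intro word_prod_append) auto
  then show ?case using Cons \<theta>_closed by (simp add: word_prod_def)
 qed (simp add: word_prod_def)
 have fs: "finsum (opposite_algebra s A) h I = finsum A h I" for h and I :: "'g word set"
  by (simp add: finsum_def finprod_def opposite_algebra_def)
 have "free_antihom A s \<theta> f =
   (\<Oplus>w\<in>Poly_Mapping.keys f. s (Poly_Mapping.lookup f w) \<odot> word_prod (opposite_algebra s A) \<theta> (letters w))"
  unfolding free_antihom_def using f \<theta>_closed O.word_prod_closed[of _ \<theta>]
  by (intro finsum_cong') (auto simp: wp free_carrier subset_iff)
 then show ?thesis by (simp add: free_hom_def fs)
qed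

end

end

text \<open>Words span, so an algebra map out of a free algebra is determined by the generators.\<close>

lemma free_algebra_maps_unique:
 assumes B: "ualg B" and f: "f \<in> algebra_maps (free_algebra S) B" and h: "h \<in> algebra_maps (free_algebra S) B"
  and gen: "\<And>g. g \<in> S ==> f (nc_gen g) = h (nc_gen g)"
  and x: "x \<in> carrier (free_algebra S)"
 shows "f x = h x"
proof -
 interpret F: ualg "free_algebra S" by (rule ualg_free)
 interpret B: ualg B by fact
 have word: "f (Poly_Mapping.single (Word gs) 1) = h (Poly_Mapping.single (Word gs) 1)
   \<and> Poly_Mapping.single (Word gs) 1 \<in> carrier (free_algebra S)" if "set gs \<subseteq> S" for gs
  using that
 proof (induction gs)
  case Nil
  have "Poly_Mapping.single (Word []) 1 = \<one>\<^bsub>free_algebra S\<^esub>" by (simp flip: zero_word_def)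
  then show ?case using alg_map_one[OF f] alg_map_one[OF h] F.one_closed by metis
 next
  case (Cons g gs)
  have e: "Poly_Mapping.single (Word (g # gs)) 1 = nc_gen g \<otimes>\<^bsub>free_algebra S\<^esub> Poly_Mapping.single (Word gs) 1"
   by (simp add: nc_gen_def mult_single plus_word_def)
  have gS: "g \<in> S" using Cons by auto
  then have gc: "nc_gen g \<in> carrier (free_algebra S)" by (rule free_carrier_closed)
  have IH: "f (Poly_Mapping.single (Word gs) 1) = h (Poly_Mapping.single (Word gs) 1)"
   "Poly_Mapping.single (Word gs) 1 \<in> carrier (free_algebra S)" using Cons by auto
  show ?case unfolding e
   using alg_map_mult[OF f gc IH(2)] alg_map_mult[OF h gc IH(2)] gen[OF gS] IH(1) F.m_closed[OF gc IH(2)]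
   by simp
 qed
 have sing: "Poly_Mapping.single w c = c \<odot>\<^bsub>free_algebra S\<^esub> Poly_Mapping.single w 1" for w c
  by (simp add: nc_const_def mult_single)
 show ?thesis using x
 proof (induction x rule: free_carrier_induct)
  case zero
  have "f \<zero>\<^bsub>free_algebra S\<^esub> = h \<zero>\<^bsub>free_algebra S\<^esub>"
   using additive_map_zero[OF F.abelian_group_axioms B.abelian_group_axioms] alg_map_additive f h by metis
  then show ?case by simp
 next
  case (single c w)
  then show ?case using word[of "letters w"] unfolding sing[of w c]
   by (simp add: alg_map_smult[OF f, unfolded free_algebra_simps(5)] alg_map_smult[OF h, unfolded free_algebra_simps(5)]
     )
 next
  case (add f' g')
  then show ?case using alg_map_add[OF f add(1,2)] alg_map_add[OF h add(1,2)] by simp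
 qed
qed

section \<open>Quotient algebras\<close>

lemma quot_lift_cong: "(\<And>x. x \<in> U ==> f x = g x) ==> quot_lift f U = quot_lift g U"
 by (simp add: quot_lift_def cong: image_cong)

locale alg_ideal = ualg A + ideal I A for A :: "(complex, 'a) module" (structure) and I
begin

abbreviation "Q \<equiv> quotient_algebra A I"

lemma smult_ideal: "x \<in> I ==> c \<odot> x \<in> I"
 using I_l_closed[of x "c \<odot> \<one>"] Icarr by (simp add: smult_mult_left)

lemma coset_eq_iff: "x \<in> carrier A ==> y \<in> carrier A ==> I +> x = I +> y \<longleftrightarrow> x \<ominus> y \<in> I"
 using quotient_eq_iff_same_a_r_cos[OF is_ideal] by simp

lemma quot_lift_additive_coset:
 assumes B: "abelian_group B" and h: "h \<in> additive_maps A B"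
  and zero: "\<And>x. x \<in> I ==> h x = \<zero>\<^bsub>B\<^esub>" and x: "x \<in> carrier A"
 shows "quot_lift h (I +> x) = h x"
proof -
 interpret B: abelian_group B by fact
 have "h (i \<oplus> x) = h x" if "i \<in> I" for i
  using additive_map_add[OF h Icarr[OF that] x] zero[OF that] additive_map_closed[OF h x] by simp
 then show ?thesis
  using quot_lift_coset[OF a_group a_subgroup, of x h] x by (simp add: a_r_coset_def)
qed

lemma quotient_simps:
 "carrier Q = {I +> x | x. x \<in> carrier A}"
 "\<zero>\<^bsub>Q\<^esub> = I" "\<one>\<^bsub>Q\<^esub> = I +> \<one>"
 "\<And>x y. x \<in> carrier A ==> y \<in> carrier A ==> (I +> x) \<oplus>\<^bsub>Q\<^esub> (I +> y) = I +> (x \<oplus> y)"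
 "\<And>x y. x \<in> carrier A ==> y \<in> carrier A ==> (I +> x) \<otimes>\<^bsub>Q\<^esub> (I +> y) = I +> (x \<otimes> y)"
 "\<And>c x. x \<in> carrier A ==> c \<odot>\<^bsub>Q\<^esub> (I +> x) = I +> (c \<odot> x)"
proof -
 show "carrier Q = {I +> x | x. x \<in> carrier A}" "\<zero>\<^bsub>Q\<^esub> = I" "\<one>\<^bsub>Q\<^esub> = I +> \<one>"
  by (auto simp: quotient_algebra_def ring.defs module.defs FactRing_def A_RCOSETS_def RCOSETS_def a_r_coset_def)
 show "(I +> x) \<oplus>\<^bsub>Q\<^esub> (I +> y) = I +> (x \<oplus> y)" if "x \<in> carrier A" "y \<in> carrier A" for x y
  using a_rcos_sum[OF that] by (simp add: quotient_algebra_def ring.defs module.defs FactRing_def)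
 show "(I +> x) \<otimes>\<^bsub>Q\<^esub> (I +> y) = I +> (x \<otimes> y)" if "x \<in> carrier A" "y \<in> carrier A" for x y
  using rcoset_mult_add[OF that] by (simp add: quotient_algebra_def ring.defs module.defs FactRing_def)
 fix c x assume x: "x \<in> carrier A"
 have "I +> (c \<odot> (i \<oplus> x)) = I +> (c \<odot> x)" if "i \<in> I" for i
 proof (subst coset_eq_iff)
  have "c \<odot> (i \<oplus> x) \<ominus> c \<odot> x = c \<odot> i"
   using x Icarr[OF that] by (simp add: smult_r_distr minus_eq a_assoc r_neg)
  then show "c \<odot> (i \<oplus> x) \<ominus> c \<odot> x \<in> I" using smult_ideal[OF that] by simp
 qed (use x Icarr[OF that] in auto)
 then show "c \<odot>\<^bsub>Q\<^esub> (I +> x) = I +> (c \<odot> x)"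
  using quot_lift_coset[OF a_group a_subgroup, of x "\<lambda>x. I +> (c \<odot> x)"] x
  by (simp add: quotient_algebra_def ring.defs module.defs a_r_coset_def)
qed

lemma ualg_quotient: "ualg Q"
proof
 have "ring (A Quot I)" by (rule quotient_is_ring)
 then have "ring Q"
  by (auto simp: quotient_algebra_def ring.defs module.defs FactRing_def ring_def monoid_def
    ring_axioms_def abelian_group_def abelian_monoid_def abelian_group_axioms_def comm_monoid_def
    comm_monoid_axioms_def comm_group_def group_def group_axioms_def Units_def)
 then show "unital_algebra Q"
  by (rule unital_algebraI)
   (auto simp: quotient_simps smult_l_distr smult_r_distr smult_assoc smult_mult_left smult_mult_right)
qed

lemma quotient_proj: "(\<lambda>x. I +> x) \<in> algebra_maps A Q"
 by (intro algebra_mapsI) (auto simp: quotient_simps)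

lemma quotient_zero_iff: "x \<in> carrier A ==> I +> x = \<zero>\<^bsub>Q\<^esub> \<longleftrightarrow> x \<in> I"
 using coset_eq_iff[of x \<zero>] a_rcos_zero[OF is_ideal, of \<zero>] additive_subgroup.zero_closed[OF additive_subgroup_axioms]
 by (simp add: quotient_simps minus_eq)

lemma quot_lift_additive:
 assumes B: "abelian_group B" and h: "h \<in> additive_maps A B" and zero: "\<And>x. x \<in> I ==> h x = \<zero>\<^bsub>B\<^esub>"
 shows "quot_lift h \<in> additive_maps Q B"
 using h quot_lift_additive_coset[OF B h zero]
 by (intro additive_mapsI) (auto simp: quotient_simps hom_def Pi_def)

lemma quot_lift_hom:
 assumes B: "ualg B" and h: "h \<in> algebra_maps A B" and zero: "\<And>x. x \<in> I ==> h x = \<zero>\<^bsub>B\<^esub>"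
 shows "quot_lift h \<in> algebra_maps Q B" and "\<And>x. x \<in> carrier A ==> quot_lift h (I +> x) = h x"
proof -
 have Bg: "abelian_group B" using ring.is_abelian_group[OF ualg.ring_A[OF B]] .
 note coset = quot_lift_additive_coset[OF Bg alg_map_additive[OF h] zero]
 show "quot_lift h (I +> x) = h x" if "x \<in> carrier A" for x by (rule coset[OF _ that])
 show "quot_lift h \<in> algebra_maps Q B"
  by (intro algebra_mapsI) (auto simp: quotient_simps coset algebra_mapsD[OF h])
qed

end

lemma alg_map_kernel_ideal:
 assumes "ualg A" "ualg B" "h \<in> algebra_maps A B"
 shows "ideal {x \<in> carrier A. h x = \<zero>\<^bsub>B\<^esub>} A"
proof -
 have "ring_hom_ring A B h"
  using assms by (intro ring_hom_ringI2) (auto simp: ualg.ring_A algebra_maps_def)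
 then show ?thesis using ring_hom_ring.kernel_is_ideal[of A B h] by (simp add: a_kernel_def')
qed

lemma (in ualg) alg_map_kills_genideal:
 assumes "ualg B" "h \<in> algebra_maps A B" "S \<subseteq> carrier A" "\<And>s. s \<in> S ==> h s = \<zero>\<^bsub>B\<^esub>" "x \<in> Idl S"
 shows "h x = \<zero>\<^bsub>B\<^esub>"
proof -
 have "Idl S \<subseteq> {x \<in> carrier A. h x = \<zero>\<^bsub>B\<^esub>}"
  using assms by (intro genideal_minimal alg_map_kernel_ideal ualg_axioms) auto
 then show ?thesis using assms(5) by auto
qed

section \<open>Square matrices over an algebra\<close>

definition matrices :: "('a, 'm) ring_scheme \<Rightarrow> 'i set \<Rightarrow> ('i \<Rightarrow> 'i \<Rightarrow> 'a) monoid" where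
 "matrices A I = \<lparr>carrier = I \<rightarrow>\<^sub>E (I \<rightarrow>\<^sub>E carrier A),
   monoid.mult = (\<lambda>U V. \<lambda>i\<in>I. \<lambda>j\<in>I. \<Oplus>\<^bsub>A\<^esub>k\<in>I. U i k \<otimes>\<^bsub>A\<^esub> V k j),
   one = (\<lambda>i\<in>I. \<lambda>j\<in>I. if i = j then \<one>\<^bsub>A\<^esub> else \<zero>\<^bsub>A\<^esub>)\<rparr>"

abbreviation mk_matrix :: "'i set \<Rightarrow> ('i \<Rightarrow> 'i \<Rightarrow> 'a) \<Rightarrow> 'i \<Rightarrow> 'i \<Rightarrow> 'a" where
 "mk_matrix I U \<equiv> \<lambda>i\<in>I. \<lambda>j\<in>I. U i j"

lemma mk_matrix_carrier: "(\<And>i j. i \<in> I ==> j \<in> I ==> U i j \<in> carrier A) ==> mk_matrix I U \<in> carrier (matrices A I)"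
 by (simp add: matrices_def)

lemma mk_matrix_cong: "(\<And>i j. i \<in> I ==> j \<in> I ==> U i j = V i j) ==> mk_matrix I U = mk_matrix I V"
 by (auto simp: fun_eq_iff restrict_def)

lemma mk_matrix_eqD: "mk_matrix I U = mk_matrix I V ==> i \<in> I ==> j \<in> I ==> U i j = V i j"
 by (drule fun_cong[of _ _ i], drule fun_cong[of _ _ j]) simp

lemma one_matrix: "\<one>\<^bsub>matrices A I\<^esub> = mk_matrix I (\<lambda>i j. if i = j then \<one>\<^bsub>A\<^esub> else \<zero>\<^bsub>A\<^esub>)"
 by (simp add: matrices_def)

context ring
begin

lemma mat_mult:
 assumes "\<And>i j. i \<in> I ==> j \<in> I ==> U i j \<in> carrier R" "\<And>i j. i \<in> I ==> j \<in> I ==> V i j \<in> carrier R"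
 shows "mk_matrix I U \<otimes>\<^bsub>matrices R I\<^esub> mk_matrix I V = mk_matrix I (\<lambda>i j. \<Oplus>k\<in>I. U i k \<otimes> V k j)"
proof (intro ext)
 fix i j
 show "(mk_matrix I U \<otimes>\<^bsub>matrices R I\<^esub> mk_matrix I V) i j = mk_matrix I (\<lambda>i j. \<Oplus>k\<in>I. U i k \<otimes> V k j) i j"
 proof (cases "i \<in> I \<and> j \<in> I")
  case True
  then have "(\<Oplus>k\<in>I. mk_matrix I U i k \<otimes> mk_matrix I V k j) = (\<Oplus>k\<in>I. U i k \<otimes> V k j)"
   using assms by (intro finsum_cong') auto
  then show ?thesis using True by (simp add: matrices_def)
 qed (auto simp: matrices_def)
qed

lemma matrices_monoid:
 assumes I: "finite I" shows "monoid (matrices R I)"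
proof (rule monoidI)
 fix U V W assume uvw: "U \<in> carrier (matrices R I)" "V \<in> carrier (matrices R I)" "W \<in> carrier (matrices R I)"
 have ex: "\<exists>u. Z = mk_matrix I u \<and> (\<forall>i\<in>I. \<forall>j\<in>I. u i j \<in> carrier R)" if "Z \<in> carrier (matrices R I)" for Z
  using that by (intro exI[of _ Z]) (auto simp: matrices_def PiE_def extensional_def restrict_def fun_eq_iff)
 obtain u v w where eq: "U = mk_matrix I u" "V = mk_matrix I v" "W = mk_matrix I w"
  and c: "\<And>i j. i \<in> I ==> j \<in> I ==> u i j \<in> carrier R" "\<And>i j. i \<in> I ==> j \<in> I ==> v i j \<in> carrier R"
   "\<And>i j. i \<in> I ==> j \<in> I ==> w i j \<in> carrier R"
  using ex[OF uvw(1)] ex[OF uvw(2)] ex[OF uvw(3)] by blast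
 have uv: "(\<Oplus>k\<in>I. u i k \<otimes> v k j) \<in> carrier R" and vw: "(\<Oplus>k\<in>I. v i k \<otimes> w k j) \<in> carrier R"
  if "i \<in> I" "j \<in> I" for i j
  using that c by (auto intro!: finsum_closed)
 show "U \<otimes>\<^bsub>matrices R I\<^esub> V \<in> carrier (matrices R I)"
  unfolding eq using c uv by (simp add: mat_mult mk_matrix_carrier)
 have "(\<Oplus>k\<in>I. (\<Oplus>l\<in>I. u i l \<otimes> v l k) \<otimes> w k j) = (\<Oplus>l\<in>I. u i l \<otimes> (\<Oplus>k\<in>I. v l k \<otimes> w k j))"
  if ij: "i \<in> I" "j \<in> I" for i j
 proof -
  have "(\<Oplus>k\<in>I. (\<Oplus>l\<in>I. u i l \<otimes> v l k) \<otimes> w k j) = (\<Oplus>k\<in>I. \<Oplus>l\<in>I. u i l \<otimes> v l k \<otimes> w k j)"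
   using ij c I by (intro finsum_cong' finsum_ldistr) (auto intro!: finsum_closed)
  also have "\<dots> = (\<Oplus>l\<in>I. \<Oplus>k\<in>I. u i l \<otimes> v l k \<otimes> w k j)"
   using ij c I by (intro finsum_finsum_swap) auto
  also have "\<dots> = (\<Oplus>l\<in>I. \<Oplus>k\<in>I. u i l \<otimes> (v l k \<otimes> w k j))"
   using ij c by (intro finsum_cong') (auto simp: m_assoc intro!: finsum_closed)
  also have "\<dots> = (\<Oplus>l\<in>I. u i l \<otimes> (\<Oplus>k\<in>I. v l k \<otimes> w k j))"
   using ij c I by (intro finsum_cong' finsum_rdistr[symmetric]) (auto intro!: finsum_closed)
  finally show ?thesis .
 qed
 then show "U \<otimes>\<^bsub>matrices R I\<^esub> V \<otimes>\<^bsub>matrices R I\<^esub> W = U \<otimes>\<^bsub>matrices R I\<^esub> (V \<otimes>\<^bsub>matrices R I\<^esub> W)"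
  unfolding eq using c uv vw by (simp add: mat_mult cong: mk_matrix_cong)
next
 fix U assume "U \<in> carrier (matrices R I)"
 then obtain u where eq: "U = mk_matrix I u" and c: "\<And>i j. i \<in> I ==> j \<in> I ==> u i j \<in> carrier R"
  by (auto simp: matrices_def PiE_def extensional_def restrict_def fun_eq_iff Pi_def intro: that[of U])
 have "(\<Oplus>k\<in>I. (if i = k then \<one> else \<zero>) \<otimes> u k j) = u i j" if "i \<in> I" "j \<in> I" for i j
  using that c I by (subst finsum_single_term[of I i]) auto
 then show "\<one>\<^bsub>matrices R I\<^esub> \<otimes>\<^bsub>matrices R I\<^esub> U = U"
  unfolding eq one_matrix using c by (simp add: mat_mult cong: mk_matrix_cong)
 have "(\<Oplus>k\<in>I. u i k \<otimes> (if k = j then \<one> else \<zero>)) = u i j" if "i \<in> I" "j \<in> I" for i j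
  using that c I by (subst finsum_single_term[of I j]) auto
 then show "U \<otimes>\<^bsub>matrices R I\<^esub> \<one>\<^bsub>matrices R I\<^esub> = U"
  unfolding eq one_matrix using c by (simp add: mat_mult cong: mk_matrix_cong)
qed (auto simp: one_matrix intro!: mk_matrix_carrier)

text \<open>The two embeddings \<open>U \<mapsto> U \<otimes> 1\<close> and \<open>U \<mapsto> 1 \<otimes> U\<close> of matrices into matrices indexed by
 pairs.\<close>

definition emb1 :: "'i set \<Rightarrow> ('i \<Rightarrow> 'i \<Rightarrow> 'a) \<Rightarrow> 'i \<times> 'i \<Rightarrow> 'i \<times> 'i \<Rightarrow> 'a" where
 "emb1 I U = mk_matrix (I \<times> I) (\<lambda>r c. if snd r = snd c then U (fst r) (fst c) else \<zero>)"

definition emb2 :: "'i set \<Rightarrow> ('i \<Rightarrow> 'i \<Rightarrow> 'a) \<Rightarrow> 'i \<times> 'i \<Rightarrow> 'i \<times> 'i \<Rightarrow> 'a" where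
 "emb2 I U = mk_matrix (I \<times> I) (\<lambda>r c. if fst r = fst c then U (snd r) (snd c) else \<zero>)"

context
 fixes I :: "'i set" and U V :: "'i \<Rightarrow> 'i \<Rightarrow> 'a"
 assumes I: "finite I"
  and U: "\<And>i j. i \<in> I ==> j \<in> I ==> U i j \<in> carrier R"
  and V: "\<And>i j. i \<in> I ==> j \<in> I ==> V i j \<in> carrier R"
begin

lemma finsum_delta_mult:
 assumes "s \<in> I" "u \<in> carrier R" "v \<in> carrier R"
 shows "(\<Oplus>b\<in>I. (if s = b then u else \<zero>) \<otimes> (if b = t then v else \<zero>)) = (if s = t then u \<otimes> v else \<zero>)"
 using assms I by (subst finsum_single_term[of I s]) auto

lemma emb_carrier: "emb1 I U \<in> carrier (matrices R (I \<times> I))" "emb2 I U \<in> carrier (matrices R (I \<times> I))"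
 unfolding emb1_def emb2_def using U by (auto intro!: mk_matrix_carrier)

lemma emb1_emb2: "emb1 I U \<otimes>\<^bsub>matrices R (I \<times> I)\<^esub> emb2 I V =
  mk_matrix (I \<times> I) (\<lambda>r c. U (fst r) (fst c) \<otimes> V (snd r) (snd c))"
 unfolding emb1_def emb2_def
 apply (subst mat_mult)
 subgoal using U by auto
 subgoal using V by auto
 subgoal
 proof (rule mk_matrix_cong)
  fix r c assume rc: "r \<in> I \<times> I" "c \<in> I \<times> I"
  show "(\<Oplus>p\<in>I \<times> I. (if snd r = snd p then U (fst r) (fst p) else \<zero>) \<otimes>
    (if fst p = fst c then V (snd p) (snd c) else \<zero>)) = U (fst r) (fst c) \<otimes> V (snd r) (snd c)"
   using rc U V I by (subst finsum_single_term[of "I \<times> I" "(fst c, snd r)"]) auto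
 qed
 done

lemma emb2_emb1: "emb2 I V \<otimes>\<^bsub>matrices R (I \<times> I)\<^esub> emb1 I U =
  mk_matrix (I \<times> I) (\<lambda>r c. V (snd r) (snd c) \<otimes> U (fst r) (fst c))"
 unfolding emb1_def emb2_def
 apply (subst mat_mult)
 subgoal using V by auto
 subgoal using U by auto
 subgoal
 proof (rule mk_matrix_cong)
  fix r c assume rc: "r \<in> I \<times> I" "c \<in> I \<times> I"
  show "(\<Oplus>p\<in>I \<times> I. (if fst r = fst p then V (snd r) (snd p) else \<zero>) \<otimes>
    (if snd p = snd c then U (fst p) (fst c) else \<zero>)) = V (snd r) (snd c) \<otimes> U (fst r) (fst c)"
   using rc U V I by (subst finsum_single_term[of "I \<times> I" "(fst r, snd c)"]) auto
 qed
 done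

lemma emb1_mult: "emb1 I U \<otimes>\<^bsub>matrices R (I \<times> I)\<^esub> emb1 I V = emb1 I (\<lambda>i j. \<Oplus>k\<in>I. U i k \<otimes> V k j)"
 unfolding emb1_def
 apply (subst mat_mult)
 subgoal using U by auto
 subgoal using V by auto
 subgoal
 proof (rule mk_matrix_cong)
  fix r c assume rc: "r \<in> I \<times> I" "c \<in> I \<times> I"
  have "(\<Oplus>p\<in>I \<times> I. (if snd r = snd p then U (fst r) (fst p) else \<zero>) \<otimes>
    (if snd p = snd c then V (fst p) (fst c) else \<zero>)) =
   (\<Oplus>a\<in>I. \<Oplus>b\<in>I. (if snd r = b then U (fst r) a else \<zero>) \<otimes> (if b = snd c then V a (fst c) else \<zero>))"
   using finsum_Times[of I I "\<lambda>a b. (if snd r = b then U (fst r) a else \<zero>) \<otimes> (if b = snd c then V a (fst c) else \<zero>)"]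
    rc U V I by auto
  also have "\<dots> = (\<Oplus>a\<in>I. if snd r = snd c then U (fst r) a \<otimes> V a (fst c) else \<zero>)"
   using rc U V I by (intro finsum_cong' finsum_delta_mult) auto
  also have "\<dots> = (if snd r = snd c then \<Oplus>k\<in>I. U (fst r) k \<otimes> V k (fst c) else \<zero>)"
   by simp
  finally show "(\<Oplus>p\<in>I \<times> I. (if snd r = snd p then U (fst r) (fst p) else \<zero>) \<otimes>
    (if snd p = snd c then V (fst p) (fst c) else \<zero>)) =
   (if snd r = snd c then \<Oplus>k\<in>I. U (fst r) k \<otimes> V k (fst c) else \<zero>)" .
 qed
 done

lemma emb2_mult: "emb2 I U \<otimes>\<^bsub>matrices R (I \<times> I)\<^esub> emb2 I V = emb2 I (\<lambda>i j. \<Oplus>k\<in>I. U i k \<otimes> V k j)"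
 unfolding emb2_def
 apply (subst mat_mult)
 subgoal using U by auto
 subgoal using V by auto
 subgoal
 proof (rule mk_matrix_cong)
  fix r c assume rc: "r \<in> I \<times> I" "c \<in> I \<times> I"
  have "(\<Oplus>p\<in>I \<times> I. (if fst r = fst p then U (snd r) (snd p) else \<zero>) \<otimes>
    (if fst p = fst c then V (snd p) (snd c) else \<zero>)) =
   (\<Oplus>a\<in>I. \<Oplus>b\<in>I. (if fst r = a then U (snd r) b else \<zero>) \<otimes> (if a = fst c then V b (snd c) else \<zero>))"
   using finsum_Times[of I I "\<lambda>a b. (if fst r = a then U (snd r) b else \<zero>) \<otimes> (if a = fst c then V b (snd c) else \<zero>)"]
    rc U V I by auto
  also have "\<dots> =
   (\<Oplus>b\<in>I. \<Oplus>a\<in>I. (if fst r = a then U (snd r) b else \<zero>) \<otimes> (if a = fst c then V b (snd c) else \<zero>))"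
   using rc U V I by (intro finsum_finsum_swap) auto
  also have "\<dots> = (\<Oplus>b\<in>I. if fst r = fst c then U (snd r) b \<otimes> V b (snd c) else \<zero>)"
   using rc U V I by (intro finsum_cong' finsum_delta_mult) auto
  also have "\<dots> = (if fst r = fst c then \<Oplus>k\<in>I. U (snd r) k \<otimes> V k (snd c) else \<zero>)"
   by simp
  finally show "(\<Oplus>p\<in>I \<times> I. (if fst r = fst p then U (snd r) (snd p) else \<zero>) \<otimes>
    (if fst p = fst c then V (snd p) (snd c) else \<zero>)) =
   (if fst r = fst c then \<Oplus>k\<in>I. U (snd r) k \<otimes> V k (snd c) else \<zero>)" .
 qed
 done

end

lemma emb_one:
 "emb1 I (\<lambda>i j. if i = j then \<one> else \<zero>) = \<one>\<^bsub>matrices R (I \<times> I)\<^esub>"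
 "emb2 I (\<lambda>i j. if i = j then \<one> else \<zero>) = \<one>\<^bsub>matrices R (I \<times> I)\<^esub>"
 unfolding emb1_def emb2_def one_matrix by (auto intro!: mk_matrix_cong simp: prod_eq_iff)

lemma emb_cong:
 assumes "\<And>i j. i \<in> I ==> j \<in> I ==> U i j = V i j"
 shows "emb1 I U = emb1 I V" "emb2 I U = emb2 I V"
 unfolding emb1_def emb2_def using assms by (auto intro!: mk_matrix_cong)

end

section \<open>The coefficients of the relations\<close>

abbreviation N4 :: "nat set" where "N4 \<equiv> {1..4}"

lemma N4_cases: "i \<in> N4 ==> i = 1 \<or> i = 2 \<or> i = 3 \<or> i = 4" by auto

lemma N4_prime [simp]: "i \<in> N4 ==> 5 - i \<in> N4" "i \<in> N4 ==> 5 - (5 - i) = i" by auto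

definition Rcoef :: "real \<Rightarrow> nat \<Rightarrow> nat \<Rightarrow> nat \<Rightarrow> nat \<Rightarrow> complex" where
 "Rcoef q i k a b =
   (if i = a \<and> k = b then (if i = k then of_real q else if k = 5 - i then inverse (of_real q) else 1) else 0)
  + (if i = b \<and> k = a \<and> a < i then of_real q - inverse (of_real q) else 0)
  - (if k = 5 - i \<and> b = 5 - a \<and> a < i then (of_real q - inverse (of_real q)) *
    (of_real q powi (rho_wt i - rho_wt a) * eps_sign i * eps_sign a) else 0)"

lemma sum_single_term:
 fixes f :: "'i \<Rightarrow> 'b :: comm_monoid_add"
 assumes "finite I" "\<And>j. j \<in> I ==> j \<noteq> i ==> f j = 0"
 shows "(\<Sum>j\<in>I. f j) = (if i \<in> I then f i else 0)"
proof -
 have "(\<Sum>j\<in>I. f j) = (\<Sum>j\<in>I. if j = i then f j else 0)"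
  using assms(2) by (intro sum.cong) auto
 then show ?thesis using assms(1) by (simp add: sum.delta)
qed

lemma Rmat_Rcoef:
 assumes "i \<in> N4" "k \<in> N4" "a \<in> N4" "b \<in> N4"
 shows "Rmat q (i, k) (a, b) = Rcoef q i k a b"
proof -
 have kron: "kron_prod (matrix_unit p r) (matrix_unit s t) (i, k) (a, b) =
   (if i = p \<and> a = r \<and> k = s \<and> b = t then 1 else 0)" for p r s t
  by (auto simp: kron_prod_def matrix_unit_def)
 have double: "(\<Sum>p\<in>N4. \<Sum>r\<in>D p. f p r) = (if r0 \<in> D i then f i r0 else 0)"
  if "\<And>p r. f p r \<noteq> 0 ==> p = i \<and> r = r0" "\<And>p. finite (D p)" for f :: "nat \<Rightarrow> nat \<Rightarrow> complex" and D r0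
 proof -
  have "(\<Sum>r\<in>D p. f p r) = (if r0 \<in> D p then f p r0 else 0)" for p
  proof (rule sum_single_term)
   show "finite (D p)" by (rule that(2))
   show "f p r = 0" if "r \<noteq> r0" for r
    using \<open>\<And>p r. f p r \<noteq> 0 ==> p = i \<and> r = r0\<close> that by auto
  qed
  then have "(\<Sum>p\<in>N4. \<Sum>r\<in>D p. f p r) = (\<Sum>p\<in>N4. if r0 \<in> D p then f p r0 else 0)" by simp
  also have "\<dots> = (if r0 \<in> D i then f i r0 else 0)"
  proof (subst sum_single_term[of _ i])
   show "(if r0 \<in> D p then f p r0 else 0) = 0" if "p \<noteq> i" for p
    using \<open>\<And>p r. f p r \<noteq> 0 ==> p = i \<and> r = r0\<close> that by auto
  qed (use assms(1) in auto)
  finally show ?thesis .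
 qed
 have 1: "(\<Sum>p=1..4. kron_prod (matrix_unit p p) (matrix_unit p p) (i, k) (a, b)) =
   (if i = a \<and> k = b \<and> i = k then 1 else 0)"
  unfolding kron using assms by (subst sum_single_term[of _ i]) auto
 have 2: "(\<Sum>p=1..4. \<Sum>r\<in>{1..4} - {p, 5 - p}. kron_prod (matrix_unit p p) (matrix_unit r r) (i, k) (a, b)) =
   (if i = a \<and> k = b \<and> k \<noteq> i \<and> k \<noteq> 5 - i then 1 else 0)"
  unfolding kron using assms by (subst double[of _ k]) (auto split: if_splits)
 have 3: "(\<Sum>p=1..4. kron_prod (matrix_unit (5 - p) (5 - p)) (matrix_unit p p) (i, k) (a, b)) =
   (if i = a \<and> k = b \<and> k = 5 - i then 1 else 0)"
  unfolding kron using assms by (subst sum_single_term[of _ k]) auto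
 have 4: "(\<Sum>p=1..4. \<Sum>r\<in>{r\<in>{1..4}. p > r}. kron_prod (matrix_unit p r) (matrix_unit r p) (i, k) (a, b)) =
   (if i = b \<and> k = a \<and> a < i then 1 else 0)"
  unfolding kron using assms by (subst double[of _ a]) (auto split: if_splits)
 have 5: "(\<Sum>p=1..4. \<Sum>r\<in>{r\<in>{1..4}. p > r}. c p r * e p * e r *
    kron_prod (matrix_unit p r) (matrix_unit (5 - p) (5 - r)) (i, k) (a, b)) =
   (if k = 5 - i \<and> b = 5 - a \<and> a < i then c i a * e i * e a else 0)" for c :: "nat \<Rightarrow> nat \<Rightarrow> complex" and e
  unfolding kron using assms by (subst double[of _ a]) (auto split: if_splits)
 have ne: "k \<noteq> 5 - i" if "i = k" using assms that by simp presburger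
 have diag_bool: "u * (if D1 \<and> D2 \<and> E then 1 else 0) + (if D1 \<and> D2 \<and> \<not> E' \<and> \<not> F then 1 else 0)
   + v * (if D1 \<and> D2 \<and> F then 1 else 0) =
   (if D1 \<and> D2 then (if E then u else if F then v else 1) else 0)"
  if "\<not> (E \<and> F)" "E' = E" for u v :: complex and D1 D2 E E' F
  using that by auto
 have diag: "u * (if i = a \<and> k = b \<and> i = k then 1 else 0) + (if i = a \<and> k = b \<and> k \<noteq> i \<and> k \<noteq> 5 - i then 1 else 0)
   + v * (if i = a \<and> k = b \<and> k = 5 - i then 1 else 0) =
   (if i = a \<and> k = b then (if i = k then u else if k = 5 - i then v else 1) else 0)" for u v :: complex
  by (rule diag_bool) (use ne in blast)+
 have ifs: "w * (if P then 1 else 0) = (if P then w else 0)" "w * (if P then z else 0) = (if P then w * z else 0)"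
  for w z :: complex and P by simp_all
 show ?thesis
  unfolding Rmat_def 1 2 3 4 5[of "\<lambda>i j. of_real q powi (rho_wt i - rho_wt j)"] Rcoef_def
  unfolding diag unfolding ifs mult_1_right ..
qed

lemma eps_rho_prime: "i \<in> N4 ==> eps_sign (5 - i) = - eps_sign i" "i \<in> N4 ==> rho_wt (5 - i) = - rho_wt i"
 using N4_cases[of i] by (auto simp: rho_wt_def eps_sign_def)

lemma Rcoef_transpose:
 assumes "i \<in> N4" "k \<in> N4" "a \<in> N4" "b \<in> N4"
 shows "Rcoef q i k a b = Rcoef q b a k i"
proof -
 have lt: "i < 5" "k < 5" "a < 5" "b < 5" using assms by auto
 have 1: "(if i = a \<and> k = b then (if i = k then u else if k = 5 - i then v else w) else 0) =
   (if b = k \<and> a = i then (if b = a then u else if a = 5 - b then v else w) else (0 :: complex))" for u v w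
  using lt by (cases "i = a \<and> k = b") auto
 have 2: "(if i = b \<and> k = a \<and> a < i then u else 0) = (if b = i \<and> a = k \<and> k < b then u else (0 :: complex))" for u
  by auto
 have 3: "(k = 5 - i \<and> b = 5 - a \<and> a < i) = (a = 5 - b \<and> i = 5 - k \<and> k < b)"
  using lt by auto
 have 4: "of_real q powi (rho_wt i - rho_wt a) * eps_sign i * eps_sign a =
   of_real q powi (rho_wt b - rho_wt k) * eps_sign b * eps_sign k"
  if "k = 5 - i \<and> b = 5 - a \<and> a < i"
  using that eps_rho_prime[OF assms(1)] eps_rho_prime[OF assms(3)] by simp
 show ?thesis unfolding Rcoef_def 1 2 using 3 4 by simp
qed

lemma Rcoef_real:
 assumes "i \<in> N4" "k \<in> N4" "a \<in> N4" "b \<in> N4"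
 shows "cnj (Rcoef q i k a b) = Rcoef q i k a b"
proof -
 have "cnj (eps_sign i) = eps_sign i" if "i \<in> N4" for i
  using N4_cases[OF that] by (auto simp: eps_sign_def)
 then show ?thesis using assms by (simp add: Rcoef_def)
qed

definition Scoef :: "real \<Rightarrow> nat \<Rightarrow> nat \<Rightarrow> complex" where
 "Scoef q i j = Cmat q i (5 - i) * Cinv q (5 - j) j"

lemma Scoef_eq:
 assumes "q \<noteq> 0" "i \<in> N4" "j \<in> N4"
 shows "Scoef q i j = of_real q powi (rho_wt j - rho_wt i) * eps_sign i * eps_sign j"
proof -
 have "i = 5 - (5 - i)" "5 - j = 5 - j" using assms by auto
 then show ?thesis
  using assms(1) eps_rho_prime[OF assms(2)] eps_rho_prime[OF assms(3)]
  by (simp add: Scoef_def Cmat_def Cinv_def power_int_diff power_int_minus field_simps)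
qed

lemma Scoef_simps:
 assumes "q \<noteq> 0" "i \<in> N4" "j \<in> N4"
 shows "Scoef q i i = 1" "Scoef q j i * Scoef q (5 - j) (5 - i) = 1" "cnj (Scoef q i j) = Scoef q i j"
  and "k \<in> N4 ==> Scoef q i k * Scoef q k j = Scoef q i j"
proof -
 have e: "eps_sign i * eps_sign i = 1" "cnj (eps_sign i) = eps_sign i" if "i \<in> N4" for i
  using N4_cases[OF that] by (auto simp: eps_sign_def)
 have q: "complex_of_real q \<noteq> 0" using assms(1) by simp
 note eq = Scoef_eq[OF assms(1)]
 have e': "eps_sign i * (eps_sign i * z) = z" if "i \<in> N4" for i z
  using e(1)[OF that] by (metis mult.assoc mult_1)
 show "Scoef q i i = 1" using e assms by (simp add: eq mult.assoc)
 show "cnj (Scoef q i j) = Scoef q i j" using e assms by (simp add: eq)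
 show "Scoef q j i * Scoef q (5 - j) (5 - i) = 1"
  using e'[OF assms(2)] e'[OF assms(3)] e[OF assms(2)] e[OF assms(3)] q eps_rho_prime[OF assms(2)] eps_rho_prime[OF assms(3)]
  by (simp add: eq[OF assms(3,2)] eq[OF N4_prime(1)[OF assms(3)] N4_prime(1)[OF assms(2)]]
    mult_ac power_int_diff)
 show "Scoef q i k * Scoef q k j = Scoef q i j" if "k \<in> N4"
  using assms that e' q by (simp add: eq power_int_diff mult_ac)
qed

lemma sgen_Scoef:
 assumes "i \<in> N4" "j \<in> N4"
 shows "sgen q i j = nc_const (Scoef q i j) * tgen (5 - j) (5 - i)"
proof -
 have C: "Cmat q i a = 0" if "a \<in> N4" "a \<noteq> 5 - i" for a using that assms by (auto simp: Cmat_def)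
 have D: "Cinv q b j = 0" if "b \<in> N4" "b \<noteq> 5 - j" for b using that assms by (auto simp: Cmat_def Cinv_def)
 let ?f = "\<lambda>a b. nc_const (Cmat q i a) * tgen b a * nc_const (Cinv q b j)"
 have "(\<Sum>b\<in>N4. ?f a b) = ?f a (5 - j)" for a
  using N4_prime(1)[OF assms(2)] D by (subst sum_single_term[of _ "5 - j"]) (simp_all add: nc_const_simps)
 then have "sgen q i j = (\<Sum>a\<in>N4. ?f a (5 - j))" unfolding sgen_def by simp
 also have "\<dots> = ?f (5 - i) (5 - j)"
  using N4_prime(1)[OF assms(1)] C by (subst sum_single_term[of _ "5 - i"]) (simp_all add: nc_const_simps)
 also have "\<dots> = nc_const (Scoef q i j) * tgen (5 - j) (5 - i)"
  using nc_const_commute[of "Cinv q (5 - j) j" "tgen (5 - j) (5 - i)"]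
  by (simp add: Scoef_def nc_const_simps mult.assoc)
 finally show ?thesis .
qed

text \<open>Keeps membership goals such as \<open>1 \<in> {1..4}\<close> in numeral form.\<close>

declare One_nat_def [simp del] atLeastAtMost_iff [simp del]

lemma N4_mem [simp]: "1 \<in> N4" "2 \<in> N4" "3 \<in> N4" "4 \<in> N4"
 by (simp_all add: atLeastAtMost_iff)

section \<open>Matrices satisfying the relations of the quantum symplectic group\<close>

context ring
begin

context
 fixes I :: "'i set" and U :: "'i \<Rightarrow> 'i \<Rightarrow> 'a" and Z :: "'i \<times> 'i \<Rightarrow> 'i \<times> 'i \<Rightarrow> 'a"
 assumes I: "finite I"
  and U: "\<And>i j. i \<in> I ==> j \<in> I ==> U i j \<in> carrier R"
  and Z: "\<And>r c. r \<in> I \<times> I ==> c \<in> I \<times> I ==> Z r c \<in> carrier R"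
begin

lemma emb1_left: "emb1 I U \<otimes>\<^bsub>matrices R (I \<times> I)\<^esub> mk_matrix (I \<times> I) Z =
  mk_matrix (I \<times> I) (\<lambda>r c. \<Oplus>a\<in>I. U (fst r) a \<otimes> Z (a, snd r) c)"
 unfolding emb1_def
proof (subst mat_mult)
 show "mk_matrix (I \<times> I) (\<lambda>r c. \<Oplus>p\<in>I \<times> I. (if snd r = snd p then U (fst r) (fst p) else \<zero>) \<otimes> Z p c) =
  mk_matrix (I \<times> I) (\<lambda>r c. \<Oplus>a\<in>I. U (fst r) a \<otimes> Z (a, snd r) c)"
 proof (rule mk_matrix_cong)
  fix r c assume rc: "r \<in> I \<times> I" "c \<in> I \<times> I"
  have "(\<Oplus>p\<in>I \<times> I. (if snd r = snd p then U (fst r) (fst p) else \<zero>) \<otimes> Z p c) =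
    (\<Oplus>a\<in>I. \<Oplus>b\<in>I. (if snd r = b then U (fst r) a else \<zero>) \<otimes> Z (a, b) c)"
   using finsum_Times[of I I "\<lambda>a b. (if snd r = b then U (fst r) a else \<zero>) \<otimes> Z (a, b) c"] rc U Z I by auto
  also have "\<dots> = (\<Oplus>a\<in>I. U (fst r) a \<otimes> Z (a, snd r) c)"
  proof (rule finsum_cong')
   fix a assume "a \<in> I"
   then show "(\<Oplus>b\<in>I. (if snd r = b then U (fst r) a else \<zero>) \<otimes> Z (a, b) c) = U (fst r) a \<otimes> Z (a, snd r) c"
    using rc U Z I by (subst finsum_single_term[of I "snd r"]) auto
  qed (use rc U Z in auto)
  finally show "(\<Oplus>p\<in>I \<times> I. (if snd r = snd p then U (fst r) (fst p) else \<zero>) \<otimes> Z p c) =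
   (\<Oplus>a\<in>I. U (fst r) a \<otimes> Z (a, snd r) c)" .
 qed
qed (use U Z in auto)

lemma emb2_left: "emb2 I U \<otimes>\<^bsub>matrices R (I \<times> I)\<^esub> mk_matrix (I \<times> I) Z =
  mk_matrix (I \<times> I) (\<lambda>r c. \<Oplus>b\<in>I. U (snd r) b \<otimes> Z (fst r, b) c)"
 unfolding emb2_def
proof (subst mat_mult)
 show "mk_matrix (I \<times> I) (\<lambda>r c. \<Oplus>p\<in>I \<times> I. (if fst r = fst p then U (snd r) (snd p) else \<zero>) \<otimes> Z p c) =
  mk_matrix (I \<times> I) (\<lambda>r c. \<Oplus>b\<in>I. U (snd r) b \<otimes> Z (fst r, b) c)"
 proof (rule mk_matrix_cong)
  fix r c assume rc: "r \<in> I \<times> I" "c \<in> I \<times> I"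
  have "(\<Oplus>p\<in>I \<times> I. (if fst r = fst p then U (snd r) (snd p) else \<zero>) \<otimes> Z p c) =
    (\<Oplus>a\<in>I. \<Oplus>b\<in>I. (if fst r = a then U (snd r) b else \<zero>) \<otimes> Z (a, b) c)"
   using finsum_Times[of I I "\<lambda>a b. (if fst r = a then U (snd r) b else \<zero>) \<otimes> Z (a, b) c"] rc U Z I by auto
  also have "\<dots> = (\<Oplus>b\<in>I. \<Oplus>a\<in>I. (if fst r = a then U (snd r) b else \<zero>) \<otimes> Z (a, b) c)"
   using rc U Z I by (intro finsum_finsum_swap) auto
  also have "\<dots> = (\<Oplus>b\<in>I. U (snd r) b \<otimes> Z (fst r, b) c)"
  proof (rule finsum_cong')
   fix b assume "b \<in> I"
   then show "(\<Oplus>a\<in>I. (if fst r = a then U (snd r) b else \<zero>) \<otimes> Z (a, b) c) = U (snd r) b \<otimes> Z (fst r, b) c"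
    using rc U Z I by (subst finsum_single_term[of I "fst r"]) auto
  qed (use rc U Z in auto)
  finally show "(\<Oplus>p\<in>I \<times> I. (if fst r = fst p then U (snd r) (snd p) else \<zero>) \<otimes> Z p c) =
   (\<Oplus>b\<in>I. U (snd r) b \<otimes> Z (fst r, b) c)" .
 qed
qed (use U Z in auto)

lemma emb1_right: "mk_matrix (I \<times> I) Z \<otimes>\<^bsub>matrices R (I \<times> I)\<^esub> emb1 I U =
  mk_matrix (I \<times> I) (\<lambda>r c. \<Oplus>a\<in>I. Z r (a, snd c) \<otimes> U a (fst c))"
 unfolding emb1_def
proof (subst mat_mult)
 show "mk_matrix (I \<times> I) (\<lambda>r c. \<Oplus>p\<in>I \<times> I. Z r p \<otimes> (if snd p = snd c then U (fst p) (fst c) else \<zero>)) =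
  mk_matrix (I \<times> I) (\<lambda>r c. \<Oplus>a\<in>I. Z r (a, snd c) \<otimes> U a (fst c))"
 proof (rule mk_matrix_cong)
  fix r c assume rc: "r \<in> I \<times> I" "c \<in> I \<times> I"
  have "(\<Oplus>p\<in>I \<times> I. Z r p \<otimes> (if snd p = snd c then U (fst p) (fst c) else \<zero>)) =
    (\<Oplus>a\<in>I. \<Oplus>b\<in>I. Z r (a, b) \<otimes> (if b = snd c then U a (fst c) else \<zero>))"
   using finsum_Times[of I I "\<lambda>a b. Z r (a, b) \<otimes> (if b = snd c then U a (fst c) else \<zero>)"] rc U Z I by auto
  also have "\<dots> = (\<Oplus>a\<in>I. Z r (a, snd c) \<otimes> U a (fst c))"
  proof (rule finsum_cong')
   fix a assume "a \<in> I"
   then show "(\<Oplus>b\<in>I. Z r (a, b) \<otimes> (if b = snd c then U a (fst c) else \<zero>)) = Z r (a, snd c) \<otimes> U a (fst c)"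
    using rc U Z I by (subst finsum_single_term[of I "snd c"]) auto
  qed (use rc U Z in auto)
  finally show "(\<Oplus>p\<in>I \<times> I. Z r p \<otimes> (if snd p = snd c then U (fst p) (fst c) else \<zero>)) =
   (\<Oplus>a\<in>I. Z r (a, snd c) \<otimes> U a (fst c))" .
 qed
qed (use U Z in auto)

lemma emb2_right: "mk_matrix (I \<times> I) Z \<otimes>\<^bsub>matrices R (I \<times> I)\<^esub> emb2 I U =
  mk_matrix (I \<times> I) (\<lambda>r c. \<Oplus>b\<in>I. Z r (fst c, b) \<otimes> U b (snd c))"
 unfolding emb2_def
proof (subst mat_mult)
 show "mk_matrix (I \<times> I) (\<lambda>r c. \<Oplus>p\<in>I \<times> I. Z r p \<otimes> (if fst p = fst c then U (snd p) (snd c) else \<zero>)) =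
  mk_matrix (I \<times> I) (\<lambda>r c. \<Oplus>b\<in>I. Z r (fst c, b) \<otimes> U b (snd c))"
 proof (rule mk_matrix_cong)
  fix r c assume rc: "r \<in> I \<times> I" "c \<in> I \<times> I"
  have "(\<Oplus>p\<in>I \<times> I. Z r p \<otimes> (if fst p = fst c then U (snd p) (snd c) else \<zero>)) =
    (\<Oplus>a\<in>I. \<Oplus>b\<in>I. Z r (a, b) \<otimes> (if a = fst c then U b (snd c) else \<zero>))"
   using finsum_Times[of I I "\<lambda>a b. Z r (a, b) \<otimes> (if a = fst c then U b (snd c) else \<zero>)"] rc U Z I by auto
  also have "\<dots> = (\<Oplus>b\<in>I. \<Oplus>a\<in>I. Z r (a, b) \<otimes> (if a = fst c then U b (snd c) else \<zero>))"
   using rc U Z I by (intro finsum_finsum_swap) auto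
  also have "\<dots> = (\<Oplus>b\<in>I. Z r (fst c, b) \<otimes> U b (snd c))"
  proof (rule finsum_cong')
   fix b assume "b \<in> I"
   then show "(\<Oplus>a\<in>I. Z r (a, b) \<otimes> (if a = fst c then U b (snd c) else \<zero>)) = Z r (fst c, b) \<otimes> U b (snd c)"
    using rc U Z I by (subst finsum_single_term[of I "fst c"]) auto
  qed (use rc U Z in auto)
  finally show "(\<Oplus>p\<in>I \<times> I. Z r p \<otimes> (if fst p = fst c then U (snd p) (snd c) else \<zero>)) =
   (\<Oplus>b\<in>I. Z r (fst c, b) \<otimes> U b (snd c))" .
 qed
qed (use U Z in auto)

end

end

text \<open>\<open>antip q A U\<close> is the matrix \<open>C U\<^sup>t C\<^sup>-\<^sup>1\<close>, and \<open>frt q A U\<close> says that the entries of \<open>U\<close>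
 satisfy the defining relations of the quantum symplectic group.\<close>

definition antip :: "real \<Rightarrow> (complex, 'a) module \<Rightarrow> (nat \<Rightarrow> nat \<Rightarrow> 'a) \<Rightarrow> nat \<Rightarrow> nat \<Rightarrow> 'a" where
 "antip q A U i j = Scoef q i j \<odot>\<^bsub>A\<^esub> U (5 - j) (5 - i)"

definition frt :: "real \<Rightarrow> (complex, 'a) module \<Rightarrow> (nat \<Rightarrow> nat \<Rightarrow> 'a) \<Rightarrow> bool" where
 "frt q A U \<longleftrightarrow>
   (\<forall>i\<in>N4. \<forall>j\<in>N4. U i j \<in> carrier A) \<and>
   (\<forall>i\<in>N4. \<forall>k\<in>N4. \<forall>j\<in>N4. \<forall>l\<in>N4.
    (\<Oplus>\<^bsub>A\<^esub>a\<in>N4. \<Oplus>\<^bsub>A\<^esub>b\<in>N4. Rcoef q i k a b \<odot>\<^bsub>A\<^esub> (U a j \<otimes>\<^bsub>A\<^esub> U b l)) =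
    (\<Oplus>\<^bsub>A\<^esub>a\<in>N4. \<Oplus>\<^bsub>A\<^esub>b\<in>N4. Rcoef q a b j l \<odot>\<^bsub>A\<^esub> (U k b \<otimes>\<^bsub>A\<^esub> U i a))) \<and>
   (\<forall>i\<in>N4. \<forall>j\<in>N4. (\<Oplus>\<^bsub>A\<^esub>k\<in>N4. U i k \<otimes>\<^bsub>A\<^esub> antip q A U k j) = (if i = j then \<one>\<^bsub>A\<^esub> else \<zero>\<^bsub>A\<^esub>)) \<and>
   (\<forall>i\<in>N4. \<forall>j\<in>N4. (\<Oplus>\<^bsub>A\<^esub>k\<in>N4. antip q A U i k \<otimes>\<^bsub>A\<^esub> U k j) = (if i = j then \<one>\<^bsub>A\<^esub> else \<zero>\<^bsub>A\<^esub>))"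

lemma frtD:
 assumes "frt q A U" "i \<in> N4" "j \<in> N4"
 shows "U i j \<in> carrier A"
  "k \<in> N4 ==> l \<in> N4 ==>
   (\<Oplus>\<^bsub>A\<^esub>a\<in>N4. \<Oplus>\<^bsub>A\<^esub>b\<in>N4. Rcoef q i k a b \<odot>\<^bsub>A\<^esub> (U a j \<otimes>\<^bsub>A\<^esub> U b l)) =
   (\<Oplus>\<^bsub>A\<^esub>a\<in>N4. \<Oplus>\<^bsub>A\<^esub>b\<in>N4. Rcoef q a b j l \<odot>\<^bsub>A\<^esub> (U k b \<otimes>\<^bsub>A\<^esub> U i a))"
  "(\<Oplus>\<^bsub>A\<^esub>k\<in>N4. U i k \<otimes>\<^bsub>A\<^esub> antip q A U k j) = (if i = j then \<one>\<^bsub>A\<^esub> else \<zero>\<^bsub>A\<^esub>)"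
  "(\<Oplus>\<^bsub>A\<^esub>k\<in>N4. antip q A U i k \<otimes>\<^bsub>A\<^esub> U k j) = (if i = j then \<one>\<^bsub>A\<^esub> else \<zero>\<^bsub>A\<^esub>)"
 using assms unfolding frt_def by blast+

lemma frtI:
 assumes "\<And>i j. i \<in> N4 ==> j \<in> N4 ==> U i j \<in> carrier A"
  "\<And>i k j l. [|i \<in> N4; k \<in> N4; j \<in> N4; l \<in> N4|] ==>
   (\<Oplus>\<^bsub>A\<^esub>a\<in>N4. \<Oplus>\<^bsub>A\<^esub>b\<in>N4. Rcoef q i k a b \<odot>\<^bsub>A\<^esub> (U a j \<otimes>\<^bsub>A\<^esub> U b l)) =
   (\<Oplus>\<^bsub>A\<^esub>a\<in>N4. \<Oplus>\<^bsub>A\<^esub>b\<in>N4. Rcoef q a b j l \<odot>\<^bsub>A\<^esub> (U k b \<otimes>\<^bsub>A\<^esub> U i a))"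
  "\<And>i j. i \<in> N4 ==> j \<in> N4 ==> (\<Oplus>\<^bsub>A\<^esub>k\<in>N4. U i k \<otimes>\<^bsub>A\<^esub> antip q A U k j) = (if i = j then \<one>\<^bsub>A\<^esub> else \<zero>\<^bsub>A\<^esub>)"
  "\<And>i j. i \<in> N4 ==> j \<in> N4 ==> (\<Oplus>\<^bsub>A\<^esub>k\<in>N4. antip q A U i k \<otimes>\<^bsub>A\<^esub> U k j) = (if i = j then \<one>\<^bsub>A\<^esub> else \<zero>\<^bsub>A\<^esub>)"
 shows "frt q A U"
 using assms unfolding frt_def by blast

lemma (in abelian_monoid) finsum_prime:
 assumes "\<And>k. k \<in> N4 ==> f k \<in> carrier G"
 shows "(\<Oplus>k\<in>N4. f (5 - k)) = (\<Oplus>k\<in>N4. f k)"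
proof -
 have "inj_on (\<lambda>k. 5 - k) N4" by (rule inj_on_inverseI[of _ "\<lambda>k. 5 - k"]) simp
 moreover have "k \<in> (\<lambda>k. 5 - k) ` N4" if "k \<in> N4" for k
  using that by (intro image_eqI[of _ _ "5 - k"]) simp_all
 then have "(\<lambda>k. 5 - k) ` N4 = N4" by auto
 ultimately show ?thesis using finsum_reindex[of f "\<lambda>k. 5 - k" N4] assms by (auto simp: Pi_def)
qed

context ualg
begin

definition RM :: "real \<Rightarrow> nat \<times> nat \<Rightarrow> nat \<times> nat \<Rightarrow> 'a" where
 "RM q = mk_matrix (N4 \<times> N4) (\<lambda>r c. Rcoef q (fst r) (snd r) (fst c) (snd c) \<odot> \<one>)"

abbreviation "MM \<equiv> matrices A (N4 \<times> N4)"

abbreviation MM_mult (infixl "\<bullet>" 70) where "U \<bullet> W \<equiv> U \<otimes>\<^bsub>MM\<^esub> W"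

lemma MM_monoid: "monoid MM" by (rule matrices_monoid) simp

lemma RM_carrier: "RM q \<in> carrier MM"
 unfolding RM_def by (rule mk_matrix_carrier) simp

context
 fixes Z assumes Z: "\<And>r c. r \<in> N4 \<times> N4 ==> c \<in> N4 \<times> N4 ==> Z r c \<in> carrier A"
begin

lemma RM_left: "RM q \<bullet> mk_matrix (N4 \<times> N4) Z =
  mk_matrix (N4 \<times> N4) (\<lambda>r c. \<Oplus>a\<in>N4. \<Oplus>b\<in>N4. Rcoef q (fst r) (snd r) a b \<odot> Z (a, b) c)"
 unfolding RM_def
proof (subst mat_mult)
 show "mk_matrix (N4 \<times> N4) (\<lambda>r c. \<Oplus>p\<in>N4 \<times> N4. (Rcoef q (fst r) (snd r) (fst p) (snd p) \<odot> \<one>) \<otimes> Z p c) =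
  mk_matrix (N4 \<times> N4) (\<lambda>r c. \<Oplus>a\<in>N4. \<Oplus>b\<in>N4. Rcoef q (fst r) (snd r) a b \<odot> Z (a, b) c)"
 proof (rule mk_matrix_cong)
  fix r c :: "nat \<times> nat" assume rc: "r \<in> N4 \<times> N4" "c \<in> N4 \<times> N4"
  have "(\<Oplus>p\<in>N4 \<times> N4. (Rcoef q (fst r) (snd r) (fst p) (snd p) \<odot> \<one>) \<otimes> Z p c) =
    (\<Oplus>p\<in>N4 \<times> N4. Rcoef q (fst r) (snd r) (fst p) (snd p) \<odot> Z (fst p, snd p) c)"
   using Z rc by (intro finsum_cong') (simp_all add: smult_mult_left Pi_def)
  also have "\<dots> = (\<Oplus>a\<in>N4. \<Oplus>b\<in>N4. Rcoef q (fst r) (snd r) a b \<odot> Z (a, b) c)"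
   using Z rc by (intro finsum_Times) auto
  finally show "(\<Oplus>p\<in>N4 \<times> N4. (Rcoef q (fst r) (snd r) (fst p) (snd p) \<odot> \<one>) \<otimes> Z p c) =
   (\<Oplus>a\<in>N4. \<Oplus>b\<in>N4. Rcoef q (fst r) (snd r) a b \<odot> Z (a, b) c)" .
 qed
qed (use Z in auto)

lemma RM_right: "mk_matrix (N4 \<times> N4) Z \<bullet> RM q =
  mk_matrix (N4 \<times> N4) (\<lambda>r c. \<Oplus>a\<in>N4. \<Oplus>b\<in>N4. Rcoef q a b (fst c) (snd c) \<odot> Z r (a, b))"
 unfolding RM_def
proof (subst mat_mult)
 show "mk_matrix (N4 \<times> N4) (\<lambda>r c. \<Oplus>p\<in>N4 \<times> N4. Z r p \<otimes> (Rcoef q (fst p) (snd p) (fst c) (snd c) \<odot> \<one>)) =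
  mk_matrix (N4 \<times> N4) (\<lambda>r c. \<Oplus>a\<in>N4. \<Oplus>b\<in>N4. Rcoef q a b (fst c) (snd c) \<odot> Z r (a, b))"
 proof (rule mk_matrix_cong)
  fix r c :: "nat \<times> nat" assume rc: "r \<in> N4 \<times> N4" "c \<in> N4 \<times> N4"
  have "(\<Oplus>p\<in>N4 \<times> N4. Z r p \<otimes> (Rcoef q (fst p) (snd p) (fst c) (snd c) \<odot> \<one>)) =
    (\<Oplus>p\<in>N4 \<times> N4. Rcoef q (fst p) (snd p) (fst c) (snd c) \<odot> Z r (fst p, snd p))"
   using Z rc by (intro finsum_cong') (simp_all add: smult_mult_right Pi_def)
  also have "\<dots> = (\<Oplus>a\<in>N4. \<Oplus>b\<in>N4. Rcoef q a b (fst c) (snd c) \<odot> Z r (a, b))"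
   using Z rc by (intro finsum_Times) auto
  finally show "(\<Oplus>p\<in>N4 \<times> N4. Z r p \<otimes> (Rcoef q (fst p) (snd p) (fst c) (snd c) \<odot> \<one>)) =
   (\<Oplus>a\<in>N4. \<Oplus>b\<in>N4. Rcoef q a b (fst c) (snd c) \<odot> Z r (a, b))" .
 qed
qed (use Z in auto)

end

text \<open>Writing the relations as an identity between matrices indexed by pairs makes products and
 inverses available: the later manipulations are calculations in one monoid.\<close>

lemma rtt_matrix_iff:
 assumes U: "\<And>i j. i \<in> N4 ==> j \<in> N4 ==> U i j \<in> carrier A"
 shows "RM q \<bullet> (emb1 N4 U \<bullet> emb2 N4 U) = (emb2 N4 U \<bullet> emb1 N4 U) \<bullet> RM q \<longleftrightarrow>
  (\<forall>i\<in>N4. \<forall>k\<in>N4. \<forall>j\<in>N4. \<forall>l\<in>N4.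
    (\<Oplus>a\<in>N4. \<Oplus>b\<in>N4. Rcoef q i k a b \<odot> (U a j \<otimes> U b l)) =
    (\<Oplus>a\<in>N4. \<Oplus>b\<in>N4. Rcoef q a b j l \<odot> (U k b \<otimes> U i a)))"
proof -
 have 1: "RM q \<bullet> (emb1 N4 U \<bullet> emb2 N4 U) = mk_matrix (N4 \<times> N4)
   (\<lambda>r c. \<Oplus>a\<in>N4. \<Oplus>b\<in>N4. Rcoef q (fst r) (snd r) a b \<odot> (U a (fst c) \<otimes> U b (snd c)))"
  using U by (subst emb1_emb2) (auto intro!: RM_left[THEN trans])
 have 2: "(emb2 N4 U \<bullet> emb1 N4 U) \<bullet> RM q = mk_matrix (N4 \<times> N4)
   (\<lambda>r c. \<Oplus>a\<in>N4. \<Oplus>b\<in>N4. Rcoef q a b (fst c) (snd c) \<odot> (U (snd r) b \<otimes> U (fst r) a))"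
  using U by (subst emb2_emb1) (auto intro!: RM_right[THEN trans])
 show ?thesis unfolding 1 2
 proof
  assume eq: "mk_matrix (N4 \<times> N4)
   (\<lambda>r c. \<Oplus>a\<in>N4. \<Oplus>b\<in>N4. Rcoef q (fst r) (snd r) a b \<odot> (U a (fst c) \<otimes> U b (snd c))) = mk_matrix (N4 \<times> N4)
   (\<lambda>r c. \<Oplus>a\<in>N4. \<Oplus>b\<in>N4. Rcoef q a b (fst c) (snd c) \<odot> (U (snd r) b \<otimes> U (fst r) a))"
  show "\<forall>i\<in>N4. \<forall>k\<in>N4. \<forall>j\<in>N4. \<forall>l\<in>N4.
    (\<Oplus>a\<in>N4. \<Oplus>b\<in>N4. Rcoef q i k a b \<odot> (U a j \<otimes> U b l)) =
    (\<Oplus>a\<in>N4. \<Oplus>b\<in>N4. Rcoef q a b j l \<odot> (U k b \<otimes> U i a))"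
  proof (intro ballI)
   fix i k j l :: nat assume "i \<in> N4" "k \<in> N4" "j \<in> N4" "l \<in> N4"
   then show "(\<Oplus>a\<in>N4. \<Oplus>b\<in>N4. Rcoef q i k a b \<odot> (U a j \<otimes> U b l)) =
    (\<Oplus>a\<in>N4. \<Oplus>b\<in>N4. Rcoef q a b j l \<odot> (U k b \<otimes> U i a))"
    using mk_matrix_eqD[OF eq, of "(i, k)" "(j, l)"] by simp
  qed
 next
  assume "\<forall>i\<in>N4. \<forall>k\<in>N4. \<forall>j\<in>N4. \<forall>l\<in>N4.
    (\<Oplus>a\<in>N4. \<Oplus>b\<in>N4. Rcoef q i k a b \<odot> (U a j \<otimes> U b l)) =
    (\<Oplus>a\<in>N4. \<Oplus>b\<in>N4. Rcoef q a b j l \<odot> (U k b \<otimes> U i a))"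
  then show "mk_matrix (N4 \<times> N4)
   (\<lambda>r c. \<Oplus>a\<in>N4. \<Oplus>b\<in>N4. Rcoef q (fst r) (snd r) a b \<odot> (U a (fst c) \<otimes> U b (snd c))) = mk_matrix (N4 \<times> N4)
   (\<lambda>r c. \<Oplus>a\<in>N4. \<Oplus>b\<in>N4. Rcoef q a b (fst c) (snd c) \<odot> (U (snd r) b \<otimes> U (fst r) a))"
   by (intro mk_matrix_cong) auto
 qed
qed

context
 fixes q U assumes frt: "frt q A U" and q: "q \<noteq> 0"
begin

lemma frt_closed: "i \<in> N4 ==> j \<in> N4 ==> U i j \<in> carrier A" by (rule frtD(1)[OF frt])

abbreviation "V \<equiv> antip q A U"

lemma antip_closed: "i \<in> N4 ==> j \<in> N4 ==> V i j \<in> carrier A"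
 using frt_closed N4_prime(1) by (simp add: antip_def)

lemma frt_emb_inverse:
 "emb1 N4 U \<bullet> emb1 N4 V = \<one>\<^bsub>MM\<^esub>" "emb1 N4 V \<bullet> emb1 N4 U = \<one>\<^bsub>MM\<^esub>"
 "emb2 N4 U \<bullet> emb2 N4 V = \<one>\<^bsub>MM\<^esub>" "emb2 N4 V \<bullet> emb2 N4 U = \<one>\<^bsub>MM\<^esub>"
 using frt_closed antip_closed
 by (simp_all add: emb1_mult emb2_mult frtD(3,4)[OF frt] emb_one cong: emb_cong)

lemma frt_RTT_matrix:
 "RM q \<bullet> (emb1 N4 U \<bullet> emb2 N4 U) = (emb2 N4 U \<bullet> emb1 N4 U) \<bullet> RM q"
 using frt by (subst rtt_matrix_iff) (simp_all add: frt_def)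

text \<open>Multiplying \<open>R U\<^sub>1 U\<^sub>2 = U\<^sub>2 U\<^sub>1 R\<close> by inverses gives the relations between \<open>U\<close> and its
 antipode \<open>V\<close>, and between the entries of \<open>V\<close>.\<close>

lemma frt_VRU: "emb2 N4 V \<bullet> (RM q \<bullet> emb1 N4 U) = emb1 N4 U \<bullet> (RM q \<bullet> emb2 N4 V)"
proof -
 interpret M: monoid MM by (rule MM_monoid)
 let ?U1 = "emb1 N4 U" and ?U2 = "emb2 N4 U" and ?V2 = "emb2 N4 V"
 have cc: "?U1 \<in> carrier MM" "?U2 \<in> carrier MM" "?V2 \<in> carrier MM" "RM q \<in> carrier MM"
  using emb_carrier[of N4 U] emb_carrier[of N4 V] frt_closed antip_closed RM_carrier by auto
 have "?V2 \<bullet> (RM q \<bullet> ?U1) = ?V2 \<bullet> ((RM q \<bullet> (?U1 \<bullet> ?U2)) \<bullet> ?V2)"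
  using cc by (simp add: M.m_assoc frt_emb_inverse)
 also have "\<dots> = (?V2 \<bullet> ?U2) \<bullet> (?U1 \<bullet> (RM q \<bullet> ?V2))"
  unfolding frt_RTT_matrix using cc by (simp add: M.m_assoc)
 also have "\<dots> = ?U1 \<bullet> (RM q \<bullet> ?V2)" using cc by (simp add: frt_emb_inverse)
 finally show ?thesis .
qed

lemma frt_RVV: "RM q \<bullet> (emb2 N4 V \<bullet> emb1 N4 V) = (emb1 N4 V \<bullet> emb2 N4 V) \<bullet> RM q"
proof -
 interpret M: monoid MM by (rule MM_monoid)
 let ?U1 = "emb1 N4 U" and ?V1 = "emb1 N4 V" and ?V2 = "emb2 N4 V"
 have cc: "?U1 \<in> carrier MM" "?V1 \<in> carrier MM" "?V2 \<in> carrier MM" "RM q \<in> carrier MM"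
  using emb_carrier[of N4 U] emb_carrier[of N4 V] frt_closed antip_closed RM_carrier by auto
 have "RM q \<bullet> (?V2 \<bullet> ?V1) = (?V1 \<bullet> ?U1) \<bullet> (RM q \<bullet> (?V2 \<bullet> ?V1))"
  using cc by (simp add: frt_emb_inverse)
 also have "\<dots> = ?V1 \<bullet> ((?U1 \<bullet> (RM q \<bullet> ?V2)) \<bullet> ?V1)"
  using cc by (simp add: M.m_assoc)
 also have "\<dots> = ?V1 \<bullet> (?V2 \<bullet> (RM q \<bullet> (?U1 \<bullet> ?V1)))"
  unfolding frt_VRU[symmetric] using cc by (simp add: M.m_assoc)
 also have "\<dots> = (?V1 \<bullet> ?V2) \<bullet> RM q"
  using cc by (simp add: frt_emb_inverse M.m_assoc)
 finally show ?thesis .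
qed

lemma frt_exchange:
 assumes idx: "m \<in> N4" "i \<in> N4" "c \<in> N4" "k \<in> N4"
 shows "(\<Oplus>a\<in>N4. \<Oplus>b\<in>N4. Rcoef q a i c b \<odot> (U m a \<otimes> V b k)) =
  (\<Oplus>a\<in>N4. \<Oplus>b\<in>N4. Rcoef q m b a k \<odot> (V i b \<otimes> U a c))"
proof -
 note cl = frt_closed antip_closed
 let ?RM = "\<lambda>r c. Rcoef q (fst r) (snd r) (fst c) (snd c) \<odot> \<one>"
 have 1: "RM q \<bullet> emb1 N4 U =
   mk_matrix (N4 \<times> N4) (\<lambda>r c. \<Oplus>a\<in>N4. ?RM r (a, snd c) \<otimes> U a (fst c))"
  unfolding RM_def using cl by (intro emb1_right) auto
 have 2: "RM q \<bullet> emb2 N4 V =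
   mk_matrix (N4 \<times> N4) (\<lambda>r c. \<Oplus>b\<in>N4. ?RM r (fst c, b) \<otimes> V b (snd c))"
  unfolding RM_def using cl by (intro emb2_right) auto
 have 3: "emb2 N4 V \<bullet> (RM q \<bullet> emb1 N4 U) = mk_matrix (N4 \<times> N4)
   (\<lambda>r c. \<Oplus>b\<in>N4. V (snd r) b \<otimes> (\<Oplus>a\<in>N4. ?RM (fst r, b) (a, snd c) \<otimes> U a (fst c)))"
  unfolding 1 using cl by (intro emb2_left) (auto intro!: finsum_closed)
 have 4: "emb1 N4 U \<bullet> (RM q \<bullet> emb2 N4 V) = mk_matrix (N4 \<times> N4)
   (\<lambda>r c. \<Oplus>a\<in>N4. U (fst r) a \<otimes> (\<Oplus>b\<in>N4. ?RM (a, snd r) (fst c, b) \<otimes> V b (snd c)))"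
  unfolding 2 using cl by (intro emb1_left) (auto intro!: finsum_closed)
 have "(\<Oplus>b\<in>N4. V i b \<otimes> (\<Oplus>a\<in>N4. ?RM (m, b) (a, k) \<otimes> U a c)) =
   (\<Oplus>a\<in>N4. U m a \<otimes> (\<Oplus>b\<in>N4. ?RM (a, i) (c, b) \<otimes> V b k))"
  using mk_matrix_eqD[OF frt_VRU[unfolded 3 4], of "(m, i)" "(c, k)"] idx by simp
 moreover have "(\<Oplus>b\<in>N4. V i b \<otimes> (\<Oplus>a\<in>N4. ?RM (m, b) (a, k) \<otimes> U a c)) =
   (\<Oplus>b\<in>N4. \<Oplus>a\<in>N4. Rcoef q m b a k \<odot> (V i b \<otimes> U a c))"
 proof (rule finsum_cong')
  fix b :: nat assume b: "b \<in> N4"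
  have "V i b \<otimes> (\<Oplus>a\<in>N4. ?RM (m, b) (a, k) \<otimes> U a c) = (\<Oplus>a\<in>N4. V i b \<otimes> (?RM (m, b) (a, k) \<otimes> U a c))"
   using b cl idx by (intro finsum_rdistr) auto
  also have "\<dots> = (\<Oplus>a\<in>N4. Rcoef q m b a k \<odot> (V i b \<otimes> U a c))"
   using b cl idx by (intro finsum_cong') (auto simp: smult_mult_left smult_mult_right)
  finally show "V i b \<otimes> (\<Oplus>a\<in>N4. ?RM (m, b) (a, k) \<otimes> U a c) = (\<Oplus>a\<in>N4. Rcoef q m b a k \<odot> (V i b \<otimes> U a c))" .
 qed (use cl idx in \<open>auto intro!: finsum_closed\<close>)
 moreover have "(\<Oplus>b\<in>N4. \<Oplus>a\<in>N4. Rcoef q m b a k \<odot> (V i b \<otimes> U a c)) =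
   (\<Oplus>a\<in>N4. \<Oplus>b\<in>N4. Rcoef q m b a k \<odot> (V i b \<otimes> U a c))"
  using cl idx by (intro finsum_finsum_swap) auto
 moreover have "(\<Oplus>a\<in>N4. U m a \<otimes> (\<Oplus>b\<in>N4. ?RM (a, i) (c, b) \<otimes> V b k)) =
   (\<Oplus>a\<in>N4. \<Oplus>b\<in>N4. Rcoef q a i c b \<odot> (U m a \<otimes> V b k))"
 proof (rule finsum_cong')
  fix a :: nat assume a: "a \<in> N4"
  have "U m a \<otimes> (\<Oplus>b\<in>N4. ?RM (a, i) (c, b) \<otimes> V b k) = (\<Oplus>b\<in>N4. U m a \<otimes> (?RM (a, i) (c, b) \<otimes> V b k))"
   using a cl idx by (intro finsum_rdistr) auto
  also have "\<dots> = (\<Oplus>b\<in>N4. Rcoef q a i c b \<odot> (U m a \<otimes> V b k))"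
   using a cl idx by (intro finsum_cong') (auto simp: smult_mult_left smult_mult_right)
  finally show "U m a \<otimes> (\<Oplus>b\<in>N4. ?RM (a, i) (c, b) \<otimes> V b k) = (\<Oplus>b\<in>N4. Rcoef q a i c b \<odot> (U m a \<otimes> V b k))" .
 qed (use cl idx in \<open>auto intro!: finsum_closed\<close>)
 ultimately show ?thesis by simp
qed

lemma frt_antip_entries:
 assumes idx: "i \<in> N4" "k \<in> N4" "j \<in> N4" "l \<in> N4"
 shows "(\<Oplus>a\<in>N4. \<Oplus>b\<in>N4. Rcoef q i k a b \<odot> (V b l \<otimes> V a j)) =
  (\<Oplus>a\<in>N4. \<Oplus>b\<in>N4. Rcoef q a b j l \<odot> (V i a \<otimes> V k b))"
proof -
 have 1: "RM q \<bullet> (emb2 N4 V \<bullet> emb1 N4 V) = mk_matrix (N4 \<times> N4)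
   (\<lambda>r c. \<Oplus>a\<in>N4. \<Oplus>b\<in>N4. Rcoef q (fst r) (snd r) a b \<odot> (V b (snd c) \<otimes> V a (fst c)))"
  using antip_closed by (subst emb2_emb1) (auto intro!: RM_left[THEN trans])
 have 2: "(emb1 N4 V \<bullet> emb2 N4 V) \<bullet> RM q = mk_matrix (N4 \<times> N4)
   (\<lambda>r c. \<Oplus>a\<in>N4. \<Oplus>b\<in>N4. Rcoef q a b (fst c) (snd c) \<odot> (V (fst r) a \<otimes> V (snd r) b))"
  using antip_closed by (subst emb1_emb2) (auto intro!: RM_right[THEN trans])
 show ?thesis using mk_matrix_eqD[OF frt_RVV[unfolded 1 2], of "(i, k)" "(j, l)"] idx by simp
qed

end

end

lemma alg_map_finsum:
 assumes "ualg A" "ualg B" "h \<in> algebra_maps A B" "g \<in> I \<rightarrow> carrier A"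
 shows "h (\<Oplus>\<^bsub>A\<^esub>i\<in>I. g i) = (\<Oplus>\<^bsub>B\<^esub>i\<in>I. h (g i))"
 by (rule additive_map_finsum[OF
  ring.is_abelian_group[OF ualg.ring_A[OF assms(1)]]
  ring.is_abelian_group[OF ualg.ring_A[OF assms(2)]] alg_map_additive[OF assms(3)] assms(4)])

lemma alg_map_zero:
 assumes "ualg A" "ualg B" "h \<in> algebra_maps A B"
 shows "h \<zero>\<^bsub>A\<^esub> = \<zero>\<^bsub>B\<^esub>"
 by (rule additive_map_zero[OF
  ring.is_abelian_group[OF ualg.ring_A[OF assms(1)]]
  ring.is_abelian_group[OF ualg.ring_A[OF assms(2)]] alg_map_additive[OF assms(3)]])

lemma alg_map_opposite: "f \<in> algebra_maps A B ==> f \<in> algebra_maps (opposite_algebra s A) (opposite_algebra s B)"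
 by (intro algebra_mapsI) (auto simp: algebra_mapsD)

lemma finsum_opposite [simp]: "finsum (opposite_algebra s A) f I = finsum A f I"
 by (simp add: finsum_def finprod_def opposite_algebra_def)

lemma frt_map:
 assumes "ualg A" "ualg B" "h \<in> algebra_maps A B" "frt q A U"
 shows "frt q B (\<lambda>i j. h (U i j))"
proof -
 interpret A: ualg A by fact
 interpret B: ualg B by fact
 note hD = algebra_mapsD[OF assms(3)] and fin = alg_map_finsum[OF assms(1-3)]
 note cl = frtD(1)[OF assms(4)]
 have ant: "antip q B (\<lambda>i j. h (U i j)) i j = h (antip q A U i j)" "antip q A U i j \<in> carrier A"
  if "i \<in> N4" "j \<in> N4" for i j using cl that by (simp_all add: antip_def hD)
 show ?thesis
 proof (rule frtI)
  fix i j :: nat assume ij: "i \<in> N4" "j \<in> N4"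
  have "(\<Oplus>\<^bsub>B\<^esub>k\<in>N4. h (U i k) \<otimes>\<^bsub>B\<^esub> antip q B (\<lambda>i j. h (U i j)) k j) = h (\<Oplus>\<^bsub>A\<^esub>k\<in>N4. U i k \<otimes>\<^bsub>A\<^esub> antip q A U k j)"
   using ij cl ant by (subst fin) (auto intro!: B.finsum_cong' simp: hD)
  then show "(\<Oplus>\<^bsub>B\<^esub>k\<in>N4. h (U i k) \<otimes>\<^bsub>B\<^esub> antip q B (\<lambda>i j. h (U i j)) k j) = (if i = j then \<one>\<^bsub>B\<^esub> else \<zero>\<^bsub>B\<^esub>)"
   using frtD(3)[OF assms(4) ij] by (simp add: hD alg_map_zero[OF assms(1-3)])
  have "(\<Oplus>\<^bsub>B\<^esub>k\<in>N4. antip q B (\<lambda>i j. h (U i j)) i k \<otimes>\<^bsub>B\<^esub> h (U k j)) = h (\<Oplus>\<^bsub>A\<^esub>k\<in>N4. antip q A U i k \<otimes>\<^bsub>A\<^esub> U k j)"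
   using ij cl ant by (subst fin) (auto intro!: B.finsum_cong' simp: hD)
  then show "(\<Oplus>\<^bsub>B\<^esub>k\<in>N4. antip q B (\<lambda>i j. h (U i j)) i k \<otimes>\<^bsub>B\<^esub> h (U k j)) = (if i = j then \<one>\<^bsub>B\<^esub> else \<zero>\<^bsub>B\<^esub>)"
   using frtD(4)[OF assms(4) ij] by (simp add: hD alg_map_zero[OF assms(1-3)])
 next
  fix i k j l :: nat assume idx: "i \<in> N4" "k \<in> N4" "j \<in> N4" "l \<in> N4"
  have 1: "h (\<Oplus>\<^bsub>A\<^esub>a\<in>N4. \<Oplus>\<^bsub>A\<^esub>b\<in>N4. Rcoef q i k a b \<odot>\<^bsub>A\<^esub> (U a j \<otimes>\<^bsub>A\<^esub> U b l)) =
    (\<Oplus>\<^bsub>B\<^esub>a\<in>N4. \<Oplus>\<^bsub>B\<^esub>b\<in>N4. Rcoef q i k a b \<odot>\<^bsub>B\<^esub> (h (U a j) \<otimes>\<^bsub>B\<^esub> h (U b l)))"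
   using idx cl by (subst fin) (auto intro!: A.finsum_closed B.finsum_cong' B.finsum_closed simp: fin hD)
  have 2: "h (\<Oplus>\<^bsub>A\<^esub>a\<in>N4. \<Oplus>\<^bsub>A\<^esub>b\<in>N4. Rcoef q a b j l \<odot>\<^bsub>A\<^esub> (U k b \<otimes>\<^bsub>A\<^esub> U i a)) =
    (\<Oplus>\<^bsub>B\<^esub>a\<in>N4. \<Oplus>\<^bsub>B\<^esub>b\<in>N4. Rcoef q a b j l \<odot>\<^bsub>B\<^esub> (h (U k b) \<otimes>\<^bsub>B\<^esub> h (U i a)))"
   using idx cl by (subst fin) (auto intro!: A.finsum_closed B.finsum_cong' B.finsum_closed simp: fin hD)
  show "(\<Oplus>\<^bsub>B\<^esub>a\<in>N4. \<Oplus>\<^bsub>B\<^esub>b\<in>N4. Rcoef q i k a b \<odot>\<^bsub>B\<^esub> (h (U a j) \<otimes>\<^bsub>B\<^esub> h (U b l))) =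
    (\<Oplus>\<^bsub>B\<^esub>a\<in>N4. \<Oplus>\<^bsub>B\<^esub>b\<in>N4. Rcoef q a b j l \<odot>\<^bsub>B\<^esub> (h (U k b) \<otimes>\<^bsub>B\<^esub> h (U i a)))"
   using frtD(2)[OF assms(4) idx(1,3,2,4)] 1 2 by simp
 qed (use cl hD in auto)
qed

context ualg
begin

text \<open>The identity matrix is the point of the quantum group that defines the counit.\<close>

lemma frt_one: assumes "q \<noteq> 0" shows "frt q A (\<lambda>i j. if i = j then \<one> else \<zero>)"
proof (rule frtI)
 have sel: "(\<Oplus>a\<in>N4. \<Oplus>b\<in>N4. c a b \<odot> ((if a = j then \<one> else \<zero>) \<otimes> (if b = l then \<one> else \<zero>))) = c j l \<odot> \<one>"
  if "j \<in> N4" "l \<in> N4" for c :: "nat \<Rightarrow> nat \<Rightarrow> complex" and j l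
 proof -
  have "(\<Oplus>b\<in>N4. c a b \<odot> ((if a = j then \<one> else \<zero>) \<otimes> (if b = l then \<one> else \<zero>))) =
    (if a = j then c a l \<odot> \<one> else \<zero>)" if "a \<in> N4" for a
   using \<open>l \<in> N4\<close> by (subst finsum_single_term[of N4 l]) auto
  then have "(\<Oplus>a\<in>N4. \<Oplus>b\<in>N4. c a b \<odot> ((if a = j then \<one> else \<zero>) \<otimes> (if b = l then \<one> else \<zero>))) =
    (\<Oplus>a\<in>N4. if a = j then c a l \<odot> \<one> else \<zero>)" by (intro finsum_cong') auto
  also have "\<dots> = c j l \<odot> \<one>" using that by (subst finsum_single_term[of N4 j]) auto
  finally show ?thesis .
 qed
 fix i k j l :: nat assume idx: "i \<in> N4" "k \<in> N4" "j \<in> N4" "l \<in> N4"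
 have "(\<Oplus>a\<in>N4. \<Oplus>b\<in>N4. Rcoef q a b j l \<odot> ((if k = b then \<one> else \<zero>) \<otimes> (if i = a then \<one> else \<zero>))) =
   (\<Oplus>a\<in>N4. \<Oplus>b\<in>N4. Rcoef q a b j l \<odot> ((if a = i then \<one> else \<zero>) \<otimes> (if b = k then \<one> else \<zero>)))"
  by (intro finsum_cong') auto
 then show "(\<Oplus>a\<in>N4. \<Oplus>b\<in>N4. Rcoef q i k a b \<odot> ((if a = j then \<one> else \<zero>) \<otimes> (if b = l then \<one> else \<zero>))) =
   (\<Oplus>a\<in>N4. \<Oplus>b\<in>N4. Rcoef q a b j l \<odot> ((if k = b then \<one> else \<zero>) \<otimes> (if i = a then \<one> else \<zero>)))"
  using idx by (simp add: sel)
next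
 fix i j :: nat assume ij: "i \<in> N4" "j \<in> N4"
 have ant: "antip q A (\<lambda>i j. if i = j then \<one> else \<zero>) i j = (if i = j then \<one> else \<zero>)"
  if ij: "i \<in> N4" "j \<in> N4" for i j
 proof (cases "i = j")
  case True then show ?thesis using Scoef_simps(1)[OF assms ij] by (simp add: antip_def)
 next
  case False
  then have "5 - j \<noteq> 5 - i" using N4_prime(2)[OF ij(1)] N4_prime(2)[OF ij(2)] by metis
  then show ?thesis using False by (simp add: antip_def)
 qed
 show "(\<Oplus>k\<in>N4. (if i = k then \<one> else \<zero>) \<otimes> antip q A (\<lambda>i j. if i = j then \<one> else \<zero>) k j) = (if i = j then \<one> else \<zero>)"
  "(\<Oplus>k\<in>N4. antip q A (\<lambda>i j. if i = j then \<one> else \<zero>) i k \<otimes> (if k = j then \<one> else \<zero>)) = (if i = j then \<one> else \<zero>)"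
  using ij ant by (auto simp: finsum_single_term[of N4 i] finsum_single_term[of N4 j])
qed auto

text \<open>If the entries of \<open>U\<close> commute with those of \<open>W\<close> then \<open>(U W)\<^sub>1 (U W)\<^sub>2 = U\<^sub>1 U\<^sub>2 W\<^sub>1 W\<^sub>2\<close>, and \<open>R\<close>
 passes through the two pairs one after the other. With the entries in two tensor factors this
 gives the comultiplication and the coaction.\<close>

lemma frt_mult:
 assumes U: "frt q A U" and W: "frt q A W" and q: "q \<noteq> 0"
  and comm: "\<And>i j k l. [|i \<in> N4; j \<in> N4; k \<in> N4; l \<in> N4|] ==> W k l \<otimes> U i j = U i j \<otimes> W k l"
 shows "frt q A (\<lambda>i j. \<Oplus>k\<in>N4. U i k \<otimes> W k j)"
proof -
 let ?Z = "\<lambda>i j. \<Oplus>k\<in>N4. U i k \<otimes> W k j"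
 note cU = frt_closed[OF U q] and cW = frt_closed[OF W q]
 note aU = antip_closed[OF U q] and aW = antip_closed[OF W q]
 have cZ: "?Z i j \<in> carrier A" if "i \<in> N4" "j \<in> N4" for i j
  using that cU cW by (auto intro!: finsum_closed)
 interpret M: monoid MM by (rule MM_monoid)
 interpret N: monoid "matrices A N4" by (rule matrices_monoid) simp
 have RTT: "RM q \<bullet> (emb1 N4 ?Z \<bullet> emb2 N4 ?Z) = (emb2 N4 ?Z \<bullet> emb1 N4 ?Z) \<bullet> RM q"
 proof -
  let ?U1 = "emb1 N4 U" and ?U2 = "emb2 N4 U" and ?W1 = "emb1 N4 W" and ?W2 = "emb2 N4 W"
  have cc: "?U1 \<in> carrier MM" "?U2 \<in> carrier MM" "?W1 \<in> carrier MM" "?W2 \<in> carrier MM" "RM q \<in> carrier MM"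
   using emb_carrier[of N4 U] emb_carrier[of N4 W] cU cW RM_carrier by auto
  have Z1: "emb1 N4 ?Z = ?U1 \<bullet> ?W1" by (rule emb1_mult[symmetric]) (use cU cW in auto)
  have Z2: "emb2 N4 ?Z = ?U2 \<bullet> ?W2" by (rule emb2_mult[symmetric]) (use cU cW in auto)
  have W1U2: "?W1 \<bullet> ?U2 = ?U2 \<bullet> ?W1"
   using cU cW comm by (subst emb1_emb2, (simp; fail)+, subst emb2_emb1) (auto intro!: mk_matrix_cong)
  have U1W2: "?U1 \<bullet> ?W2 = ?W2 \<bullet> ?U1"
   using cU cW comm by (subst emb1_emb2, (simp; fail)+, subst emb2_emb1) (auto intro!: mk_matrix_cong)
  have "RM q \<bullet> ((?U1 \<bullet> ?W1) \<bullet> (?U2 \<bullet> ?W2)) =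
    RM q \<bullet> (?U1 \<bullet> ((?W1 \<bullet> ?U2) \<bullet> ?W2))"
   using cc by (simp add: M.m_assoc)
  also have "\<dots> = (RM q \<bullet> (?U1 \<bullet> ?U2)) \<bullet> (?W1 \<bullet> ?W2)"
   unfolding W1U2 using cc by (simp add: M.m_assoc)
  also have "\<dots> = (?U2 \<bullet> ?U1) \<bullet> (RM q \<bullet> (?W1 \<bullet> ?W2))"
   unfolding frt_RTT_matrix[OF U q] using cc by (simp add: M.m_assoc)
  also have "\<dots> = ?U2 \<bullet> ((?U1 \<bullet> ?W2) \<bullet> (?W1 \<bullet> RM q))"
   unfolding frt_RTT_matrix[OF W q] using cc by (simp add: M.m_assoc)
  also have "\<dots> = ((?U2 \<bullet> ?W2) \<bullet> (?U1 \<bullet> ?W1)) \<bullet> RM q"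
   unfolding U1W2 using cc by (simp add: M.m_assoc)
  finally show ?thesis unfolding Z1 Z2 .
 qed
 have ant: "antip q A ?Z k j = (\<Oplus>m\<in>N4. antip q A W k m \<otimes> antip q A U m j)" if kj: "k \<in> N4" "j \<in> N4" for k j
 proof -
  have "(\<Oplus>m\<in>N4. antip q A W k m \<otimes> antip q A U m j) =
    (\<Oplus>m\<in>N4. Scoef q k j \<odot> (U (5 - j) (5 - m) \<otimes> W (5 - m) (5 - k)))"
   using kj cU cW comm Scoef_simps(4)[OF q kj, unfolded mult.commute[of "Scoef q k _"]]
   by (intro finsum_cong') (auto simp: antip_def smult_mult_left smult_mult_right smult_assoc)
  also have "\<dots> = (\<Oplus>m\<in>N4. Scoef q k j \<odot> (U (5 - j) m \<otimes> W m (5 - k)))"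
   using kj cU cW by (intro finsum_prime[of "\<lambda>m. Scoef q k j \<odot> (U (5 - j) m \<otimes> W m (5 - k))"]) auto
  also have "\<dots> = antip q A ?Z k j"
   using kj cU cW by (simp add: antip_def finsum_smult Pi_def)
  finally show ?thesis by simp
 qed
 let ?m = "mk_matrix N4"
 have mm: "?m ?Z = ?m U \<otimes>\<^bsub>matrices A N4\<^esub> ?m W"
  "?m (antip q A ?Z) = ?m (antip q A W) \<otimes>\<^bsub>matrices A N4\<^esub> ?m (antip q A U)"
  using cU cW aU aW ant by (simp_all add: mat_mult cong: mk_matrix_cong)
 have inv: "?m Y \<otimes>\<^bsub>matrices A N4\<^esub> ?m (antip q A Y) = \<one>\<^bsub>matrices A N4\<^esub>"
  "?m (antip q A Y) \<otimes>\<^bsub>matrices A N4\<^esub> ?m Y = \<one>\<^bsub>matrices A N4\<^esub>" if "frt q A Y" for Y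
  using frt_closed[OF that q] antip_closed[OF that q]
  by (simp_all add: mat_mult one_matrix frtD(3,4)[OF that] cong: mk_matrix_cong)
 have c: "?m U \<in> carrier (matrices A N4)" "?m W \<in> carrier (matrices A N4)"
  "?m (antip q A U) \<in> carrier (matrices A N4)" "?m (antip q A W) \<in> carrier (matrices A N4)"
  using cU cW aU aW by (auto intro!: mk_matrix_carrier)
 have aZ: "antip q A ?Z i j \<in> carrier A" if "i \<in> N4" "j \<in> N4" for i j
  using ant[OF that] that aU aW by (auto intro!: finsum_closed)
 have 1: "?m ?Z \<otimes>\<^bsub>matrices A N4\<^esub> ?m (antip q A ?Z) = \<one>\<^bsub>matrices A N4\<^esub>"
 proof -
  have "?m ?Z \<otimes>\<^bsub>matrices A N4\<^esub> ?m (antip q A ?Z) =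
    ?m U \<otimes>\<^bsub>matrices A N4\<^esub> ((?m W \<otimes>\<^bsub>matrices A N4\<^esub> ?m (antip q A W)) \<otimes>\<^bsub>matrices A N4\<^esub> ?m (antip q A U))"
   unfolding mm using c by (simp only: N.m_assoc N.m_closed)
  also have "\<dots> = \<one>\<^bsub>matrices A N4\<^esub>" unfolding inv[OF W] using c by (simp only: N.l_one inv[OF U])
  finally show ?thesis .
 qed
 have 2: "?m (antip q A ?Z) \<otimes>\<^bsub>matrices A N4\<^esub> ?m ?Z = \<one>\<^bsub>matrices A N4\<^esub>"
 proof -
  have "?m (antip q A ?Z) \<otimes>\<^bsub>matrices A N4\<^esub> ?m ?Z =
    ?m (antip q A W) \<otimes>\<^bsub>matrices A N4\<^esub> ((?m (antip q A U) \<otimes>\<^bsub>matrices A N4\<^esub> ?m U) \<otimes>\<^bsub>matrices A N4\<^esub> ?m W)"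
   unfolding mm using c by (simp only: N.m_assoc N.m_closed)
  also have "\<dots> = \<one>\<^bsub>matrices A N4\<^esub>" unfolding inv[OF U] using c by (simp only: N.l_one inv[OF W])
  finally show ?thesis .
 qed
 have rtt: "RM q \<bullet> (emb1 N4 ?Z \<bullet> emb2 N4 ?Z) = (emb2 N4 ?Z \<bullet> emb1 N4 ?Z) \<bullet> RM q \<longleftrightarrow>
  (\<forall>i\<in>N4. \<forall>k\<in>N4. \<forall>j\<in>N4. \<forall>l\<in>N4.
    (\<Oplus>a\<in>N4. \<Oplus>b\<in>N4. Rcoef q i k a b \<odot> (?Z a j \<otimes> ?Z b l)) =
    (\<Oplus>a\<in>N4. \<Oplus>b\<in>N4. Rcoef q a b j l \<odot> (?Z k b \<otimes> ?Z i a)))"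
  by (rule rtt_matrix_iff) (rule cZ)
 show ?thesis
 proof (rule frtI)
  show "(\<Oplus>a\<in>N4. \<Oplus>b\<in>N4. Rcoef q i k a b \<odot> (?Z a j \<otimes> ?Z b l)) =
   (\<Oplus>a\<in>N4. \<Oplus>b\<in>N4. Rcoef q a b j l \<odot> (?Z k b \<otimes> ?Z i a))"
   if "i \<in> N4" "k \<in> N4" "j \<in> N4" "l \<in> N4" for i k j l
   using iffD1[OF rtt RTT] that by blast
  show "(\<Oplus>k\<in>N4. ?Z i k \<otimes> antip q A ?Z k j) = (if i = j then \<one> else \<zero>)" if "i \<in> N4" "j \<in> N4" for i j
  proof -
   have "mk_matrix N4 (\<lambda>i j. \<Oplus>k\<in>N4. ?Z i k \<otimes> antip q A ?Z k j) = mk_matrix N4 (\<lambda>i j. if i = j then \<one> else \<zero>)"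
    using 1 unfolding one_matrix by (subst (asm) mat_mult) (use cZ aZ in auto)
   from mk_matrix_eqD[OF this that] show ?thesis .
  qed
  show "(\<Oplus>k\<in>N4. antip q A ?Z i k \<otimes> ?Z k j) = (if i = j then \<one> else \<zero>)" if "i \<in> N4" "j \<in> N4" for i j
  proof -
   have "mk_matrix N4 (\<lambda>i j. \<Oplus>k\<in>N4. antip q A ?Z i k \<otimes> ?Z k j) = mk_matrix N4 (\<lambda>i j. if i = j then \<one> else \<zero>)"
    using 2 unfolding one_matrix by (subst (asm) mat_mult) (use cZ aZ in auto)
   from mk_matrix_eqD[OF this that] show ?thesis .
  qed
 qed (rule cZ)
qed

lemma antip_inverse_swapped:
 assumes U: "frt q A U" and q: "q \<noteq> 0" and ij: "i \<in> N4" "j \<in> N4"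
 shows "(\<Oplus>k\<in>N4. Scoef q k j \<odot> antip q A U (5 - j) (5 - k) \<otimes> antip q A U i k) = (if i = j then \<one> else \<zero>)"
  "(\<Oplus>k\<in>N4. antip q A U k j \<otimes> (Scoef q i k \<odot> antip q A U (5 - k) (5 - i))) = (if i = j then \<one> else \<zero>)"
proof -
 note cU = frt_closed[OF U q] and aU = antip_closed[OF U q]
 have del: "Scoef q i j \<odot> (if 5 - j = 5 - i then \<one> else \<zero>) = (if i = j then \<one> else \<zero>)"
 proof (cases "i = j")
  case True then show ?thesis using Scoef_simps(1)[OF q ij] by simp
 next
  case False
  then have "5 - j \<noteq> 5 - i" using N4_prime(2)[OF ij(1)] N4_prime(2)[OF ij(2)] by metis
  then show ?thesis using False by simp
 qed
 have "(\<Oplus>k\<in>N4. Scoef q k j \<odot> antip q A U (5 - j) (5 - k) \<otimes> antip q A U i k) =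
   (\<Oplus>k\<in>N4. Scoef q i j \<odot> (antip q A U (5 - j) (5 - k) \<otimes> U (5 - k) (5 - i)))"
 proof (rule finsum_cong')
  fix k :: nat assume k: "k \<in> N4"
  have "antip q A U i k = Scoef q i k \<odot> U (5 - k) (5 - i)" by (simp add: antip_def)
  then show "Scoef q k j \<odot> antip q A U (5 - j) (5 - k) \<otimes> antip q A U i k =
    Scoef q i j \<odot> (antip q A U (5 - j) (5 - k) \<otimes> U (5 - k) (5 - i))"
   using k ij cU aU Scoef_simps(4)[OF q ij k]
   by (simp add: smult_mult_left smult_mult_right smult_assoc mult.commute)
 qed (use ij cU aU in auto)
 also have "\<dots> = (\<Oplus>k\<in>N4. Scoef q i j \<odot> (antip q A U (5 - j) k \<otimes> U k (5 - i)))"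
  using ij cU aU by (intro finsum_prime[of "\<lambda>k. Scoef q i j \<odot> (antip q A U (5 - j) k \<otimes> U k (5 - i))"]) auto
 also have "\<dots> = Scoef q i j \<odot> (\<Oplus>k\<in>N4. antip q A U (5 - j) k \<otimes> U k (5 - i))"
  using ij cU aU by (intro finsum_smult[symmetric]) auto
 also have "\<dots> = (if i = j then \<one> else \<zero>)" using frtD(4)[OF U, of "5 - j" "5 - i"] ij del by simp
 finally show "(\<Oplus>k\<in>N4. Scoef q k j \<odot> antip q A U (5 - j) (5 - k) \<otimes> antip q A U i k) = (if i = j then \<one> else \<zero>)" .
 have "(\<Oplus>k\<in>N4. antip q A U k j \<otimes> (Scoef q i k \<odot> antip q A U (5 - k) (5 - i))) =
   (\<Oplus>k\<in>N4. Scoef q i j \<odot> (U (5 - j) (5 - k) \<otimes> antip q A U (5 - k) (5 - i)))"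
 proof (rule finsum_cong')
  fix k :: nat assume k: "k \<in> N4"
  have "antip q A U k j = Scoef q k j \<odot> U (5 - j) (5 - k)" by (simp add: antip_def)
  then show "antip q A U k j \<otimes> (Scoef q i k \<odot> antip q A U (5 - k) (5 - i)) =
    Scoef q i j \<odot> (U (5 - j) (5 - k) \<otimes> antip q A U (5 - k) (5 - i))"
   using k ij cU aU Scoef_simps(4)[OF q ij k]
   by (simp add: smult_mult_left smult_mult_right smult_assoc mult.commute)
 qed (use ij cU aU in auto)
 also have "\<dots> = (\<Oplus>k\<in>N4. Scoef q i j \<odot> (U (5 - j) k \<otimes> antip q A U k (5 - i)))"
  using ij cU aU by (intro finsum_prime[of "\<lambda>k. Scoef q i j \<odot> (U (5 - j) k \<otimes> antip q A U k (5 - i))"]) auto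
 also have "\<dots> = Scoef q i j \<odot> (\<Oplus>k\<in>N4. U (5 - j) k \<otimes> antip q A U k (5 - i))"
  using ij cU aU by (intro finsum_smult[symmetric]) auto
 also have "\<dots> = (if i = j then \<one> else \<zero>)" using frtD(3)[OF U, of "5 - j" "5 - i"] ij del by simp
 finally show "(\<Oplus>k\<in>N4. antip q A U k j \<otimes> (Scoef q i k \<odot> antip q A U (5 - k) (5 - i))) = (if i = j then \<one> else \<zero>)" .
qed

lemma frt_antip_opposite:
 assumes U: "frt q A U" and q: "q \<noteq> 0"
 shows "frt q (opposite_algebra id A) (antip q A U)"
proof (rule frtI)
 fix i k j l :: nat assume idx: "i \<in> N4" "k \<in> N4" "j \<in> N4" "l \<in> N4"
 show "(\<Oplus>\<^bsub>opposite_algebra id A\<^esub>a\<in>N4. \<Oplus>\<^bsub>opposite_algebra id A\<^esub>b\<in>N4. Rcoef q i k a b \<odot>\<^bsub>opposite_algebra id A\<^esub>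
    (antip q A U a j \<otimes>\<^bsub>opposite_algebra id A\<^esub> antip q A U b l)) =
   (\<Oplus>\<^bsub>opposite_algebra id A\<^esub>a\<in>N4. \<Oplus>\<^bsub>opposite_algebra id A\<^esub>b\<in>N4. Rcoef q a b j l \<odot>\<^bsub>opposite_algebra id A\<^esub>
    (antip q A U k b \<otimes>\<^bsub>opposite_algebra id A\<^esub> antip q A U i a))"
  using frt_antip_entries[OF U q idx] by simp
qed (use antip_closed[OF U q] antip_inverse_swapped[OF U q] in \<open>simp_all add: antip_def[of q "opposite_algebra id A"]\<close>)

text \<open>The star structure exists because \<open>R\<close> is real and its transpose exchanges the two
 tensor factors.\<close>

lemma frt_antip_star:
 assumes U: "frt q A U" and q: "q \<noteq> 0"
 shows "frt q (opposite_algebra cnj A) (\<lambda>i j. antip q A U j i)"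
proof (rule frtI)
 note cU = frt_closed[OF U q] and aU = antip_closed[OF U q]
 fix i k j l :: nat assume idx: "i \<in> N4" "k \<in> N4" "j \<in> N4" "l \<in> N4"
 have "(\<Oplus>a\<in>N4. \<Oplus>b\<in>N4. Rcoef q i k a b \<odot> (antip q A U l b \<otimes> antip q A U j a)) =
   (\<Oplus>a\<in>N4. \<Oplus>b\<in>N4. Rcoef q b a k i \<odot> (antip q A U l b \<otimes> antip q A U j a))"
  using idx aU Rcoef_transpose[OF idx(1,2)] by (intro finsum_cong') (auto intro!: finsum_cong' finsum_closed)
 also have "\<dots> = (\<Oplus>b\<in>N4. \<Oplus>a\<in>N4. Rcoef q b a k i \<odot> (antip q A U l b \<otimes> antip q A U j a))"
  using idx aU by (intro finsum_finsum_swap) auto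
 also have "\<dots> = (\<Oplus>a\<in>N4. \<Oplus>b\<in>N4. Rcoef q l j a b \<odot> (antip q A U b i \<otimes> antip q A U a k))"
  by (rule frt_antip_entries[OF U q idx(4,3,2,1), symmetric])
 also have "\<dots> = (\<Oplus>b\<in>N4. \<Oplus>a\<in>N4. Rcoef q l j a b \<odot> (antip q A U b i \<otimes> antip q A U a k))"
  using idx aU by (intro finsum_finsum_swap) auto
 also have "\<dots> = (\<Oplus>a\<in>N4. \<Oplus>b\<in>N4. Rcoef q a b j l \<odot> (antip q A U a i \<otimes> antip q A U b k))"
  using idx aU Rcoef_transpose[OF idx(4,3)] by (intro finsum_cong') (auto intro!: finsum_cong' finsum_closed)
 finally have "(\<Oplus>a\<in>N4. \<Oplus>b\<in>N4. cnj (Rcoef q i k a b) \<odot> (antip q A U l b \<otimes> antip q A U j a)) =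
   (\<Oplus>a\<in>N4. \<Oplus>b\<in>N4. cnj (Rcoef q a b j l) \<odot> (antip q A U a i \<otimes> antip q A U b k))"
  using idx by (simp add: Rcoef_real aU Pi_def cong: finsum_cong)
 then show "(\<Oplus>\<^bsub>opposite_algebra cnj A\<^esub>a\<in>N4. \<Oplus>\<^bsub>opposite_algebra cnj A\<^esub>b\<in>N4. Rcoef q i k a b \<odot>\<^bsub>opposite_algebra cnj A\<^esub>
    (antip q A U j a \<otimes>\<^bsub>opposite_algebra cnj A\<^esub> antip q A U l b)) =
   (\<Oplus>\<^bsub>opposite_algebra cnj A\<^esub>a\<in>N4. \<Oplus>\<^bsub>opposite_algebra cnj A\<^esub>b\<in>N4. Rcoef q a b j l \<odot>\<^bsub>opposite_algebra cnj A\<^esub>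
    (antip q A U b k \<otimes>\<^bsub>opposite_algebra cnj A\<^esub> antip q A U a i))"
  by simp
next
 note cU = frt_closed[OF U q] and aU = antip_closed[OF U q]
 have ant: "antip q (opposite_algebra cnj A) (\<lambda>i j. antip q A U j i) i j = U j i" if "i \<in> N4" "j \<in> N4" for i j
  using that cU Scoef_simps(2,3)[OF q that(2,1)] Scoef_simps(3)[OF q that]
  by (simp add: antip_def smult_assoc)
 fix i j :: nat assume ij: "i \<in> N4" "j \<in> N4"
 have "(\<Oplus>k\<in>N4. antip q (opposite_algebra cnj A) (\<lambda>i j. antip q A U j i) k j \<otimes> antip q A U k i) =
   (\<Oplus>k\<in>N4. U j k \<otimes> antip q A U k i)"
  using ij ant cU aU by (intro finsum_cong') auto
 then show "(\<Oplus>\<^bsub>opposite_algebra cnj A\<^esub>k\<in>N4. antip q A U k i \<otimes>\<^bsub>opposite_algebra cnj A\<^esub>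
   antip q (opposite_algebra cnj A) (\<lambda>i j. antip q A U j i) k j) =
  (if i = j then \<one>\<^bsub>opposite_algebra cnj A\<^esub> else \<zero>\<^bsub>opposite_algebra cnj A\<^esub>)"
  using frtD(3)[OF U ij(2,1)] by (cases "i = j") auto
 have "(\<Oplus>k\<in>N4. antip q A U j k \<otimes> antip q (opposite_algebra cnj A) (\<lambda>i j. antip q A U j i) i k) =
   (\<Oplus>k\<in>N4. antip q A U j k \<otimes> U k i)"
  using ij ant cU aU by (intro finsum_cong') auto
 then show "(\<Oplus>\<^bsub>opposite_algebra cnj A\<^esub>k\<in>N4. antip q (opposite_algebra cnj A) (\<lambda>i j. antip q A U j i) i k
   \<otimes>\<^bsub>opposite_algebra cnj A\<^esub> antip q A U j k) =
  (if i = j then \<one>\<^bsub>opposite_algebra cnj A\<^esub> else \<zero>\<^bsub>opposite_algebra cnj A\<^esub>)"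
  using frtD(4)[OF U ij(2,1)] by (cases "i = j") auto
qed (use antip_closed[OF U q] in auto)

end

section \<open>The quantum symplectic group as a Hopf algebra\<close>

lemma FT_closed:
 "1 \<in> carrier FT" "0 \<in> carrier FT" "nc_const c \<in> carrier FT"
 "f \<in> carrier FT ==> g \<in> carrier FT ==> f + g \<in> carrier FT"
 "f \<in> carrier FT ==> g \<in> carrier FT ==> f - g \<in> carrier FT"
 "f \<in> carrier FT ==> g \<in> carrier FT ==> f * g \<in> carrier FT"
 "i \<in> N4 ==> j \<in> N4 ==> tgen i j \<in> carrier FT"
 unfolding FT_def by (auto intro: free_carrier_closed)

lemma FT_closed_sum: "(\<And>i. i \<in> I ==> f i \<in> carrier FT) ==> (\<Sum>i\<in>I. f i) \<in> carrier FT"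
 unfolding FT_def by (rule free_carrier_sum)

lemma FT_simps [simp]:
 "x \<otimes>\<^bsub>FT\<^esub> y = x * y" "\<one>\<^bsub>FT\<^esub> = 1" "\<zero>\<^bsub>FT\<^esub> = 0" "x \<oplus>\<^bsub>FT\<^esub> y = x + y" "c \<odot>\<^bsub>FT\<^esub> x = nc_const c * x"
 by (simp_all add: FT_def)

lemma ualg_FT: "ualg FT" unfolding FT_def by (rule ualg_free)

lemma FT_finsum:
 assumes "\<And>i. i \<in> I ==> f i \<in> carrier FT" "finite I"
 shows "finsum FT f I = (\<Sum>i\<in>I. f i)"
proof -
 interpret F: ualg FT by (rule ualg_FT)
 show ?thesis using assms(2,1) by (induction I rule: finite_induct) auto
qed

lemma (in ualg) frt_cong:
 assumes U: "frt q A U" and eq: "\<And>i j. i \<in> N4 ==> j \<in> N4 ==> U' i j = U i j"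
 shows "frt q A U'"
proof (rule frtI)
 note cU = frtD(1)[OF U]
 have ant: "antip q A U' i j = antip q A U i j" "antip q A U i j \<in> carrier A" if "i \<in> N4" "j \<in> N4" for i j
  using that cU by (simp_all add: antip_def eq)
 show "U' i j \<in> carrier A" if "i \<in> N4" "j \<in> N4" for i j using that cU eq by simp
 fix i j :: nat assume ij: "i \<in> N4" "j \<in> N4"
 have "(\<Oplus>k\<in>N4. U' i k \<otimes> antip q A U' k j) = (\<Oplus>k\<in>N4. U i k \<otimes> antip q A U k j)"
  "(\<Oplus>k\<in>N4. antip q A U' i k \<otimes> U' k j) = (\<Oplus>k\<in>N4. antip q A U i k \<otimes> U k j)"
  using ij cU ant by (auto intro!: finsum_cong' simp: eq)
 then show "(\<Oplus>k\<in>N4. U' i k \<otimes> antip q A U' k j) = (if i = j then \<one> else \<zero>)"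
  "(\<Oplus>k\<in>N4. antip q A U' i k \<otimes> U' k j) = (if i = j then \<one> else \<zero>)"
  using frtD(3,4)[OF U ij] by simp_all
next
 note cU = frtD(1)[OF U]
 fix i k j l :: nat assume idx: "i \<in> N4" "k \<in> N4" "j \<in> N4" "l \<in> N4"
 have "(\<Oplus>a\<in>N4. \<Oplus>b\<in>N4. Rcoef q i k a b \<odot> (U' a j \<otimes> U' b l)) = (\<Oplus>a\<in>N4. \<Oplus>b\<in>N4. Rcoef q i k a b \<odot> (U a j \<otimes> U b l))"
  "(\<Oplus>a\<in>N4. \<Oplus>b\<in>N4. Rcoef q a b j l \<odot> (U' k b \<otimes> U' i a)) = (\<Oplus>a\<in>N4. \<Oplus>b\<in>N4. Rcoef q a b j l \<odot> (U k b \<otimes> U i a))"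
  using idx cU by (auto intro!: finsum_cong' finsum_closed simp: eq)
 then show "(\<Oplus>a\<in>N4. \<Oplus>b\<in>N4. Rcoef q i k a b \<odot> (U' a j \<otimes> U' b l)) =
   (\<Oplus>a\<in>N4. \<Oplus>b\<in>N4. Rcoef q a b j l \<odot> (U' k b \<otimes> U' i a))"
  using frtD(2)[OF U idx(1,3,2,4)] by simp
qed

text \<open>An algebra map out of the free algebra kills the relations exactly if the images of the
 generators form a matrix that satisfies \<^const>\<open>frt\<close>.\<close>

lemma kills_relations_iff:
 assumes A: "ualg A" and h: "h \<in> algebra_maps FT A"
 shows "(\<forall>r\<in>spq_relations q. h r = \<zero>\<^bsub>A\<^esub>) \<longleftrightarrow> frt q A (\<lambda>i j. h (tgen i j))"
proof -
 interpret A: ualg A by fact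
 interpret F: ualg FT by (rule ualg_FT)
 let ?U = "\<lambda>i j. h (tgen i j)"
 note hD = algebra_mapsD[OF h, unfolded FT_simps]
 have U: "?U i j \<in> carrier A" if "i \<in> N4" "j \<in> N4" for i j
  using that FT_closed hD(1) by auto
 have sum: "h (\<Sum>i\<in>I. f i) = (\<Oplus>\<^bsub>A\<^esub>i\<in>I. h (f i))" if "\<And>i. i \<in> I ==> f i \<in> carrier FT" "finite I"
  for f :: "nat \<Rightarrow> (nat \<times> nat) ncpoly" and I
  using alg_map_finsum[OF ualg_FT A h, of f I] that by (simp add: FT_finsum)
 have const: "h (nc_const c * x) = c \<odot>\<^bsub>A\<^esub> h x" "h (x * nc_const c) = c \<odot>\<^bsub>A\<^esub> h x" if "x \<in> carrier FT" for c x
  using hD(5)[OF that, of c] by (simp_all add: nc_const_commute)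
 have const1: "h (nc_const c) = c \<odot>\<^bsub>A\<^esub> \<one>\<^bsub>A\<^esub>" for c
  using const(1)[OF FT_closed(1), of c] hD(4) by simp
 have diff: "h (x - y) = \<zero>\<^bsub>A\<^esub> \<longleftrightarrow> h x = h y" if "x \<in> carrier FT" "y \<in> carrier FT" for x y
 proof -
  have "h x = h (x - y) \<oplus>\<^bsub>A\<^esub> h y" using hD(3)[OF FT_closed(5)[OF that] that(2)] by simp
  moreover have "h (x - y) \<in> carrier A" "h y \<in> carrier A" using that hD(1) FT_closed(5) by auto
  ultimately show ?thesis by (metis A.add.r_cancel_one' A.l_zero)
 qed
 have hT: "h (tgen a j * tgen b l) = ?U a j \<otimes>\<^bsub>A\<^esub> ?U b l" if "a \<in> N4" "j \<in> N4" "b \<in> N4" "l \<in> N4" for a j b l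
  using that hD(2) FT_closed(7) by simp
 have sg: "sgen q i j \<in> carrier FT" "h (sgen q i j) = antip q A ?U i j" if "i \<in> N4" "j \<in> N4" for i j
  using that by (simp_all add: sgen_Scoef FT_closed const antip_def)
 have r1: "h (\<Sum>a=1..4. \<Sum>b=1..4. nc_const (Rmat q (i, k) (a, b)) * tgen a j * tgen b l) =
   (\<Oplus>\<^bsub>A\<^esub>a\<in>N4. \<Oplus>\<^bsub>A\<^esub>b\<in>N4. Rcoef q i k a b \<odot>\<^bsub>A\<^esub> (?U a j \<otimes>\<^bsub>A\<^esub> ?U b l))"
  if idx: "i \<in> N4" "k \<in> N4" "j \<in> N4" "l \<in> N4" for i k j l
 proof (subst sum)
  show "(\<Oplus>\<^bsub>A\<^esub>a\<in>N4. h (\<Sum>b=1..4. nc_const (Rmat q (i, k) (a, b)) * tgen a j * tgen b l)) =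
   (\<Oplus>\<^bsub>A\<^esub>a\<in>N4. \<Oplus>\<^bsub>A\<^esub>b\<in>N4. Rcoef q i k a b \<odot>\<^bsub>A\<^esub> (?U a j \<otimes>\<^bsub>A\<^esub> ?U b l))"
   using idx U by (intro A.finsum_cong')
    (auto simp: sum FT_closed Rmat_Rcoef mult.assoc const hT intro!: A.finsum_closed A.finsum_cong')
 qed (use idx in \<open>auto intro!: FT_closed FT_closed_sum\<close>)
 have r2: "h (\<Sum>a=1..4. \<Sum>b=1..4. tgen k b * tgen i a * nc_const (Rmat q (a, b) (j, l))) =
   (\<Oplus>\<^bsub>A\<^esub>a\<in>N4. \<Oplus>\<^bsub>A\<^esub>b\<in>N4. Rcoef q a b j l \<odot>\<^bsub>A\<^esub> (?U k b \<otimes>\<^bsub>A\<^esub> ?U i a))"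
  if idx: "i \<in> N4" "k \<in> N4" "j \<in> N4" "l \<in> N4" for i k j l
 proof (subst sum)
  show "(\<Oplus>\<^bsub>A\<^esub>a\<in>N4. h (\<Sum>b=1..4. tgen k b * tgen i a * nc_const (Rmat q (a, b) (j, l)))) =
   (\<Oplus>\<^bsub>A\<^esub>a\<in>N4. \<Oplus>\<^bsub>A\<^esub>b\<in>N4. Rcoef q a b j l \<odot>\<^bsub>A\<^esub> (?U k b \<otimes>\<^bsub>A\<^esub> ?U i a))"
   using idx U by (intro A.finsum_cong')
    (auto simp: sum FT_closed Rmat_Rcoef const hT intro!: A.finsum_closed A.finsum_cong')
 qed (use idx in \<open>auto intro!: FT_closed FT_closed_sum\<close>)
 have r3: "h (\<Sum>k=1..4. tgen i k * sgen q k j) = (\<Oplus>\<^bsub>A\<^esub>k\<in>N4. ?U i k \<otimes>\<^bsub>A\<^esub> antip q A ?U k j)"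
  "h (\<Sum>k=1..4. sgen q i k * tgen k j) = (\<Oplus>\<^bsub>A\<^esub>k\<in>N4. antip q A ?U i k \<otimes>\<^bsub>A\<^esub> ?U k j)"
  if idx: "i \<in> N4" "j \<in> N4" for i j
  using idx U sg hD(1)[OF sg(1)] by (auto simp: sum FT_closed hD intro!: A.finsum_cong')
 have r4: "h (nc_const (if i = j then 1 else 0)) = (if i = j then \<one>\<^bsub>A\<^esub> else \<zero>\<^bsub>A\<^esub>)" for i j :: nat
  by (simp add: const1)
 have mem: "(\<Sum>a=1..4. \<Sum>b=1..4. nc_const (Rmat q (i, k) (a, b)) * tgen a j * tgen b l) \<in> carrier FT"
  "(\<Sum>a=1..4. \<Sum>b=1..4. tgen k b * tgen i a * nc_const (Rmat q (a, b) (j, l))) \<in> carrier FT"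
  "(\<Sum>k=1..4. tgen i k * sgen q k j) \<in> carrier FT" "(\<Sum>k=1..4. sgen q i k * tgen k j) \<in> carrier FT"
  if "i \<in> N4" "k \<in> N4" "j \<in> N4" "l \<in> N4" for i k j l
  using that sg(1) by (auto intro!: FT_closed FT_closed_sum)
 have ball: "(\<forall>r\<in>{f i j k l | i j k l. {i, j, k, l} \<subseteq> N4}. Q r) \<longleftrightarrow> (\<forall>i\<in>N4. \<forall>k\<in>N4. \<forall>j\<in>N4. \<forall>l\<in>N4. Q (f i j k l))"
  "(\<forall>r\<in>{g i j | i j. {i, j} \<subseteq> N4}. Q r) \<longleftrightarrow> (\<forall>i\<in>N4. \<forall>j\<in>N4. Q (g i j))"
  for f g and Q :: "(nat \<times> nat) ncpoly \<Rightarrow> bool" by blast+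
 show ?thesis
  unfolding spq_relations_def frt_def ball_Un ball
  using U mem by (auto simp: diff FT_closed r1 r2 r3 r4)
qed

lemma spq_relations_subset: "spq_relations q \<subseteq> carrier FT"
 unfolding spq_relations_def
 by (auto intro!: FT_closed FT_closed_sum simp: sgen_Scoef)

locale spq =
 fixes q :: real
 assumes q0: "q \<noteq> 0"

context spq
begin

abbreviation "P \<equiv> ASp2 q"
abbreviation "H \<equiv> ASp1 q"
abbreviation "T \<equiv> Tmat q"
abbreviation "T1 \<equiv> Tmat1 q"
abbreviation "S \<equiv> antip q P T"
abbreviation "I \<equiv> spq_ideal q"

end

sublocale spq \<subseteq> FT: alg_ideal FT "spq_ideal q"
proof -
 interpret F: ualg FT by (rule ualg_FT)
 show "alg_ideal FT (spq_ideal q)"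
  unfolding alg_ideal_def spq_ideal_def
  using F.genideal_ideal[OF spq_relations_subset] F.ualg_axioms by simp
qed

sublocale spq \<subseteq> P: ualg "ASp2 q" unfolding ASp2_def by (rule FT.ualg_quotient)

context spq
begin

abbreviation P_mult (infixl "\<cdot>" 70) where "x \<cdot> y \<equiv> x \<otimes>\<^bsub>P\<^esub> y"
abbreviation P_smult (infixl "\<^bold>*" 70) where "c \<^bold>* x \<equiv> c \<odot>\<^bsub>P\<^esub> x"
abbreviation P_add (infixl "\<^bold>+" 65) where "x \<^bold>+ y \<equiv> x \<oplus>\<^bsub>P\<^esub> y"
abbreviation P_one ("\<^bold>1") where "\<^bold>1 \<equiv> \<one>\<^bsub>P\<^esub>"
abbreviation P_zero ("\<^bold>0") where "\<^bold>0 \<equiv> \<zero>\<^bsub>P\<^esub>"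

lemma P_eq: "FT.Q = P" by (simp add: ASp2_def)

lemma T_coset: "T i j = I +>\<^bsub>FT\<^esub> tgen i j" by (simp add: Tmat_def)

lemma proj_P: "(\<lambda>x. I +>\<^bsub>FT\<^esub> x) \<in> algebra_maps FT P" unfolding P_eq[symmetric] by (rule FT.quotient_proj)

lemma T_frt: "frt q P T"
proof -
 have "I +>\<^bsub>FT\<^esub> r = \<^bold>0" if "r \<in> spq_relations q" for r
  using FT.quotient_zero_iff[of r] that spq_relations_subset FT.genideal_self[OF spq_relations_subset]
  unfolding P_eq by (auto simp: spq_ideal_def)
 moreover have "T = (\<lambda>i j. I +>\<^bsub>FT\<^esub> tgen i j)" by (simp add: fun_eq_iff T_coset)
 ultimately show ?thesis using iffD1[OF kills_relations_iff[OF P.ualg_axioms proj_P, of q]] by auto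
qed

lemma T_closed [simp, intro]: "i \<in> N4 ==> j \<in> N4 ==> T i j \<in> carrier P" by (rule frtD(1)[OF T_frt])

lemma S_closed [simp, intro]: "i \<in> N4 ==> j \<in> N4 ==> S i j \<in> carrier P" by (rule P.antip_closed[OF T_frt q0])

lemma Smat_S: "i \<in> N4 ==> j \<in> N4 ==> Smat q i j = S i j"
 using alg_map_smult[OF proj_P FT_closed(7), of "5 - j" "5 - i" "Scoef q i j"]
 by (simp add: Smat_def sgen_Scoef antip_def T_coset)

text \<open>Together with uniqueness on generators this is the universal property of \<open>A(Sp\<^sub>q(2))\<close>; every
 structure map below arises by exhibiting a matrix that satisfies the relations.\<close>

lemma P_hom:
 assumes A: "ualg A" and U: "frt q A (\<lambda>i j. \<theta> (i, j))"
 shows "quot_lift (free_hom A \<theta>) \<in> algebra_maps P A"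
  and "\<And>i j. i \<in> N4 ==> j \<in> N4 ==> quot_lift (free_hom A \<theta>) (T i j) = \<theta> (i, j)"
proof -
 interpret A: ualg A by fact
 have cl: "\<theta> g \<in> carrier A" if "g \<in> N4 \<times> N4" for g using frtD(1)[OF U] that by auto
 have h: "free_hom A \<theta> \<in> algebra_maps FT A" unfolding FT_def by (rule A.free_hom_algebra_map[OF cl])
 have gen: "free_hom A \<theta> (tgen i j) = \<theta> (i, j)" if "i \<in> N4" "j \<in> N4" for i j
  by (rule A.free_hom_gen[OF cl]) (use that in auto)
 have "frt q A (\<lambda>i j. free_hom A \<theta> (tgen i j))"
  by (rule A.frt_cong[OF U gen])
 then have "\<forall>r\<in>spq_relations q. free_hom A \<theta> r = \<zero>\<^bsub>A\<^esub>"
  using kills_relations_iff[OF A h] by blast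
 then have "free_hom A \<theta> x = \<zero>\<^bsub>A\<^esub>" if "x \<in> I" for x
  using FT.alg_map_kills_genideal[OF A h spq_relations_subset] that unfolding spq_ideal_def by blast
 note l = FT.quot_lift_hom[OF A h this, unfolded P_eq]
 show "quot_lift (free_hom A \<theta>) \<in> algebra_maps P A" by (rule l(1))
 show "quot_lift (free_hom A \<theta>) (T i j) = \<theta> (i, j)" if "i \<in> N4" "j \<in> N4" for i j
  using l(2)[OF _ FT_closed(7)[OF that]] gen[OF that] by (simp add: T_coset)
qed

lemma P_unique:
 assumes A: "ualg A" and f: "f \<in> algebra_maps P A" and g: "g \<in> algebra_maps P A"
  and gen: "\<And>i j. i \<in> N4 ==> j \<in> N4 ==> f (T i j) = g (T i j)" and x: "x \<in> carrier P"
 shows "f x = g x"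
proof -
 obtain y where y: "y \<in> carrier FT" "x = I +>\<^bsub>FT\<^esub> y" using x FT.quotient_simps(1) unfolding P_eq by auto
 have "f (I +>\<^bsub>FT\<^esub> y) = g (I +>\<^bsub>FT\<^esub> y)"
 proof (rule free_algebra_maps_unique[OF A])
  show "(\<lambda>y. f (I +>\<^bsub>FT\<^esub> y)) \<in> algebra_maps (free_algebra (N4 \<times> N4)) A"
   using alg_map_compose[OF proj_P f] by (simp add: FT_def)
  show "(\<lambda>y. g (I +>\<^bsub>FT\<^esub> y)) \<in> algebra_maps (free_algebra (N4 \<times> N4)) A"
   using alg_map_compose[OF proj_P g] by (simp add: FT_def)
  show "y \<in> carrier (free_algebra (N4 \<times> N4))" using y by (simp add: FT_def)
 qed (use gen in \<open>auto simp: T_coset\<close>)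
 then show ?thesis by (simp add: y)
qed

lemma P_induct [consumes 1, case_names one gen add smult]:
 assumes x: "x \<in> carrier P"
  and one: "\<Phi> \<^bold>1"
  and gen: "\<And>i j x. [|i \<in> N4; j \<in> N4; x \<in> carrier P; \<Phi> x|] ==> \<Phi> (T i j \<cdot> x)"
  and add: "\<And>x y. [|x \<in> carrier P; y \<in> carrier P; \<Phi> x; \<Phi> y|] ==> \<Phi> (x \<^bold>+ y)"
  and smult: "\<And>c x. [|x \<in> carrier P; \<Phi> x|] ==> \<Phi> (c \<^bold>* x)"
 shows "\<Phi> x"
proof -
 let ?p = "\<lambda>y. I +>\<^bsub>FT\<^esub> y"
 note pD = algebra_mapsD[OF proj_P, unfolded FT_simps]
 have word: "Poly_Mapping.single (Word gs) 1 \<in> carrier FT \<and> \<Phi> (?p (Poly_Mapping.single (Word gs) 1))"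
  if "set gs \<subseteq> N4 \<times> N4" for gs using that
 proof (induction gs)
  case Nil
  have "Poly_Mapping.single (Word []) 1 = (1 :: (nat \<times> nat) ncpoly)" by (simp flip: zero_word_def)
  then show ?case using one pD(4) FT_closed(1) by simp
 next
  case (Cons g gs)
  obtain i j where g: "g = (i, j)" "i \<in> N4" "j \<in> N4" using Cons.prems by auto
  have e: "Poly_Mapping.single (Word (g # gs)) 1 = tgen i j * Poly_Mapping.single (Word gs) 1"
   by (simp add: nc_gen_def mult_single plus_word_def g)
  have IH: "Poly_Mapping.single (Word gs) 1 \<in> carrier FT" "\<Phi> (?p (Poly_Mapping.single (Word gs) 1))"
   using Cons by auto
  show ?case unfolding e
   using gen[OF g(2,3) pD(1)[OF IH(1)] IH(2)] pD(2)[OF FT_closed(7)[OF g(2,3)] IH(1)]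
    FT_closed(6)[OF FT_closed(7)[OF g(2,3)] IH(1)] by (simp add: T_coset)
 qed
 obtain y where y: "y \<in> carrier FT" "x = ?p y" using x FT.quotient_simps(1) unfolding P_eq by auto
 from y(1) have "\<Phi> (?p y)" unfolding FT_def
 proof (induction y rule: free_carrier_induct)
  case zero
  have "\<Phi> (0 \<^bold>* \<^bold>1)" by (rule smult) (use one in auto)
  moreover have "?p 0 = \<^bold>0" using alg_map_zero[OF ualg_FT P.ualg_axioms proj_P] by simp
  ultimately show ?case by (simp add: FT_def)
 next
  case (single c w)
  have w: "Poly_Mapping.single w 1 \<in> carrier FT" "\<Phi> (?p (Poly_Mapping.single w 1))"
   using word[of "letters w"] single by simp_all
  have e: "Poly_Mapping.single w c = nc_const c * Poly_Mapping.single w 1"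
   by (simp add: nc_const_def mult_single)
  show ?case using smult[OF pD(1)[OF w(1)] w(2), of c] pD(5)[OF w(1), of c] unfolding e by (simp add: FT_def)
 next
  case (add f g)
  then have "f \<in> carrier FT" "g \<in> carrier FT" by (simp_all add: FT_def)
  then show ?case using assms(4)[OF pD(1) pD(1)] add pD(3) by (simp add: FT_def)
 qed
 then show ?thesis by (simp add: y)
qed

end

lemma algebra_maps_cong:
 assumes "ualg A" "h \<in> algebra_maps A B" "\<And>x. x \<in> carrier A ==> h' x = h x"
 shows "h' \<in> algebra_maps A B"
proof -
 interpret ualg A by fact
 show ?thesis using assms(3) by (intro algebra_mapsI) (simp_all add: algebra_mapsD[OF assms(2)])
qed

context ualg2
begin

lemma frt_tensor:
 assumes "frt q A U" "frt q B W" "q \<noteq> 0"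
 shows "frt q AB (\<lambda>i j. \<Oplus>\<^bsub>AB\<^esub>k\<in>N4. U i k \<otimes>\<^sub>t W k j)"
proof (rule AB.frt_cong)
 note cU = frtD(1)[OF assms(1)] and cW = frtD(1)[OF assms(2)]
 show "frt q AB (\<lambda>i j. \<Oplus>\<^bsub>AB\<^esub>k\<in>N4. (U i k \<otimes>\<^sub>t \<one>\<^bsub>B\<^esub>) \<otimes>\<^bsub>AB\<^esub> (\<one>\<^bsub>A\<^esub> \<otimes>\<^sub>t W k j))"
  using cU cW
  by (intro AB.frt_mult frt_map[OF A.ualg_axioms ualg_AB AB_left_hom assms(1)]
    frt_map[OF B.ualg_axioms ualg_AB AB_right_hom assms(2)] assms(3)) auto
 show "(\<Oplus>\<^bsub>AB\<^esub>k\<in>N4. U i k \<otimes>\<^sub>t W k j) = (\<Oplus>\<^bsub>AB\<^esub>k\<in>N4. (U i k \<otimes>\<^sub>t \<one>\<^bsub>B\<^esub>) \<otimes>\<^bsub>AB\<^esub> (\<one>\<^bsub>A\<^esub> \<otimes>\<^sub>t W k j))"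
  if "i \<in> N4" "j \<in> N4" for i j
  using that cU cW by (intro AB.finsum_cong') auto
qed

lemma matrix_coassoc:
 assumes \<delta>: "\<delta> \<in> algebra_maps A AB" and \<Delta>: "\<Delta> \<in> algebra_maps B (tensor_algebra B B)"
  and U: "\<And>i j. i \<in> N4 ==> j \<in> N4 ==> U i j \<in> carrier A"
  and W: "\<And>i j. i \<in> N4 ==> j \<in> N4 ==> W i j \<in> carrier B"
  and \<delta>U: "\<And>i j. i \<in> N4 ==> j \<in> N4 ==> \<delta> (U i j) = (\<Oplus>\<^bsub>AB\<^esub>k\<in>N4. U i k \<otimes>\<^sub>t W k j)"
  and \<Delta>W: "\<And>i j. i \<in> N4 ==> j \<in> N4 ==> \<Delta> (W i j) = (\<Oplus>\<^bsub>tensor_algebra B B\<^esub>k\<in>N4. ctensor B B (W i k) (W k j))"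
  and ij: "i \<in> N4" "j \<in> N4"
 shows "tensor_assoc A B B (ctensor_map AB B \<delta> id (\<delta> (U i j))) =
  ctensor_map A (tensor_algebra B B) id \<Delta> (\<delta> (U i j))"
proof -
 interpret BB: ualg2 B B by unfold_locales
 interpret L: ualg2 AB B by unfold_locales
 interpret R: ualg2 A BB.AB by unfold_locales
 note ua = A.ualg_axioms B.ualg_axioms ualg_AB BB.ualg_AB L.ualg_AB R.ualg_AB
 note m1 = tensor_map_hom[OF ua(1,2,3,2) \<delta> alg_map_id(1)]
 note m2 = tensor_map_hom[OF ua(1,2,1,4) alg_map_id(1) \<Delta>]
 note as = tensor_assoc_hom[OF ua(1,2,2)]
 have "ctensor_map AB B \<delta> id (\<delta> (U i j)) = (\<Oplus>\<^bsub>L.AB\<^esub>k\<in>N4. ctensor AB B (\<Oplus>\<^bsub>AB\<^esub>l\<in>N4. U i l \<otimes>\<^sub>t W l k) (W k j))"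
  using ij U W
  by (simp only: \<delta>U) (subst alg_map_finsum[OF ua(3,5) m1(1)], force, intro L.AB.finsum_cong',
   simp_all add: m1(2) \<delta>U Pi_def)
 also have "\<dots> = (\<Oplus>\<^bsub>L.AB\<^esub>k\<in>N4. \<Oplus>\<^bsub>L.AB\<^esub>l\<in>N4. ctensor AB B (U i l \<otimes>\<^sub>t W l k) (W k j))"
  using ij U W
  by (intro L.AB.finsum_cong' additive_map_finsum[OF abelian_group_AB L.abelian_group_AB L.AB_left_additive])
   (auto intro!: L.AB.finsum_closed)
 finally have "tensor_assoc A B B (ctensor_map AB B \<delta> id (\<delta> (U i j))) =
   (\<Oplus>\<^bsub>R.AB\<^esub>k\<in>N4. tensor_assoc A B B (\<Oplus>\<^bsub>L.AB\<^esub>l\<in>N4. ctensor AB B (U i l \<otimes>\<^sub>t W l k) (W k j)))"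
  using ij U W by (simp only:) (rule alg_map_finsum[OF ua(5,6) as(1)], auto intro!: L.AB.finsum_closed)
 also have "\<dots> = (\<Oplus>\<^bsub>R.AB\<^esub>k\<in>N4. \<Oplus>\<^bsub>R.AB\<^esub>l\<in>N4. ctensor A BB.AB (U i l) (ctensor B B (W l k) (W k j)))"
  using ij U W
  by (intro R.AB.finsum_cong') (simp_all add: alg_map_finsum[OF ua(5,6) as(1)] as(2) Pi_def
   cong: R.AB.finsum_cong)
 also have "\<dots> = (\<Oplus>\<^bsub>R.AB\<^esub>l\<in>N4. \<Oplus>\<^bsub>R.AB\<^esub>k\<in>N4. ctensor A BB.AB (U i l) (ctensor B B (W l k) (W k j)))"
  using ij U W by (intro R.AB.finsum_finsum_swap) auto
 also have "\<dots> = (\<Oplus>\<^bsub>R.AB\<^esub>l\<in>N4. ctensor A BB.AB (U i l) (\<Delta> (W l j)))"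
  using ij U W
  by (intro R.AB.finsum_cong')
   (simp_all add: \<Delta>W Pi_def additive_map_finsum[OF BB.abelian_group_AB R.abelian_group_AB R.AB_right_additive])
 also have "\<dots> = ctensor_map A BB.AB id \<Delta> (\<delta> (U i j))"
  using ij U W alg_map_closed[OF \<Delta>]
  by (simp only: \<delta>U) (subst alg_map_finsum[OF ua(3,6) m2(1)], force, intro R.AB.finsum_cong',
   simp_all add: m2(2) Pi_def)
 finally show ?thesis .
qed

end

context spq
begin

abbreviation "border i j \<equiv> i \<in> {1, 4 :: nat} \<or> j \<in> {1, 4 :: nat}"
abbreviation "star \<equiv> spq_star q"
abbreviation "pr \<equiv> spq_proj q"
abbreviation "opP s \<equiv> opposite_algebra s P"

lemma antihom_hom:
 assumes s: "s = id \<or> s = cnj" and U: "frt q (opP s) (\<lambda>i j. \<theta> (i, j))"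
 shows "quot_lift (free_antihom P s \<theta>) \<in> algebra_maps P (opP s)"
  and "\<And>i j. i \<in> N4 ==> j \<in> N4 ==> quot_lift (free_antihom P s \<theta>) (T i j) = \<theta> (i, j)"
proof -
 have O: "ualg (opP s)" by (rule P.ualg_opposite[OF s])
 have cl: "\<theta> g \<in> carrier P" if "g \<in> N4 \<times> N4" for g using frtD(1)[OF U] that by auto
 have eq: "quot_lift (free_antihom P s \<theta>) V = quot_lift (free_hom (opP s) \<theta>) V" if V: "V \<in> carrier P" for V
 proof (rule quot_lift_cong)
  obtain y where y: "y \<in> carrier FT" "V = I +>\<^bsub>FT\<^esub> y" using V FT.quotient_simps(1) unfolding P_eq by auto
  fix x assume "x \<in> V"
  then have "x \<in> carrier FT" using FT.a_r_coset_subset_G[OF FT.a_subset y(1)] y(2) by auto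
  then show "free_antihom P s \<theta> x = free_hom (opP s) \<theta> x"
   using P.free_antihom_opposite[OF cl s] by (simp add: FT_def)
 qed
 note h = P_hom[OF O U]
 show "quot_lift (free_antihom P s \<theta>) \<in> algebra_maps P (opP s)"
  by (rule algebra_maps_cong[OF P.ualg_axioms h(1) eq])
 show "quot_lift (free_antihom P s \<theta>) (T i j) = \<theta> (i, j)" if "i \<in> N4" "j \<in> N4" for i j
  using h(2)[OF that] eq that by simp
qed

lemma star_hom: "star \<in> algebra_maps P (opP cnj)"
 and star_T: "\<And>i j. i \<in> N4 ==> j \<in> N4 ==> star (T i j) = S j i"
proof -
 interpret O: ualg "opP cnj" by (rule P.ualg_opposite) simp
 have "frt q (opP cnj) (\<lambda>i j. (\<lambda>(i, j). Smat q j i) (i, j))"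
  by (rule O.frt_cong[OF P.frt_antip_star[OF T_frt q0]]) (simp add: Smat_S)
 note h = antihom_hom[OF disjI2[OF refl] this, folded spq_star_def]
 show "star \<in> algebra_maps P (opP cnj)" by (rule h(1))
 show "star (T i j) = S j i" if "i \<in> N4" "j \<in> N4" for i j using h(2)[OF that] that by (simp add: Smat_S)
qed

lemma antipode_hom: "spq_antipode q \<in> algebra_maps P (opP id)"
 and antipode_T: "\<And>i j. i \<in> N4 ==> j \<in> N4 ==> spq_antipode q (T i j) = S i j"
proof -
 interpret O: ualg "opP id" by (rule P.ualg_opposite) simp
 have "frt q (opP id) (\<lambda>i j. (\<lambda>(i, j). Smat q i j) (i, j))"
  by (rule O.frt_cong[OF P.frt_antip_opposite[OF T_frt q0]]) (simp add: Smat_S)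
 note h = antihom_hom[OF disjI1[OF refl] this, folded spq_antipode_def]
 show "spq_antipode q \<in> algebra_maps P (opP id)" by (rule h(1))
 show "spq_antipode q (T i j) = S i j" if "i \<in> N4" "j \<in> N4" for i j using h(2)[OF that] that by (simp add: Smat_S)
qed

lemma star_props:
 "x \<in> carrier P ==> star x \<in> carrier P"
 "x \<in> carrier P ==> y \<in> carrier P ==> star (x \<cdot> y) = star y \<cdot> star x"
 "x \<in> carrier P ==> y \<in> carrier P ==> star (x \<^bold>+ y) = star x \<^bold>+ star y"
 "star \<^bold>1 = \<^bold>1"
 "x \<in> carrier P ==> star (c \<^bold>* x) = cnj c \<^bold>* star x"
 using algebra_mapsD[OF star_hom] by simp_all

lemma star_star: "x \<in> carrier P ==> star (star x) = x"
proof -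
 assume x: "x \<in> carrier P"
 interpret O: ualg "opP cnj" by (rule P.ualg_opposite) simp
 let ?O = "opposite_algebra cnj (opP cnj)"
 have "star (star x) = id x"
 proof (rule P_unique[OF O.ualg_opposite _ _ _ x])
  show "(\<lambda>x. star (star x)) \<in> algebra_maps P ?O"
   by (rule alg_map_compose[OF star_hom alg_map_opposite[OF star_hom]])
  show "id \<in> algebra_maps P ?O" by (intro algebra_mapsI) auto
  show "star (star (T i j)) = id (T i j)" if "i \<in> N4" "j \<in> N4" for i j
   using that Scoef_simps(2,3)[OF q0, of i j] Scoef_simps(3)[OF q0, of j i]
   by (simp add: star_T antip_def star_props P.smult_assoc)
 qed simp
 then show ?thesis by simp
qed

subsection \<open>The quotient Hopf algebra\<close>

lemma I_gens_ball: "(\<forall>x\<in>I_gens q. Q x) \<longleftrightarrow>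
  (\<forall>i\<in>N4. \<forall>j\<in>N4. border i j \<longrightarrow> Q (T i j \<ominus>\<^bsub>P\<^esub> (if i = j then \<^bold>1 else \<^bold>0)))"
proof -
 have N4: "N4 = {1, 2, 3, 4}" by (auto simp: atLeastAtMost_iff)
 have z: "T i j \<ominus>\<^bsub>P\<^esub> \<^bold>0 = T i j" if "i \<in> N4" "j \<in> N4" for i j
  using that by (simp add: P.minus_eq)
 have z': "T 1 2 \<ominus>\<^bsub>P\<^esub> \<^bold>0 = T 1 2" "T 1 3 \<ominus>\<^bsub>P\<^esub> \<^bold>0 = T 1 3" "T 1 4 \<ominus>\<^bsub>P\<^esub> \<^bold>0 = T 1 4"
  "T 2 1 \<ominus>\<^bsub>P\<^esub> \<^bold>0 = T 2 1" "T 2 4 \<ominus>\<^bsub>P\<^esub> \<^bold>0 = T 2 4" "T 3 1 \<ominus>\<^bsub>P\<^esub> \<^bold>0 = T 3 1"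
  "T 3 4 \<ominus>\<^bsub>P\<^esub> \<^bold>0 = T 3 4" "T 4 1 \<ominus>\<^bsub>P\<^esub> \<^bold>0 = T 4 1" "T 4 2 \<ominus>\<^bsub>P\<^esub> \<^bold>0 = T 4 2" "T 4 3 \<ominus>\<^bsub>P\<^esub> \<^bold>0 = T 4 3"
  by (simp_all add: z)
 show ?thesis unfolding I_gens_def N4 by (simp add: z' conj_ac)
qed

lemma I_gens_subset: "I_gens q \<subseteq> carrier P"
proof -
 have "\<forall>x\<in>I_gens q. x \<in> carrier P" unfolding I_gens_ball by auto
 then show ?thesis by blast
qed

lemma border_prime: "i \<in> N4 ==> j \<in> N4 ==> border (5 - j) (5 - i) \<longleftrightarrow> border i j"
 using N4_cases[of i] N4_cases[of j] by auto

lemma Scoef_delta: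
 assumes "ualg A" "i \<in> N4" "j \<in> N4"
 shows "Scoef q i j \<odot>\<^bsub>A\<^esub> (if 5 - j = 5 - i then \<one>\<^bsub>A\<^esub> else \<zero>\<^bsub>A\<^esub>) = (if i = j then \<one>\<^bsub>A\<^esub> else \<zero>\<^bsub>A\<^esub>)"
proof -
 interpret ualg A by fact
 show ?thesis
 proof (cases "i = j")
  case True then show ?thesis using Scoef_simps(1)[OF q0 assms(2,3)] by simp
 next
  case False
  then have "5 - j \<noteq> 5 - i" using N4_prime(2)[OF assms(2)] N4_prime(2)[OF assms(3)] by metis
  then show ?thesis using False by simp
 qed
qed

lemma kills_I_gens_iff:
 assumes A: "ualg A" and h: "h \<in> algebra_maps P A"
 shows "(\<forall>x\<in>I_gens q. h x = \<zero>\<^bsub>A\<^esub>) \<longleftrightarrow>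
  (\<forall>i\<in>N4. \<forall>j\<in>N4. border i j \<longrightarrow> h (T i j) = (if i = j then \<one>\<^bsub>A\<^esub> else \<zero>\<^bsub>A\<^esub>))"
proof -
 interpret A: ualg A by fact
 note hD = algebra_mapsD[OF h]
 have "h (T i j \<ominus>\<^bsub>P\<^esub> (if i = j then \<^bold>1 else \<^bold>0)) = \<zero>\<^bsub>A\<^esub> \<longleftrightarrow> h (T i j) = (if i = j then \<one>\<^bsub>A\<^esub> else \<zero>\<^bsub>A\<^esub>)"
  if ij: "i \<in> N4" "j \<in> N4" for i j
 proof -
  have "h (T i j \<ominus>\<^bsub>P\<^esub> (if i = j then \<^bold>1 else \<^bold>0)) = h (T i j) \<ominus>\<^bsub>A\<^esub> (if i = j then \<one>\<^bsub>A\<^esub> else \<zero>\<^bsub>A\<^esub>)"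
   using ij additive_map_diff[OF P.abelian_group_axioms A.abelian_group_axioms alg_map_additive[OF h]]
   by (simp add: hD(4) alg_map_zero[OF P.ualg_axioms A h])
  then show ?thesis using hD(1)[OF T_closed[OF ij]] by (simp add: A.r_right_minus_eq)
 qed
 then show ?thesis unfolding I_gens_ball by simp
qed

text \<open>The antiinvolution permutes the generators of the ideal up to scalars, so closing under it adds nothing.\<close>

lemma Iq_eq: "Iq q = Idl\<^bsub>P\<^esub> (I_gens q)"
proof -
 let ?J = "Idl\<^bsub>P\<^esub> (I_gens q)"
 interpret J: alg_ideal P ?J
  unfolding alg_ideal_def using P.genideal_ideal[OF I_gens_subset] P.ualg_axioms by simp
 let ?O = "opposite_algebra cnj J.Q"
 interpret O: ualg ?O by (rule ualg.ualg_opposite[OF J.ualg_quotient]) simp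
 define h where "h x = ?J +>\<^bsub>P\<^esub> star x" for x
 have h: "h \<in> algebra_maps P ?O"
  unfolding h_def by (rule alg_map_compose[OF star_hom alg_map_opposite[OF J.quotient_proj]])
 have proj0: "\<forall>i\<in>N4. \<forall>j\<in>N4. border i j \<longrightarrow> ?J +>\<^bsub>P\<^esub> T i j = (if i = j then \<one>\<^bsub>J.Q\<^esub> else \<zero>\<^bsub>J.Q\<^esub>)"
 proof (rule iffD1[OF kills_I_gens_iff[OF J.ualg_quotient J.quotient_proj]], intro ballI)
  fix x assume x: "x \<in> I_gens q"
  have "x \<in> carrier P" "x \<in> ?J" using x P.genideal_self[OF I_gens_subset] I_gens_subset by auto
  then show "?J +>\<^bsub>P\<^esub> x = \<zero>\<^bsub>J.Q\<^esub>" using J.quotient_zero_iff by simp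
 qed
 have "h (T i j) = (if i = j then \<one>\<^bsub>?O\<^esub> else \<zero>\<^bsub>?O\<^esub>)" if ij: "i \<in> N4" "j \<in> N4" "border i j" for i j
 proof -
  have "border (5 - i) (5 - j)" using border_prime[OF ij(2,1)] ij(3) by auto
  from proj0[rule_format, OF N4_prime(1)[OF ij(1)] N4_prime(1)[OF ij(2)] this]
  have "?J +>\<^bsub>P\<^esub> T (5 - i) (5 - j) = (if 5 - i = 5 - j then \<one>\<^bsub>J.Q\<^esub> else \<zero>\<^bsub>J.Q\<^esub>)" .
  moreover have "?J +>\<^bsub>P\<^esub> S j i = Scoef q j i \<odot>\<^bsub>J.Q\<^esub> (?J +>\<^bsub>P\<^esub> T (5 - i) (5 - j))"
   using ij by (simp add: antip_def J.quotient_simps)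
  ultimately show ?thesis
   using Scoef_delta[OF J.ualg_quotient ij(2,1)] ij by (auto simp: h_def star_T)
 qed
 then have k: "\<forall>x\<in>I_gens q. h x = \<zero>\<^bsub>?O\<^esub>" using kills_I_gens_iff[OF O.ualg_axioms h] by blast
 have "star x \<in> ?J" if x: "x \<in> ?J" for x
 proof -
  have "h x = \<zero>\<^bsub>?O\<^esub>"
   using P.alg_map_kills_genideal[OF O.ualg_axioms h I_gens_subset _ x] k by blast
  then show ?thesis using J.quotient_zero_iff[of "star x"] J.Icarr[OF x] by (simp add: h_def star_props)
 qed
 then have "?J \<in> {J. ideal J P \<and> star ` J \<subseteq> J \<and> I_gens q \<subseteq> J}"
  using J.ideal_axioms P.genideal_self[OF I_gens_subset] by auto
 then show ?thesis unfolding Iq_def star_ideal_def genideal_def by blast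
qed

end

sublocale spq \<subseteq> HI: alg_ideal "ASp2 q" "Iq q"
 unfolding alg_ideal_def Iq_eq using P.genideal_ideal[OF I_gens_subset] P.ualg_axioms by simp

sublocale spq \<subseteq> H: ualg "ASp1 q" unfolding ASp1_def by (rule HI.ualg_quotient)

sublocale spq \<subseteq> PP: ualg2 "ASp2 q" "ASp2 q" ..
sublocale spq \<subseteq> PH: ualg2 "ASp2 q" "ASp1 q" ..
sublocale spq \<subseteq> HH: ualg2 "ASp1 q" "ASp1 q" ..

context spq
begin

lemma H_eq: "HI.Q = H" by (simp add: ASp1_def)

lemma pr_coset: "pr x = Iq q +>\<^bsub>P\<^esub> x" by (simp add: spq_proj_def)

lemma pr_hom: "pr \<in> algebra_maps P H"
 using HI.quotient_proj unfolding H_eq by (simp add: pr_coset[abs_def])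

lemma T1_pr: "T1 i j = pr (T i j)" by (simp add: Tmat1_def)

lemma T1_frt: "frt q H T1"
 using frt_map[OF P.ualg_axioms H.ualg_axioms pr_hom T_frt] by (simp add: T1_pr[abs_def])

lemma T1_closed [simp, intro]: "i \<in> N4 ==> j \<in> N4 ==> T1 i j \<in> carrier H" by (rule frtD(1)[OF T1_frt])

lemma pr_zero_iff: "x \<in> carrier P ==> pr x = \<zero>\<^bsub>H\<^esub> \<longleftrightarrow> x \<in> Iq q"
 using HI.quotient_zero_iff[of x] unfolding H_eq pr_coset .

lemma T1_border:
 assumes "i \<in> N4" "j \<in> N4" "border i j" shows "T1 i j = (if i = j then \<one>\<^bsub>H\<^esub> else \<zero>\<^bsub>H\<^esub>)"
proof -
 have "\<forall>x\<in>I_gens q. pr x = \<zero>\<^bsub>H\<^esub>"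
  using pr_zero_iff P.genideal_self[OF I_gens_subset] I_gens_subset unfolding Iq_eq by blast
 then show ?thesis using kills_I_gens_iff[OF H.ualg_axioms pr_hom] assms unfolding T1_pr by blast
qed

lemma H_surj: "V \<in> carrier H ==> \<exists>x\<in>carrier P. V = pr x"
 using HI.quotient_simps(1) unfolding H_eq by (auto simp: pr_coset)

lemma H_hom:
 assumes A: "ualg A" and h: "h \<in> algebra_maps P A"
  and b: "\<And>i j. [|i \<in> N4; j \<in> N4; border i j|] ==> h (T i j) = (if i = j then \<one>\<^bsub>A\<^esub> else \<zero>\<^bsub>A\<^esub>)"
 shows "quot_lift h \<in> algebra_maps H A" and "\<And>x. x \<in> carrier P ==> quot_lift h (pr x) = h x"
proof -
 have k: "\<forall>x\<in>I_gens q. h x = \<zero>\<^bsub>A\<^esub>" using kills_I_gens_iff[OF A h] b by blast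
 have "h x = \<zero>\<^bsub>A\<^esub>" if "x \<in> Iq q" for x
  by (rule P.alg_map_kills_genideal[OF A h I_gens_subset]) (use k that Iq_eq in auto)
 note l = HI.quot_lift_hom[OF A h this, unfolded H_eq]
 show "quot_lift h \<in> algebra_maps H A" by (rule l(1))
 show "quot_lift h (pr x) = h x" if "x \<in> carrier P" for x using l(2)[OF _ that] unfolding pr_coset .
qed

lemma H_unique:
 assumes A: "ualg A" and f: "f \<in> algebra_maps H A" and g: "g \<in> algebra_maps H A"
  and gen: "\<And>i j. i \<in> N4 ==> j \<in> N4 ==> f (T1 i j) = g (T1 i j)" and x: "x \<in> carrier H"
 shows "f x = g x"
proof -
 obtain y where y: "y \<in> carrier P" "x = pr y" using H_surj[OF x] by blast
 show ?thesis unfolding y(2)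
  by (rule P_unique[OF A alg_map_compose[OF pr_hom f] alg_map_compose[OF pr_hom g] _ y(1)])
   (use gen in \<open>auto simp: T1_pr\<close>)
qed

lemma H_induct [consumes 1, case_names one gen add smult]:
 assumes x: "x \<in> carrier H"
  and one: "\<Phi> \<one>\<^bsub>H\<^esub>"
  and gen: "\<And>i j x. [|i \<in> N4; j \<in> N4; x \<in> carrier H; \<Phi> x|] ==> \<Phi> (T1 i j \<otimes>\<^bsub>H\<^esub> x)"
  and add: "\<And>x y. [|x \<in> carrier H; y \<in> carrier H; \<Phi> x; \<Phi> y|] ==> \<Phi> (x \<oplus>\<^bsub>H\<^esub> y)"
  and smult: "\<And>c x. [|x \<in> carrier H; \<Phi> x|] ==> \<Phi> (c \<odot>\<^bsub>H\<^esub> x)"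
 shows "\<Phi> x"
proof -
 note pD = algebra_mapsD[OF pr_hom]
 obtain y where y: "y \<in> carrier P" "x = pr y" using H_surj[OF x] by blast
 from y(1) have "\<Phi> (pr y)"
  by (induction y rule: P_induct) (simp_all add: pD one gen add smult flip: T1_pr)
 then show ?thesis by (simp add: y(2))
qed

subsection \<open>Comultiplication, counit, coaction\<close>

abbreviation "\<Delta>P \<equiv> spq_comult q"
abbreviation "\<Delta>H \<equiv> comult1 q"
abbreviation "\<epsilon>H \<equiv> counit1 q"
abbreviation "SH \<equiv> antipode1 q"
abbreviation "co \<equiv> coaction q"

lemma comult_hom: "\<Delta>P \<in> algebra_maps P PP.AB"
 and comult_T: "\<And>i j. i \<in> N4 ==> j \<in> N4 ==> \<Delta>P (T i j) = (\<Oplus>\<^bsub>PP.AB\<^esub>k\<in>N4. ctensor P P (T i k) (T k j))"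
 using P_hom[OF PP.ualg_AB, of "\<lambda>(i, j). \<Oplus>\<^bsub>PP.AB\<^esub>k\<in>{1..4}. ctensor P P (T i k) (T k j)"]
  PP.frt_tensor[OF T_frt T_frt q0] by (simp_all add: spq_comult_def)

lemma coaction_hom: "co \<in> algebra_maps P PH.AB"
 and coaction_T: "\<And>i j. i \<in> N4 ==> j \<in> N4 ==> co (T i j) = (\<Oplus>\<^bsub>PH.AB\<^esub>k\<in>N4. ctensor P H (T i k) (T1 k j))"
 using P_hom[OF PH.ualg_AB, of "\<lambda>(i, j). \<Oplus>\<^bsub>PH.AB\<^esub>k\<in>{1..4}. ctensor P H (T i k) (T1 k j)"]
  PH.frt_tensor[OF T_frt T1_frt q0] by (simp_all add: coaction_def)

lemma counit_hom: "spq_counit q \<in> algebra_maps P complex_algebra"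
 and counit_T: "\<And>i j. i \<in> N4 ==> j \<in> N4 ==> spq_counit q (T i j) = (if i = j then 1 else 0)"
proof -
 have "frt q complex_algebra (\<lambda>i j. (\<lambda>(i, j). if i = j then 1 else 0) (i, j))"
  using ualg.frt_one[OF ualg_complex q0] unfolding complex_algebra_simps by simp
 note h = P_hom[OF ualg_complex, where \<theta> = "\<lambda>(i, j). if i = j then 1 else 0", OF this]
 show "spq_counit q \<in> algebra_maps P complex_algebra" unfolding spq_counit_def by (rule h(1))
 show "spq_counit q (T i j) = (if i = j then 1 else 0)" if "i \<in> N4" "j \<in> N4" for i j
  using h(2)[OF that] by (simp add: spq_counit_def)
qed

lemma comult1_hom: "\<Delta>H \<in> algebra_maps H HH.AB"
 and comult1_T: "\<And>i j. i \<in> N4 ==> j \<in> N4 ==> \<Delta>H (T1 i j) = (\<Oplus>\<^bsub>HH.AB\<^esub>k\<in>N4. ctensor H H (T1 i k) (T1 k j))"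
proof -
 let ?h = "\<lambda>x. ctensor_map H H pr pr (\<Delta>P x)"
 note m = tensor_map_hom[OF P.ualg_axioms P.ualg_axioms H.ualg_axioms H.ualg_axioms pr_hom pr_hom]
 have h: "?h \<in> algebra_maps P HH.AB" by (rule alg_map_compose[OF comult_hom m(1)])
 have T: "?h (T i j) = (\<Oplus>\<^bsub>HH.AB\<^esub>k\<in>N4. ctensor H H (T1 i k) (T1 k j))" if "i \<in> N4" "j \<in> N4" for i j
  using that
  by (simp add: comult_T alg_map_finsum[OF PP.ualg_AB HH.ualg_AB m(1)] Pi_def)
   (intro HH.AB.finsum_cong', simp_all add: m(2) T1_pr algebra_mapsD(1)[OF pr_hom])
 have b: "?h (T i j) = (if i = j then \<one>\<^bsub>HH.AB\<^esub> else \<zero>\<^bsub>HH.AB\<^esub>)" if ij: "i \<in> N4" "j \<in> N4" "border i j" for i j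
 proof (cases "i \<in> {1, 4}")
  case True
  then have r: "T1 i k = (if i = k then \<one>\<^bsub>H\<^esub> else \<zero>\<^bsub>H\<^esub>)" if "k \<in> N4" for k
   using T1_border[OF ij(1) that] by simp
  have "?h (T i j) = ctensor H H (T1 i i) (T1 i j)"
   unfolding T[OF ij(1,2)] using ij(1,2) r by (subst HH.AB.finsum_single_term[of N4 i]) auto
  then show ?thesis using r ij by (simp add: HH.AB_one)
 next
  case False
  then have r: "T1 k j = (if k = j then \<one>\<^bsub>H\<^esub> else \<zero>\<^bsub>H\<^esub>)" if "k \<in> N4" for k
   using T1_border[OF that ij(2)] ij(3) by simp
  have "?h (T i j) = ctensor H H (T1 i j) (T1 j j)"
   unfolding T[OF ij(1,2)] using ij(1,2) r by (subst HH.AB.finsum_single_term[of N4 j]) auto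
  then show ?thesis using r ij by (simp add: HH.AB_one)
 qed
 note l = H_hom[OF HH.ualg_AB h b, folded comult1_def]
 show "\<Delta>H \<in> algebra_maps H HH.AB" by (rule l(1))
 show "\<Delta>H (T1 i j) = (\<Oplus>\<^bsub>HH.AB\<^esub>k\<in>N4. ctensor H H (T1 i k) (T1 k j))" if "i \<in> N4" "j \<in> N4" for i j
  using l(2)[OF _ _ _ T_closed[OF that]] T[OF that] that unfolding T1_pr by simp
qed

lemma counit1_hom: "\<epsilon>H \<in> algebra_maps H complex_algebra"
 and counit1_T: "\<And>i j. i \<in> N4 ==> j \<in> N4 ==> \<epsilon>H (T1 i j) = (if i = j then 1 else 0)"
 using H_hom[OF ualg_complex counit_hom, folded counit1_def] by (simp_all add: counit_T T1_pr)

lemma antipode1_hom: "SH \<in> algebra_maps H (opposite_algebra id H)"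
 and antipode1_T: "\<And>i j. i \<in> N4 ==> j \<in> N4 ==> SH (T1 i j) = antip q H T1 i j"
proof -
 let ?O = "opposite_algebra id H"
 have O: "ualg ?O" by (rule H.ualg_opposite) simp
 have h: "(\<lambda>x. pr (spq_antipode q x)) \<in> algebra_maps P ?O"
  by (rule alg_map_compose[OF antipode_hom alg_map_opposite[OF pr_hom]])
 have T: "pr (spq_antipode q (T i j)) = antip q H T1 i j" if "i \<in> N4" "j \<in> N4" for i j
  using that by (simp add: antipode_T antip_def alg_map_smult[OF pr_hom] T1_pr)
 have b: "pr (spq_antipode q (T i j)) = (if i = j then \<one>\<^bsub>?O\<^esub> else \<zero>\<^bsub>?O\<^esub>)"
  if ij: "i \<in> N4" "j \<in> N4" "border i j" for i j
  using T1_border[of "5 - j" "5 - i"] border_prime[OF ij(1,2)] ij Scoef_delta[OF H.ualg_axioms ij(1,2)]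
  by (simp only: T[OF ij(1,2)] antip_def N4_prime(1) opposite_algebra_simps)
 note l = H_hom[OF O h b, folded antipode1_def]
 show "SH \<in> algebra_maps H ?O" by (rule l(1))
 show "SH (T1 i j) = antip q H T1 i j" if "i \<in> N4" "j \<in> N4" for i j
  using l(2)[OF _ _ _ T_closed[OF that]] T[OF that] that unfolding T1_pr by simp
qed

end

lemma (in ualg) unit_hom: "(\<lambda>c. c \<odot> \<one>) \<in> algebra_maps complex_algebra A"
 by (intro algebra_mapsI) (simp_all add: smult_l_distr smult_mult_left smult_assoc)

context ualg2
begin

lemma counit_right_hom:
 assumes "\<epsilon> \<in> algebra_maps B complex_algebra"
 shows "tensor_lift A (\<lambda>a b. \<epsilon> b \<odot>\<^bsub>A\<^esub> a) \<in> algebra_maps AB A"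
  and "\<And>a b. [|a \<in> carrier A; b \<in> carrier B|] ==> tensor_lift A (\<lambda>a b. \<epsilon> b \<odot>\<^bsub>A\<^esub> a) (a \<otimes>\<^sub>t b) = \<epsilon> b \<odot>\<^bsub>A\<^esub> a"
 by (rule AB_lift_hom[OF A.ualg_axioms alg_map_id(2) alg_map_compose[OF assms A.unit_hom]];
   simp add: A.smult_mult_left A.smult_mult_right)+

lemma counit_left_hom:
 assumes "\<epsilon> \<in> algebra_maps A complex_algebra"
 shows "tensor_lift B (\<lambda>a b. \<epsilon> a \<odot>\<^bsub>B\<^esub> b) \<in> algebra_maps AB B"
  and "\<And>a b. [|a \<in> carrier A; b \<in> carrier B|] ==> tensor_lift B (\<lambda>a b. \<epsilon> a \<odot>\<^bsub>B\<^esub> b) (a \<otimes>\<^sub>t b) = \<epsilon> a \<odot>\<^bsub>B\<^esub> b"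
 by (rule AB_lift_hom[OF B.ualg_axioms alg_map_compose[OF assms B.unit_hom] alg_map_id(2)];
   simp add: B.smult_mult_left B.smult_mult_right)+

end

context spq
begin

lemma SH_props:
 "x \<in> carrier H ==> SH x \<in> carrier H"
 "x \<in> carrier H ==> y \<in> carrier H ==> SH (x \<otimes>\<^bsub>H\<^esub> y) = SH y \<otimes>\<^bsub>H\<^esub> SH x"
 "x \<in> carrier H ==> y \<in> carrier H ==> SH (x \<oplus>\<^bsub>H\<^esub> y) = SH x \<oplus>\<^bsub>H\<^esub> SH y"
 "SH \<one>\<^bsub>H\<^esub> = \<one>\<^bsub>H\<^esub>"
 "x \<in> carrier H ==> SH (c \<odot>\<^bsub>H\<^esub> x) = c \<odot>\<^bsub>H\<^esub> SH x"
 using algebra_mapsD[OF antipode1_hom] by simp_all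

lemma H_coassoc:
 assumes "h \<in> carrier H"
 shows "tensor_assoc H H H (ctensor_map HH.AB H \<Delta>H id (\<Delta>H h)) = ctensor_map H HH.AB id \<Delta>H (\<Delta>H h)"
proof -
 note ua = H.ualg_axioms HH.ualg_AB
 interpret R: ualg2 H HH.AB by unfold_locales
 interpret L: ualg2 HH.AB H by unfold_locales
 show ?thesis
 proof (rule H_unique[OF R.ualg_AB _ _ _ assms])
  show "(\<lambda>h. tensor_assoc H H H (ctensor_map HH.AB H \<Delta>H id (\<Delta>H h))) \<in> algebra_maps H R.AB"
   by (rule alg_map_compose[OF alg_map_compose[OF comult1_hom tensor_map_hom(1)[OF ua(1,1,2,1) comult1_hom alg_map_id(1)]]
      tensor_assoc_hom(1)[OF ua(1,1,1)]])
  show "(\<lambda>h. ctensor_map H HH.AB id \<Delta>H (\<Delta>H h)) \<in> algebra_maps H R.AB"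
   by (rule alg_map_compose[OF comult1_hom tensor_map_hom(1)[OF ua(1,1,1,2) alg_map_id(1) comult1_hom]])
 qed (rule HH.matrix_coassoc[OF comult1_hom comult1_hom T1_closed T1_closed comult1_T comult1_T])
qed

lemma P_coassoc:
 assumes "p \<in> carrier P"
 shows "tensor_assoc P H H (ctensor_map PH.AB H co id (co p)) = ctensor_map P HH.AB id \<Delta>H (co p)"
proof -
 note ua = P.ualg_axioms H.ualg_axioms PH.ualg_AB HH.ualg_AB
 interpret R: ualg2 P HH.AB by unfold_locales
 interpret L: ualg2 PH.AB H by unfold_locales
 show ?thesis
 proof (rule P_unique[OF R.ualg_AB _ _ _ assms])
  show "(\<lambda>h. tensor_assoc P H H (ctensor_map PH.AB H co id (co h))) \<in> algebra_maps P R.AB"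
   by (rule alg_map_compose[OF alg_map_compose[OF coaction_hom tensor_map_hom(1)[OF ua(1,2,3,2) coaction_hom alg_map_id(1)]]
      tensor_assoc_hom(1)[OF ua(1,2,2)]])
  show "(\<lambda>h. ctensor_map P HH.AB id \<Delta>H (co h)) \<in> algebra_maps P R.AB"
   by (rule alg_map_compose[OF coaction_hom tensor_map_hom(1)[OF ua(1,2,1,4) alg_map_id(1) comult1_hom]])
 qed (rule PH.matrix_coassoc[OF coaction_hom comult1_hom T_closed T1_closed coaction_T comult1_T])
qed

lemma H_counit_left:
 assumes "h \<in> carrier H" shows "tensor_lift H (\<lambda>a b. \<epsilon>H a \<odot>\<^bsub>H\<^esub> b) (\<Delta>H h) = h"
proof -
 note c = HH.counit_left_hom[OF counit1_hom]
 have "tensor_lift H (\<lambda>a b. \<epsilon>H a \<odot>\<^bsub>H\<^esub> b) (\<Delta>H h) = id h"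
 proof (rule H_unique[OF H.ualg_axioms alg_map_compose[OF comult1_hom c(1)] alg_map_id(1) _ assms])
  fix i j :: nat assume ij: "i \<in> N4" "j \<in> N4"
  have "tensor_lift H (\<lambda>a b. \<epsilon>H a \<odot>\<^bsub>H\<^esub> b) (\<Delta>H (T1 i j)) = (\<Oplus>\<^bsub>H\<^esub>k\<in>N4. \<epsilon>H (T1 i k) \<odot>\<^bsub>H\<^esub> T1 k j)"
   using ij by (simp add: comult1_T alg_map_finsum[OF HH.ualg_AB H.ualg_axioms c(1)] Pi_def)
    (intro H.finsum_cong', simp_all add: c(2))
  also have "\<dots> = T1 i j"
   using ij by (subst H.finsum_single_term[of N4 i]) (simp_all add: counit1_T)
  finally show "tensor_lift H (\<lambda>a b. \<epsilon>H a \<odot>\<^bsub>H\<^esub> b) (\<Delta>H (T1 i j)) = id (T1 i j)" by simp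
 qed
 then show ?thesis by simp
qed

lemma H_counit_right:
 assumes "h \<in> carrier H" shows "tensor_lift H (\<lambda>a b. \<epsilon>H b \<odot>\<^bsub>H\<^esub> a) (\<Delta>H h) = h"
proof -
 note c = HH.counit_right_hom[OF counit1_hom]
 have "tensor_lift H (\<lambda>a b. \<epsilon>H b \<odot>\<^bsub>H\<^esub> a) (\<Delta>H h) = id h"
 proof (rule H_unique[OF H.ualg_axioms alg_map_compose[OF comult1_hom c(1)] alg_map_id(1) _ assms])
  fix i j :: nat assume ij: "i \<in> N4" "j \<in> N4"
  have "tensor_lift H (\<lambda>a b. \<epsilon>H b \<odot>\<^bsub>H\<^esub> a) (\<Delta>H (T1 i j)) = (\<Oplus>\<^bsub>H\<^esub>k\<in>N4. \<epsilon>H (T1 k j) \<odot>\<^bsub>H\<^esub> T1 i k)"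
   using ij by (simp add: comult1_T alg_map_finsum[OF HH.ualg_AB H.ualg_axioms c(1)] Pi_def)
    (intro H.finsum_cong', simp_all add: c(2))
  also have "\<dots> = T1 i j"
   using ij by (subst H.finsum_single_term[of N4 j]) (simp_all add: counit1_T)
  finally show "tensor_lift H (\<lambda>a b. \<epsilon>H b \<odot>\<^bsub>H\<^esub> a) (\<Delta>H (T1 i j)) = id (T1 i j)" by simp
 qed
 then show ?thesis by simp
qed

lemma P_counit:
 assumes "p \<in> carrier P" shows "tensor_lift P (\<lambda>a b. \<epsilon>H b \<^bold>* a) (co p) = p"
proof -
 note c = PH.counit_right_hom[OF counit1_hom]
 have "tensor_lift P (\<lambda>a b. \<epsilon>H b \<^bold>* a) (co p) = id p"
 proof (rule P_unique[OF P.ualg_axioms alg_map_compose[OF coaction_hom c(1)] alg_map_id(1) _ assms])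
  fix i j :: nat assume ij: "i \<in> N4" "j \<in> N4"
  have "tensor_lift P (\<lambda>a b. \<epsilon>H b \<^bold>* a) (co (T i j)) = (\<Oplus>\<^bsub>P\<^esub>k\<in>N4. \<epsilon>H (T1 k j) \<^bold>* T i k)"
   using ij by (simp add: coaction_T alg_map_finsum[OF PH.ualg_AB P.ualg_axioms c(1)] Pi_def)
    (intro P.finsum_cong', simp_all add: c(2))
  also have "\<dots> = T i j"
   using ij by (subst P.finsum_single_term[of N4 j]) (simp_all add: counit1_T)
  finally show "tensor_lift P (\<lambda>a b. \<epsilon>H b \<^bold>* a) (co (T i j)) = id (T i j)" by simp
 qed
 then show ?thesis by simp
qed

text \<open>The antipode axioms are not identities between algebra maps; they hold on products
 because they hold on the factors.\<close>

lemma H_antipode_left: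
 assumes "h \<in> carrier H" shows "tensor_lift H (\<lambda>a b. SH a \<otimes>\<^bsub>H\<^esub> b) (\<Delta>H h) = \<epsilon>H h \<odot>\<^bsub>H\<^esub> \<one>\<^bsub>H\<^esub>"
proof -
 define F where "F = tensor_lift H (\<lambda>a b. SH a \<otimes>\<^bsub>H\<^esub> b)"
 have bil: "bilinear_balanced complex_algebra H H H (\<lambda>a b. SH a \<otimes>\<^bsub>H\<^esub> b)"
  by (intro bilinear_balancedI)
   (simp_all add: SH_props H.l_distr H.r_distr H.smult_mult_left H.smult_mult_right)
 have F_tens: "F (ctensor H H a b) = SH a \<otimes>\<^bsub>H\<^esub> b" if "a \<in> carrier H" "b \<in> carrier H" for a b
  unfolding F_def by (rule HH.AB_lift_tensor[OF H.abelian_group_axioms bil that])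
 have F_add: "F \<in> additive_maps HH.AB H"
  unfolding F_def by (rule HH.AB_lift_additive[OF H.abelian_group_axioms bil])
 note comp = additive_map_compose
 note eqI = HH.AB_maps_eqI[OF H.abelian_group_axioms]
 note cl = additive_map_closed[OF F_add]
 have F_mult: "F (U \<otimes>\<^bsub>HH.AB\<^esub> V) = e \<odot>\<^bsub>H\<^esub> F V"
  if U: "U \<in> carrier HH.AB" and V: "V \<in> carrier HH.AB" and e: "F U = e \<odot>\<^bsub>H\<^esub> \<one>\<^bsub>H\<^esub>" for U V e
 proof (rule eqI[OF comp[OF HH.AB_mult_additive_right[OF U] F_add] comp[OF F_add H.smult_additive] _ V])
  fix a b assume ab: "a \<in> carrier H" "b \<in> carrier H"
  have "F (U \<otimes>\<^bsub>HH.AB\<^esub> ctensor H H a b) = SH a \<otimes>\<^bsub>H\<^esub> F U \<otimes>\<^bsub>H\<^esub> b"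
   by (rule eqI[OF comp[OF HH.AB_mult_additive_left[OF HH.AB_closed[OF ab]] F_add]
      comp[OF comp[OF F_add H.mult_left_additive[OF SH_props(1)[OF ab(1)]]] H.mult_right_additive[OF ab(2)]] _ U])
    (use ab in \<open>simp add: F_tens SH_props H.m_assoc\<close>)
  then show "F (U \<otimes>\<^bsub>HH.AB\<^esub> ctensor H H a b) = e \<odot>\<^bsub>H\<^esub> F (ctensor H H a b)"
   using ab by (simp add: e F_tens SH_props H.smult_mult_left H.smult_mult_right)
 qed
 have F_smult: "F (c \<odot>\<^bsub>HH.AB\<^esub> U) = c \<odot>\<^bsub>H\<^esub> F U" if "U \<in> carrier HH.AB" for c U
  by (rule eqI[OF comp[OF HH.AB_smult_additive F_add] comp[OF F_add H.smult_additive] _ that])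
   (simp add: F_tens SH_props H.smult_mult_left)
 have gen: "F (\<Delta>H (T1 i j)) = \<epsilon>H (T1 i j) \<odot>\<^bsub>H\<^esub> \<one>\<^bsub>H\<^esub>" if ij: "i \<in> N4" "j \<in> N4" for i j
 proof -
  have "F (\<Delta>H (T1 i j)) = (\<Oplus>\<^bsub>H\<^esub>k\<in>N4. antip q H T1 i k \<otimes>\<^bsub>H\<^esub> T1 k j)"
   using ij by (simp add: comult1_T additive_map_finsum[OF HH.abelian_group_AB H.abelian_group_axioms F_add] Pi_def)
    (intro H.finsum_cong', simp_all add: F_tens antipode1_T H.antip_closed[OF T1_frt q0])
  then show ?thesis using frtD(4)[OF T1_frt ij] ij by (simp add: counit1_T)
 qed
 note \<Delta>D = algebra_mapsD[OF comult1_hom] and \<epsilon>D = algebra_mapsD[OF counit1_hom, unfolded complex_algebra_simps]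
 have "F (\<Delta>H h) = \<epsilon>H h \<odot>\<^bsub>H\<^esub> \<one>\<^bsub>H\<^esub>" using assms
 proof (induction h rule: H_induct)
  case one then show ?case by (simp add: \<Delta>D \<epsilon>D HH.AB_one F_tens SH_props)
 next
  case (gen i j x)
  then show ?case
   using F_mult[OF \<Delta>D(1) \<Delta>D(1) \<open>\<And>i j. [|i \<in> N4; j \<in> N4|] ==> F (\<Delta>H (T1 i j)) = \<epsilon>H (T1 i j) \<odot>\<^bsub>H\<^esub> \<one>\<^bsub>H\<^esub>\<close>, of i j x]
   by (simp add: \<Delta>D \<epsilon>D H.smult_assoc)
 next
  case (add x y) then show ?case by (simp add: \<Delta>D \<epsilon>D additive_map_add[OF F_add] H.smult_l_distr)
 next
  case (smult c x) then show ?case by (simp add: \<Delta>D \<epsilon>D F_smult H.smult_assoc)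
 qed
 then show ?thesis by (simp add: F_def)
qed

lemma H_antipode_right:
 assumes "h \<in> carrier H" shows "tensor_lift H (\<lambda>a b. a \<otimes>\<^bsub>H\<^esub> SH b) (\<Delta>H h) = \<epsilon>H h \<odot>\<^bsub>H\<^esub> \<one>\<^bsub>H\<^esub>"
proof -
 define F where "F = tensor_lift H (\<lambda>a b. a \<otimes>\<^bsub>H\<^esub> SH b)"
 have bil: "bilinear_balanced complex_algebra H H H (\<lambda>a b. a \<otimes>\<^bsub>H\<^esub> SH b)"
  by (intro bilinear_balancedI)
   (simp_all add: SH_props H.l_distr H.r_distr H.smult_mult_left H.smult_mult_right)
 have F_tens: "F (ctensor H H a b) = a \<otimes>\<^bsub>H\<^esub> SH b" if "a \<in> carrier H" "b \<in> carrier H" for a b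
  unfolding F_def by (rule HH.AB_lift_tensor[OF H.abelian_group_axioms bil that])
 have F_add: "F \<in> additive_maps HH.AB H"
  unfolding F_def by (rule HH.AB_lift_additive[OF H.abelian_group_axioms bil])
 note comp = additive_map_compose
 note eqI = HH.AB_maps_eqI[OF H.abelian_group_axioms]
 note cl = additive_map_closed[OF F_add]
 have F_mult: "F (U \<otimes>\<^bsub>HH.AB\<^esub> V) = e \<odot>\<^bsub>H\<^esub> F U"
  if U: "U \<in> carrier HH.AB" and V: "V \<in> carrier HH.AB" and e: "F V = e \<odot>\<^bsub>H\<^esub> \<one>\<^bsub>H\<^esub>" for U V e
 proof (rule eqI[OF comp[OF HH.AB_mult_additive_left[OF V] F_add] comp[OF F_add H.smult_additive] _ U])
  fix a b assume ab: "a \<in> carrier H" "b \<in> carrier H"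
  have "F (ctensor H H a b \<otimes>\<^bsub>HH.AB\<^esub> V) = a \<otimes>\<^bsub>H\<^esub> F V \<otimes>\<^bsub>H\<^esub> SH b"
   by (rule eqI[OF comp[OF HH.AB_mult_additive_right[OF HH.AB_closed[OF ab]] F_add]
      comp[OF comp[OF F_add H.mult_left_additive[OF ab(1)]] H.mult_right_additive[OF SH_props(1)[OF ab(2)]]] _ V])
    (use ab in \<open>simp add: F_tens SH_props H.m_assoc\<close>)
  then show "F (ctensor H H a b \<otimes>\<^bsub>HH.AB\<^esub> V) = e \<odot>\<^bsub>H\<^esub> F (ctensor H H a b)"
   using ab by (simp add: e F_tens SH_props H.smult_mult_left H.smult_mult_right)
 qed
 have F_smult: "F (c \<odot>\<^bsub>HH.AB\<^esub> U) = c \<odot>\<^bsub>H\<^esub> F U" if "U \<in> carrier HH.AB" for c U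
  by (rule eqI[OF comp[OF HH.AB_smult_additive F_add] comp[OF F_add H.smult_additive] _ that])
   (simp add: F_tens SH_props H.smult_mult_left)
 have gen: "F (\<Delta>H (T1 i j)) = \<epsilon>H (T1 i j) \<odot>\<^bsub>H\<^esub> \<one>\<^bsub>H\<^esub>" if ij: "i \<in> N4" "j \<in> N4" for i j
 proof -
  have "F (\<Delta>H (T1 i j)) = (\<Oplus>\<^bsub>H\<^esub>k\<in>N4. T1 i k \<otimes>\<^bsub>H\<^esub> antip q H T1 k j)"
   using ij by (simp add: comult1_T additive_map_finsum[OF HH.abelian_group_AB H.abelian_group_axioms F_add] Pi_def)
    (intro H.finsum_cong', simp_all add: F_tens antipode1_T H.antip_closed[OF T1_frt q0])
  then show ?thesis using frtD(3)[OF T1_frt ij] ij by (simp add: counit1_T)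
 qed
 note \<Delta>D = algebra_mapsD[OF comult1_hom] and \<epsilon>D = algebra_mapsD[OF counit1_hom, unfolded complex_algebra_simps]
 have "F (\<Delta>H h) = \<epsilon>H h \<odot>\<^bsub>H\<^esub> \<one>\<^bsub>H\<^esub>" using assms
 proof (induction h rule: H_induct)
  case one then show ?case by (simp add: \<Delta>D \<epsilon>D HH.AB_one F_tens SH_props)
 next
  case (gen i j x)
  then show ?case
   using F_mult[OF \<Delta>D(1) \<Delta>D(1) gen(4), of "T1 i j"]
    \<open>\<And>i j. [|i \<in> N4; j \<in> N4|] ==> F (\<Delta>H (T1 i j)) = \<epsilon>H (T1 i j) \<odot>\<^bsub>H\<^esub> \<one>\<^bsub>H\<^esub>\<close>[of i j]
   by (simp add: \<Delta>D \<epsilon>D H.smult_assoc mult.commute)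
 next
  case (add x y) then show ?case by (simp add: \<Delta>D \<epsilon>D additive_map_add[OF F_add] H.smult_l_distr)
 next
  case (smult c x) then show ?case by (simp add: \<Delta>D \<epsilon>D F_smult H.smult_assoc)
 qed
 then show ?thesis by (simp add: F_def)
qed

lemma hopf_algebra_H: "hopf_algebra H \<Delta>H \<epsilon>H SH"
proof -
 have "SH \<in> linear_maps H H UNIV"
  by (intro linear_mapsI additive_mapsI) (simp_all add: SH_props)
 then show ?thesis
  unfolding hopf_algebra_def
  using H.unital_algebra comult1_hom counit1_hom
  by (simp add: H_coassoc H_counit_left H_counit_right H_antipode_left H_antipode_right)
qed

lemma comodule_algebra_P: "comodule_algebra P H \<Delta>H \<epsilon>H co"
 unfolding comodule_algebra_def
 using P.unital_algebra coaction_hom by (simp add: P_coassoc P_counit)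

section \<open>The quantum sphere\<close>

abbreviation "B \<equiv> AS7 q"

lemma AS7_closed:
 "B \<subseteq> carrier P" "\<^bold>1 \<in> B" "x \<in> B ==> y \<in> B ==> x \<^bold>+ y \<in> B" "x \<in> B ==> \<ominus>\<^bsub>P\<^esub> x \<in> B"
 "x \<in> B ==> y \<in> B ==> x \<cdot> y \<in> B" "x \<in> B ==> c \<^bold>* x \<in> B" "\<^bold>0 \<in> B"
 "i \<in> N4 ==> T i 4 \<in> B" "i \<in> N4 ==> T i 1 \<in> B"
proof -
 let ?S = "(\<lambda>i. T i 4) ` {1..4} \<union> (\<lambda>i. star (T i 4)) ` {1..4}"
 let ?VV = "{V. subring V P \<and> (\<forall>c. \<forall>x\<in>V. c \<^bold>* x \<in> V) \<and> ?S \<subseteq> V}"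
 have B: "B = \<Inter>?VV" by (simp add: AS7_def generated_subalgebra_def)
 have "carrier P \<in> ?VV" using P.carrier_is_subring by (auto simp: star_props)
 then show "B \<subseteq> carrier P" unfolding B by blast
 have V: "\<^bold>0 \<in> V" "\<^bold>1 \<in> V" "\<And>x y. x \<in> V ==> y \<in> V ==> x \<^bold>+ y \<in> V" "\<And>x. x \<in> V ==> \<ominus>\<^bsub>P\<^esub> x \<in> V"
  "\<And>x y. x \<in> V ==> y \<in> V ==> x \<cdot> y \<in> V" "\<And>c x. x \<in> V ==> c \<^bold>* x \<in> V" "?S \<subseteq> V" if "V \<in> ?VV" for V
  using that subringE[of V P] by auto
 show "\<^bold>1 \<in> B" "x \<in> B ==> y \<in> B ==> x \<^bold>+ y \<in> B" "x \<in> B ==> \<ominus>\<^bsub>P\<^esub> x \<in> B" "\<^bold>0 \<in> B"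
  "x \<in> B ==> y \<in> B ==> x \<cdot> y \<in> B" and smult: "\<And>c x. x \<in> B ==> c \<^bold>* x \<in> B"
  unfolding B using V by (meson InterI InterE)+
 have S: "?S \<subseteq> B" unfolding B using V(7) by blast
 show "T i 4 \<in> B" if "i \<in> N4" using S that by blast
 show "T i 1 \<in> B" if i: "i \<in> N4"
 proof -
  have "star (T (5 - i) 4) \<in> B" using S N4_prime(1)[OF i] by blast
  then have "Scoef q (5 - i) 4 \<^bold>* star (T (5 - i) 4) \<in> B" by (rule smult)
  moreover have "Scoef q (5 - i) 4 * Scoef q 4 (5 - i) = 1"
   using Scoef_simps(4)[OF q0 N4_prime(1)[OF i] N4_prime(1)[OF i], of 4] Scoef_simps(1)[OF q0 N4_prime(1)[OF i] N4_prime(1)[OF i]]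
   by simp
  ultimately show ?thesis using i by (simp add: star_T antip_def P.smult_assoc flip: One_nat_def)
 qed
qed

lemma B_carrier: "x \<in> B ==> x \<in> carrier P" using AS7_closed(1) by blast

lemma AS7_induct [consumes 1, case_names gen one add mult smult]:
 assumes x: "x \<in> B"
  and gen: "\<And>i c. i \<in> N4 ==> c \<in> {1, 4} ==> \<Phi> (T i c)"
  and one: "\<Phi> \<^bold>1"
  and add: "\<And>x y. [|x \<in> B; y \<in> B; \<Phi> x; \<Phi> y|] ==> \<Phi> (x \<^bold>+ y)"
  and mult: "\<And>x y. [|x \<in> B; y \<in> B; \<Phi> x; \<Phi> y|] ==> \<Phi> (x \<cdot> y)"
  and smult: "\<And>c x. [|x \<in> B; \<Phi> x|] ==> \<Phi> (c \<^bold>* x)"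
 shows "\<Phi> x"
proof -
 let ?V = "{x \<in> B. \<Phi> x}"
 have minus: "\<ominus>\<^bsub>P\<^esub> x = (- 1) \<^bold>* x" if "x \<in> B" for x
  using P.smult_minus[OF B_carrier[OF that], of 1] B_carrier[OF that] by simp
 have "subring ?V P"
  using minus smult AS7_closed one add mult
  by (intro P.subringI) (auto simp: subset_iff)
 moreover have "star (T i 4) \<in> ?V" if i: "i \<in> N4" for i
  using i smult[OF AS7_closed(9) gen[of "5 - i" 1]] AS7_closed(6)[OF AS7_closed(9)]
  by (simp add: star_T antip_def flip: One_nat_def)
 ultimately have "?V \<in> {V. subring V P \<and> (\<forall>c. \<forall>x\<in>V. c \<^bold>* x \<in> V) \<and>
   (\<lambda>i. T i 4) ` {1..4} \<union> (\<lambda>i. star (T i 4)) ` {1..4} \<subseteq> V}"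
  using gen smult AS7_closed(6,8) by auto
 then have "generated_subalgebra P ((\<lambda>i. T i 4) ` {1..4} \<union> (\<lambda>i. star (T i 4)) ` {1..4}) \<subseteq> ?V"
  unfolding generated_subalgebra_def by (rule Inter_lower)
 then have "B \<subseteq> ?V" unfolding AS7_def[symmetric] .
 then show ?thesis using x by blast
qed

lemma star_B: "x \<in> B ==> star x \<in> B"
proof (induction x rule: AS7_induct)
 case (gen i c)
 then show ?case using AS7_closed(6)[OF AS7_closed(8)] AS7_closed(6)[OF AS7_closed(9)]
  by (auto simp: star_T antip_def simp flip: One_nat_def)
qed (simp_all add: star_props B_carrier AS7_closed)

text \<open>In the quotient the columns 1 and 4 of \<open>T\<close> become columns of the identity matrix, so the
 generators of the sphere are coinvariant, and coinvariance is multiplicative.\<close>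

lemma coaction_B: "x \<in> B ==> co x = ctensor P H x \<one>\<^bsub>H\<^esub>"
proof (induction x rule: AS7_induct)
 case (gen i c)
 then have c: "c \<in> N4" by auto
 have "co (T i c) = ctensor P H (T i c) (T1 c c)"
  unfolding coaction_T[OF gen(1) c] using gen c T1_border[OF _ c]
  by (intro PH.AB.finsum_single_term) auto
 then show ?case using T1_border[OF c c] gen by auto
qed (simp_all add: algebra_mapsD[OF coaction_hom] PH.AB_one B_carrier PH.AB_add_left)

end

section \<open>The canonical map\<close>

lemma regular_simps [simp]:
 "carrier (left_regular P) = carrier P" "carrier (right_regular P) = carrier P"
 "x \<oplus>\<^bsub>left_regular P\<^esub> y = x \<oplus>\<^bsub>P\<^esub> y" "x \<oplus>\<^bsub>right_regular P\<^esub> y = x \<oplus>\<^bsub>P\<^esub> y"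
 "\<zero>\<^bsub>left_regular P\<^esub> = \<zero>\<^bsub>P\<^esub>" "\<zero>\<^bsub>right_regular P\<^esub> = \<zero>\<^bsub>P\<^esub>"
 "b \<odot>\<^bsub>left_regular P\<^esub> p = b \<otimes>\<^bsub>P\<^esub> p" "b \<odot>\<^bsub>right_regular P\<^esub> p = p \<otimes>\<^bsub>P\<^esub> b"
 by (simp_all add: left_regular_def right_regular_def ring.defs module.defs)

lemma (in ring) regular_modules:
 assumes "subring K R"
 shows "left_module (R\<lparr>carrier := K\<rparr>) (left_regular R)" "right_module (R\<lparr>carrier := K\<rparr>) (right_regular R)"
proof -
 have r: "ring (R\<lparr>carrier := K\<rparr>)" by (rule subring_is_ring[OF assms])
 have sub: "K \<subseteq> carrier R" using subringE(1)[OF assms] .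
 have a: "abelian_group (left_regular R)" "abelian_group (right_regular R)"
  by (rule abelian_group_cong[OF abelian_group_axioms]; simp add: fun_eq_iff)+
 show "left_module (R\<lparr>carrier := K\<rparr>) (left_regular R)" "right_module (R\<lparr>carrier := K\<rparr>) (right_regular R)"
  unfolding left_module_def right_module_def left_module_axioms_def right_module_axioms_def
  using r a sub by (auto simp: subset_iff l_distr r_distr m_assoc)
qed

lemma (in ualg) finsum_two_deltas:
 assumes f: "\<And>a b. a \<in> J ==> b \<in> J ==> f a b \<in> carrier A" and J: "finite J"
  and idx: "a1 \<in> J" "b1 \<in> J" "a2 \<in> J" "b2 \<in> J"
  and c: "\<And>a b. a \<in> J ==> b \<in> J ==>
   c a b = (if a = a1 \<and> b = b1 then u else 0) + (if a = a2 \<and> b = b2 then v else 0)"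
 shows "(\<Oplus>a\<in>J. \<Oplus>b\<in>J. c a b \<odot> f a b) = u \<odot> f a1 b1 \<oplus> v \<odot> f a2 b2"
proof -
 have one: "(\<Oplus>a\<in>J. \<Oplus>b\<in>J. (if a = a1 \<and> b = b1 then u else 0) \<odot> f a b) = u \<odot> f a1 b1"
  if "a1 \<in> J" "b1 \<in> J" for a1 b1 u
  using that f J by (simp add: finsum_single_term[of J a1] finsum_single_term[of J b1] Pi_def)
 let ?g = "\<lambda>a b. (if a = a1 \<and> b = b1 then u else 0) \<odot> f a b"
 let ?h = "\<lambda>a b. (if a = a2 \<and> b = b2 then v else 0) \<odot> f a b"
 have "(\<Oplus>a\<in>J. \<Oplus>b\<in>J. c a b \<odot> f a b) = (\<Oplus>a\<in>J. \<Oplus>b\<in>J. ?g a b \<oplus> ?h a b)"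
  using f by (intro finsum_cong') (simp_all add: c smult_l_distr Pi_def)
 also have "\<dots> = (\<Oplus>a\<in>J. (\<Oplus>b\<in>J. ?g a b) \<oplus> (\<Oplus>b\<in>J. ?h a b))"
  using f by (intro finsum_cong' finsum_addf) (simp_all add: Pi_def)
 also have "\<dots> = (\<Oplus>a\<in>J. \<Oplus>b\<in>J. ?g a b) \<oplus> (\<Oplus>a\<in>J. \<Oplus>b\<in>J. ?h a b)"
  using f by (intro finsum_addf) (simp_all add: Pi_def)
 finally show ?thesis by (simp add: one idx)
qed

context spq
begin

lemma B_subring: "subring B P"
 using AS7_closed by (intro P.subringI) (auto simp: subset_iff)

abbreviation "BR \<equiv> P\<lparr>carrier := B\<rparr>"
abbreviation "LP \<equiv> left_regular P"
abbreviation "RP \<equiv> right_regular P"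

end

sublocale spq \<subseteq> TM: tensor_pair "ASp2 q\<lparr>carrier := AS7 q\<rparr>" "right_regular (ASp2 q)" "left_regular (ASp2 q)"
 by (rule tensor_pair.intro[OF P.regular_modules(2)[OF B_subring] P.regular_modules(1)[OF B_subring]])

context spq
begin

abbreviation "M \<equiv> TM.MN"
abbreviation tb (infixl "\<otimes>\<^sub>B" 75) where "x \<otimes>\<^sub>B y \<equiv> tensor BR RP LP x y"

lemma M_group: "abelian_group M" by (rule TM.tensor_group_abelian)

lemma tb_simps:
 "x \<in> carrier P ==> y \<in> carrier P ==> x \<otimes>\<^sub>B y \<in> carrier M"
 "[|x \<in> carrier P; x' \<in> carrier P; y \<in> carrier P|] ==> (x \<^bold>+ x') \<otimes>\<^sub>B y = x \<otimes>\<^sub>B y \<oplus>\<^bsub>M\<^esub> x' \<otimes>\<^sub>B y"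
 "[|x \<in> carrier P; y \<in> carrier P; y' \<in> carrier P|] ==> x \<otimes>\<^sub>B (y \<^bold>+ y') = x \<otimes>\<^sub>B y \<oplus>\<^bsub>M\<^esub> x \<otimes>\<^sub>B y'"
 "[|b \<in> B; x \<in> carrier P; y \<in> carrier P|] ==> (x \<cdot> b) \<otimes>\<^sub>B y = x \<otimes>\<^sub>B (b \<cdot> y)"
 using TM.tensor_closed TM.tensor_add_left TM.tensor_add_right TM.tensor_balanced by simp_all

lemma tb_left: "y \<in> carrier P ==> (\<lambda>x. x \<otimes>\<^sub>B y) \<in> additive_maps P M"
 by (intro additive_mapsI) (simp_all add: tb_simps)

lemma tb_right: "x \<in> carrier P ==> (\<lambda>y. x \<otimes>\<^sub>B y) \<in> additive_maps P M"
 by (intro additive_mapsI) (simp_all add: tb_simps)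

lemma tb_finsum_left:
 "y \<in> carrier P ==> g \<in> J \<rightarrow> carrier P ==> (\<Oplus>\<^bsub>P\<^esub>i\<in>J. g i) \<otimes>\<^sub>B y = (\<Oplus>\<^bsub>M\<^esub>i\<in>J. g i \<otimes>\<^sub>B y)"
 by (rule additive_map_finsum[OF P.abelian_group_axioms M_group tb_left])

lemma tb_finsum_right:
 "x \<in> carrier P ==> g \<in> J \<rightarrow> carrier P ==> x \<otimes>\<^sub>B (\<Oplus>\<^bsub>P\<^esub>i\<in>J. g i) = (\<Oplus>\<^bsub>M\<^esub>i\<in>J. x \<otimes>\<^sub>B g i)"
 by (rule additive_map_finsum[OF P.abelian_group_axioms M_group tb_right])

lemma tb_zero: "x \<in> carrier P ==> \<^bold>0 \<otimes>\<^sub>B x = \<zero>\<^bsub>M\<^esub>" "x \<in> carrier P ==> x \<otimes>\<^sub>B \<^bold>0 = \<zero>\<^bsub>M\<^esub>"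
 using additive_map_zero[OF P.abelian_group_axioms M_group tb_left]
  additive_map_zero[OF P.abelian_group_axioms M_group tb_right] by simp_all

lemma scal_B: "c \<^bold>* \<^bold>1 \<in> B" by (rule AS7_closed(6)[OF AS7_closed(2)])

lemma smult_scal: "x \<in> carrier P ==> c \<^bold>* x = (c \<^bold>* \<^bold>1) \<cdot> x" "x \<in> carrier P ==> c \<^bold>* x = x \<cdot> (c \<^bold>* \<^bold>1)"
 by (simp_all add: P.smult_mult_left P.smult_mult_right)

lemma tb_scal: "x \<in> carrier P ==> y \<in> carrier P ==> (c \<^bold>* x) \<otimes>\<^sub>B y = x \<otimes>\<^sub>B (c \<^bold>* y)"
 by (simp only: smult_scal(2)[of x] smult_scal(1)[of y] tb_simps(4)[OF scal_B])

lemma tb_eqI: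
 assumes "abelian_group Z" "f \<in> additive_maps M Z" "g \<in> additive_maps M Z"
  and "\<And>x y. [|x \<in> carrier P; y \<in> carrier P|] ==> f (x \<otimes>\<^sub>B y) = g (x \<otimes>\<^sub>B y)" "m \<in> carrier M"
 shows "f m = g m"
 using assms(4) by (intro TM.tensor_maps_eqI[OF assms(1-3) _ assms(5)]) simp

lemma tb_lift:
 assumes Z: "abelian_group Z"
  and "\<And>x y. [|x \<in> carrier P; y \<in> carrier P|] ==> \<beta> x y \<in> carrier Z"
  and "\<And>x x' y. [|x \<in> carrier P; x' \<in> carrier P; y \<in> carrier P|] ==> \<beta> (x \<^bold>+ x') y = \<beta> x y \<oplus>\<^bsub>Z\<^esub> \<beta> x' y"
  and "\<And>x y y'. [|x \<in> carrier P; y \<in> carrier P; y' \<in> carrier P|] ==> \<beta> x (y \<^bold>+ y') = \<beta> x y \<oplus>\<^bsub>Z\<^esub> \<beta> x y'"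
  and "\<And>b x y. [|b \<in> B; x \<in> carrier P; y \<in> carrier P|] ==> \<beta> (x \<cdot> b) y = \<beta> x (b \<cdot> y)"
 shows "tensor_lift Z \<beta> \<in> additive_maps M Z"
  and "\<And>x y. [|x \<in> carrier P; y \<in> carrier P|] ==> tensor_lift Z \<beta> (x \<otimes>\<^sub>B y) = \<beta> x y"
proof -
 have b: "bilinear_balanced BR RP LP Z \<beta>" using assms(2-) by (intro bilinear_balancedI) simp_all
 show "tensor_lift Z \<beta> \<in> additive_maps M Z" by (rule TM.tensor_lift_additive[OF Z b])
 show "tensor_lift Z \<beta> (x \<otimes>\<^sub>B y) = \<beta> x y" if "x \<in> carrier P" "y \<in> carrier P" for x y
  by (rule TM.tensor_lift_tensor[OF Z b]) (use that in simp_all)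
qed

subsection \<open>The bimodule structure\<close>

definition lm :: "spq \<Rightarrow> (spq \<times> spq \<Rightarrow>\<^sub>0 int) set \<Rightarrow> (spq \<times> spq \<Rightarrow>\<^sub>0 int) set" where
 "lm p = tensor_lift M (\<lambda>a b. (p \<cdot> a) \<otimes>\<^sub>B b)"

definition rm :: "spq \<Rightarrow> (spq \<times> spq \<Rightarrow>\<^sub>0 int) set \<Rightarrow> (spq \<times> spq \<Rightarrow>\<^sub>0 int) set" where
 "rm p = tensor_lift M (\<lambda>a b. a \<otimes>\<^sub>B (b \<cdot> p))"

lemma lm_additive: "p \<in> carrier P ==> lm p \<in> additive_maps M M"
 and lm_tb: "[|p \<in> carrier P; x \<in> carrier P; y \<in> carrier P|] ==> lm p (x \<otimes>\<^sub>B y) = (p \<cdot> x) \<otimes>\<^sub>B y"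
 unfolding lm_def
 by (rule tb_lift[OF M_group]; simp add: tb_simps P.r_distr P.m_assoc[symmetric] B_carrier)+

lemma rm_additive: "p \<in> carrier P ==> rm p \<in> additive_maps M M"
 and rm_tb: "[|p \<in> carrier P; x \<in> carrier P; y \<in> carrier P|] ==> rm p (x \<otimes>\<^sub>B y) = x \<otimes>\<^sub>B (y \<cdot> p)"
 unfolding rm_def
 by (rule tb_lift[OF M_group]; simp add: tb_simps P.l_distr P.m_assoc B_carrier)+

lemmas lm_closed = additive_map_closed[OF lm_additive]
lemmas rm_closed = additive_map_closed[OF rm_additive]

lemma lm_mult: "[|p \<in> carrier P; p' \<in> carrier P; m \<in> carrier M|] ==> lm (p \<cdot> p') m = lm p (lm p' m)"
 by (rule tb_eqI[OF M_group lm_additive additive_map_compose[OF lm_additive lm_additive]])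
  (simp_all add: lm_tb P.m_assoc)

lemma rm_mult: "[|p \<in> carrier P; p' \<in> carrier P; m \<in> carrier M|] ==> rm (p \<cdot> p') m = rm p' (rm p m)"
 by (rule tb_eqI[OF M_group rm_additive additive_map_compose[OF rm_additive rm_additive]])
  (simp_all add: rm_tb P.m_assoc)

lemma lm_rm: "[|p \<in> carrier P; p' \<in> carrier P; m \<in> carrier M|] ==> lm p (rm p' m) = rm p' (lm p m)"
 by (rule tb_eqI[OF M_group additive_map_compose[OF rm_additive lm_additive] additive_map_compose[OF lm_additive rm_additive]])
  (simp_all add: rm_tb lm_tb)

lemma lm_add: "[|p \<in> carrier P; p' \<in> carrier P; m \<in> carrier M|] ==> lm (p \<^bold>+ p') m = lm p m \<oplus>\<^bsub>M\<^esub> lm p' m"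
 by (rule tb_eqI[OF M_group lm_additive additive_map_sum[OF M_group lm_additive lm_additive]])
  (simp_all add: lm_tb P.l_distr tb_simps)

lemma rm_add: "[|p \<in> carrier P; p' \<in> carrier P; m \<in> carrier M|] ==> rm (p \<^bold>+ p') m = rm p m \<oplus>\<^bsub>M\<^esub> rm p' m"
 by (rule tb_eqI[OF M_group rm_additive additive_map_sum[OF M_group rm_additive rm_additive]])
  (simp_all add: rm_tb P.r_distr tb_simps)

lemma lm_one: "m \<in> carrier M ==> lm \<^bold>1 m = m"
 by (rule tb_eqI[OF M_group lm_additive, of _ "\<lambda>m. m"]) (simp_all add: lm_tb hom_def)

lemma rm_one: "m \<in> carrier M ==> rm \<^bold>1 m = m"
 by (rule tb_eqI[OF M_group rm_additive, of _ "\<lambda>m. m"]) (simp_all add: rm_tb hom_def)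

lemma lm_scal_rm: "m \<in> carrier M ==> lm (c \<^bold>* \<^bold>1) m = rm (c \<^bold>* \<^bold>1) m"
 by (rule tb_eqI[OF M_group lm_additive rm_additive]) (simp_all add: lm_tb rm_tb P.smult_mult_left P.smult_mult_right tb_scal)

definition central :: "(spq \<times> spq \<Rightarrow>\<^sub>0 int) set \<Rightarrow> bool" where
 "central m \<longleftrightarrow> m \<in> carrier M \<and> (\<forall>b\<in>B. lm b m = rm b m)"

text \<open>For a central \<open>m\<close> the bimodule map that sends \<open>1 \<otimes> 1\<close> to \<open>m\<close>.\<close>

definition sandwich :: "(spq \<times> spq \<Rightarrow>\<^sub>0 int) set \<Rightarrow> (spq \<times> spq \<Rightarrow>\<^sub>0 int) set \<Rightarrow> (spq \<times> spq \<Rightarrow>\<^sub>0 int) set" where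
 "sandwich m = tensor_lift M (\<lambda>a b. lm a (rm b m))"

context
 fixes m assumes m: "central m"
begin

lemma m_closed: "m \<in> carrier M" using m by (simp add: central_def)

lemma sandwich_additive: "sandwich m \<in> additive_maps M M"
 and sandwich_tb: "\<And>x y. [|x \<in> carrier P; y \<in> carrier P|] ==> sandwich m (x \<otimes>\<^sub>B y) = lm x (rm y m)"
proof -
 have bal: "lm (x \<cdot> b) (rm y m) = lm x (rm (b \<cdot> y) m)" if "b \<in> B" "x \<in> carrier P" "y \<in> carrier P" for b x y
  using m that by (simp add: lm_mult rm_mult rm_closed m_closed B_carrier lm_rm[of b] central_def)
 note l = tb_lift[OF M_group, of "\<lambda>a b. lm a (rm b m)", folded sandwich_def]
 show "sandwich m \<in> additive_maps M M"
  by (rule l(1)) (simp_all add: lm_closed rm_closed m_closed lm_add rm_add additive_map_add[OF lm_additive] bal)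
 show "sandwich m (x \<otimes>\<^sub>B y) = lm x (rm y m)" if "x \<in> carrier P" "y \<in> carrier P" for x y
  by (rule l(2)[OF _ _ _ _ that]) (simp_all add: lm_closed rm_closed m_closed lm_add rm_add additive_map_add[OF lm_additive] bal)
qed

lemmas sandwich_closed = additive_map_closed[OF sandwich_additive]

lemma sandwich_lm: "p \<in> carrier P ==> m' \<in> carrier M ==> sandwich m (lm p m') = lm p (sandwich m m')"
 by (rule tb_eqI[OF M_group additive_map_compose[OF lm_additive sandwich_additive] additive_map_compose[OF sandwich_additive lm_additive]])
  (simp_all add: lm_tb sandwich_tb lm_mult rm_closed m_closed)

lemma sandwich_rm: "p \<in> carrier P ==> m' \<in> carrier M ==> sandwich m (rm p m') = rm p (sandwich m m')"
 by (rule tb_eqI[OF M_group additive_map_compose[OF rm_additive sandwich_additive] additive_map_compose[OF sandwich_additive rm_additive]])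
  (simp_all add: rm_tb sandwich_tb rm_mult rm_closed m_closed lm_rm)

lemma sandwich_central: "central m' ==> central (sandwich m m')"
 unfolding central_def by (simp add: sandwich_closed sandwich_lm[symmetric] sandwich_rm[symmetric] B_carrier)

end

subsection \<open>The translation map\<close>

abbreviation "ap \<equiv> spq_antipode q"

lemma ap_props:
 "x \<in> carrier P ==> ap x \<in> carrier P"
 "x \<in> carrier P ==> y \<in> carrier P ==> ap (x \<cdot> y) = ap y \<cdot> ap x"
 "x \<in> carrier P ==> y \<in> carrier P ==> ap (x \<^bold>+ y) = ap x \<^bold>+ ap y"
 "ap \<^bold>1 = \<^bold>1"
 "x \<in> carrier P ==> ap (c \<^bold>* x) = c \<^bold>* ap x"
 using algebra_mapsD[OF antipode_hom] by simp_all

definition ap_tb :: "(spq \<times> spq \<Rightarrow>\<^sub>0 int) set \<Rightarrow> (spq \<times> spq \<Rightarrow>\<^sub>0 int) set" where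
 "ap_tb = tensor_lift M (\<lambda>a b. ap a \<otimes>\<^sub>B b)"

text \<open>The candidate \<open>x \<mapsto> S(x\<^sub>1) \<otimes> x\<^sub>2\<close> for the translation map \<open>h \<mapsto> \<chi>\<^sup>-\<^sup>1(1 \<otimes> h)\<close>, at first on all of
 \<open>A(Sp\<^sub>q(2))\<close>. It descends to \<open>A(Sp\<^sub>q(1))\<close> once its values are known to commute with \<open>B\<close>.\<close>

definition transl :: "spq \<Rightarrow> (spq \<times> spq \<Rightarrow>\<^sub>0 int) set" where
 "transl x = ap_tb (\<Delta>P x)"

lemma ap_tb_bilinear: "bilinear_balanced complex_algebra P P M (\<lambda>a b. ap a \<otimes>\<^sub>B b)"
 by (intro bilinear_balancedI) (simp_all add: ap_props tb_simps tb_scal)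

lemma ap_tb_additive: "ap_tb \<in> additive_maps PP.AB M"
 unfolding ap_tb_def by (rule PP.AB_lift_additive[OF M_group ap_tb_bilinear])

lemma ap_tb_tensor: "a \<in> carrier P ==> b \<in> carrier P ==> ap_tb (ctensor P P a b) = ap a \<otimes>\<^sub>B b"
 unfolding ap_tb_def by (rule PP.AB_lift_tensor[OF M_group ap_tb_bilinear])

lemma ap_tb_mult:
 assumes U: "U \<in> carrier PP.AB" and V: "V \<in> carrier PP.AB" and c: "central (ap_tb U)"
 shows "ap_tb (U \<otimes>\<^bsub>PP.AB\<^esub> V) = sandwich (ap_tb U) (ap_tb V)"
proof (rule PP.AB_maps_eqI[OF M_group additive_map_compose[OF PP.AB_mult_additive_right[OF U] ap_tb_additive]
   additive_map_compose[OF ap_tb_additive sandwich_additive[OF c]] _ V])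
 fix a b assume ab: "a \<in> carrier P" "b \<in> carrier P"
 have "ap_tb (U \<otimes>\<^bsub>PP.AB\<^esub> ctensor P P a b) = lm (ap a) (rm b (ap_tb U))"
  by (rule PP.AB_maps_eqI[OF M_group additive_map_compose[OF PP.AB_mult_additive_left[OF PP.AB_closed[OF ab]] ap_tb_additive]
    additive_map_compose[OF additive_map_compose[OF ap_tb_additive rm_additive[OF ab(2)]] lm_additive[OF ap_props(1)[OF ab(1)]]] _ U])
   (use ab in \<open>simp add: ap_tb_tensor ap_props rm_tb lm_tb\<close>)
 then show "ap_tb (U \<otimes>\<^bsub>PP.AB\<^esub> ctensor P P a b) = sandwich (ap_tb U) (ap_tb (ctensor P P a b))"
  using ab c by (simp add: ap_tb_tensor sandwich_tb ap_props)
qed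

lemma transl_additive: "transl \<in> additive_maps P M"
 unfolding transl_def[abs_def] by (rule additive_map_compose[OF alg_map_additive[OF comult_hom] ap_tb_additive])

lemmas transl_closed = additive_map_closed[OF transl_additive]

text \<open>\<open>S(x\<^sub>1 y\<^sub>1) \<otimes> x\<^sub>2 y\<^sub>2 = S(y\<^sub>1) (S(x\<^sub>1) \<otimes> x\<^sub>2) y\<^sub>2\<close>, and for central \<open>S(x\<^sub>1) \<otimes> x\<^sub>2\<close> this expression depends on
 \<open>y\<close> only through \<open>S(y\<^sub>1) \<otimes> y\<^sub>2\<close>, although the tensor product is taken over \<open>B\<close>.\<close>

lemma transl_mult:
 "x \<in> carrier P ==> y \<in> carrier P ==> central (transl x) ==> transl (x \<cdot> y) = sandwich (transl x) (transl y)"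
 unfolding transl_def by (simp add: algebra_mapsD[OF comult_hom] ap_tb_mult)

lemma transl_one: "transl \<^bold>1 = \<^bold>1 \<otimes>\<^sub>B \<^bold>1"
 unfolding transl_def by (simp add: algebra_mapsD[OF comult_hom] PP.AB_one ap_tb_tensor ap_props)

lemma central_one: "central (\<^bold>1 \<otimes>\<^sub>B \<^bold>1)"
 unfolding central_def using tb_simps(4)[of _ "\<^bold>1" "\<^bold>1"]
 by (simp add: tb_simps(1) lm_tb rm_tb B_carrier)

lemma transl_scal: "transl (c \<^bold>* \<^bold>1) = lm (c \<^bold>* \<^bold>1) (\<^bold>1 \<otimes>\<^sub>B \<^bold>1)"
 unfolding transl_def by (simp add: algebra_mapsD[OF comult_hom] PP.AB_one ap_tb_tensor ap_props lm_tb)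

lemma transl_T:
 assumes "i \<in> N4" "j \<in> N4"
 shows "transl (T i j) = (\<Oplus>\<^bsub>M\<^esub>k\<in>N4. S i k \<otimes>\<^sub>B T k j)"
proof -
 interpret M: abelian_group M by (rule M_group)
 show ?thesis unfolding transl_def
  using assms by (simp add: comult_T additive_map_finsum[OF PP.abelian_group_AB M_group ap_tb_additive] Pi_def)
   (intro M.finsum_cong', simp_all add: ap_tb_tensor antipode_T tb_simps)
qed

text \<open>Here one of the two factors of each summand lies in \<open>B\<close> and can be moved to the other side,
 where the summands add up to an entry of \<open>S(T) T = 1\<close>.\<close>

lemma transl_T_border:
 assumes ij: "i \<in> N4" "j \<in> N4" "border i j"
 shows "transl (T i j) = (if i = j then \<^bold>1 \<otimes>\<^sub>B \<^bold>1 else \<zero>\<^bsub>M\<^esub>)"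
proof -
 interpret M: abelian_group M by (rule M_group)
 have sum: "(\<Oplus>\<^bsub>P\<^esub>k\<in>N4. S i k \<cdot> T k j) = (if i = j then \<^bold>1 else \<^bold>0)"
  by (rule frtD(4)[OF T_frt ij(1,2)])
 show ?thesis
 proof (cases "i \<in> {1, 4}")
  case True
  have S: "S i k \<in> B" if "k \<in> N4" for k
   using True that AS7_closed(6)[OF AS7_closed(8)[of "5 - k"]] AS7_closed(6)[OF AS7_closed(9)[of "5 - k"]]
   by (auto simp: antip_def simp flip: One_nat_def)
  have "transl (T i j) = (\<Oplus>\<^bsub>M\<^esub>k\<in>N4. \<^bold>1 \<otimes>\<^sub>B (S i k \<cdot> T k j))"
   unfolding transl_T[OF ij(1,2)] using ij(1,2) tb_simps(4)[OF S, of _ "\<^bold>1"]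
   by (intro M.finsum_cong') (simp_all add: tb_simps(1))
  also have "\<dots> = \<^bold>1 \<otimes>\<^sub>B (if i = j then \<^bold>1 else \<^bold>0)"
   unfolding sum[symmetric] using ij(1,2) by (subst tb_finsum_right) simp_all
  finally show ?thesis by (simp add: tb_zero)
 next
  case False
  then have T: "T k j \<in> B" if "k \<in> N4" for k using ij that AS7_closed(8,9) by auto
  have "transl (T i j) = (\<Oplus>\<^bsub>M\<^esub>k\<in>N4. (S i k \<cdot> T k j) \<otimes>\<^sub>B \<^bold>1)"
   unfolding transl_T[OF ij(1,2)] using ij(1,2) tb_simps(4)[OF T _ P.one_closed]
   by (intro M.finsum_cong') (simp_all add: tb_simps(1))
  also have "\<dots> = (if i = j then \<^bold>1 else \<^bold>0) \<otimes>\<^sub>B \<^bold>1"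
   unfolding sum[symmetric] using ij(1,2) by (subst tb_finsum_left) simp_all
  finally show ?thesis by (simp add: tb_zero)
 qed
qed

lemma N4_inner: "i \<in> N4 ==> i \<notin> {1, 4} ==> i = 2 \<or> i = 3" using N4_cases[of i] by auto

text \<open>For the columns 1 and 4 almost all coefficients of \<open>R\<close> vanish; what survives is the exchanged
 product and one correction with a border entry, which the translation map kills.\<close>

lemma exchange_left:
 assumes m: "m \<in> N4" and i: "i \<in> {2, 3}" and c: "c \<in> {1, 4}"
 shows "\<exists>\<kappa>. \<forall>k\<in>N4. (\<Oplus>\<^bsub>P\<^esub>a\<in>N4. \<Oplus>\<^bsub>P\<^esub>b\<in>N4. Rcoef q a i c b \<^bold>* (T m a \<cdot> S b k)) =
  T m c \<cdot> S i k \<^bold>+ \<kappa> \<^bold>* (T m (5 - i) \<cdot> S 4 k)"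
proof -
 have iN: "i \<in> N4" and cN: "c \<in> N4" using i c by auto
 define \<kappa> where "\<kappa> = (if c = 1 then Rcoef q (5 - i) i 1 4 else 0)"
 have R: "Rcoef q a i c b = (if a = c \<and> b = i then 1 else 0) + (if a = 5 - i \<and> b = 4 then \<kappa> else 0)"
  if "a \<in> N4" "b \<in> N4" for a b
  using i c N4_cases[OF that(1)] N4_cases[OF that(2)] unfolding \<kappa>_def
  by (elim disjE insertE emptyE; simp add: Rcoef_def)
 show ?thesis
 proof (intro exI ballI)
  fix k :: nat assume k: "k \<in> N4"
  show "(\<Oplus>\<^bsub>P\<^esub>a\<in>N4. \<Oplus>\<^bsub>P\<^esub>b\<in>N4. Rcoef q a i c b \<^bold>* (T m a \<cdot> S b k)) =
   T m c \<cdot> S i k \<^bold>+ \<kappa> \<^bold>* (T m (5 - i) \<cdot> S 4 k)"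
   using P.finsum_two_deltas[of N4 "\<lambda>a b. T m a \<cdot> S b k" c i "5 - i" 4 "\<lambda>a b. Rcoef q a i c b" 1 \<kappa>]
    m k iN cN R by simp
 qed
qed

lemma exchange_right:
 assumes m: "m \<in> N4" and j: "j \<in> {2, 3}" and c: "c \<in> {1, 4}"
 shows "\<exists>\<kappa>. \<forall>k\<in>N4. (\<Oplus>\<^bsub>P\<^esub>a\<in>N4. \<Oplus>\<^bsub>P\<^esub>b\<in>N4. Rcoef q m k a b \<^bold>* (T a c \<cdot> T b j)) =
  T k j \<cdot> T m c \<^bold>+ \<kappa> \<^bold>* (T k 1 \<cdot> T m j)"
proof -
 have jN: "j \<in> N4" and cN: "c \<in> N4" using j c by auto
 define \<kappa> where "\<kappa> = (if c = 1 then Rcoef q j 1 1 j else 0)"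
 have R: "Rcoef q a b c j = (if a = c \<and> b = j then 1 else 0) + (if a = j \<and> b = 1 then \<kappa> else 0)"
  if "a \<in> N4" "b \<in> N4" for a b
  using j c N4_cases[OF that(1)] N4_cases[OF that(2)] unfolding \<kappa>_def
  by (elim disjE insertE emptyE; simp add: Rcoef_def)
 show ?thesis
 proof (intro exI ballI)
  fix k :: nat assume k: "k \<in> N4"
  have "(\<Oplus>\<^bsub>P\<^esub>a\<in>N4. \<Oplus>\<^bsub>P\<^esub>b\<in>N4. Rcoef q m k a b \<^bold>* (T a c \<cdot> T b j)) =
    (\<Oplus>\<^bsub>P\<^esub>a\<in>N4. \<Oplus>\<^bsub>P\<^esub>b\<in>N4. Rcoef q a b c j \<^bold>* (T k b \<cdot> T m a))"
   by (rule frtD(2)[OF T_frt m cN k jN])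
  also have "\<dots> = T k j \<cdot> T m c \<^bold>+ \<kappa> \<^bold>* (T k 1 \<cdot> T m j)"
   using P.finsum_two_deltas[of N4 "\<lambda>a b. T k b \<cdot> T m a" c j j 1 "\<lambda>a b. Rcoef q a b c j" 1 \<kappa>]
    m k jN cN R by simp
  finally show "(\<Oplus>\<^bsub>P\<^esub>a\<in>N4. \<Oplus>\<^bsub>P\<^esub>b\<in>N4. Rcoef q m k a b \<^bold>* (T a c \<cdot> T b j)) =
   T k j \<cdot> T m c \<^bold>+ \<kappa> \<^bold>* (T k 1 \<cdot> T m j)" .
 qed
qed

end

context spq
begin

lemma transl_T_shift:
 assumes "i \<in> N4" "j \<in> N4" "x \<in> carrier P"
 shows "(\<Oplus>\<^bsub>M\<^esub>k\<in>N4. (x \<cdot> S i k) \<otimes>\<^sub>B T k j) = lm x (transl (T i j))"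
  "(\<Oplus>\<^bsub>M\<^esub>k\<in>N4. S i k \<otimes>\<^sub>B (T k j \<cdot> x)) = rm x (transl (T i j))"
proof -
 interpret M: abelian_group M by (rule M_group)
 show "(\<Oplus>\<^bsub>M\<^esub>k\<in>N4. (x \<cdot> S i k) \<otimes>\<^sub>B T k j) = lm x (transl (T i j))"
  using assms by (simp add: transl_T additive_map_finsum[OF M_group M_group lm_additive] Pi_def tb_simps(1))
   (intro M.finsum_cong', simp_all add: lm_tb tb_simps(1))
 show "(\<Oplus>\<^bsub>M\<^esub>k\<in>N4. S i k \<otimes>\<^sub>B (T k j \<cdot> x)) = rm x (transl (T i j))"
  using assms by (simp add: transl_T additive_map_finsum[OF M_group M_group rm_additive] Pi_def tb_simps(1))
   (intro M.finsum_cong', simp_all add: rm_tb tb_simps(1))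
qed

text \<open>Moving a column-\<open>c\<close> generator of the sphere through \<open>S(T\<^sub>i)\<close> produces the coefficients
 of \<open>R\<close>; being in \<open>B\<close>, it jumps over the tensor sign, and the relations \<open>R T\<^sub>1 T\<^sub>2 = T\<^sub>2 T\<^sub>1 R\<close>
 absorb these coefficients again. The correction terms contain \<open>transl\<close> of a generator of
 the ideal and vanish.\<close>

lemma transl_inner_commutes:
 assumes m: "m \<in> N4" and i: "i \<in> {2, 3}" and j: "j \<in> {2, 3}" and c: "c \<in> {1, 4}"
 shows "lm (T m c) (transl (T i j)) = rm (T m c) (transl (T i j))"
proof -
 interpret M: abelian_group M by (rule M_group)
 have iN: "i \<in> N4" and jN: "j \<in> N4" and cN: "c \<in> N4" using i j c by auto
 note [simp] = m iN jN cN tb_simps(1)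
 have TB: "T a c \<in> B" if "a \<in> N4" for a using c that AS7_closed(8,9) by auto
 obtain \<kappa> where \<kappa>: "\<And>k. k \<in> N4 ==> (\<Oplus>\<^bsub>P\<^esub>a\<in>N4. \<Oplus>\<^bsub>P\<^esub>b\<in>N4. Rcoef q a i c b \<^bold>* (T m a \<cdot> S b k)) =
   T m c \<cdot> S i k \<^bold>+ \<kappa> \<^bold>* (T m (5 - i) \<cdot> S 4 k)"
  using exchange_left[OF m i c] by blast
 obtain \<kappa>' where \<kappa>': "\<And>k. k \<in> N4 ==> (\<Oplus>\<^bsub>P\<^esub>a\<in>N4. \<Oplus>\<^bsub>P\<^esub>b\<in>N4. Rcoef q m k a b \<^bold>* (T a c \<cdot> T b j)) =
   T k j \<cdot> T m c \<^bold>+ \<kappa>' \<^bold>* (T k 1 \<cdot> T m j)"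
  using exchange_right[OF m j c] by blast
 let ?G = "\<lambda>k. \<Oplus>\<^bsub>P\<^esub>a\<in>N4. \<Oplus>\<^bsub>P\<^esub>b\<in>N4. Rcoef q m b a k \<^bold>* (S i b \<cdot> T a c)"
 let ?t = "\<lambda>k a b. S i b \<otimes>\<^sub>B (Rcoef q m b a k \<^bold>* (T a c \<cdot> T k j))"
 have left: "(\<Oplus>\<^bsub>M\<^esub>k\<in>N4. ?G k \<otimes>\<^sub>B T k j) = lm (T m c) (transl (T i j))"
 proof -
  have G: "?G k = T m c \<cdot> S i k \<^bold>+ (\<kappa> \<^bold>* T m (5 - i)) \<cdot> S 4 k" if "k \<in> N4" for k
   using P.frt_exchange[OF T_frt q0 m iN cN that] \<kappa>[OF that] that by (simp add: P.smult_mult_left)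
  have "(\<Oplus>\<^bsub>M\<^esub>k\<in>N4. ?G k \<otimes>\<^sub>B T k j) = (\<Oplus>\<^bsub>M\<^esub>k\<in>N4. (T m c \<cdot> S i k) \<otimes>\<^sub>B T k j \<oplus>\<^bsub>M\<^esub>
    ((\<kappa> \<^bold>* T m (5 - i)) \<cdot> S 4 k) \<otimes>\<^sub>B T k j)"
   by (intro M.finsum_cong') (simp_all add: G tb_simps(2))
  also have "\<dots> = lm (T m c) (transl (T i j)) \<oplus>\<^bsub>M\<^esub> lm (\<kappa> \<^bold>* T m (5 - i)) (transl (T 4 j))"
   by (simp add: M.finsum_addf Pi_def transl_T_shift)
  also have "transl (T 4 j) = \<zero>\<^bsub>M\<^esub>" using j transl_T_border[of 4 j] by auto
  finally show ?thesis
   using additive_map_zero[OF M_group M_group lm_additive] by (simp add: lm_closed transl_closed)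
 qed
 have right: "(\<Oplus>\<^bsub>M\<^esub>b\<in>N4. S i b \<otimes>\<^sub>B (\<Oplus>\<^bsub>P\<^esub>a\<in>N4. \<Oplus>\<^bsub>P\<^esub>k\<in>N4. Rcoef q m b a k \<^bold>* (T a c \<cdot> T k j))) =
   rm (T m c) (transl (T i j))"
 proof -
  have "(\<Oplus>\<^bsub>M\<^esub>b\<in>N4. S i b \<otimes>\<^sub>B (\<Oplus>\<^bsub>P\<^esub>a\<in>N4. \<Oplus>\<^bsub>P\<^esub>k\<in>N4. Rcoef q m b a k \<^bold>* (T a c \<cdot> T k j))) =
    (\<Oplus>\<^bsub>M\<^esub>b\<in>N4. S i b \<otimes>\<^sub>B (T b j \<cdot> T m c) \<oplus>\<^bsub>M\<^esub> S i b \<otimes>\<^sub>B (T b 1 \<cdot> (\<kappa>' \<^bold>* T m j)))"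
   by (intro M.finsum_cong') (simp_all add: \<kappa>' tb_simps(3) P.smult_mult_right)
  also have "\<dots> = rm (T m c) (transl (T i j)) \<oplus>\<^bsub>M\<^esub> rm (\<kappa>' \<^bold>* T m j) (transl (T i 1))"
   by (simp add: M.finsum_addf Pi_def transl_T_shift)
  also have "transl (T i 1) = \<zero>\<^bsub>M\<^esub>" using i transl_T_border[of i 1] by auto
  finally show ?thesis
   using additive_map_zero[OF M_group M_group rm_additive] by (simp add: rm_closed transl_closed)
 qed
 have "(\<Oplus>\<^bsub>M\<^esub>k\<in>N4. ?G k \<otimes>\<^sub>B T k j) = (\<Oplus>\<^bsub>M\<^esub>k\<in>N4. \<Oplus>\<^bsub>M\<^esub>a\<in>N4. \<Oplus>\<^bsub>M\<^esub>b\<in>N4. ?t k a b)"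
 proof (rule M.finsum_cong')
  fix k :: nat assume k[simp]: "k \<in> N4"
  have t: "(Rcoef q m b a k \<^bold>* (S i b \<cdot> T a c)) \<otimes>\<^sub>B T k j = ?t k a b" if "a \<in> N4" "b \<in> N4" for a b
   using that tb_simps(4)[OF TB[OF that(1)] S_closed[OF iN that(2)], of "Rcoef q m b a k \<^bold>* T k j"]
   by (simp add: tb_scal P.smult_mult_right)
  have inner: "(\<Oplus>\<^bsub>P\<^esub>b\<in>N4. Rcoef q m b a k \<^bold>* (S i b \<cdot> T a c)) \<otimes>\<^sub>B T k j = (\<Oplus>\<^bsub>M\<^esub>b\<in>N4. ?t k a b)"
   if a[simp]: "a \<in> N4" for a
   by (subst tb_finsum_left, simp_all add: Pi_def) (intro M.finsum_cong', simp_all add: t)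
  show "?G k \<otimes>\<^sub>B T k j = (\<Oplus>\<^bsub>M\<^esub>a\<in>N4. \<Oplus>\<^bsub>M\<^esub>b\<in>N4. ?t k a b)"
   by (subst tb_finsum_left, simp_all add: Pi_def) (intro M.finsum_cong', simp_all add: inner)
 qed simp_all
 also have "\<dots> = (\<Oplus>\<^bsub>M\<^esub>k\<in>N4. \<Oplus>\<^bsub>M\<^esub>b\<in>N4. \<Oplus>\<^bsub>M\<^esub>a\<in>N4. ?t k a b)"
  by (intro M.finsum_cong' M.finsum_finsum_swap) simp_all
 also have "\<dots> = (\<Oplus>\<^bsub>M\<^esub>b\<in>N4. \<Oplus>\<^bsub>M\<^esub>k\<in>N4. \<Oplus>\<^bsub>M\<^esub>a\<in>N4. ?t k a b)"
  by (intro M.finsum_finsum_swap) simp_all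
 also have "\<dots> = (\<Oplus>\<^bsub>M\<^esub>b\<in>N4. \<Oplus>\<^bsub>M\<^esub>a\<in>N4. \<Oplus>\<^bsub>M\<^esub>k\<in>N4. ?t k a b)"
  by (intro M.finsum_cong' M.finsum_finsum_swap) simp_all
 also have "\<dots> = (\<Oplus>\<^bsub>M\<^esub>b\<in>N4. S i b \<otimes>\<^sub>B (\<Oplus>\<^bsub>P\<^esub>a\<in>N4. \<Oplus>\<^bsub>P\<^esub>k\<in>N4. Rcoef q m b a k \<^bold>* (T a c \<cdot> T k j)))"
 proof (rule M.finsum_cong')
  fix b :: nat assume b[simp]: "b \<in> N4"
  show "(\<Oplus>\<^bsub>M\<^esub>a\<in>N4. \<Oplus>\<^bsub>M\<^esub>k\<in>N4. ?t k a b) =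
    S i b \<otimes>\<^sub>B (\<Oplus>\<^bsub>P\<^esub>a\<in>N4. \<Oplus>\<^bsub>P\<^esub>k\<in>N4. Rcoef q m b a k \<^bold>* (T a c \<cdot> T k j))"
   by (simp add: tb_finsum_right Pi_def) (intro M.finsum_cong', simp_all add: tb_finsum_right Pi_def)
 qed simp_all
 finally show ?thesis using left right by simp
qed

lemma central_zero: "central \<zero>\<^bsub>M\<^esub>"
proof -
 interpret M: abelian_group M by (rule M_group)
 show ?thesis unfolding central_def
  by (simp add: B_carrier additive_map_zero[OF M_group M_group lm_additive] additive_map_zero[OF M_group M_group rm_additive])
qed

lemma transl_T_central: assumes ij: "i \<in> N4" "j \<in> N4" shows "central (transl (T i j))"
proof (cases "border i j")
 case True
 then show ?thesis using transl_T_border[OF ij True] central_one central_zero by simp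
next
 case False
 then have i: "i \<in> {2, 3}" and j: "j \<in> {2, 3}" using N4_inner ij by auto
 let ?m = "transl (T i j)"
 have m: "?m \<in> carrier M" using ij by (simp add: transl_closed)
 have "lm b ?m = rm b ?m" if "b \<in> B" for b using that
 proof (induction b rule: AS7_induct)
  case (gen m c) then show ?case by (rule transl_inner_commutes[OF _ i j])
 next
  case one then show ?case using m by (simp add: lm_one rm_one)
 next
  case (add x y) then show ?case using m by (simp add: lm_add rm_add B_carrier)
 next
  case (mult x y) then show ?case using m by (simp add: lm_mult rm_mult B_carrier lm_rm)
 next
  case (smult c x)
  then show ?case using m lm_scal_rm[of ?m c]
   by (simp add: smult_scal(1)[of x] lm_mult rm_mult B_carrier lm_rm)
 qed
 then show ?thesis using m by (simp add: central_def)
qed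

lemma central_add: "central m ==> central m' ==> central (m \<oplus>\<^bsub>M\<^esub> m')"
proof -
 interpret M: abelian_group M by (rule M_group)
 show "central m ==> central m' ==> central (m \<oplus>\<^bsub>M\<^esub> m')"
  by (simp add: central_def additive_map_add[OF lm_additive] additive_map_add[OF rm_additive] B_carrier)
qed

text \<open>Centrality holds for the generators, and products only sandwich one central element in
 another.\<close>

lemma transl_central: "x \<in> carrier P ==> central (transl x)"
proof (induction x rule: P_induct)
 case one then show ?case by (simp add: transl_one central_one)
next
 case (gen i j x)
 then show ?case by (simp add: transl_mult transl_T_central sandwich_central)
next
 case (add x y) then show ?case by (simp add: additive_map_add[OF transl_additive] central_add)
next
 case (smult c x)
 have c: "central (transl (c \<^bold>* \<^bold>1))"
  unfolding central_def transl_scal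
 proof (intro conjI ballI)
  fix b assume b: "b \<in> B"
  have bP: "b \<in> carrier P" by (rule B_carrier[OF b])
  show "lm b (lm (c \<^bold>* \<^bold>1) (\<^bold>1 \<otimes>\<^sub>B \<^bold>1)) = rm b (lm (c \<^bold>* \<^bold>1) (\<^bold>1 \<otimes>\<^sub>B \<^bold>1))"
   using bP tb_simps(4)[OF AS7_closed(6)[OF b, of c] P.one_closed P.one_closed]
   by (simp add: lm_tb rm_tb tb_simps(1) P.smult_mult_right P.smult_mult_left tb_scal)
 qed (simp add: lm_closed tb_simps(1))
 have "transl (c \<^bold>* x) = sandwich (transl (c \<^bold>* \<^bold>1)) (transl x)"
  using smult transl_mult[OF _ _ c] by (simp add: smult_scal(1)[of x])
 then show ?case using sandwich_central[OF c smult(2)] by simp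
qed

lemma sandwich_zero: "m \<in> carrier M ==> sandwich \<zero>\<^bsub>M\<^esub> m = \<zero>\<^bsub>M\<^esub>"
proof -
 interpret M: abelian_group M by (rule M_group)
 show "m \<in> carrier M ==> sandwich \<zero>\<^bsub>M\<^esub> m = \<zero>\<^bsub>M\<^esub>"
  by (rule tb_eqI[OF M_group sandwich_additive[OF central_zero], of "\<lambda>_. \<zero>\<^bsub>M\<^esub>"], intro additive_mapsI)
   (simp_all add: sandwich_tb[OF central_zero] additive_map_zero[OF M_group M_group lm_additive]
    additive_map_zero[OF M_group M_group rm_additive])
qed

text \<open>By multiplicativity the kernel of the translation map is a two-sided ideal, and it contains
 the generators of the ideal.\<close>

lemma transl_Iq: assumes "x \<in> Iq q" shows "transl x = \<zero>\<^bsub>M\<^esub>"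
proof -
 interpret M: abelian_group M by (rule M_group)
 let ?J = "{x \<in> carrier P. transl x = \<zero>\<^bsub>M\<^esub>}"
 have "ideal ?J P"
 proof (rule idealI[OF P.ring_axioms])
  show "subgroup ?J (add_monoid P)"
  proof (rule group.subgroupI[OF P.a_group])
   show "?J \<noteq> {}" using additive_map_zero[OF P.abelian_group_axioms M_group transl_additive] by auto
   show "inv\<^bsub>add_monoid P\<^esub> a \<in> ?J" if "a \<in> ?J" for a
    using that additive_map_minus[OF P.abelian_group_axioms M_group transl_additive, of a]
     M.minus_equality[of "\<zero>\<^bsub>M\<^esub>" "\<zero>\<^bsub>M\<^esub>"]
    by (simp add: a_inv_def[symmetric])
  qed (auto simp: additive_map_add[OF transl_additive])
  show "x \<cdot> a \<in> ?J" if "a \<in> ?J" "x \<in> carrier P" for a x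
   using that additive_map_zero[OF M_group M_group sandwich_additive[OF transl_central[OF that(2)]]]
   by (simp add: transl_mult transl_central)
  show "a \<cdot> x \<in> ?J" if "a \<in> ?J" "x \<in> carrier P" for a x
   using that by (simp add: transl_mult central_zero sandwich_zero transl_closed)
 qed
 moreover have "\<forall>x\<in>I_gens q. x \<in> ?J"
  unfolding I_gens_ball
 proof (intro ballI impI)
  fix i j :: nat assume ij: "i \<in> N4" "j \<in> N4" "border i j"
  let ?d = "if i = j then \<^bold>1 else \<^bold>0"
  have "transl (T i j \<ominus>\<^bsub>P\<^esub> ?d) = transl (T i j) \<ominus>\<^bsub>M\<^esub> transl ?d"
   using ij by (intro additive_map_diff[OF P.abelian_group_axioms M_group transl_additive]) auto
  also have "transl ?d = transl (T i j)"
   using transl_T_border[OF ij] transl_one additive_map_zero[OF P.abelian_group_axioms M_group transl_additive] by simp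
  finally show "T i j \<ominus>\<^bsub>P\<^esub> ?d \<in> ?J"
   using ij transl_closed[of "T i j"] by (simp add: M.minus_eq M.r_neg)
 qed
 ultimately have "Idl\<^bsub>P\<^esub> (I_gens q) \<subseteq> ?J" by (intro P.genideal_minimal) auto
 then show ?thesis using assms unfolding Iq_eq by auto
qed

definition htransl :: "spq set \<Rightarrow> (spq \<times> spq \<Rightarrow>\<^sub>0 int) set" where
 "htransl = quot_lift transl"

lemma htransl_additive: "htransl \<in> additive_maps H M"
 using HI.quot_lift_additive[OF M_group transl_additive transl_Iq] by (simp add: htransl_def H_eq)

lemma htransl_pr: "x \<in> carrier P ==> htransl (pr x) = transl x"
 using HI.quot_lift_additive_coset[OF M_group transl_additive transl_Iq] by (simp add: htransl_def pr_coset)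

lemma htransl_closed: "h \<in> carrier H ==> htransl h \<in> carrier M"
 by (rule additive_map_closed[OF htransl_additive])

lemma transl_smult: "x \<in> carrier P ==> transl (c \<^bold>* x) = lm (c \<^bold>* \<^bold>1) (transl x)"
 using transl_mult[of x "c \<^bold>* \<^bold>1"] sandwich_lm[OF transl_central, of x "c \<^bold>* \<^bold>1" "\<^bold>1 \<otimes>\<^sub>B \<^bold>1"]
  sandwich_tb[OF transl_central, of x "\<^bold>1" "\<^bold>1"]
 by (simp add: smult_scal(2)[of x] transl_scal transl_central tb_simps(1) lm_one rm_one transl_closed)

subsection \<open>The inverse of the canonical map\<close>

abbreviation "\<chi> \<equiv> canonical_map P H co"

lemma \<chi>_lift:
 shows \<chi>_additive: "\<chi> \<in> additive_maps M PH.AB"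
  and \<chi>_tb: "\<And>x y. [|x \<in> carrier P; y \<in> carrier P|] ==> \<chi> (x \<otimes>\<^sub>B y) = ctensor P H x \<one>\<^bsub>H\<^esub> \<otimes>\<^bsub>PH.AB\<^esub> co y"
proof -
 note coD = algebra_mapsD[OF coaction_hom]
 have bal: "ctensor P H (x \<cdot> b) \<one>\<^bsub>H\<^esub> \<otimes>\<^bsub>PH.AB\<^esub> co y = ctensor P H x \<one>\<^bsub>H\<^esub> \<otimes>\<^bsub>PH.AB\<^esub> co (b \<cdot> y)"
  if "b \<in> B" "x \<in> carrier P" "y \<in> carrier P" for b x y
 proof -
  have "ctensor P H (x \<cdot> b) \<one>\<^bsub>H\<^esub> = ctensor P H x \<one>\<^bsub>H\<^esub> \<otimes>\<^bsub>PH.AB\<^esub> ctensor P H b \<one>\<^bsub>H\<^esub>"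
   using that by (simp add: B_carrier)
  then show ?thesis using that PH.AB.m_assoc[of "ctensor P H x \<one>\<^bsub>H\<^esub>" "ctensor P H b \<one>\<^bsub>H\<^esub>" "co y"]
   by (simp add: coD coaction_B B_carrier del: PH.AB_mult_tensor)
 qed
 note l = tb_lift[OF PH.abelian_group_AB, of "\<lambda>p' p. ctensor P H p' \<one>\<^bsub>H\<^esub> \<otimes>\<^bsub>PH.AB\<^esub> co p", folded canonical_map_def]
 show "\<chi> \<in> additive_maps M PH.AB"
  by (rule l(1)) (simp_all add: coD PH.AB_add_left PH.AB.l_distr PH.AB.r_distr bal)
 show "\<chi> (x \<otimes>\<^sub>B y) = ctensor P H x \<one>\<^bsub>H\<^esub> \<otimes>\<^bsub>PH.AB\<^esub> co y" if "x \<in> carrier P" "y \<in> carrier P" for x y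
  by (rule l(2)[OF _ _ _ _ that]) (simp_all add: coD PH.AB_add_left PH.AB.l_distr PH.AB.r_distr bal)
qed

lemma \<chi>_lm: "p \<in> carrier P ==> m \<in> carrier M ==> \<chi> (lm p m) = ctensor P H p \<one>\<^bsub>H\<^esub> \<otimes>\<^bsub>PH.AB\<^esub> \<chi> m"
 by (rule tb_eqI[OF PH.abelian_group_AB additive_map_compose[OF lm_additive \<chi>_additive]
    additive_map_compose[OF \<chi>_additive PH.AB.mult_left_additive]])
  (simp_all add: lm_tb \<chi>_tb algebra_mapsD[OF coaction_hom] PH.AB.m_assoc[symmetric])

lemma \<chi>_rm: "p \<in> carrier P ==> m \<in> carrier M ==> \<chi> (rm p m) = \<chi> m \<otimes>\<^bsub>PH.AB\<^esub> co p"
 by (rule tb_eqI[OF PH.abelian_group_AB additive_map_compose[OF rm_additive \<chi>_additive]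
    additive_map_compose[OF \<chi>_additive PH.AB.mult_right_additive]])
  (simp_all add: rm_tb \<chi>_tb algebra_mapsD[OF coaction_hom] PH.AB.m_assoc)

lemma \<chi>_transl_T:
 assumes ij: "i \<in> N4" "j \<in> N4" shows "\<chi> (transl (T i j)) = ctensor P H \<^bold>1 (T1 i j)"
proof -
 have "\<chi> (transl (T i j)) = (\<Oplus>\<^bsub>PH.AB\<^esub>k\<in>N4. \<Oplus>\<^bsub>PH.AB\<^esub>l\<in>N4. ctensor P H (S i k \<cdot> T k l) (T1 l j))"
 proof -
  have "\<chi> (transl (T i j)) = (\<Oplus>\<^bsub>PH.AB\<^esub>k\<in>N4. ctensor P H (S i k) \<one>\<^bsub>H\<^esub> \<otimes>\<^bsub>PH.AB\<^esub> co (T k j))"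
   using ij by (simp add: transl_T additive_map_finsum[OF M_group PH.abelian_group_AB \<chi>_additive] Pi_def tb_simps(1))
    (intro PH.AB.finsum_cong', simp_all add: \<chi>_tb algebra_mapsD[OF coaction_hom])
  also have "\<dots> = (\<Oplus>\<^bsub>PH.AB\<^esub>k\<in>N4. \<Oplus>\<^bsub>PH.AB\<^esub>l\<in>N4. ctensor P H (S i k \<cdot> T k l) (T1 l j))"
   using ij by (intro PH.AB.finsum_cong') (simp_all add: coaction_T PH.AB.finsum_rdistr Pi_def cong: PH.AB.finsum_cong)
  finally show ?thesis .
 qed
 also have "\<dots> = (\<Oplus>\<^bsub>PH.AB\<^esub>l\<in>N4. \<Oplus>\<^bsub>PH.AB\<^esub>k\<in>N4. ctensor P H (S i k \<cdot> T k l) (T1 l j))"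
  using ij by (intro PH.AB.finsum_finsum_swap) simp_all
 also have "\<dots> = (\<Oplus>\<^bsub>PH.AB\<^esub>l\<in>N4. ctensor P H (if i = l then \<^bold>1 else \<^bold>0) (T1 l j))"
  using ij frtD(4)[OF T_frt ij(1)]
  by (intro PH.AB.finsum_cong')
   (simp_all add: additive_map_finsum[OF P.abelian_group_axioms PH.abelian_group_AB PH.AB_left_additive, symmetric] Pi_def)
 also have "\<dots> = ctensor P H \<^bold>1 (T1 i j)"
  using ij by (subst PH.AB.finsum_single_term[of N4 i]) simp_all
 finally show ?thesis .
qed

lemma \<chi>_sandwich:
 assumes m: "central m" "m' \<in> carrier M" "h \<in> carrier H" and e: "\<chi> m = ctensor P H \<^bold>1 h"
 shows "\<chi> (sandwich m m') = ctensor P H \<^bold>1 h \<otimes>\<^bsub>PH.AB\<^esub> \<chi> m'"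
proof (rule tb_eqI[OF PH.abelian_group_AB additive_map_compose[OF sandwich_additive[OF m(1)] \<chi>_additive]
   additive_map_compose[OF \<chi>_additive PH.AB.mult_left_additive] _ m(2)])
 show "ctensor P H \<^bold>1 h \<in> carrier PH.AB" using m by simp
 fix x y assume xy: "x \<in> carrier P" "y \<in> carrier P"
 have "\<chi> (sandwich m (x \<otimes>\<^sub>B y)) = ctensor P H x \<one>\<^bsub>H\<^esub> \<otimes>\<^bsub>PH.AB\<^esub> (ctensor P H \<^bold>1 h \<otimes>\<^bsub>PH.AB\<^esub> co y)"
  using xy m by (simp add: sandwich_tb \<chi>_lm \<chi>_rm rm_closed central_def e)
 also have "\<dots> = ctensor P H \<^bold>1 h \<otimes>\<^bsub>PH.AB\<^esub> (ctensor P H x \<one>\<^bsub>H\<^esub> \<otimes>\<^bsub>PH.AB\<^esub> co y)"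
  using xy m by (simp add: PH.AB.m_assoc[symmetric] algebra_mapsD[OF coaction_hom])
 finally show "\<chi> (sandwich m (x \<otimes>\<^sub>B y)) = ctensor P H \<^bold>1 h \<otimes>\<^bsub>PH.AB\<^esub> \<chi> (x \<otimes>\<^sub>B y)"
  using xy by (simp add: \<chi>_tb)
qed

lemma \<chi>_transl: "x \<in> carrier P ==> \<chi> (transl x) = ctensor P H \<^bold>1 (pr x)"
proof (induction x rule: P_induct)
 case one then show ?case
  by (simp add: transl_one \<chi>_tb algebra_mapsD[OF coaction_hom] algebra_mapsD[OF pr_hom] PH.AB_one)
next
 case (gen i j x)
 then show ?case
  by (simp add: transl_mult transl_T_central \<chi>_sandwich[OF transl_T_central _ _ \<chi>_transl_T] transl_closed
    algebra_mapsD[OF pr_hom] T1_pr[symmetric])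
next
 case (add x y) then show ?case
  by (simp add: additive_map_add[OF transl_additive] additive_map_add[OF \<chi>_additive] transl_closed
    algebra_mapsD[OF pr_hom] PH.AB_add_right)
next
 case (smult c x) then show ?case
  by (simp add: transl_smult \<chi>_lm transl_closed algebra_mapsD[OF pr_hom] PH.AB_balanced H.smult_mult_left)
qed

text \<open>The inverse \<open>p \<otimes> h \<mapsto> p \<tau>(h)\<close> of the canonical map, with \<open>\<tau>\<close> the translation map.\<close>

definition \<psi> :: "(spq \<times> spq set \<Rightarrow>\<^sub>0 int) set \<Rightarrow> (spq \<times> spq \<Rightarrow>\<^sub>0 int) set" where
 "\<psi> = tensor_lift M (\<lambda>p h. lm p (htransl h))"

lemma \<psi>_bilinear: "bilinear_balanced complex_algebra P H M (\<lambda>p h. lm p (htransl h))"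
proof (rule bilinear_balancedI)
 fix r x y assume r: "x \<in> carrier P" "y \<in> carrier H"
 obtain z where z: "z \<in> carrier P" "y = pr z" using H_surj[OF r(2)] by blast
 show "lm (r \<^bold>* x) (htransl y) = lm x (htransl (r \<odot>\<^bsub>H\<^esub> y))"
  using r z by (simp add: smult_scal(2)[of x] lm_mult transl_closed htransl_pr transl_smult
    alg_map_smult[OF pr_hom, symmetric])
qed (simp_all add: lm_closed htransl_closed lm_add additive_map_add[OF htransl_additive] additive_map_add[OF lm_additive])

lemma \<psi>_additive: "\<psi> \<in> additive_maps PH.AB M"
 unfolding \<psi>_def by (rule PH.AB_lift_additive[OF M_group \<psi>_bilinear])

lemma \<psi>_tensor: "p \<in> carrier P ==> x \<in> carrier P ==> \<psi> (ctensor P H p (pr x)) = lm p (transl x)"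
 unfolding \<psi>_def using PH.AB_lift_tensor[OF M_group \<psi>_bilinear, of p "pr x"]
 by (simp add: htransl_pr algebra_mapsD[OF pr_hom])

lemma PH_eqI:
 assumes "abelian_group Z" "f \<in> additive_maps PH.AB Z" "g \<in> additive_maps PH.AB Z"
  and eq: "\<And>p x. [|p \<in> carrier P; x \<in> carrier P|] ==> f (ctensor P H p (pr x)) = g (ctensor P H p (pr x))"
  and "U \<in> carrier PH.AB"
 shows "f U = g U"
proof (rule PH.AB_maps_eqI[OF assms(1-3) _ assms(5)])
 fix p h assume ph: "p \<in> carrier P" "h \<in> carrier H"
 obtain z where "z \<in> carrier P" "h = pr z" using H_surj[OF ph(2)] by blast
 then show "f (ctensor P H p h) = g (ctensor P H p h)" using eq[OF ph(1)] by simp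
qed

lemma \<psi>_mult:
 assumes U: "U \<in> carrier PH.AB" and V: "V \<in> carrier PH.AB" and y: "y \<in> carrier P" and e: "\<psi> V = \<^bold>1 \<otimes>\<^sub>B y"
 shows "\<psi> (U \<otimes>\<^bsub>PH.AB\<^esub> V) = rm y (\<psi> U)"
proof (rule PH_eqI[OF M_group additive_map_compose[OF PH.AB_mult_additive_left[OF V] \<psi>_additive]
   additive_map_compose[OF \<psi>_additive rm_additive[OF y]] _ U])
 fix p z assume pz: "p \<in> carrier P" "z \<in> carrier P"
 note c = transl_central[OF pz(2)]
 have pzc: "ctensor P H p (pr z) \<in> carrier PH.AB" using pz by (simp add: algebra_mapsD[OF pr_hom])
 have "\<psi> (ctensor P H p (pr z) \<otimes>\<^bsub>PH.AB\<^esub> V) = lm p (sandwich (transl z) (\<psi> V))"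
 proof (rule PH_eqI[OF M_group additive_map_compose[OF PH.AB_mult_additive_right[OF pzc] \<psi>_additive]
   additive_map_compose[OF additive_map_compose[OF \<psi>_additive sandwich_additive[OF c]] lm_additive[OF pz(1)]] _ V])
  fix p' z' assume pz': "p' \<in> carrier P" "z' \<in> carrier P"
  have "ctensor P H p (pr z) \<otimes>\<^bsub>PH.AB\<^esub> ctensor P H p' (pr z') = ctensor P H (p \<cdot> p') (pr (z \<cdot> z'))"
   using pz pz' by (simp add: algebra_mapsD[OF pr_hom])
  then show "\<psi> (ctensor P H p (pr z) \<otimes>\<^bsub>PH.AB\<^esub> ctensor P H p' (pr z')) =
   lm p (sandwich (transl z) (\<psi> (ctensor P H p' (pr z'))))"
   using pz pz' by (simp add: \<psi>_tensor transl_mult c sandwich_lm[OF c] transl_closed lm_mult sandwich_closed[OF c])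
 qed
 also have "\<dots> = rm y (\<psi> (ctensor P H p (pr z)))"
  using pz y by (simp add: e sandwich_tb[OF c] lm_one rm_closed transl_closed \<psi>_tensor lm_rm)
 finally show "\<psi> (ctensor P H p (pr z) \<otimes>\<^bsub>PH.AB\<^esub> V) = rm y (\<psi> (ctensor P H p (pr z)))" .
qed

lemma \<psi>_coaction_T:
 assumes ij: "i \<in> N4" "j \<in> N4" shows "\<psi> (co (T i j)) = \<^bold>1 \<otimes>\<^sub>B T i j"
proof -
 interpret M: abelian_group M by (rule M_group)
 note [simp] = ij tb_simps(1)
 have "\<psi> (co (T i j)) = (\<Oplus>\<^bsub>M\<^esub>k\<in>N4. lm (T i k) (transl (T k j)))"
  by (simp add: coaction_T additive_map_finsum[OF PH.abelian_group_AB M_group \<psi>_additive] Pi_def)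
   (intro M.finsum_cong', simp_all add: T1_pr \<psi>_tensor lm_closed transl_closed)
 also have "\<dots> = (\<Oplus>\<^bsub>M\<^esub>k\<in>N4. \<Oplus>\<^bsub>M\<^esub>l\<in>N4. (T i k \<cdot> S k l) \<otimes>\<^sub>B T l j)"
  by (intro M.finsum_cong') (simp_all add: transl_T_shift(1)[symmetric])
 also have "\<dots> = (\<Oplus>\<^bsub>M\<^esub>l\<in>N4. \<Oplus>\<^bsub>M\<^esub>k\<in>N4. (T i k \<cdot> S k l) \<otimes>\<^sub>B T l j)"
  by (intro M.finsum_finsum_swap) simp_all
 also have "\<dots> = (\<Oplus>\<^bsub>M\<^esub>l\<in>N4. (if i = l then \<^bold>1 else \<^bold>0) \<otimes>\<^sub>B T l j)"
  using frtD(3)[OF T_frt ij(1)] by (intro M.finsum_cong') (simp_all add: tb_finsum_left[symmetric] Pi_def)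
 also have "\<dots> = \<^bold>1 \<otimes>\<^sub>B T i j"
  by (subst M.finsum_single_term[of N4 i]) (simp_all add: tb_zero)
 finally show ?thesis .
qed

text \<open>On generators this is \<open>T S(T) = 1\<close>; products are handled by letting the second factor act
 from the right.\<close>

lemma \<psi>_coaction: "p \<in> carrier P ==> \<psi> (co p) = \<^bold>1 \<otimes>\<^sub>B p"
proof (induction p rule: P_induct)
 note coD = algebra_mapsD[OF coaction_hom]
 have scal: "\<psi> (ctensor P H (c \<^bold>* \<^bold>1) \<one>\<^bsub>H\<^esub>) = (c \<^bold>* \<^bold>1) \<otimes>\<^sub>B \<^bold>1" for c
  using \<psi>_tensor[of "c \<^bold>* \<^bold>1" "\<^bold>1"] by (simp add: algebra_mapsD[OF pr_hom] transl_one lm_tb)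
 {
  case one
  have "co \<^bold>1 = ctensor P H (1 \<^bold>* \<^bold>1) \<one>\<^bsub>H\<^esub>" by (simp add: coD PH.AB_one)
  then show ?case using scal[of 1] by simp
 next
  case (gen i j x) then show ?case
   by (simp add: coD \<psi>_mult[OF _ _ gen(3)] \<psi>_coaction_T rm_tb)
 next
  case (add x y) then show ?case by (simp add: coD additive_map_add[OF \<psi>_additive] tb_simps(3))
 next
  case (smult c x)
  have "co (c \<^bold>* x) = ctensor P H (c \<^bold>* \<^bold>1) \<one>\<^bsub>H\<^esub> \<otimes>\<^bsub>PH.AB\<^esub> co x"
   using smult by (simp add: smult_scal(1)[of x] coD PH.AB_one)
  then show ?case using smult
   by (simp add: \<psi>_mult[OF _ _ smult(1) smult(2)] coD scal rm_tb tb_scal P.smult_mult_left)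
 }
qed

lemma \<psi>_\<chi>: "m \<in> carrier M ==> \<psi> (\<chi> m) = m"
proof (rule tb_eqI[OF M_group additive_map_compose[OF \<chi>_additive \<psi>_additive], of "\<lambda>m. m"])
 fix x y assume xy: "x \<in> carrier P" "y \<in> carrier P"
 have xc: "ctensor P H x \<one>\<^bsub>H\<^esub> \<in> carrier PH.AB" using xy by simp
 have "\<psi> (ctensor P H x \<one>\<^bsub>H\<^esub> \<otimes>\<^bsub>PH.AB\<^esub> V) = lm x (\<psi> V)" if V: "V \<in> carrier PH.AB" for V
  by (rule PH_eqI[OF M_group additive_map_compose[OF PH.AB_mult_additive_right[OF xc] \<psi>_additive]
    additive_map_compose[OF \<psi>_additive lm_additive[OF xy(1)]] _ V])
   (use xy in \<open>simp add: algebra_mapsD[OF pr_hom] \<psi>_tensor lm_mult transl_closed\<close>)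
 then show "\<psi> (\<chi> (x \<otimes>\<^sub>B y)) = x \<otimes>\<^sub>B y"
  using xy by (simp add: \<chi>_tb algebra_mapsD[OF coaction_hom] \<psi>_coaction lm_tb)
qed (auto simp: hom_def)

lemma \<chi>_\<psi>: "U \<in> carrier PH.AB ==> \<chi> (\<psi> U) = U"
 by (rule PH_eqI[OF PH.abelian_group_AB additive_map_compose[OF \<psi>_additive \<chi>_additive], of "\<lambda>U. U"])
  (auto simp: hom_def \<psi>_tensor \<chi>_lm transl_closed \<chi>_transl algebra_mapsD[OF pr_hom])

lemma canonical_map_bij: "bij_betw \<chi> (carrier M) (carrier PH.AB)"
 by (rule bij_betw_byWitness[of _ \<psi>])
  (auto simp: \<psi>_\<chi> \<chi>_\<psi> additive_map_closed[OF \<chi>_additive] additive_map_closed[OF \<psi>_additive])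

end

section \<open>Twisted derivations from upper triangular matrices\<close>

text \<open>The algebra of upper triangular \<open>2 \<times> 2\<close> matrices with diagonal \<open>(a, d)\<close> and corner \<open>x\<close>.
 An algebra map \<open>p \<mapsto> (p, e p, g p)\<close> into it is the same as an algebra endomorphism \<open>g\<close>
 with a twisted derivation \<open>e (p p') = p e p' + e p g p'\<close>.\<close>

definition tri :: "(complex, 'a) module \<Rightarrow> (complex, 'a \<times> 'a \<times> 'a) module" where
 "tri A = \<lparr>carrier = carrier A \<times> carrier A \<times> carrier A,
   monoid.mult = (\<lambda>u w. (fst u \<otimes>\<^bsub>A\<^esub> fst w, fst u \<otimes>\<^bsub>A\<^esub> fst (snd w) \<oplus>\<^bsub>A\<^esub> fst (snd u) \<otimes>\<^bsub>A\<^esub> snd (snd w),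
    snd (snd u) \<otimes>\<^bsub>A\<^esub> snd (snd w))),
   one = (\<one>\<^bsub>A\<^esub>, \<zero>\<^bsub>A\<^esub>, \<one>\<^bsub>A\<^esub>), ring.zero = (\<zero>\<^bsub>A\<^esub>, \<zero>\<^bsub>A\<^esub>, \<zero>\<^bsub>A\<^esub>),
   add = (\<lambda>u w. (fst u \<oplus>\<^bsub>A\<^esub> fst w, fst (snd u) \<oplus>\<^bsub>A\<^esub> fst (snd w), snd (snd u) \<oplus>\<^bsub>A\<^esub> snd (snd w))),
   module.smult = (\<lambda>c u. (c \<odot>\<^bsub>A\<^esub> fst u, c \<odot>\<^bsub>A\<^esub> fst (snd u), c \<odot>\<^bsub>A\<^esub> snd (snd u)))\<rparr>"

lemma tri_simps [simp]:
 "carrier (tri A) = carrier A \<times> carrier A \<times> carrier A"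
 "(a, x, d) \<otimes>\<^bsub>tri A\<^esub> (a', x', d') = (a \<otimes>\<^bsub>A\<^esub> a', a \<otimes>\<^bsub>A\<^esub> x' \<oplus>\<^bsub>A\<^esub> x \<otimes>\<^bsub>A\<^esub> d', d \<otimes>\<^bsub>A\<^esub> d')"
 "(a, x, d) \<oplus>\<^bsub>tri A\<^esub> (a', x', d') = (a \<oplus>\<^bsub>A\<^esub> a', x \<oplus>\<^bsub>A\<^esub> x', d \<oplus>\<^bsub>A\<^esub> d')"
 "c \<odot>\<^bsub>tri A\<^esub> (a, x, d) = (c \<odot>\<^bsub>A\<^esub> a, c \<odot>\<^bsub>A\<^esub> x, c \<odot>\<^bsub>A\<^esub> d)"
 "\<one>\<^bsub>tri A\<^esub> = (\<one>\<^bsub>A\<^esub>, \<zero>\<^bsub>A\<^esub>, \<one>\<^bsub>A\<^esub>)" "\<zero>\<^bsub>tri A\<^esub> = (\<zero>\<^bsub>A\<^esub>, \<zero>\<^bsub>A\<^esub>, \<zero>\<^bsub>A\<^esub>)"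
 by (simp_all add: tri_def)

lemma (in ualg) ualg_tri: "ualg (tri A)"
proof (intro ualg.intro unital_algebraI)
 show "ring (tri A)"
 proof (intro ringI abelian_groupI monoidI)
  fix x assume "x \<in> carrier (tri A)"
  then show "\<exists>y\<in>carrier (tri A). y \<oplus>\<^bsub>tri A\<^esub> x = \<zero>\<^bsub>tri A\<^esub>"
   by (intro bexI[of _ "(\<ominus> fst x, \<ominus> fst (snd x), \<ominus> snd (snd x))"]) (auto simp: l_neg)
 qed (auto simp: m_assoc a_assoc a_comm a_lcomm l_distr r_distr)
qed (auto simp: smult_l_distr smult_r_distr smult_assoc smult_mult_left smult_mult_right)

lemma (in ualg) tri_projections:
 "fst \<in> algebra_maps (tri A) A" "(\<lambda>z. snd (snd z)) \<in> algebra_maps (tri A) A"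
 "(\<lambda>z. fst (snd z)) \<in> additive_maps (tri A) A"
 by (intro algebra_mapsI additive_mapsI; auto)+

lemma (in ualg) tri_finsum:
 assumes f: "f \<in> J \<rightarrow> carrier (tri A)"
 shows "finsum (tri A) f J = (\<Oplus>j\<in>J. fst (f j), \<Oplus>j\<in>J. fst (snd (f j)), \<Oplus>j\<in>J. snd (snd (f j)))"
proof -
 interpret T: ualg "tri A" by (rule ualg_tri)
 note ag = T.abelian_group_axioms abelian_group_axioms
 show ?thesis
  using additive_map_finsum[OF ag alg_map_additive[OF tri_projections(1)] f]
   additive_map_finsum[OF ag alg_map_additive[OF tri_projections(2)] f]
   additive_map_finsum[OF ag tri_projections(3) f] by (simp add: prod_eq_iff)
qed

lemma tri_map:
 assumes "ualg A" "ualg C" "h \<in> algebra_maps A C"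
 shows "(\<lambda>z. (h (fst z), h (fst (snd z)), h (snd (snd z)))) \<in> algebra_maps (tri A) (tri C)"
 using algebra_mapsD[OF assms(3)] ring.ring_simprules(2)[OF ualg.ring_A[OF assms(1)]] alg_map_zero[OF assms]
 by (intro algebra_mapsI) (auto simp: ualg.ring_A[OF assms(1)] ring.ring_simprules)

lemma finsum_complex: "finite J ==> finsum complex_algebra f J = sum f J"
proof (induction J rule: finite_induct)
 case empty
 interpret C: ualg complex_algebra by (rule ualg_complex)
 show ?case by simp
next
 case (insert x F)
 interpret C: ualg complex_algebra by (rule ualg_complex)
 from insert show ?case by simp
qed

text \<open>The matrix of the element \<open>u E + v F\<close> of the dual quantum group, with its group-like twist,
 in the fundamental representation.\<close>

definition Lnil :: "complex \<Rightarrow> complex \<Rightarrow> nat \<Rightarrow> complex" where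
 "Lnil u v j = (if j = 2 then v else if j = 3 then u else 0)"

definition Ltwist :: "real \<Rightarrow> nat \<Rightarrow> complex" where
 "Ltwist q j = (if j = 2 then inverse (of_real q) ^ 2 else if j = 3 then of_real q ^ 2 else 1)"

definition Lmat :: "real \<Rightarrow> complex \<Rightarrow> complex \<Rightarrow> nat \<Rightarrow> nat \<Rightarrow> complex \<times> complex \<times> complex" where
 "Lmat q u v i j = (if i = j then 1 else 0, if i = 5 - j then Lnil u v j else 0, if i = j then Ltwist q j else 0)"

lemma Rcoef_nonzero: "Rcoef q i k a b \<noteq> 0 ==> i = a \<and> k = b \<or> i = b \<and> k = a \<or> k = 5 - i \<and> b = 5 - a"
 by (auto simp: Rcoef_def split: if_splits)

text \<open>\<open>R\<close> preserves the weights of the torus, in which the twist lies.\<close>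

lemma Ltwist_exchange:
 assumes "q \<noteq> 0" "i \<in> N4" "k \<in> N4" "j \<in> N4" "l \<in> N4"
 shows "Ltwist q j * Ltwist q l * Rcoef q i k j l = Ltwist q i * Ltwist q k * Rcoef q i k j l"
proof -
 have inv: "Ltwist q i * Ltwist q (5 - i) = 1" if "i \<in> N4" for i
  using N4_cases[OF that] assms(1) by (auto simp: Ltwist_def power_inverse)
 show ?thesis
  using Rcoef_nonzero[of q i k j l] inv[OF assms(2)] inv[OF assms(4)]
  by (cases "Rcoef q i k j l = 0") (auto simp: mult.commute)
qed

text \<open>The corner component of the relations. Since the nilpotent part has only the entries
 \<open>(2, 3)\<close> and \<open>(3, 2)\<close>, both double sums collapse and 256 identities in \<open>q\<close> remain.\<close>

lemma Lnil_exchange: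
 assumes "q \<noteq> 0" "i \<in> N4" "k \<in> N4" "j \<in> N4" "l \<in> N4"
 shows "Lnil u v l * Rcoef q i k j (5 - l) + Lnil u v j * Ltwist q l * Rcoef q i k (5 - j) l =
  Lnil u v (5 - i) * Rcoef q (5 - i) k j l + Lnil u v (5 - k) * Ltwist q i * Rcoef q i (5 - k) j l"
proof -
 define Q where "Q = complex_of_real q"
 define W where "W i a = Q powi (rho_wt i - rho_wt a) * eps_sign i * eps_sign a" for i a
 have W: "W 2 1 = inverse Q" "W 3 1 = - (inverse Q ^ 3)" "W 4 1 = - (inverse Q ^ 4)"
  "W 3 2 = - (inverse Q ^ 2)" "W 4 2 = - (inverse Q ^ 3)" "W 4 3 = inverse Q"
  by (simp_all add: W_def rho_wt_def eps_sign_def power_int_minus power_inverse)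
 have R: "Rcoef q i k a b =
   (if i = a \<and> k = b then (if i = k then Q else if k = 5 - i then inverse Q else 1) else 0)
  + (if i = b \<and> k = a \<and> a < i then Q - inverse Q else 0)
  - (if k = 5 - i \<and> b = 5 - a \<and> a < i then (Q - inverse Q) * W i a else 0)" for i k a b
  unfolding Rcoef_def W_def Q_def ..
 have Q: "Q \<noteq> 0" using assms(1) by (simp add: Q_def)
 have T: "Ltwist q j = (if j = 2 then inverse Q ^ 2 else if j = 3 then Q ^ 2 else 1)" for j
  by (simp add: Ltwist_def Q_def)
 have E: "Q * inverse Q = 1" "inverse Q * Q = 1" using Q by simp_all
 show ?thesis
  using N4_cases[OF assms(2)] N4_cases[OF assms(3)] N4_cases[OF assms(4)] N4_cases[OF assms(5)]
  unfolding R T Lnil_def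
  by (elim disjE) (simp_all add: W cong: if_cong del: diff_numeral_special,
   (use Q in \<open>simp add: field_simps power2_eq_square power3_eq_cube\<close>)+)
qed

lemma sum_delta_delta:
 fixes R :: "nat \<Rightarrow> nat \<Rightarrow> complex"
 assumes "a \<in> N4" "b \<in> N4"
 shows "(\<Sum>i\<in>N4. \<Sum>j\<in>N4. R i j * ((if i = a then x else 0) * (if j = b then y else 0))) = R a b * (x * y)"
proof -
 have "(\<Sum>j\<in>N4. R i j * ((if i = a then x else 0) * (if j = b then y else 0))) = (if i = a then R a b * (x * y) else 0)" for i
  using assms by (subst sum_single_term[of N4 b]) simp_all
 then show ?thesis using assms by simp
qed

lemma tri_complex_finsum:
 assumes "finite J"
 shows "finsum (tri complex_algebra) (\<lambda>j. (f j, g j, h j)) J = (\<Sum>j\<in>J. f j, \<Sum>j\<in>J. g j, \<Sum>j\<in>J. h j)"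
 using assms by (subst ualg.tri_finsum[OF ualg_complex]) (simp_all add: finsum_complex)

lemma prime_eq_iff: "i \<in> N4 ==> j \<in> N4 ==> (i = 5 - j) = (j = 5 - i)"
 using N4_prime(2) by metis

text \<open>The two diagonal components are matrices of characters of the quantum group, and the corner is
 the twisted derivation rule for \<open>u E + v F\<close>.\<close>

lemma Lmat_frt:
 assumes q: "q \<noteq> 0" shows "frt q (tri complex_algebra) (Lmat q u v)"
proof (rule frtI)
 fix i k j l assume idx: "i \<in> N4" "k \<in> N4" "j \<in> N4" "l \<in> N4"
 note p = N4_prime[OF idx(1)] N4_prime[OF idx(2)] N4_prime[OF idx(3)] N4_prime[OF idx(4)]
 have kp': "(if k = 5 - b then Lnil u v b else 0) = (if b = 5 - k then Lnil u v (5 - k) else 0)" if "b \<in> N4" for b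
  using prime_eq_iff[OF idx(2) that] idx by auto
 have ip': "(if i = 5 - a then Lnil u v a else 0) = (if a = 5 - i then Lnil u v (5 - i) else 0)" if "a \<in> N4" for a
  using prime_eq_iff[OF idx(1) that] idx by auto
 have w: "(if k = b then Ltwist q b else 0) = (if b = k then Ltwist q k else 0)"
  "(if k = b then 1 else 0) = (if b = k then 1 else (0 :: complex))"
  "(if i = b then Ltwist q b else 0) = (if b = i then Ltwist q i else 0)"
  "(if i = b then 1 else 0) = (if b = i then 1 else (0 :: complex))" for b by auto
 have "(\<Sum>a\<in>N4. \<Sum>b\<in>N4. Rcoef q a b j l * ((if k = b then 1 else 0) * (if i = a then 1 else 0))) =
   (\<Sum>a\<in>N4. \<Sum>b\<in>N4. Rcoef q a b j l * ((if a = i then 1 else 0) * (if b = k then 1 else 0)))"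
  by (intro sum.cong refl) (simp add: eq_commute[of k] eq_commute[of i])
 then have "(\<Sum>a\<in>N4. \<Sum>b\<in>N4. Rcoef q i k a b * ((if a = j then 1 else 0) * (if b = l then 1 else 0))) =
   (\<Sum>a\<in>N4. \<Sum>b\<in>N4. Rcoef q a b j l * ((if k = b then 1 else 0) * (if i = a then 1 else 0)))"
  by (simp only: sum_delta_delta idx p)
 moreover have "(\<Sum>a\<in>N4. \<Sum>b\<in>N4. Rcoef q i k a b * ((if a = j then Ltwist q j else 0) * (if b = l then Ltwist q l else 0))) =
   (\<Sum>a\<in>N4. \<Sum>b\<in>N4. Rcoef q a b j l * ((if k = b then Ltwist q b else 0) * (if i = a then Ltwist q a else 0)))"
 proof -
  have "(\<Sum>a\<in>N4. \<Sum>b\<in>N4. Rcoef q a b j l * ((if k = b then Ltwist q b else 0) * (if i = a then Ltwist q a else 0))) =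
    (\<Sum>a\<in>N4. \<Sum>b\<in>N4. Rcoef q a b j l * ((if a = i then Ltwist q i else 0) * (if b = k then Ltwist q k else 0)))"
   by (intro sum.cong refl) (auto split: if_splits)
  then show ?thesis
   using Ltwist_exchange[OF q idx] by (simp only: sum_delta_delta idx p) (simp add: mult_ac)
 qed
 moreover have "(\<Sum>a\<in>N4. \<Sum>b\<in>N4. Rcoef q i k a b * ((if a = j then 1 else 0) * (if b = 5 - l then Lnil u v l else 0) +
    (if a = 5 - j then Lnil u v j else 0) * (if b = l then Ltwist q l else 0))) =
   (\<Sum>a\<in>N4. \<Sum>b\<in>N4. Rcoef q a b j l * ((if k = b then 1 else 0) * (if i = 5 - a then Lnil u v a else 0) +
    (if k = 5 - b then Lnil u v b else 0) * (if i = a then Ltwist q a else 0)))"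
 proof -
  have "(\<Sum>a\<in>N4. \<Sum>b\<in>N4. Rcoef q a b j l * ((if k = b then 1 else 0) * (if i = 5 - a then Lnil u v a else 0) +
    (if k = 5 - b then Lnil u v b else 0) * (if i = a then Ltwist q a else 0))) =
   (\<Sum>a\<in>N4. \<Sum>b\<in>N4. Rcoef q a b j l * ((if a = 5 - i then Lnil u v (5 - i) else 0) * (if b = k then 1 else 0) +
    (if a = i then Ltwist q i else 0) * (if b = 5 - k then Lnil u v (5 - k) else 0)))"
  proof (intro sum.cong refl)
   fix a b assume ab: "a \<in> N4" "b \<in> N4"
   show "Rcoef q a b j l * ((if k = b then 1 else 0) * (if i = 5 - a then Lnil u v a else 0) +
     (if k = 5 - b then Lnil u v b else 0) * (if i = a then Ltwist q a else 0)) =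
    Rcoef q a b j l * ((if a = 5 - i then Lnil u v (5 - i) else 0) * (if b = k then 1 else 0) +
     (if a = i then Ltwist q i else 0) * (if b = 5 - k then Lnil u v (5 - k) else 0))"
    unfolding kp'[OF ab(2)] ip'[OF ab(1)] by (cases "a = i"; cases "b = k"; simp)
  qed
  then show ?thesis
   using Lnil_exchange[OF q idx, of u v]
   by (simp only: distrib_left sum.distrib sum_delta_delta idx p) (simp add: mult_ac)
 qed
 ultimately show "(\<Oplus>\<^bsub>tri complex_algebra\<^esub>a\<in>N4. \<Oplus>\<^bsub>tri complex_algebra\<^esub>b\<in>N4.
   Rcoef q i k a b \<odot>\<^bsub>tri complex_algebra\<^esub> (Lmat q u v a j \<otimes>\<^bsub>tri complex_algebra\<^esub> Lmat q u v b l)) =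
  (\<Oplus>\<^bsub>tri complex_algebra\<^esub>a\<in>N4. \<Oplus>\<^bsub>tri complex_algebra\<^esub>b\<in>N4.
   Rcoef q a b j l \<odot>\<^bsub>tri complex_algebra\<^esub> (Lmat q u v k b \<otimes>\<^bsub>tri complex_algebra\<^esub> Lmat q u v i a))"
  by (simp only: Lmat_def tri_simps complex_algebra_simps tri_complex_finsum finite_atLeastAtMost prod.inject simp_thms)
next
 fix i j assume "i \<in> N4" "j \<in> N4"
 note c = N4_cases[OF this(1)] N4_cases[OF this(2)]
 have s: "(\<Sum>k\<in>N4. f k) = f 1 + f 2 + f 3 + f 4" for f :: "nat \<Rightarrow> complex"
 proof -
  have "N4 = {1, 2, 3, 4}" using N4_cases by auto
  then show ?thesis by (simp add: add.assoc)
 qed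
 have Q: "complex_of_real q \<noteq> 0" using q by simp
 show "(\<Oplus>\<^bsub>tri complex_algebra\<^esub>k\<in>N4. Lmat q u v i k \<otimes>\<^bsub>tri complex_algebra\<^esub> antip q (tri complex_algebra) (Lmat q u v) k j) =
   (if i = j then \<one>\<^bsub>tri complex_algebra\<^esub> else \<zero>\<^bsub>tri complex_algebra\<^esub>)"
  "(\<Oplus>\<^bsub>tri complex_algebra\<^esub>k\<in>N4. antip q (tri complex_algebra) (Lmat q u v) i k \<otimes>\<^bsub>tri complex_algebra\<^esub> Lmat q u v k j) =
   (if i = j then \<one>\<^bsub>tri complex_algebra\<^esub> else \<zero>\<^bsub>tri complex_algebra\<^esub>)"
  unfolding antip_def Lmat_def tri_simps complex_algebra_simps tri_complex_finsum[OF finite_atLeastAtMost] s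
  using c Q by (elim disjE; simp add: Scoef_eq[OF q] rho_wt_def eps_sign_def Lnil_def Ltwist_def
    power_int_minus power2_eq_square flip: One_nat_def; simp add: field_simps)+
qed (simp add: Lmat_def)

text \<open>Left \<open>K\<close>-linear combinations of \<open>Z\<close>. The inductive form allows facts about them to be
 proved one summand at a time.\<close>

inductive_set left_span :: "('a, 'k) ring_scheme \<Rightarrow> 'a set \<Rightarrow> 'a set \<Rightarrow> 'a set" for A K Z where
 Bspan_zero: "\<zero>\<^bsub>A\<^esub> \<in> left_span A K Z"
| Bspan_gen: "b \<in> K ==> x \<in> Z ==> b \<otimes>\<^bsub>A\<^esub> x \<in> left_span A K Z"
| Bspan_add: "x \<in> left_span A K Z ==> y \<in> left_span A K Z ==> x \<oplus>\<^bsub>A\<^esub> y \<in> left_span A K Z"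

lemmas Bspan_zero = left_span.Bspan_zero and Bspan_gen = left_span.Bspan_gen and Bspan_add = left_span.Bspan_add

context spq
begin

lemma unit_hom: "(\<lambda>c. c \<^bold>* \<^bold>1) \<in> algebra_maps complex_algebra P"
 by (intro algebra_mapsI) (simp_all add: P.smult_l_distr P.smult_mult_left P.smult_assoc)

lemma diag_hom: "(\<lambda>p. (p, \<^bold>0, p)) \<in> algebra_maps P (tri P)"
 by (intro algebra_mapsI) simp_all

text \<open>The product of \<open>T\<close> with the scalar matrix of \<open>u E + v F\<close>; it yields the action of this element
 on \<open>A(Sp\<^sub>q(2))\<close>.\<close>

definition Umat :: "complex \<Rightarrow> complex \<Rightarrow> nat \<Rightarrow> nat \<Rightarrow> spq \<times> spq \<times> spq" where
 "Umat u v i j = (T i j, Lnil u v j \<^bold>* T i (5 - j), Ltwist q j \<^bold>* T i j)"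

lemma Umat_frt: "frt q (tri P) (Umat u v)"
proof -
 interpret TP: ualg "tri P" by (rule P.ualg_tri)
 let ?W = "\<lambda>i j. ((if i = j then 1 else 0) \<^bold>* \<^bold>1, (if i = 5 - j then Lnil u v j else 0) \<^bold>* \<^bold>1,
  (if i = j then Ltwist q j else 0) \<^bold>* \<^bold>1)"
 have W: "frt q (tri P) ?W"
  using frt_map[OF ualg.ualg_tri[OF ualg_complex] P.ualg_tri tri_map[OF ualg_complex P.ualg_axioms unit_hom] Lmat_frt[OF q0, of u v]]
  unfolding Lmat_def fst_conv snd_conv .
 have D: "frt q (tri P) (\<lambda>i j. (T i j, \<^bold>0, T i j))"
  by (rule frt_map[OF P.ualg_axioms P.ualg_tri diag_hom T_frt])
 have "frt q (tri P) (\<lambda>i j. \<Oplus>\<^bsub>tri P\<^esub>k\<in>N4. (T i k, \<^bold>0, T i k) \<otimes>\<^bsub>tri P\<^esub> ?W k j)"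
  by (rule TP.frt_mult[OF D W q0]) (simp add: P.smult_mult_left P.smult_mult_right)
 then show ?thesis
 proof (rule TP.frt_cong)
  fix i j assume ij: "i \<in> N4" "j \<in> N4"
  have s: "(\<Oplus>\<^bsub>P\<^esub>k\<in>N4. (if k = j0 then c else 0) \<^bold>* T i k) = c \<^bold>* T i j0" if "j0 \<in> N4" for c j0
   using ij that by (subst P.finsum_single_term[of N4 j0]) simp_all
  show "Umat u v i j = (\<Oplus>\<^bsub>tri P\<^esub>k\<in>N4. (T i k, \<^bold>0, T i k) \<otimes>\<^bsub>tri P\<^esub> ?W k j)"
   using ij s[OF ij(2), of 1] s[OF ij(2), of "Ltwist q j"] s[OF N4_prime(1)[OF ij(2)], of "Lnil u v j"]
   by (subst P.tri_finsum) (simp_all add: Umat_def Pi_def P.smult_mult_right cong: P.finsum_cong)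
 qed
qed

definition "Dmap u v = quot_lift (free_hom (tri P) (\<lambda>(i, j). Umat u v i j))"
definition "der u v p = fst (snd (Dmap u v p))"

lemma Dmap_hom: "Dmap u v \<in> algebra_maps P (tri P)"
 and Dmap_T: "i \<in> N4 ==> j \<in> N4 ==> Dmap u v (T i j) = Umat u v i j"
 unfolding Dmap_def using P_hom[OF P.ualg_tri, of "\<lambda>(i, j). Umat u v i j"] Umat_frt by simp_all

lemma Dmap_fst: "p \<in> carrier P ==> fst (Dmap u v p) = p"
 by (rule P_unique[OF P.ualg_axioms alg_map_compose[OF Dmap_hom P.tri_projections(1)] alg_map_id(2)])
  (simp_all add: Dmap_T Umat_def)

lemma Dmap_mult: "x \<in> carrier P ==> y \<in> carrier P ==>
  Dmap u v (x \<cdot> y) = (x \<cdot> y, x \<cdot> der u v y \<^bold>+ der u v x \<cdot> snd (snd (Dmap u v y)),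
   snd (snd (Dmap u v x)) \<cdot> snd (snd (Dmap u v y)))"
 using Dmap_fst[of x u v] Dmap_fst[of y u v]
 by (cases "Dmap u v x"; cases "Dmap u v y") (simp add: alg_map_mult[OF Dmap_hom] der_def)

lemma der_additive: "der u v \<in> additive_maps P P"
 unfolding der_def[abs_def] by (rule additive_map_compose[OF alg_map_additive[OF Dmap_hom] P.tri_projections(3)])

lemmas der_closed [simp] = additive_map_closed[OF der_additive]

text \<open>The derivations vanish and the twist is trivial on the columns 1 and 4, which generate \<open>B\<close>.\<close>

lemma Dmap_B: "b \<in> B ==> Dmap u v b = (b, \<^bold>0, b)"
proof (induction b rule: AS7_induct)
 case (gen i c)
 then have "c \<in> N4" "Lnil u v c = 0" "Ltwist q c = 1" by (auto simp: Lnil_def Ltwist_def)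
 then show ?case using gen by (simp add: Dmap_T Umat_def)
qed (simp_all add: algebra_mapsD[OF Dmap_hom] B_carrier)

lemma der_B: "b \<in> B ==> der u v b = \<^bold>0"
 by (simp add: der_def Dmap_B)

lemma der_left: "b \<in> B ==> x \<in> carrier P ==> der u v (b \<cdot> x) = b \<cdot> der u v x"
 using algebra_mapsD(1)[OF Dmap_hom, of x u v]
 by (simp add: der_def[of _ _ "b \<cdot> x"] Dmap_mult B_carrier der_B mem_Times_iff)

lemma der_right: "b \<in> B ==> x \<in> carrier P ==> der u v (x \<cdot> b) = der u v x \<cdot> b"
 by (simp add: der_def[of _ _ "x \<cdot> b"] Dmap_mult B_carrier der_B Dmap_B)

lemma der_T: "x \<in> carrier P ==> i \<in> N4 ==> j \<in> N4 ==>
  der u v (x \<cdot> T i j) = Lnil u v j \<^bold>* (x \<cdot> T i (5 - j)) \<^bold>+ Ltwist q j \<^bold>* (der u v x \<cdot> T i j)"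
 by (simp add: der_def[of _ _ "x \<cdot> T i j"] Dmap_mult) (simp add: der_def[of _ _ "T i j"] Dmap_T Umat_def P.smult_mult_right)

lemma der_smult: "x \<in> carrier P ==> der u v (c \<^bold>* x) = c \<^bold>* der u v x"
 using der_left[OF scal_B, of x u v c] by (simp add: P.smult_mult_left)

section \<open>The filtration by the number of inner columns\<close>

abbreviation "Bspan Z \<equiv> left_span P B Z"

lemma Bspan_carrier: "Z \<subseteq> carrier P ==> p \<in> Bspan Z ==> p \<in> carrier P"
 by (erule left_span.induct) (auto simp: B_carrier subset_iff)

lemma Bspan_map:
 assumes Z: "Z \<subseteq> carrier P" and h: "h \<in> additive_maps P P"
  and lin: "\<And>b x. b \<in> B ==> x \<in> carrier P ==> h (b \<cdot> x) = b \<cdot> h x"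
  and Y: "Y \<subseteq> carrier P" and XY: "\<And>x. x \<in> Z ==> h x \<in> Bspan Y"
  and p: "p \<in> Bspan Z"
 shows "h p \<in> Bspan Y"
proof -
 have left: "b \<cdot> y \<in> Bspan Y" if b: "b \<in> B" and y: "y \<in> Bspan Y" for b y
  using y
 proof induction
  case (Bspan_gen b' x)
  then have "b \<cdot> b' \<cdot> x \<in> Bspan Y" using b by (intro left_span.Bspan_gen) (simp_all add: AS7_closed)
  then show ?case using b Bspan_gen Y by (simp add: P.m_assoc B_carrier subset_iff)
 qed (use b Bspan_carrier[OF Y] in \<open>simp_all add: B_carrier P.r_distr left_span.Bspan_zero left_span.Bspan_add\<close>)
 from p show ?thesis
 proof induction
  case Bspan_zero
  then show ?case using additive_map_zero[OF P.abelian_group_axioms P.abelian_group_axioms h] by (simp add: left_span.Bspan_zero)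
 next
  case (Bspan_gen b x)
  then show ?case using Z lin left XY by (simp add: subset_iff)
 next
  case (Bspan_add x y)
  then show ?case using Bspan_carrier[OF Z] by (simp add: additive_map_add[OF h] left_span.Bspan_add)
 qed
qed

lemma Bspan_mono: "Z \<subseteq> Bspan Y ==> Z \<subseteq> carrier P ==> Y \<subseteq> carrier P ==> p \<in> Bspan Z ==> p \<in> Bspan Y"
 by (rule Bspan_map[of Z "\<lambda>x. x"]) (auto intro: additive_mapsI)

lemma Bspan_sub: "Z \<subseteq> carrier P ==> x \<in> Z ==> x \<in> Bspan Z"
 using Bspan_gen[OF AS7_closed(2), of x Z P] by (auto simp: subset_iff)

lemma Bspan_left: "Z \<subseteq> carrier P ==> b \<in> B ==> p \<in> Bspan Z ==> b \<cdot> p \<in> Bspan Z"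
proof (erule left_span.induct)
 fix b' x assume "Z \<subseteq> carrier P" "b \<in> B" "b' \<in> B" "x \<in> Z"
 then show "b \<cdot> (b' \<cdot> x) \<in> Bspan Z"
  using Bspan_gen[of "b \<cdot> b'" B x Z P] by (simp add: P.m_assoc B_carrier subset_iff AS7_closed)
qed (simp_all add: B_carrier P.r_distr Bspan_zero Bspan_add Bspan_carrier)

lemma Bspan_smult: "Z \<subseteq> carrier P ==> p \<in> Bspan Z ==> c \<^bold>* p \<in> Bspan Z"
 using Bspan_left[OF _ scal_B, of Z p c] by (simp add: P.smult_mult_left Bspan_carrier)

lemma Bspan_minus: "Z \<subseteq> carrier P ==> p \<in> Bspan Z ==> \<ominus>\<^bsub>P\<^esub> p \<in> Bspan Z"
 using Bspan_smult[of Z p "- 1"] P.smult_minus[of p 1] by (simp add: Bspan_carrier)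

lemma Bspan_finsum:
 assumes "Z \<subseteq> carrier P"
 shows "finite J ==> (\<And>j. j \<in> J ==> f j \<in> Bspan Z) ==> (\<Oplus>\<^bsub>P\<^esub>j\<in>J. f j) \<in> Bspan Z"
proof (induct J rule: finite_induct)
 case (insert j J)
 then show ?case by (simp add: Bspan_carrier[OF assms] Pi_def Bspan_add)
qed (simp add: Bspan_zero)

fun word :: "(nat \<times> nat) list \<Rightarrow> spq" where
 "word [] = \<^bold>1"
| "word ((i, c) # w) = word w \<cdot> T i c"

text \<open>Words of length less than \<open>n\<close>, so that \<open>Fil 0\<close> is zero and \<open>Fil 1\<close> is \<open>B\<close>; this offset
 makes zero the start of all inductions.\<close>

definition inner_words :: "nat \<Rightarrow> spq set" where
 "inner_words n = {word w | w. set w \<subseteq> N4 \<times> {2, 3} \<and> length w < n}"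

abbreviation "Fil n \<equiv> Bspan (inner_words n)"

lemma word_closed: "set w \<subseteq> N4 \<times> {2, 3} ==> word w \<in> carrier P"
 by (induction w rule: word.induct) auto

lemma inner_words_carrier: "inner_words n \<subseteq> carrier P" using word_closed by (auto simp: inner_words_def)

lemmas Fil_carrier = Bspan_carrier[OF inner_words_carrier]

lemma Fil_mono: assumes "m \<le> n" "p \<in> Fil m" shows "p \<in> Fil n"
proof (rule Bspan_mono[OF _ inner_words_carrier inner_words_carrier assms(2)])
 have "inner_words m \<subseteq> inner_words n" using assms(1) by (force simp: inner_words_def)
 then show "inner_words m \<subseteq> Fil n" using Bspan_sub[OF inner_words_carrier] by blast
qed

lemma word_Fil: "set w \<subseteq> N4 \<times> {2, 3} ==> length w < n ==> word w \<in> Fil n"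
 by (rule Bspan_sub[OF inner_words_carrier]) (auto simp: inner_words_def)

lemma Fil_T:
 assumes "p \<in> Fil n" "i \<in> N4" "c \<in> {2, 3}" shows "p \<cdot> T i c \<in> Fil (Suc n)"
proof (rule Bspan_map[OF inner_words_carrier P.mult_right_additive _ inner_words_carrier _ assms(1)])
 have c: "c \<in> N4" using assms by auto
 then show "T i c \<in> carrier P" using assms by simp
 show "b \<cdot> x \<cdot> T i c = b \<cdot> (x \<cdot> T i c)" if "b \<in> B" "x \<in> carrier P" for b x
  using that c assms by (simp add: P.m_assoc B_carrier)
 fix x assume "x \<in> inner_words n"
 then obtain w where "x = word w" "set w \<subseteq> N4 \<times> {2, 3}" "length w < n" by (auto simp: inner_words_def)
 then show "x \<cdot> T i c \<in> Fil (Suc n)" using word_Fil[of "(i, c) # w" "Suc n"] assms by simp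
qed

text \<open>The relations move a generator of the sphere to the left past an inner column. The
 correction has a border generator followed by an inner one, so the induction on the length of
 the word applies to it as well.\<close>

lemma word_outer:
 assumes "set w \<subseteq> N4 \<times> {2, 3}" "length w < n" "m \<in> N4" "c \<in> {1, 4}"
 shows "word w \<cdot> T m c \<in> Fil n"
 using assms
proof (induction w arbitrary: n m c rule: word.induct)
 case 1
 then have "T m c \<in> B" using AS7_closed(8,9) by auto
 then show ?case using Bspan_left[OF inner_words_carrier _ word_Fil[of "[]" n]] 1 by (simp add: B_carrier)
next
 case (2 k j w)
 then have w: "set w \<subseteq> N4 \<times> {2, 3}" and k: "k \<in> N4" and j: "j \<in> {2, 3}" and cN: "c \<in> N4" and jN: "j \<in> N4" by auto
 obtain n' where n: "n = Suc n'" "length w < n'" using 2(3) by (cases n) auto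
 note IH = 2(1)[OF w n(2)]
 have wc: "word w \<in> carrier P" using w by (rule word_closed)
 obtain \<kappa> where \<kappa>: "(\<Oplus>\<^bsub>P\<^esub>a\<in>N4. \<Oplus>\<^bsub>P\<^esub>b\<in>N4. Rcoef q m k a b \<^bold>* (T a c \<cdot> T b j)) =
   T k j \<cdot> T m c \<^bold>+ \<kappa> \<^bold>* (T k 1 \<cdot> T m j)"
  using exchange_right[OF 2(4) j 2(5)] k by blast
 let ?X = "\<Oplus>\<^bsub>P\<^esub>a\<in>N4. \<Oplus>\<^bsub>P\<^esub>b\<in>N4. Rcoef q m k a b \<^bold>* (T a c \<cdot> T b j)"
 let ?Y = "T k 1 \<cdot> T m j"
 note [simp] = wc k cN jN 2(4)
 have T: "T k j \<cdot> T m c = ?X \<ominus>\<^bsub>P\<^esub> \<kappa> \<^bold>* ?Y"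
  unfolding \<kappa> by (simp add: P.minus_eq P.a_assoc P.r_neg)
 have X: "word w \<cdot> ?X = (\<Oplus>\<^bsub>P\<^esub>a\<in>N4. \<Oplus>\<^bsub>P\<^esub>b\<in>N4. Rcoef q m k a b \<^bold>* (word w \<cdot> T a c \<cdot> T b j))"
  by (simp add: P.finsum_rdistr P.m_assoc P.smult_mult_right Pi_def cong: P.finsum_cong)
 have XF: "word w \<cdot> ?X \<in> Fil n"
  unfolding X n(1) using IH[OF _ 2(5)] j
  by (intro Bspan_finsum inner_words_carrier finite_atLeastAtMost Bspan_smult Fil_T)
 have YF: "word w \<cdot> ?Y \<in> Fil n"
  unfolding n(1) using Fil_T[OF IH[of k 1] 2(4) j] by (simp add: P.m_assoc)
 have E: "word ((k, j) # w) \<cdot> T m c = word w \<cdot> ?X \<^bold>+ \<ominus>\<^bsub>P\<^esub> (\<kappa> \<^bold>* (word w \<cdot> ?Y))"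
  by (simp add: P.m_assoc T P.minus_eq P.r_distr P.r_minus P.smult_mult_right)
 show ?case
  unfolding E by (rule Bspan_add[OF XF Bspan_minus[OF inner_words_carrier Bspan_smult[OF inner_words_carrier YF]]])
qed

lemma Fil_B:
 assumes "b \<in> B" "p \<in> Fil n" shows "p \<cdot> b \<in> Fil n"
 using assms
proof (induction b arbitrary: p rule: AS7_induct)
 case (gen i c)
 have c: "T i c \<in> carrier P" using gen by auto
 show ?case
 proof (rule Bspan_map[OF inner_words_carrier P.mult_right_additive[OF c] _ inner_words_carrier _ gen(3)])
  fix x assume "x \<in> inner_words n"
  then show "x \<cdot> T i c \<in> Fil n" using word_outer gen by (auto simp: inner_words_def)
 qed (use c in \<open>simp add: P.m_assoc B_carrier\<close>)
next
 case (mult x y) then show ?case using Fil_carrier by (simp add: P.m_assoc[symmetric] B_carrier)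
next
 case (smult c x) then show ?case
  using Fil_carrier Bspan_smult[OF inner_words_carrier] by (simp add: P.smult_mult_right B_carrier)
qed (use Fil_carrier in \<open>simp_all add: P.r_distr B_carrier Bspan_add\<close>)

text \<open>The union of the filtration contains 1 and is stable under right multiplication by all
 generators.\<close>

lemma Fil_exhausts: "p \<in> carrier P ==> \<exists>n. p \<in> Fil n"
proof -
 let ?U = "\<Union>n. Fil n"
 have U_add: "x \<^bold>+ y \<in> ?U" if xy: "x \<in> ?U" "y \<in> ?U" for x y
 proof -
  obtain m n where "x \<in> Fil m" "y \<in> Fil n" using xy by blast
  then have "x \<in> Fil (max m n)" "y \<in> Fil (max m n)" using Fil_mono by (meson max.cobounded1 max.cobounded2)+
  then have "x \<^bold>+ y \<in> Fil (max m n)" by (rule Bspan_add)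
  then show ?thesis by (rule UN_I[OF UNIV_I])
 qed
 have U_T: "x \<cdot> T i j \<in> ?U" if "x \<in> ?U" "i \<in> N4" "j \<in> N4" for x i j
 proof (cases "j \<in> {2, 3}")
  case True
  then show ?thesis using that Fil_T by blast
 next
  case False
  then have "j = 1 \<or> j = 4" using N4_cases[OF that(3)] by auto
  then have "T i j \<in> B" using AS7_closed(8,9)[OF that(2)] by auto
  then show ?thesis using that Fil_B by blast
 qed
 assume "p \<in> carrier P"
 then have "\<forall>x\<in>?U. x \<cdot> p \<in> ?U"
 proof (induction p rule: P_induct)
  case one then show ?case using Fil_carrier by (metis (no_types, lifting) P.r_one UN_E)
 next
  case (gen i j y)
  show ?case
  proof
   fix x assume x: "x \<in> ?U"
   then have "x \<in> carrier P" using Fil_carrier by blast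
   then have "x \<cdot> (T i j \<cdot> y) = (x \<cdot> T i j) \<cdot> y" using gen by (simp add: P.m_assoc)
   then show "x \<cdot> (T i j \<cdot> y) \<in> ?U" by (simp only:) (rule bspec[OF gen(4) U_T[OF x gen(1,2)]])
  qed
 next
  case (add y z)
  show ?case
  proof
   fix x assume x: "x \<in> ?U"
   then have "x \<in> carrier P" using Fil_carrier by blast
   then have "x \<cdot> (y \<^bold>+ z) = x \<cdot> y \<^bold>+ x \<cdot> z" using add by (simp add: P.r_distr)
   moreover have "x \<cdot> y \<in> ?U" "x \<cdot> z \<in> ?U" using add x by blast+
   ultimately show "x \<cdot> (y \<^bold>+ z) \<in> ?U" using U_add by simp
  qed
 next
  case (smult c y)
  show ?case
  proof
   fix x assume x: "x \<in> ?U"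
   then have "x \<in> carrier P" using Fil_carrier by blast
   then have "x \<cdot> (c \<^bold>* y) = c \<^bold>* (x \<cdot> y)" using smult by (simp add: P.smult_mult_right)
   moreover obtain n where "x \<cdot> y \<in> Fil n" using smult x by blast
   then have "c \<^bold>* (x \<cdot> y) \<in> Fil n" by (rule Bspan_smult[OF inner_words_carrier])
   ultimately show "x \<cdot> (c \<^bold>* y) \<in> ?U" by auto
  qed
 qed
 moreover have "\<^bold>1 \<in> ?U" using word_Fil[of "[]" 1] by (intro UN_I[of 1]) simp_all
 ultimately have "\<^bold>1 \<cdot> p \<in> ?U" by blast
 then show ?thesis using \<open>p \<in> carrier P\<close> by simp
qed

lemma Fil_one: "p \<in> Fil 1 ==> p \<in> B"
 by (erule left_span.induct) (auto simp: inner_words_def AS7_closed B_carrier)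

lemma Fil_zero: "p \<in> Fil 0 ==> p = \<^bold>0"
 by (erule left_span.induct) (auto simp: inner_words_def)

end

lemma (in abelian_group) solve_summand:
 assumes "a \<oplus> (x \<oplus> (y \<oplus> b)) = d" "a \<in> carrier G" "x \<in> carrier G" "y \<in> carrier G" "b \<in> carrier G"
 shows "y = (d \<ominus> a \<ominus> b) \<oplus> \<ominus> x"
proof -
 let ?s = "a \<oplus> (x \<oplus> b)"
 have d: "d = y \<oplus> ?s" using assms by (simp add: a_ac flip: assms(1))
 have "(d \<ominus> a \<ominus> b) \<oplus> \<ominus> x = d \<oplus> \<ominus> ?s"
  using assms d by (simp add: minus_eq minus_add a_assoc a_comm[of "\<ominus> b" "\<ominus> x"])
 also have "\<dots> = y" unfolding d using assms by (simp add: a_assoc[of y] r_neg)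
 finally show ?thesis by simp
qed

context spq
begin

text \<open>Congruence modulo the filtration.\<close>

definition cg :: "nat \<Rightarrow> spq \<Rightarrow> spq \<Rightarrow> bool" where
 "cg n x y \<longleftrightarrow> x \<in> carrier P \<and> y \<in> carrier P \<and> x \<ominus>\<^bsub>P\<^esub> y \<in> Fil n"

lemma cg_refl: "x \<in> carrier P ==> cg n x x"
 by (simp add: cg_def P.minus_eq P.r_neg Bspan_zero)

lemma cg_eq: "x = y ==> x \<in> carrier P ==> cg n x y"
 using cg_refl by simp

lemma cg_trans:
 assumes "cg n x y" "cg n y z" shows "cg n x z"
proof -
 have "(x \<ominus>\<^bsub>P\<^esub> y) \<^bold>+ (y \<ominus>\<^bsub>P\<^esub> z) \<in> Fil n" by (rule Bspan_add) (use assms in \<open>simp_all add: cg_def\<close>)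
 moreover have "(x \<ominus>\<^bsub>P\<^esub> y) \<^bold>+ (y \<ominus>\<^bsub>P\<^esub> z) = x \<ominus>\<^bsub>P\<^esub> z"
  using assms by (simp add: cg_def P.minus_eq P.a_assoc P.l_neg P.r_neg1 P.r_neg2)
 ultimately show ?thesis using assms by (simp add: cg_def)
qed

lemma cg_map:
 assumes "cg n x y" "h \<in> additive_maps P P" "\<And>z. z \<in> Fil n ==> h z \<in> Fil m"
 shows "cg m (h x) (h y)"
 using assms(1) assms(3)[of "x \<ominus>\<^bsub>P\<^esub> y"] additive_map_closed[OF assms(2)]
  additive_map_diff[OF P.abelian_group_axioms P.abelian_group_axioms assms(2), of x y]
 by (simp add: cg_def)

lemma cg_smult: "cg n x y ==> cg n (c \<^bold>* x) (c \<^bold>* y)"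
 by (rule cg_map[OF _ P.smult_additive Bspan_smult[OF inner_words_carrier]])

lemma cg_T: "cg n x y ==> i \<in> N4 ==> c \<in> {2, 3} ==> cg (Suc n) (x \<cdot> T i c) (y \<cdot> T i c)"
 by (rule cg_map[OF _ P.mult_right_additive Fil_T]) auto

lemma cg_add:
 assumes "cg n x y" "cg n x' y'" shows "cg n (x \<^bold>+ x') (y \<^bold>+ y')"
proof -
 have "(x \<ominus>\<^bsub>P\<^esub> y) \<^bold>+ (x' \<ominus>\<^bsub>P\<^esub> y') \<in> Fil n" by (rule Bspan_add) (use assms in \<open>simp_all add: cg_def\<close>)
 moreover have "(x \<ominus>\<^bsub>P\<^esub> y) \<^bold>+ (x' \<ominus>\<^bsub>P\<^esub> y') = (x \<^bold>+ x') \<ominus>\<^bsub>P\<^esub> (y \<^bold>+ y')"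
  using assms by (simp add: cg_def P.minus_eq P.a_ac P.minus_add)
 ultimately show ?thesis using assms by (simp add: cg_def)
qed

lemma cg_Fil: "x \<in> Fil n ==> cg n x \<^bold>0"
 by (simp add: cg_def P.minus_eq Fil_carrier)

lemma cg_span: "cg n x y ==> Z \<subseteq> carrier P ==> inner_words n \<subseteq> Z ==> y \<in> Bspan Z ==> x \<in> Bspan Z"
proof -
 assume a: "cg n x y" "Z \<subseteq> carrier P" "inner_words n \<subseteq> Z" "y \<in> Bspan Z"
 have "x \<ominus>\<^bsub>P\<^esub> y \<in> Bspan Z"
  by (rule Bspan_mono[of "inner_words n"]) (use a Bspan_sub[OF a(2)] in \<open>auto simp: cg_def inner_words_carrier[THEN subsetD]\<close>)
 then have "(x \<ominus>\<^bsub>P\<^esub> y) \<^bold>+ y \<in> Bspan Z" using a(4) by (rule Bspan_add)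
 then show ?thesis using a(1) by (simp add: cg_def P.minus_eq P.a_assoc P.l_neg)
qed

text \<open>The entry \<open>(i, 5 - j)\<close> of \<open>T S(T) = 1\<close> is a relation between \<open>T\<^sub>i\<^sup>2 T\<^sub>j\<^sup>3\<close>, \<open>T\<^sub>i\<^sup>3 T\<^sub>j\<^sup>2\<close> and
 two products of border generators, which are in \<open>B\<close>.\<close>

lemma column_exchange:
 assumes "i \<in> N4" "j \<in> N4"
 shows "\<exists>\<beta>\<in>B. T i 3 \<cdot> T j 2 = (inverse (of_real q) ^ 2) \<^bold>* (T i 2 \<cdot> T j 3) \<^bold>+ \<beta>"
proof -
 have N: "N4 = {1, 2, 3, 4}" using N4_cases by auto
 let ?s = "\<lambda>k. Scoef q k (5 - j)"
 let ?d = "if i = 5 - j then \<^bold>1 else \<^bold>0"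
 let ?x = "T i 2 \<cdot> T j 3" and ?y = "T i 3 \<cdot> T j 2"
 let ?b1 = "T i 1 \<cdot> T j 4" and ?b4 = "T i 4 \<cdot> T j 1"
 note [simp] = assms
 have B: "?b1 \<in> B" "?b4 \<in> B" using assms AS7_closed by simp_all
 have S: "S k (5 - j) = ?s k \<^bold>* T j (5 - k)" for k using assms by (simp add: antip_def)
 have "(\<Oplus>\<^bsub>P\<^esub>k\<in>N4. T i k \<cdot> S k (5 - j)) = ?d"
  using frtD(3)[OF T_frt assms(1) N4_prime(1)[OF assms(2)]] .
 moreover have "(\<Oplus>\<^bsub>P\<^esub>k\<in>N4. T i k \<cdot> S k (5 - j)) =
   ?s 1 \<^bold>* ?b1 \<^bold>+ (?s 2 \<^bold>* ?x \<^bold>+ (?s 3 \<^bold>* ?y \<^bold>+ ?s 4 \<^bold>* ?b4))"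
  unfolding S N using assms by (simp add: P.smult_mult_right flip: One_nat_def)
 ultimately have eq: "?s 1 \<^bold>* ?b1 \<^bold>+ (?s 2 \<^bold>* ?x \<^bold>+ (?s 3 \<^bold>* ?y \<^bold>+ ?s 4 \<^bold>* ?b4)) = ?d" by simp
 let ?\<gamma> = "?d \<ominus>\<^bsub>P\<^esub> ?s 1 \<^bold>* ?b1 \<ominus>\<^bsub>P\<^esub> ?s 4 \<^bold>* ?b4"
 have g: "?\<gamma> \<in> B" using B AS7_closed by (simp add: P.minus_eq)
 have "?s 3 \<^bold>* ?y = ?\<gamma> \<^bold>+ \<ominus>\<^bsub>P\<^esub> (?s 2 \<^bold>* ?x)"
  by (rule P.solve_summand[OF eq]) simp_all
 moreover have s: "?s 3 = - (of_real q ^ 2) * ?s 2" "?s 3 \<noteq> 0"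
 proof -
  have "Scoef q 3 2 = - (of_real q ^ 2)"
   using q0 by (simp add: Scoef_eq rho_wt_def eps_sign_def power2_eq_square)
  then show "?s 3 = - (of_real q ^ 2) * ?s 2"
   using Scoef_simps(4)[OF q0, of 3 "5 - j" 2] by simp
  show "?s 3 \<noteq> 0" using Scoef_simps(2)[OF q0, of "5 - j" 3] by auto
 qed
 ultimately have "?s 3 \<^bold>* ?y = ?\<gamma> \<^bold>+ (- ?s 2) \<^bold>* ?x"
  by (simp add: P.smult_minus)
 then have "inverse (?s 3) \<^bold>* (?s 3 \<^bold>* ?y) = inverse (?s 3) \<^bold>* (?\<gamma> \<^bold>+ (- ?s 2) \<^bold>* ?x)" by simp
 then have "?y = (inverse (?s 3) * - ?s 2) \<^bold>* ?x \<^bold>+ inverse (?s 3) \<^bold>* ?\<gamma>"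
  using s(2) B_carrier[OF g] by (simp add: P.smult_assoc P.smult_r_distr P.a_comm)
 moreover have "inverse (?s 3) * - ?s 2 = inverse (of_real q) ^ 2"
  using s q0 by (auto simp: field_simps)
 ultimately show ?thesis using AS7_closed(6)[OF g, of "inverse (?s 3)"] by metis
qed

text \<open>The normally ordered word with rows \<open>rs\<close>, whose last \<open>b\<close> columns are \<open>3\<close>
 and whose other columns are \<open>2\<close>; the list \<open>rs\<close> is read from right to left.\<close>

fun nword :: "nat list \<Rightarrow> nat \<Rightarrow> spq" where
 "nword [] b = \<^bold>1"
| "nword (i # rs) 0 = nword rs 0 \<cdot> T i 2"
| "nword (i # rs) (Suc b) = nword rs b \<cdot> T i 3"

lemma nword_word: "set rs \<subseteq> N4 ==> \<exists>w. nword rs b = word w \<and> set w \<subseteq> N4 \<times> {2, 3} \<and> length w = length rs"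
proof (induction rs b rule: nword.induct)
 case (1 b) then show ?case by (intro exI[of _ "[]"]) simp
next
 case (2 i rs)
 then obtain w where "nword rs 0 = word w \<and> set w \<subseteq> N4 \<times> {2, 3} \<and> length w = length rs" by auto
 then show ?case using 2(2) by (intro exI[of _ "(i, 2) # w"]) simp
next
 case (3 i rs b)
 then obtain w where "nword rs b = word w \<and> set w \<subseteq> N4 \<times> {2, 3} \<and> length w = length rs" by auto
 then show ?case using 3(2) by (intro exI[of _ "(i, 3) # w"]) simp
qed

lemma nword_closed: "set rs \<subseteq> N4 ==> nword rs b \<in> carrier P"
 using nword_word[of rs b] word_closed by auto

lemma nword_Fil: "set rs \<subseteq> N4 ==> length rs < n ==> nword rs b \<in> Fil n"
 using nword_word[of rs b] word_Fil by auto

abbreviation "Q \<equiv> complex_of_real q"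

text \<open>Moving the new column 2 to the left past \<open>b\<close> columns 3 costs a factor \<open>q\<^sup>-\<^sup>2\<close> for each of them, and
 elements of \<open>B\<close> that appear on the way only lower the length.\<close>

lemma straighten:
 "set rs \<subseteq> N4 ==> i \<in> N4 ==> b \<le> length rs ==>
  cg (Suc (length rs)) (nword rs b \<cdot> T i 2) ((inverse Q ^ (2 * b)) \<^bold>* nword (i # rs) b)"
proof (induction rs b arbitrary: i rule: nword.induct)
 case (3 j rs b)
 then have rs: "set rs \<subseteq> N4" and j: "j \<in> N4" and b: "b \<le> length rs" by simp_all
 let ?x = "nword rs b"
 note [simp] = j \<open>i \<in> N4\<close> nword_closed[OF rs]
 obtain \<beta> where \<beta>: "\<beta> \<in> B" "T j 3 \<cdot> T i 2 = (inverse Q ^ 2) \<^bold>* (T j 2 \<cdot> T i 3) \<^bold>+ \<beta>"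
  using column_exchange[OF j 3(3)] by blast
 have "?x \<cdot> T j 3 \<cdot> T i 2 = (inverse Q ^ 2) \<^bold>* (?x \<cdot> T j 2 \<cdot> T i 3) \<^bold>+ ?x \<cdot> \<beta>"
  using \<beta>(1) by (simp add: P.m_assoc \<beta>(2) P.r_distr B_carrier P.smult_mult_right)
 moreover have "cg (Suc (Suc (length rs))) (?x \<cdot> \<beta>) \<^bold>0"
  by (intro cg_Fil Fil_B \<beta> nword_Fil rs) simp
 moreover have "cg (Suc (Suc (length rs))) (?x \<cdot> T j 2 \<cdot> T i 3) ((inverse Q ^ (2 * b)) \<^bold>* nword (j # rs) b \<cdot> T i 3)"
  by (intro cg_T 3(1) rs j b) simp_all
 ultimately have "cg (Suc (Suc (length rs))) (?x \<cdot> T j 3 \<cdot> T i 2)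
   ((inverse Q ^ 2) \<^bold>* ((inverse Q ^ (2 * b)) \<^bold>* nword (j # rs) b \<cdot> T i 3) \<^bold>+ \<^bold>0)"
  by (simp only:) (intro cg_add cg_smult)
 then show ?case using nword_closed[of "j # rs" b] rs
  by (simp add: P.smult_mult_left P.smult_assoc power_add[symmetric] power2_eq_square mult.assoc)
qed (use nword_closed in \<open>auto intro!: cg_eq\<close>)

abbreviation "eop \<equiv> der 1 0"
abbreviation "fop \<equiv> der 0 1"

text \<open>The coefficients of the raising and the lowering operator on normal words, as they come out of
 the twisted Leibniz rule. Only their signs matter.\<close>

fun \<epsilon>c :: "real \<Rightarrow> nat \<Rightarrow> real" where
 "\<epsilon>c r 0 = 0"
| "\<epsilon>c r (Suc b) = inverse r ^ (2 * b) + r ^ 2 * \<epsilon>c r b"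

fun \<phi>c :: "real \<Rightarrow> nat \<Rightarrow> nat \<Rightarrow> real" where
 "\<phi>c r 0 b = 0"
| "\<phi>c r (Suc n) 0 = 1 + inverse r ^ 4 * \<phi>c r n 0"
| "\<phi>c r (Suc n) (Suc b) = r ^ 2 * \<phi>c r n b"

lemma \<epsilon>c_pos: "r \<noteq> 0 ==> \<epsilon>c r b \<ge> 0" "r \<noteq> 0 ==> \<epsilon>c r (Suc b) > 0"
proof -
 assume r: "r \<noteq> 0"
 show "\<epsilon>c r b \<ge> 0" by (induction b) (auto simp: power_mult)
 then show "\<epsilon>c r (Suc b) > 0" using r by (simp add: add_pos_nonneg power_mult)
qed

lemma \<phi>c_pos: "r \<noteq> 0 ==> b \<le> n ==> \<phi>c r n b \<ge> 0 \<and> (b < n \<longrightarrow> \<phi>c r n b > 0) \<and> \<phi>c r n n = 0"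
proof (induction r n b rule: \<phi>c.induct)
 case (2 r n)
 then have "0 \<le> \<phi>c r n 0" by simp
 then show ?case using 2 by (simp add: add_pos_nonneg)
qed auto

lemma eop_nword:
 "set rs \<subseteq> N4 ==> b \<le> length rs ==> cg (length rs) (eop (nword rs b)) (of_real (\<epsilon>c q b) \<^bold>* nword rs (b - 1))"
proof (induction rs b rule: nword.induct)
 case (1 b) then show ?case by (simp add: der_B AS7_closed cg_refl)
next
 case (2 i rs)
 then have rs: "set rs \<subseteq> N4" and i: "i \<in> N4" by simp_all
 note [simp] = i nword_closed[OF rs]
 have "cg (Suc (length rs)) (eop (nword rs 0) \<cdot> T i 2) (of_real (\<epsilon>c q 0) \<^bold>* nword rs (0 - 1) \<cdot> T i 2)"
  by (rule cg_T[OF 2(1)[OF rs]]) simp_all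
 from cg_smult[OF this, of "Ltwist q 2"] show ?case
  by (simp add: der_T Lnil_def)
next
 case (3 i rs b)
 then have rs: "set rs \<subseteq> N4" and i: "i \<in> N4" and b: "b \<le> length rs" by simp_all
 note [simp] = i nword_closed[OF rs]
 have V: "nword (i # rs) b \<in> carrier P" using nword_closed[of "i # rs" b] rs by simp
 have "cg (Suc (length rs)) (eop (nword rs b) \<cdot> T i 3) (of_real (\<epsilon>c q b) \<^bold>* nword rs (b - 1) \<cdot> T i 3)"
  by (rule cg_T[OF 3(1)[OF rs b]]) simp_all
 moreover have "of_real (\<epsilon>c q b) \<^bold>* nword rs (b - 1) \<cdot> T i 3 = of_real (\<epsilon>c q b) \<^bold>* nword (i # rs) b"
  using V by (cases b) (simp_all add: P.smult_mult_left)
 ultimately have "cg (Suc (length rs)) (eop (nword rs b \<cdot> T i 3))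
   ((inverse Q ^ (2 * b)) \<^bold>* nword (i # rs) b \<^bold>+ (Q ^ 2) \<^bold>* (of_real (\<epsilon>c q b) \<^bold>* nword (i # rs) b))"
  using cg_add[OF straighten[OF rs i b] cg_smult] by (simp add: der_T Lnil_def Ltwist_def)
 then show ?case using V by (simp add: P.smult_assoc P.smult_l_distr of_real_power)
qed

lemma fop_nword:
 "set rs \<subseteq> N4 ==> b \<le> length rs ==> cg (length rs) (fop (nword rs b)) (of_real (\<phi>c q (length rs) b) \<^bold>* nword rs (Suc b))"
proof (induction rs b rule: nword.induct)
 case (1 b) then show ?case by (simp add: der_B AS7_closed cg_refl)
next
 case (2 i rs)
 then have rs: "set rs \<subseteq> N4" and i: "i \<in> N4" by simp_all
 note [simp] = i nword_closed[OF rs]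
 let ?f = "complex_of_real (\<phi>c q (length rs) 0)"
 have V: "nword (i # rs) (Suc 0) \<in> carrier P" using nword_closed[of "i # rs" "Suc 0"] rs by simp
 have "cg (Suc (length rs)) (?f \<^bold>* (nword rs (Suc 0) \<cdot> T i 2)) (?f \<^bold>* ((inverse Q ^ 2) \<^bold>* nword (i # rs) (Suc 0)))"
 proof (cases rs)
  case Nil then show ?thesis using V by (auto intro!: cg_eq)
 next
  case (Cons j J)
  then show ?thesis using cg_smult[OF straighten[OF rs i, of "Suc 0"], of ?f] by simp
 qed
 moreover have "cg (Suc (length rs)) (fop (nword rs 0) \<cdot> T i 2) (?f \<^bold>* (nword rs (Suc 0) \<cdot> T i 2))"
  using cg_T[OF 2(1)[OF rs] i, of 2] by (simp add: P.smult_mult_left)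
 ultimately have "cg (Suc (length rs)) (fop (nword rs 0) \<cdot> T i 2) (?f \<^bold>* ((inverse Q ^ 2) \<^bold>* nword (i # rs) (Suc 0)))"
  using cg_trans by blast
 from cg_add[OF cg_refl[OF V] cg_smult[OF this, of "inverse Q ^ 2"]]
 show ?case using V
  by (simp add: der_T Lnil_def Ltwist_def P.smult_assoc P.smult_l_distr of_real_power of_real_inverse
    power2_eq_square power4_eq_xxxx mult_ac)
next
 case (3 i rs b)
 then have rs: "set rs \<subseteq> N4" and i: "i \<in> N4" and b: "b \<le> length rs" by simp_all
 note [simp] = i nword_closed[OF rs]
 have "cg (Suc (length rs)) (fop (nword rs b) \<cdot> T i 3) (of_real (\<phi>c q (length rs) b) \<^bold>* nword rs (Suc b) \<cdot> T i 3)"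
  by (rule cg_T[OF 3(1)[OF rs b]]) simp_all
 from cg_smult[OF this, of "Q ^ 2"] show ?case
  by (simp add: der_T Lnil_def Ltwist_def P.smult_mult_left P.smult_assoc of_real_power)
qed

lemma der_word:
 assumes "set w \<subseteq> N4 \<times> {2, 3}" "length w < n" shows "der u v (word w) \<in> Fil n"
 using assms
proof (induction w arbitrary: n rule: word.induct)
 case 1 then show ?case by (simp add: der_B AS7_closed Bspan_zero)
next
 case (2 i c w)
 then obtain n' where n: "n = Suc n'" "length w < n'" by (cases n) auto
 have w: "set w \<subseteq> N4 \<times> {2, 3}" and i: "i \<in> N4" and c: "c \<in> {2, 3}" "5 - c \<in> {2, 3}" and cN: "c \<in> N4"
  using 2(2) by auto
 show ?case unfolding word.simps der_T[OF word_closed[OF w] i cN] n(1)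
  by (intro Bspan_add Bspan_smult inner_words_carrier Fil_T 2(1) word_Fil w n i c)
qed

lemma der_Fil: assumes "p \<in> Fil n" shows "der u v p \<in> Fil n"
proof (rule Bspan_map[OF inner_words_carrier der_additive der_left inner_words_carrier _ assms])
 fix x assume "x \<in> inner_words n"
 then obtain w where w: "x = word w" "set w \<subseteq> N4 \<times> {2, 3}" "length w < n" by (auto simp: inner_words_def)
 show "der u v x \<in> Fil n" unfolding w(1) by (rule der_word[OF w(2,3)])
qed

text \<open>The symmetrized Casimir element. It vanishes on \<open>B\<close>, commutes with \<open>B\<close> on both sides, and
 is triangular on normal words.\<close>

definition casimir :: "spq \<Rightarrow> spq" where
 "casimir p = fop (eop p) \<^bold>+ eop (fop p)"

lemma casimir_additive: "casimir \<in> additive_maps P P"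
 unfolding casimir_def[abs_def]
 by (rule additive_map_sum[OF P.abelian_group_axioms additive_map_compose[OF der_additive der_additive]
  additive_map_compose[OF der_additive der_additive]])

lemmas casimir_closed [simp] = additive_map_closed[OF casimir_additive]

lemma casimir_left: "b \<in> B ==> x \<in> carrier P ==> casimir (b \<cdot> x) = b \<cdot> casimir x"
 by (simp add: casimir_def der_left P.r_distr B_carrier)

lemma casimir_right: "b \<in> B ==> x \<in> carrier P ==> casimir (x \<cdot> b) = casimir x \<cdot> b"
 by (simp add: casimir_def der_right P.l_distr B_carrier)

lemma casimir_smult: "x \<in> carrier P ==> casimir (c \<^bold>* x) = c \<^bold>* casimir x"
 by (simp add: casimir_def der_smult P.smult_r_distr)

lemma casimir_B: "b \<in> B ==> casimir b = \<^bold>0"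
 using additive_map_zero[OF P.abelian_group_axioms P.abelian_group_axioms der_additive] by (simp add: casimir_def der_B)

definition \<kappa>c :: "nat \<Rightarrow> nat \<Rightarrow> real" where
 "\<kappa>c n b = \<epsilon>c q b * \<phi>c q n (b - 1) + \<phi>c q n b * \<epsilon>c q (Suc b)"

text \<open>All powers of \<open>q\<close> that occur are even, so the coefficients are sums of squares for every real
 nonzero \<open>q\<close>; at least one of the two operators moves a word of positive length.\<close>

lemma \<kappa>c_pos: assumes "n > 0" "b \<le> n" shows "\<kappa>c n b > 0"
proof (cases b)
 case 0
 then show ?thesis using \<phi>c_pos[OF q0, of 0 n] \<epsilon>c_pos(2)[OF q0, of 0] assms by (simp add: \<kappa>c_def del: \<epsilon>c.simps(2))
next
 case (Suc c)
 have "\<epsilon>c q b * \<phi>c q n (b - 1) > 0"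
  using Suc \<phi>c_pos[OF q0, of c n] \<epsilon>c_pos(2)[OF q0, of c] assms by (simp del: \<epsilon>c.simps(2))
 moreover have "\<phi>c q n b * \<epsilon>c q (Suc b) \<ge> 0"
  using \<phi>c_pos[OF q0, of b n] \<epsilon>c_pos(1)[OF q0, of "Suc b"] assms by (simp del: \<epsilon>c.simps(2))
 ultimately show ?thesis by (simp add: \<kappa>c_def del: \<epsilon>c.simps(2))
qed

lemma casimir_nword:
 assumes rs: "set rs \<subseteq> N4" and b: "b \<le> length rs"
 shows "cg (length rs) (casimir (nword rs b)) (of_real (\<kappa>c (length rs) b) \<^bold>* nword rs b)"
proof -
 let ?n = "length rs"
 note [simp] = nword_closed[OF rs]
 have "cg ?n (fop (of_real (\<epsilon>c q b) \<^bold>* nword rs (b - 1))) ((of_real (\<epsilon>c q b * \<phi>c q ?n (b - 1))) \<^bold>* nword rs b)"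
 proof (cases b)
  case 0 then show ?thesis using additive_map_zero[OF P.abelian_group_axioms P.abelian_group_axioms der_additive]
   by (simp add: cg_refl)
 next
  case (Suc c)
  have "cg ?n (of_real (\<epsilon>c q b) \<^bold>* fop (nword rs c)) (of_real (\<epsilon>c q b) \<^bold>* (of_real (\<phi>c q ?n c) \<^bold>* nword rs (Suc c)))"
   by (intro cg_smult fop_nword rs) (use b Suc in simp)
  then show ?thesis using Suc by (simp add: der_smult P.smult_assoc del: \<epsilon>c.simps(2))
 qed
 then have 1: "cg ?n (fop (eop (nword rs b))) ((of_real (\<epsilon>c q b * \<phi>c q ?n (b - 1))) \<^bold>* nword rs b)"
  using cg_trans cg_map[OF eop_nword[OF rs b] der_additive der_Fil] by blast
 have "cg ?n (eop (of_real (\<phi>c q ?n b) \<^bold>* nword rs (Suc b))) ((of_real (\<phi>c q ?n b * \<epsilon>c q (Suc b))) \<^bold>* nword rs b)"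
 proof (cases "b = ?n")
  case True
  then have "\<phi>c q ?n b = 0" using \<phi>c_pos[OF q0, of b ?n] by simp
  then show ?thesis using additive_map_zero[OF P.abelian_group_axioms P.abelian_group_axioms der_additive]
   by (simp add: cg_refl del: \<epsilon>c.simps(2))
 next
  case False
  have "cg ?n (of_real (\<phi>c q ?n b) \<^bold>* eop (nword rs (Suc b)))
    (of_real (\<phi>c q ?n b) \<^bold>* (of_real (\<epsilon>c q (Suc b)) \<^bold>* nword rs (Suc b - 1)))"
   by (intro cg_smult eop_nword rs) (use b False in simp)
  then show ?thesis by (simp add: der_smult P.smult_assoc del: \<epsilon>c.simps(2))
 qed
 then have 2: "cg ?n (eop (fop (nword rs b))) ((of_real (\<phi>c q ?n b * \<epsilon>c q (Suc b))) \<^bold>* nword rs b)"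
  using cg_trans cg_map[OF fop_nword[OF rs b] der_additive der_Fil] by blast
 show ?thesis using cg_add[OF 1 2] unfolding casimir_def \<kappa>c_def
  by (simp add: P.smult_l_distr[symmetric] del: \<epsilon>c.simps(2))
qed

text \<open>The part of the filtration spanned by \<open>Fil n\<close> and by the normal words of length \<open>n\<close>
 with fewer than \<open>m\<close> columns \<open>3\<close>.\<close>

definition part_words :: "nat \<Rightarrow> nat \<Rightarrow> spq set" where
 "part_words n m = inner_words n \<union> {nword rs b | rs b. set rs \<subseteq> N4 \<and> length rs = n \<and> b < m}"

lemma part_words_carrier: "part_words n m \<subseteq> carrier P"
 using inner_words_carrier nword_closed by (auto simp: part_words_def)

text \<open>Normal words span modulo shorter words, because appending a column can be straightened.\<close>

lemma word_part: "set w \<subseteq> N4 \<times> {2, 3} ==> word w \<in> Bspan (part_words (length w) (Suc (length w)))"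
proof (induction w rule: word.induct)
 case 1
 have "nword [] 0 \<in> part_words 0 (Suc 0)" unfolding part_words_def by (intro UnI2 CollectI exI[of _ "[]"] exI[of _ 0]) simp
 then show ?case using Bspan_sub[OF part_words_carrier] by auto
next
 case (2 i c w)
 let ?n = "length w"
 have w: "set w \<subseteq> N4 \<times> {2, 3}" and i: "i \<in> N4" and c: "c \<in> {2, 3}" and cN: "c \<in> N4" using 2(2) by auto
 have "word w \<cdot> T i c \<in> Bspan (part_words (Suc ?n) (Suc (Suc ?n)))"
 proof (rule Bspan_map[OF part_words_carrier P.mult_right_additive _ part_words_carrier _ 2(1)[OF w]])
  show "b \<cdot> x \<cdot> T i c = b \<cdot> (x \<cdot> T i c)" if "b \<in> B" "x \<in> carrier P" for b x
   using that i cN by (simp add: P.m_assoc B_carrier)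
  fix x assume "x \<in> part_words ?n (Suc ?n)"
  then consider w' where "x = word w'" "set w' \<subseteq> N4 \<times> {2, 3}" "length w' < ?n"
   | rs b where "x = nword rs b" "set rs \<subseteq> N4" "length rs = ?n" "b \<le> ?n"
   by (auto simp: part_words_def inner_words_def less_Suc_eq_le)
  then show "x \<cdot> T i c \<in> Bspan (part_words (Suc ?n) (Suc (Suc ?n)))"
  proof cases
   case (1 w')
   have "word ((i, c) # w') \<in> inner_words (Suc ?n)"
    unfolding inner_words_def by (rule CollectI, rule exI[of _ "(i, c) # w'"]) (use 1 i c in simp)
   then show ?thesis using Bspan_sub[OF part_words_carrier] 1 by (simp add: part_words_def)
  next
   case (2 rs b)
   have V: "nword (i # rs) b' \<in> Bspan (part_words (Suc ?n) (Suc (Suc ?n)))" if "b' \<le> Suc ?n" for b'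
   proof (rule Bspan_sub[OF part_words_carrier])
    show "nword (i # rs) b' \<in> part_words (Suc ?n) (Suc (Suc ?n))"
     unfolding part_words_def by (intro UnI2 CollectI exI[of _ "i # rs"] exI[of _ b']) (use 2 i that in simp)
   qed
   show ?thesis
   proof (cases "c = 3")
    case True then show ?thesis using V[of "Suc b"] 2 by simp
   next
    case False
    then have c2: "c = 2" using c by simp
    show ?thesis unfolding 2(1) c2
    proof (rule cg_span[OF straighten[OF 2(2) i] part_words_carrier])
     show "(inverse Q ^ (2 * b)) \<^bold>* nword (i # rs) b \<in> Bspan (part_words (Suc ?n) (Suc (Suc ?n)))"
      by (intro Bspan_smult part_words_carrier V) (use 2 in simp)
    qed (use 2 in \<open>auto simp: part_words_def\<close>)
   qed
  qed
 qed (use i cN in simp)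
 then show ?case by simp
qed

lemma Fil_part: "p \<in> Fil (Suc n) ==> p \<in> Bspan (part_words n (Suc n))"
proof (rule Bspan_mono[OF _ inner_words_carrier part_words_carrier])
 show "inner_words (Suc n) \<subseteq> Bspan (part_words n (Suc n))"
 proof
  fix x assume "x \<in> inner_words (Suc n)"
  then obtain w where w: "x = word w" "set w \<subseteq> N4 \<times> {2, 3}" "length w \<le> n" by (auto simp: inner_words_def)
  show "x \<in> Bspan (part_words n (Suc n))"
  proof (cases "length w = n")
   case True then show ?thesis using word_part[OF w(2)] w(1) by simp
  next
   case False
   then have "x \<in> inner_words n" using w by (auto simp: inner_words_def)
   then show ?thesis by (intro Bspan_sub part_words_carrier) (simp add: part_words_def)
  qed
 qed
qed

lemma part_zero: "part_words n 0 = inner_words n"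
 by (simp add: part_words_def)

lemma casimir_part:
 assumes p: "p \<in> Bspan (part_words n (Suc m))" and m: "m \<le> n"
 shows "casimir p \<^bold>+ (- of_real (\<kappa>c n m)) \<^bold>* p \<in> Bspan (part_words n m)"
proof (rule Bspan_map[OF part_words_carrier _ _ part_words_carrier _ p, of "\<lambda>p. casimir p \<^bold>+ (- of_real (\<kappa>c n m)) \<^bold>* p"])
 show "(\<lambda>p. casimir p \<^bold>+ (- of_real (\<kappa>c n m)) \<^bold>* p) \<in> additive_maps P P"
  by (rule additive_map_sum[OF P.abelian_group_axioms casimir_additive P.smult_additive])
 show "casimir (b \<cdot> x) \<^bold>+ (- of_real (\<kappa>c n m)) \<^bold>* (b \<cdot> x) =
   b \<cdot> (casimir x \<^bold>+ (- of_real (\<kappa>c n m)) \<^bold>* x)" if "b \<in> B" "x \<in> carrier P" for b x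
  using that by (simp add: casimir_left P.r_distr B_carrier P.smult_mult_right)
 fix x assume "x \<in> part_words n (Suc m)"
 then consider "x \<in> inner_words n" | rs b where "x = nword rs b" "set rs \<subseteq> N4" "length rs = n" "b \<le> m"
  by (auto simp: part_words_def less_Suc_eq_le)
 then show "casimir x \<^bold>+ (- of_real (\<kappa>c n m)) \<^bold>* x \<in> Bspan (part_words n m)"
 proof cases
  case 1
  then have "x \<in> Fil n" by (rule Bspan_sub[OF inner_words_carrier])
  then have "casimir x \<^bold>+ (- of_real (\<kappa>c n m)) \<^bold>* x \<in> Fil n"
   unfolding casimir_def by (intro Bspan_add der_Fil Bspan_smult inner_words_carrier)
  then show ?thesis
   by (rule Bspan_mono[OF _ inner_words_carrier part_words_carrier, rotated])
    (rule subsetI, rule Bspan_sub[OF part_words_carrier], simp add: part_words_def)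
 next
  case (2 rs b)
  have V: "nword rs b \<in> carrier P" by (rule nword_closed[OF 2(2)])
  have "cg n (casimir x \<^bold>+ (- of_real (\<kappa>c n m)) \<^bold>* x) (of_real (\<kappa>c n b) \<^bold>* x \<^bold>+ (- of_real (\<kappa>c n m)) \<^bold>* x)"
   using casimir_nword[OF 2(2), of b] 2 m V by (intro cg_add cg_refl) simp_all
  moreover have "of_real (\<kappa>c n b) \<^bold>* x \<^bold>+ (- of_real (\<kappa>c n m)) \<^bold>* x = of_real (\<kappa>c n b - \<kappa>c n m) \<^bold>* x"
   using V 2(1) P.smult_l_distr[of x "of_real (\<kappa>c n b)" "- of_real (\<kappa>c n m)"] by simp
  moreover have "of_real (\<kappa>c n b - \<kappa>c n m) \<^bold>* x \<in> Bspan (part_words n m)"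
  proof (cases "b = m")
   case True then show ?thesis using V 2(1) by (simp add: Bspan_zero)
  next
   case False
   then have "b < m" using 2(4) by simp
   then have "x \<in> part_words n m"
    unfolding part_words_def using 2 by (intro UnI2 CollectI exI[of _ rs] exI[of _ b]) simp
   then show ?thesis by (intro Bspan_smult Bspan_sub part_words_carrier)
  qed
  ultimately have cong: "cg n (casimir x \<^bold>+ (- of_real (\<kappa>c n m)) \<^bold>* x) (of_real (\<kappa>c n b - \<kappa>c n m) \<^bold>* x)"
   and span: "of_real (\<kappa>c n b - \<kappa>c n m) \<^bold>* x \<in> Bspan (part_words n m)" by simp_all
  show ?thesis by (rule cg_span[OF cong part_words_carrier _ span]) (simp add: part_words_def)
 qed
qed

text \<open>On each step of the refined filtration the Casimir operator \<open>K\<close> acts as a nonzero scalar \<open>c\<close> up to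
 lower terms. So \<open>p\<close> differs from \<open>c\<^sup>-\<^sup>1 K p\<close> by a lower term, and if \<open>K (K p) = 0\<close> then the lower term
 \<open>p' = K p - c p\<close> satisfies \<open>K p' = - c K p\<close> and \<open>K (K p') = 0\<close>; both claims follow by induction.
 They say that \<open>A(Sp\<^sub>q(2))\<close> is the direct sum of \<open>B\<close> and the image of \<open>K\<close>.\<close>

lemma casimir_split:
 assumes "p \<in> Fil n"
 shows "(casimir (casimir p) = \<^bold>0 \<longrightarrow> casimir p = \<^bold>0) \<and> (\<exists>b\<in>B. \<exists>y\<in>carrier P. p = b \<^bold>+ casimir y)"
  (is "?\<Phi> p")
 using assms
proof (induction n arbitrary: p)
 have c0: "casimir \<^bold>0 = \<^bold>0" by (rule casimir_B[OF AS7_closed(7)])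
 have B: "?\<Phi> p" if "p \<in> B" for p
 proof (intro conjI impI)
  show "casimir p = \<^bold>0" by (rule casimir_B[OF that])
  show "\<exists>b\<in>B. \<exists>y\<in>carrier P. p = b \<^bold>+ casimir y"
   using that c0 by (intro bexI[of _ p] bexI[of _ "\<^bold>0"]) (simp_all add: B_carrier)
 qed
 {
  case 0 then show ?case using B AS7_closed(7) Fil_zero by blast
 next
  case (Suc n)
  show ?case
  proof (cases "n = 0")
   case True then show ?thesis using B Fil_one Suc(2) by (simp add: One_nat_def)
  next
   case False
   have "\<forall>p \<in> Bspan (part_words n m). ?\<Phi> p" if "m \<le> Suc n" for m using that
   proof (induction m)
    case 0 then show ?case using Suc.IH by (simp add: part_zero)
   next
    case (Suc m)
    show ?case
    proof
     fix p assume p: "p \<in> Bspan (part_words n (Suc m))"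
     define c where "c = complex_of_real (\<kappa>c n m)"
     have c: "c \<noteq> 0" using \<kappa>c_pos[of n m] False Suc(2) by (simp add: c_def)
     have pP: "p \<in> carrier P" by (rule Bspan_carrier[OF part_words_carrier p])
     \<comment> \<open>The lower term left over when the Casimir operator acts as the scalar on \<open>p\<close>.\<close>
     define p' where "p' = casimir p \<^bold>+ (- c) \<^bold>* p"
     have pP': "p' \<in> carrier P" using pP by (simp add: p'_def)
     have "p' \<in> Bspan (part_words n m)"
      unfolding p'_def c_def by (rule casimir_part[OF p]) (use Suc(2) in simp)
     then have IH: "?\<Phi> p'" using Suc by simp
     have inv: "x = \<^bold>0" if "(- c) \<^bold>* x = \<^bold>0" "x \<in> carrier P" for x
     proof -
      have "inverse (- c) \<^bold>* ((- c) \<^bold>* x) = x" using that(2) c by (simp add: P.smult_assoc)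
      then show ?thesis using that by simp
     qed
     have ker: "casimir p = \<^bold>0" if KK: "casimir (casimir p) = \<^bold>0"
     proof -
      have K: "casimir p' = (- c) \<^bold>* casimir p"
       using pP by (simp add: p'_def additive_map_add[OF casimir_additive] casimir_smult KK)
      then have "casimir (casimir p') = \<^bold>0" using pP by (simp add: casimir_smult KK)
      then have "casimir p' = \<^bold>0" using IH by blast
      then show ?thesis using inv K pP by simp
     qed
     obtain b y where dec: "b \<in> B" "y \<in> carrier P" "p' = b \<^bold>+ casimir y" using IH by blast
     have "p = (- inverse c) \<^bold>* b \<^bold>+ casimir ((- inverse c) \<^bold>* y \<^bold>+ inverse c \<^bold>* p)"
     proof -
      have "(- inverse c) \<^bold>* p' = (- inverse c) \<^bold>* casimir p \<^bold>+ p"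
       using pP c unfolding p'_def by (simp add: P.smult_r_distr P.smult_assoc)
      then have "p = (- inverse c) \<^bold>* p' \<^bold>+ inverse c \<^bold>* casimir p"
       using pP pP' by (simp add: P.smult_minus P.a_ac P.r_neg2 P.r_neg1 P.l_neg P.r_neg)
      then show ?thesis using dec pP
       by (simp add: P.smult_r_distr B_carrier additive_map_add[OF casimir_additive] casimir_smult P.a_assoc)
     qed
     then have split: "\<exists>b\<in>B. \<exists>y\<in>carrier P. p = b \<^bold>+ casimir y"
      using dec pP AS7_closed(6)[OF dec(1)] by (intro bexI[of _ "(- inverse c) \<^bold>* b"]
       bexI[of _ "(- inverse c) \<^bold>* y \<^bold>+ inverse c \<^bold>* p"]) simp_all
     show "?\<Phi> p" using ker split by blast
    qed
   qed
   then show ?thesis using Fil_part[OF Suc(2)] by blast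
  qed
 }
qed

text \<open>The projection onto \<open>B\<close> along the image of the Casimir operator. It is a map of
 \<open>B\<close>-bimodules because the Casimir operator is.\<close>

definition E :: "spq \<Rightarrow> spq" where
 "E p = (THE b. b \<in> B \<and> (\<exists>y\<in>carrier P. p = b \<^bold>+ casimir y))"

lemma E_eqI:
 assumes "b \<in> B" "y \<in> carrier P" "p = b \<^bold>+ casimir y" shows "E p = b"
 unfolding E_def
proof (rule the_equality)
 show "b \<in> B \<and> (\<exists>y\<in>carrier P. p = b \<^bold>+ casimir y)" using assms by blast
 fix b' assume "b' \<in> B \<and> (\<exists>y\<in>carrier P. p = b' \<^bold>+ casimir y)"
 then obtain y' where b': "b' \<in> B" "y' \<in> carrier P" "p = b' \<^bold>+ casimir y'" by blast
 note [simp] = assms(2) b'(2) B_carrier[OF assms(1)] B_carrier[OF b'(1)]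
 let ?z = "y' \<ominus>\<^bsub>P\<^esub> y"
 have "casimir ?z = casimir y' \<ominus>\<^bsub>P\<^esub> casimir y"
  by (rule additive_map_diff[OF P.abelian_group_axioms P.abelian_group_axioms casimir_additive]) simp_all
 also have "\<dots> = b \<ominus>\<^bsub>P\<^esub> b'"
 proof -
  have "casimir y' = \<ominus>\<^bsub>P\<^esub> b' \<^bold>+ p"
   unfolding b'(3) by (simp add: P.r_neg1)
  then have "casimir y' = \<ominus>\<^bsub>P\<^esub> b' \<^bold>+ (b \<^bold>+ casimir y)"
   unfolding assms(3) .
  then show ?thesis by (simp add: P.minus_eq P.a_assoc P.r_neg P.r_neg1 P.r_neg2 P.a_comm[of b])
 qed
 finally have z: "casimir ?z = b \<ominus>\<^bsub>P\<^esub> b'" .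
 moreover have "b \<ominus>\<^bsub>P\<^esub> b' \<in> B" using assms(1) b'(1) AS7_closed by (simp add: P.minus_eq)
 ultimately have "casimir (casimir ?z) = \<^bold>0" by (simp add: casimir_B)
 moreover obtain n where "?z \<in> Fil n" using Fil_exhausts[of ?z] by auto
 ultimately have "casimir ?z = \<^bold>0" using casimir_split by blast
 then show "b' = b" using z by (simp add: P.r_right_minus_eq)
qed

lemma E_split: assumes "p \<in> carrier P" shows "\<exists>y\<in>carrier P. p = E p \<^bold>+ casimir y" "E p \<in> B"
proof -
 obtain n where "p \<in> Fil n" using Fil_exhausts[OF assms] by blast
 then obtain b y where "b \<in> B" "y \<in> carrier P" "p = b \<^bold>+ casimir y" using casimir_split by blast
 then show "\<exists>y\<in>carrier P. p = E p \<^bold>+ casimir y" "E p \<in> B" using E_eqI by auto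
qed

lemma E_B: "b \<in> B ==> E b = b"
 by (rule E_eqI[of _ "\<^bold>0"]) (simp_all add: casimir_B AS7_closed B_carrier)

lemma E_closed [simp]: "p \<in> carrier P ==> E p \<in> carrier P" using E_split(2) B_carrier by blast

lemma E_additive: "E \<in> additive_maps P P"
proof (rule additive_mapsI)
 fix x y assume xy: "x \<in> carrier P" "y \<in> carrier P"
 obtain x' y' where "x' \<in> carrier P" "x = E x \<^bold>+ casimir x'" "y' \<in> carrier P" "y = E y \<^bold>+ casimir y'"
  using E_split(1) xy by meson
 moreover from this have "x \<^bold>+ y = (E x \<^bold>+ casimir x') \<^bold>+ (E y \<^bold>+ casimir y')" by simp
 ultimately show "E (x \<^bold>+ y) = E x \<^bold>+ E y"
  using xy E_split(2) by (intro E_eqI[of _ "x' \<^bold>+ y'"])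
   (simp_all add: AS7_closed additive_map_add[OF casimir_additive] P.a_ac)
qed simp

lemma E_linear:
 assumes "b \<in> B" "p \<in> carrier P"
 shows "E (b \<cdot> p) = b \<cdot> E p" "E (p \<cdot> b) = E p \<cdot> b"
proof -
 obtain y where y: "y \<in> carrier P" "p = E p \<^bold>+ casimir y" using E_split(1)[OF assms(2)] by blast
 have "b \<cdot> p = b \<cdot> (E p \<^bold>+ casimir y)" "p \<cdot> b = (E p \<^bold>+ casimir y) \<cdot> b" using y(2) by simp_all
 then show "E (b \<cdot> p) = b \<cdot> E p" "E (p \<cdot> b) = E p \<cdot> b"
  using y(1) assms E_split(2)[OF assms(2)]
  by (intro E_eqI[of _ "b \<cdot> y"] E_eqI[of _ "y \<cdot> b"];
   simp add: AS7_closed casimir_left casimir_right P.r_distr P.l_distr B_carrier)+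
qed

end

section \<open>Local identities and faithful flatness\<close>

text \<open>Maps of the form \<open>\<Sum> h\<^sub>i(-) e\<^sub>i\<close> with linear functionals \<open>h\<^sub>i\<close>; the last rule makes the set
 independent of values outside the carrier.\<close>

inductive_set finite_rank :: "('r, 'k) ring_scheme \<Rightarrow> ('r, 'm) module \<Rightarrow> ('m \<Rightarrow> 'm) set"
 for R N where
 zero: "(\<lambda>p. \<zero>\<^bsub>N\<^esub>) \<in> finite_rank R N"
| single: "h \<in> linear_maps N (left_regular R) (carrier R) ==> e \<in> carrier N ==> (\<lambda>p. h p \<odot>\<^bsub>N\<^esub> e) \<in> finite_rank R N"
| sum: "u \<in> finite_rank R N ==> w \<in> finite_rank R N ==> (\<lambda>p. u p \<oplus>\<^bsub>N\<^esub> w p) \<in> finite_rank R N"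
| cong: "u \<in> finite_rank R N ==> (\<And>p. p \<in> carrier N ==> w p = u p) ==> w \<in> finite_rank R N"

text \<open>Every finite subset is fixed by a map of finite rank: this is the part of a dual basis that
 flatness needs, without a choice of basis.\<close>

definition local_identities :: "('r, 'k) ring_scheme \<Rightarrow> ('r, 'm) module \<Rightarrow> bool" where
 "local_identities R N \<longleftrightarrow> (\<forall>F. finite F \<longrightarrow> F \<subseteq> carrier N \<longrightarrow> (\<exists>u\<in>finite_rank R N. \<forall>p\<in>F. u p = p))"

lemma finite_rank_linear_left:
 assumes "left_module R N" "u \<in> finite_rank R N"
 shows "u \<in> linear_maps N N (carrier R)"
proof -
 interpret left_module R N by fact
 note ag = M.abelian_group_axioms
 have z: "a \<odot>\<^bsub>N\<^esub> \<zero>\<^bsub>N\<^esub> = \<zero>\<^bsub>N\<^esub>" if "a \<in> carrier R" for a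
  by (rule additive_map_zero[OF ag ag]) (use that in \<open>auto intro!: additive_mapsI simp: smult_closed smult_r_distr\<close>)
 show ?thesis using assms(2)
 proof induction
  case zero then show ?case by (intro linear_mapsI additive_mapsI) (simp_all add: z)
 next
  case (single h e)
  note hD = linear_mapsD[OF single(1)]
  show ?case using single(2) additive_map_closed[OF hD(1)]
   by (intro linear_mapsI additive_mapsI)
    (simp_all add: smult_closed additive_map_add[OF hD(1)] smult_l_distr hD(2) smult_assoc)
 next
  case (sum u w)
  show ?case
   using additive_map_closed[OF linear_mapsD(1)[OF sum(3)]] additive_map_closed[OF linear_mapsD(1)[OF sum(4)]]
    linear_mapsD(2)[OF sum(3)] linear_mapsD(2)[OF sum(4)]
   by (intro linear_mapsI additive_map_sum[OF ag] linear_mapsD(1)[OF sum(3)] linear_mapsD(1)[OF sum(4)])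
    (simp add: smult_r_distr)
 next
  case (cong u w)
  show ?case using linear_mapsD[OF cong(3)] additive_map_closed[OF linear_mapsD(1)[OF cong(3)]] cong(2)
   by (intro linear_mapsI additive_mapsI) (simp_all add: smult_closed additive_map_add[OF linear_mapsD(1)[OF cong(3)]])
 qed
qed

text \<open>A linear functional on one factor contracts a tensor to an element of the other factor. These
 slices replace the coordinates that a basis would give.\<close>

context tensor_pair
begin

lemma slice_right:
 assumes h: "h \<in> linear_maps N (left_regular R) (carrier R)"
 shows "tensor_lift M (\<lambda>x y. h y \<odot>\<^bsub>M\<^esub> x) \<in> additive_maps MN M"
  and "[|x \<in> carrier M; y \<in> carrier N|] ==> tensor_lift M (\<lambda>x y. h y \<odot>\<^bsub>M\<^esub> x) (tensor R M N x y) = h y \<odot>\<^bsub>M\<^esub> x"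
proof -
 interpret M: right_module R M by (rule right_module_M)
 note hD = linear_mapsD[OF h] and hc = additive_map_closed[OF linear_mapsD(1)[OF h]]
 have b: "bilinear_balanced R M N M (\<lambda>x y. h y \<odot>\<^bsub>M\<^esub> x)"
  using hc by (intro bilinear_balancedI)
   (simp_all add: M.smult_closed additive_map_add[OF hD(1)] M.smult_l_distr M.smult_r_distr hD(2) M.smult_assoc)
 show "tensor_lift M (\<lambda>x y. h y \<odot>\<^bsub>M\<^esub> x) \<in> additive_maps MN M"
  by (rule tensor_lift_additive[OF M.M.abelian_group_axioms b])
 show "[|x \<in> carrier M; y \<in> carrier N|] ==> tensor_lift M (\<lambda>x y. h y \<odot>\<^bsub>M\<^esub> x) (tensor R M N x y) = h y \<odot>\<^bsub>M\<^esub> x"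
  by (rule tensor_lift_tensor[OF M.M.abelian_group_axioms b])
qed

lemma tensor_self: "tensor_pairs2 R M N M N" by unfold_locales

text \<open>A tensor involves only finitely many elements of the second factor.\<close>

lemma tensor_support_right:
 assumes U: "U \<in> carrier MN"
 shows "\<exists>F. finite F \<and> F \<subseteq> carrier N \<and> (\<forall>u\<in>linear_maps N N (carrier R). (\<forall>p\<in>F. u p = p) \<longrightarrow> tensor_map R M N id u U = U)"
proof -
 interpret MN: tensor_pairs2 R M N M N by (rule tensor_self)
 show ?thesis using U
 proof (induction U rule: tensor_induct)
  case zero
  have "tensor_map R M N id u \<zero>\<^bsub>MN\<^esub> = \<zero>\<^bsub>MN\<^esub>" if "u \<in> linear_maps N N (carrier R)" for u
   by (rule additive_map_zero[OF tensor_group_abelian tensor_group_abelian MN.tensor_map_additive[OF linear_map_id that]])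
  then show ?case by (intro exI[of _ "{}"]) blast
 next
  case (tensor x y)
  have "tensor_map R M N id u (tensor R M N x y) = tensor R M N x y" if "u \<in> linear_maps N N (carrier R)" "u y = y" for u
   using MN.tensor_map_tensor[OF linear_map_id that(1) tensor] that(2) by (simp only: id_apply)
  then show ?case using tensor by (intro exI[of _ "{y}"]) blast
 next
  case (add V W)
  obtain F G where "finite F \<and> F \<subseteq> carrier N \<and> (\<forall>u\<in>linear_maps N N (carrier R). (\<forall>p\<in>F. u p = p) \<longrightarrow> tensor_map R M N id u V = V)"
   "finite G \<and> G \<subseteq> carrier N \<and> (\<forall>u\<in>linear_maps N N (carrier R). (\<forall>p\<in>G. u p = p) \<longrightarrow> tensor_map R M N id u W = W)"
   using add by blast
  moreover have "tensor_map R M N id u (V \<oplus>\<^bsub>MN\<^esub> W) = tensor_map R M N id u V \<oplus>\<^bsub>MN\<^esub> tensor_map R M N id u W"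
   if "u \<in> linear_maps N N (carrier R)" for u
   by (rule additive_map_add[OF MN.tensor_map_additive[OF linear_map_id that] add(1,2)])
  ultimately show ?case by (intro exI[of _ "F \<union> G"]) (metis UnCI Un_subset_iff finite_UnI)
 qed
qed

lemma local_identity_right:
 assumes "finite \<U>" "\<U> \<subseteq> carrier MN" and loc: "local_identities R N"
 shows "\<exists>u\<in>finite_rank R N. \<forall>U\<in>\<U>. tensor_map R M N id u U = U"
proof -
 have "\<forall>U\<in>\<U>. \<exists>F. finite F \<and> F \<subseteq> carrier N \<and> (\<forall>u\<in>linear_maps N N (carrier R). (\<forall>p\<in>F. u p = p) \<longrightarrow> tensor_map R M N id u U = U)"
  using tensor_support_right assms(2) by blast
 then obtain F where F: "\<And>U. U \<in> \<U> ==> finite (F U)" "\<And>U. U \<in> \<U> ==> F U \<subseteq> carrier N"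
  "\<And>U u. [|U \<in> \<U>; u \<in> linear_maps N N (carrier R); \<forall>p\<in>F U. u p = p|] ==> tensor_map R M N id u U = U"
  by metis
 have "finite (\<Union>U\<in>\<U>. F U)" "(\<Union>U\<in>\<U>. F U) \<subseteq> carrier N" using F(1,2) assms(1) by auto
 then obtain u where u: "u \<in> finite_rank R N" "\<forall>p\<in>\<Union>U\<in>\<U>. F U. u p = p"
  using loc unfolding local_identities_def by blast
 have "tensor_map R M N id u U = U" if "U \<in> \<U>" for U
  by (rule F(3)[OF that finite_rank_linear_left[OF left_module_N u(1)]]) (use u(2) that in blast)
 then show ?thesis using u(1) by blast
qed

end

text \<open>Let \<open>g U = 0\<close>. A map of finite rank fixes \<open>U\<close>, so \<open>U\<close> is a sum of tensors \<open>n \<otimes> d\<close> whose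
 first factors \<open>n\<close> are slices of \<open>U\<close>. Slicing commutes with \<open>g\<close>, so \<open>g n = 0\<close>, and exactness before
 tensoring lifts each \<open>n\<close>. Conversely \<open>n \<mapsto> n \<otimes> e\<close> is split by slicing with \<open>E\<close>, so exactness
 can be tested after tensoring.\<close>

lemma faithfully_flat_leftI:
 fixes R :: "('r, 'k) ring_scheme" and M :: "('r, 'm) module"
 assumes M: "left_module R M" and loc: "local_identities R M"
  and E: "E \<in> linear_maps M (left_regular R) (carrier R)" and e: "e \<in> carrier M" "E e = \<one>\<^bsub>R\<^esub>"
 shows "faithfully_flat_left TYPE('n1) TYPE('n2) TYPE('n3) R M"
 unfolding faithfully_flat_left_def
proof (intro conjI allI impI M, elim conjE)
 fix N1 :: "('r, 'n1) module" and N2 :: "('r, 'n2) module" and N3 :: "('r, 'n3) module" and f g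
 assume N: "right_module R N1" "right_module R N2" "right_module R N3"
  and f: "f \<in> linear_maps N1 N2 (carrier R)" and g: "g \<in> linear_maps N2 N3 (carrier R)"
 interpret M: left_module R M by (rule M)
 interpret N1: right_module R N1 by (rule N(1))
 interpret N2: right_module R N2 by (rule N(2))
 interpret N3: right_module R N3 by (rule N(3))
 interpret F: tensor_pairs2 R N1 M N2 M by (intro tensor_pairs2.intro tensor_pair.intro N M)
 interpret G: tensor_pairs2 R N2 M N3 M by (intro tensor_pairs2.intro tensor_pair.intro N M)
 let ?f = "tensor_map R N2 M f id" and ?g = "tensor_map R N3 M g id"
 note fa = linear_mapsD(1)[OF f] and ga = linear_mapsD(1)[OF g]
 note fc = additive_map_closed[OF fa] and gc = additive_map_closed[OF ga]
 note Fa = F.tensor_map_additive[OF f linear_map_id] and Ga = G.tensor_map_additive[OF g linear_map_id]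
 have Ft: "?f (tensor R N1 M x y) = tensor R N2 M (f x) y" if "x \<in> carrier N1" "y \<in> carrier M" for x y
  using F.tensor_map_tensor[OF f linear_map_id that] by (simp only: id_apply)
 have Gt: "?g (tensor R N2 M x y) = tensor R N3 M (g x) y" if "x \<in> carrier N2" "y \<in> carrier M" for x y
  using G.tensor_map_tensor[OF g linear_map_id that] by (simp only: id_apply)
 note g1 = F.A.tensor_group_abelian and g2 = F.B.tensor_group_abelian and g3 = G.B.tensor_group_abelian
 note hc = additive_map_closed[OF linear_mapsD(1)]
 let ?s1 = "\<lambda>h. tensor_lift N1 (\<lambda>x y. h y \<odot>\<^bsub>N1\<^esub> x)" and ?s2 = "\<lambda>h. tensor_lift N2 (\<lambda>x y. h y \<odot>\<^bsub>N2\<^esub> x)"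
  and ?s3 = "\<lambda>h. tensor_lift N3 (\<lambda>x y. h y \<odot>\<^bsub>N3\<^esub> x)"
 have slice_f: "?s2 h (?f U) = f (?s1 h U)" if h: "h \<in> linear_maps M (left_regular R) (carrier R)" and U: "U \<in> carrier F.A.MN" for h U
  by (rule F.A.tensor_maps_eqI[OF N2.M.abelian_group_axioms additive_map_compose[OF Fa F.B.slice_right(1)[OF h]]
     additive_map_compose[OF F.A.slice_right(1)[OF h] fa] _ U])
   (use hc[OF h] in \<open>simp add: Ft F.B.slice_right(2)[OF h] F.A.slice_right(2)[OF h] fc linear_mapsD(2)[OF f]\<close>)
 have slice_g: "?s3 h (?g U) = g (?s2 h U)" if h: "h \<in> linear_maps M (left_regular R) (carrier R)" and U: "U \<in> carrier F.B.MN" for h U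
  by (rule F.B.tensor_maps_eqI[OF N3.M.abelian_group_axioms additive_map_compose[OF Ga G.B.slice_right(1)[OF h]]
     additive_map_compose[OF F.B.slice_right(1)[OF h] ga] _ U])
   (use hc[OF h] in \<open>simp add: Gt G.B.slice_right(2)[OF h] F.B.slice_right(2)[OF h] gc linear_mapsD(2)[OF g]\<close>)
 have s3z: "?s3 h \<zero>\<^bsub>G.B.MN\<^esub> = \<zero>\<^bsub>N3\<^esub>" if "h \<in> linear_maps M (left_regular R) (carrier R)" for h
  by (rule additive_map_zero[OF g3 N3.M.abelian_group_axioms G.B.slice_right(1)[OF that]])
 show "exact_pair N1 N2 N3 f g \<longleftrightarrow> exact_pair F.A.MN F.B.MN G.B.MN ?f ?g"
 proof
  assume ex: "exact_pair N1 N2 N3 f g"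
  have gf: "g (f x) = \<zero>\<^bsub>N3\<^esub>" if "x \<in> carrier N1" for x using ex that unfolding exact_pair_def by blast
  have lift: "\<exists>y\<in>carrier N1. x = f y" if "x \<in> carrier N2" "g x = \<zero>\<^bsub>N3\<^esub>" for x
   using ex that unfolding exact_pair_def by blast
  have "?g (?f U) = \<zero>\<^bsub>G.B.MN\<^esub>" if U: "U \<in> carrier F.A.MN" for U
  proof (rule F.A.tensor_maps_eqI[OF g3 additive_map_compose[OF Fa Ga] _ _ U, of "\<lambda>_. \<zero>\<^bsub>G.B.MN\<^esub>"])
   interpret Z: abelian_group G.B.MN by (rule g3)
   show "(\<lambda>_. \<zero>\<^bsub>G.B.MN\<^esub>) \<in> additive_maps F.A.MN G.B.MN" by (intro additive_mapsI) simp_all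
  qed (simp add: Ft Gt fc gf G.B.tensor_zero_left)
  moreover have "\<exists>V\<in>carrier F.A.MN. U = ?f V" if U: "U \<in> carrier F.B.MN" and gU: "?g U = \<zero>\<^bsub>G.B.MN\<^esub>" for U
  proof -
   interpret S: tensor_pairs2 R N2 M N2 M by (rule F.B.tensor_self)
   obtain u where u: "u \<in> finite_rank R M" "tensor_map R N2 M id u U = U"
    using F.B.local_identity_right[of "{U}"] U loc by blast
   have "\<exists>V\<in>carrier F.A.MN. tensor_map R N2 M id u U = ?f V" using u(1)
   proof induction
    case zero
    have l: "(\<lambda>p. \<zero>\<^bsub>M\<^esub>) \<in> linear_maps M M (carrier R)"
     by (rule finite_rank_linear_left[OF M finite_rank.zero])
    interpret Z1: abelian_group F.A.MN by (rule g1)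
    interpret Z2: abelian_group F.B.MN by (rule g2)
    have "tensor_map R N2 M id (\<lambda>p. \<zero>\<^bsub>M\<^esub>) U = \<zero>\<^bsub>F.B.MN\<^esub>"
    proof (rule F.B.tensor_maps_eqI[OF g2 S.tensor_map_additive[OF linear_map_id l] _ _ U])
     show "(\<lambda>_. \<zero>\<^bsub>F.B.MN\<^esub>) \<in> additive_maps F.B.MN F.B.MN" by (intro additive_mapsI) simp_all
    qed (simp add: S.tensor_map_tensor[OF linear_map_id l] F.B.tensor_zero_right)
    then show ?case using additive_map_zero[OF g1 g2 Fa] Z1.zero_closed by metis
   next
    case (single h d)
    note h = single(1)
    have l: "(\<lambda>p. h p \<odot>\<^bsub>M\<^esub> d) \<in> linear_maps M M (carrier R)"
     by (rule finite_rank_linear_left[OF M finite_rank.single[OF single]])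
    have t: "tensor_map R N2 M id (\<lambda>p. h p \<odot>\<^bsub>M\<^esub> d) U = tensor R N2 M (?s2 h U) d"
    proof (rule F.B.tensor_maps_eqI[OF g2 S.tensor_map_additive[OF linear_map_id l] _ _ U])
     show "(\<lambda>U. tensor R N2 M (?s2 h U) d) \<in> additive_maps F.B.MN F.B.MN"
      by (rule additive_map_compose[OF F.B.slice_right(1)[OF h] F.B.tensor_map_left[OF single(2)]])
     fix x y assume xy: "x \<in> carrier N2" "y \<in> carrier M"
     then show "tensor_map R N2 M id (\<lambda>p. h p \<odot>\<^bsub>M\<^esub> d) (tensor R N2 M x y) = tensor R N2 M (?s2 h (tensor R N2 M x y)) d"
      using hc[OF h] single(2)
      by (simp add: S.tensor_map_tensor[OF linear_map_id l] F.B.slice_right(2)[OF h] F.B.tensor_balanced)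
    qed
    have "g (?s2 h U) = \<zero>\<^bsub>N3\<^esub>" using slice_g[OF h U] s3z[OF h] gU by simp
    moreover have sc: "?s2 h U \<in> carrier N2" by (rule additive_map_closed[OF F.B.slice_right(1)[OF h] U])
    ultimately obtain y where y: "y \<in> carrier N1" "?s2 h U = f y" using lift by blast
    show ?case unfolding t y(2) using Ft[OF y(1) single(2)] F.A.tensor_closed[OF y(1) single(2)] by metis
   next
    case (sum u w)
    note lu = finite_rank_linear_left[OF M sum(1)] and lw = finite_rank_linear_left[OF M sum(2)]
     and ls = finite_rank_linear_left[OF M finite_rank.sum[OF sum(1,2)]]
    obtain V W where VW: "V \<in> carrier F.A.MN" "tensor_map R N2 M id u U = ?f V" "W \<in> carrier F.A.MN" "tensor_map R N2 M id w U = ?f W"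
     using sum(3,4) by blast
    interpret Z1: abelian_group F.A.MN by (rule g1)
    have "tensor_map R N2 M id (\<lambda>p. u p \<oplus>\<^bsub>M\<^esub> w p) U = tensor_map R N2 M id u U \<oplus>\<^bsub>F.B.MN\<^esub> tensor_map R N2 M id w U"
     by (rule F.B.tensor_maps_eqI[OF g2 S.tensor_map_additive[OF linear_map_id ls]
       additive_map_sum[OF g2 S.tensor_map_additive[OF linear_map_id lu] S.tensor_map_additive[OF linear_map_id lw]] _ U])
      (simp add: S.tensor_map_tensor[OF linear_map_id ls] S.tensor_map_tensor[OF linear_map_id lu]
       S.tensor_map_tensor[OF linear_map_id lw] F.B.tensor_add_right hc[OF lu] hc[OF lw])
    then have "tensor_map R N2 M id (\<lambda>p. u p \<oplus>\<^bsub>M\<^esub> w p) U = ?f (V \<oplus>\<^bsub>F.A.MN\<^esub> W)"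
     unfolding VW(2,4) additive_map_add[OF Fa VW(1,3)] .
    then show ?case using Z1.a_closed[OF VW(1,3)] by blast
   next
    case (cong u w)
    have "w \<in> finite_rank R M" by (rule finite_rank.cong[OF cong(1)]) (rule cong(2))
    note lw = finite_rank_linear_left[OF M this] and lu = finite_rank_linear_left[OF M cong(1)]
    have "tensor_map R N2 M id w U = tensor_map R N2 M id u U"
    proof (rule F.B.tensor_maps_eqI[OF g2 S.tensor_map_additive[OF linear_map_id lw] S.tensor_map_additive[OF linear_map_id lu] _ U])
     fix x y assume xy: "x \<in> carrier N2" "y \<in> carrier M"
     show "tensor_map R N2 M id w (tensor R N2 M x y) = tensor_map R N2 M id u (tensor R N2 M x y)"
      unfolding S.tensor_map_tensor[OF linear_map_id lw xy] S.tensor_map_tensor[OF linear_map_id lu xy] cong(2)[OF xy(2)] ..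
    qed
    then show ?case using cong(3) by (simp only:)
   qed
   then show ?thesis using u(2) by simp
  qed
  ultimately show "exact_pair F.A.MN F.B.MN G.B.MN ?f ?g"
   unfolding exact_pair_def using additive_map_closed[OF Fa] by blast
 next
  assume ex: "exact_pair F.A.MN F.B.MN G.B.MN ?f ?g"
  have gf: "?g (?f U) = \<zero>\<^bsub>G.B.MN\<^esub>" if "U \<in> carrier F.A.MN" for U using ex that unfolding exact_pair_def by blast
  have lift: "\<exists>V\<in>carrier F.A.MN. U = ?f V" if "U \<in> carrier F.B.MN" "?g U = \<zero>\<^bsub>G.B.MN\<^esub>" for U
   using ex that unfolding exact_pair_def by blast
  have "g (f x) = \<zero>\<^bsub>N3\<^esub>" if x: "x \<in> carrier N1" for x
  proof -
   have "?s3 E (tensor R N3 M (g (f x)) e) = \<zero>\<^bsub>N3\<^esub>"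
    using gf[OF F.A.tensor_closed[OF x e(1)]] s3z[OF E] x e by (simp add: Ft Gt fc)
   then show ?thesis using x e by (simp add: G.B.slice_right(2)[OF E] gc fc N3.smult_one)
  qed
  moreover have "\<exists>y\<in>carrier N1. x = f y" if x: "x \<in> carrier N2" "g x = \<zero>\<^bsub>N3\<^esub>" for x
  proof -
   have "?g (tensor R N2 M x e) = \<zero>\<^bsub>G.B.MN\<^esub>" using x e by (simp add: Gt G.B.tensor_zero_left)
   then obtain V where V: "V \<in> carrier F.A.MN" "tensor R N2 M x e = ?f V"
    using lift F.B.tensor_closed x e by blast
   have "x = ?s2 E (tensor R N2 M x e)" using x e by (simp add: F.B.slice_right(2)[OF E] N2.smult_one)
   also have "\<dots> = f (?s1 E V)" unfolding V(2) by (rule slice_f[OF E V(1)])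
   finally show ?thesis using additive_map_closed[OF F.A.slice_right(1)[OF E] V(1)] by blast
  qed
  ultimately show "exact_pair N1 N2 N3 f g" unfolding exact_pair_def using fc by blast
 qed
qed

lemma exact_pair_transport:
 assumes \<omega>: "bij_betw \<omega>1 (carrier A1) (carrier C1)" "bij_betw \<omega>2 (carrier A2) (carrier C2)"
  and f: "\<And>x. x \<in> carrier A1 ==> f x \<in> carrier A2 \<and> f' (\<omega>1 x) = \<omega>2 (f x)"
  and g: "\<And>x. x \<in> carrier A2 ==> g' (\<omega>2 x) = \<zero>\<^bsub>C3\<^esub> \<longleftrightarrow> g x = \<zero>\<^bsub>A3\<^esub>"
 shows "exact_pair A1 A2 A3 f g \<longleftrightarrow> exact_pair C1 C2 C3 f' g'"
proof -
 have "f' ` carrier C1 = \<omega>2 ` f ` carrier A1"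
  using f unfolding bij_betw_imp_surj_on[OF \<omega>(1), symmetric] image_image by (intro image_cong) simp_all
 moreover have "{y \<in> carrier C2. g' y = \<zero>\<^bsub>C3\<^esub>} = \<omega>2 ` {x \<in> carrier A2. g x = \<zero>\<^bsub>A3\<^esub>}"
  using g unfolding bij_betw_imp_surj_on[OF \<omega>(2), symmetric] by blast
 moreover have "f ` carrier A1 \<subseteq> carrier A2" using f by blast
 ultimately show ?thesis unfolding exact_pair_def
  using inj_on_image_eq_iff[OF bij_betw_imp_inj_on[OF \<omega>(2)], of "f ` carrier A1" "{x \<in> carrier A2. g x = \<zero>\<^bsub>A3\<^esub>}"]
  by auto
qed

text \<open>An antiautomorphism \<open>s\<close> of the ring turns left modules into right modules.\<close>

definition twist :: "('r \<Rightarrow> 'r) \<Rightarrow> ('r, 'm) module \<Rightarrow> ('r, 'm) module" where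
 "twist s N = N\<lparr>module.smult := (\<lambda>r n. s r \<odot>\<^bsub>N\<^esub> n)\<rparr>"

lemma twist_simps [simp]:
 "carrier (twist s N) = carrier N" "\<zero>\<^bsub>twist s N\<^esub> = \<zero>\<^bsub>N\<^esub>" "x \<oplus>\<^bsub>twist s N\<^esub> y = x \<oplus>\<^bsub>N\<^esub> y"
 "r \<odot>\<^bsub>twist s N\<^esub> x = s r \<odot>\<^bsub>N\<^esub> x"
 by (simp_all add: twist_def)

text \<open>The flip of the two factors identifies \<open>M \<otimes> N\<close> with \<open>twist s N \<otimes> L\<close> when \<open>M\<close> is the right module
 obtained from \<open>L\<close> by \<open>s\<close>; hence flatness of \<open>L\<close> on the left is flatness of \<open>M\<close> on the right.\<close>

locale conjugation =
 fixes R :: "('r, 'k) ring_scheme" and s and L :: "('r, 'm) module" and M :: "('r, 'm2) module" and \<theta> \<theta>'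
 assumes L: "left_module R L" and M: "right_module R M"
  and s: "\<And>r. r \<in> carrier R ==> s r \<in> carrier R" "\<And>r. r \<in> carrier R ==> s (s r) = r" "s \<one>\<^bsub>R\<^esub> = \<one>\<^bsub>R\<^esub>"
   "\<And>r r'. [|r \<in> carrier R; r' \<in> carrier R|] ==> s (r \<oplus>\<^bsub>R\<^esub> r') = s r \<oplus>\<^bsub>R\<^esub> s r'"
   "\<And>r r'. [|r \<in> carrier R; r' \<in> carrier R|] ==> s (r \<otimes>\<^bsub>R\<^esub> r') = s r' \<otimes>\<^bsub>R\<^esub> s r"
  and \<theta>: "\<theta> \<in> additive_maps L M" "\<theta>' \<in> additive_maps M L" "\<And>x. x \<in> carrier L ==> \<theta>' (\<theta> x) = x"
   "\<And>y. y \<in> carrier M ==> \<theta> (\<theta>' y) = y"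
   "\<And>r x. [|r \<in> carrier R; x \<in> carrier L|] ==> \<theta> (r \<odot>\<^bsub>L\<^esub> x) = s r \<odot>\<^bsub>M\<^esub> \<theta> x"
begin

lemma twist_right: assumes N: "left_module R N" shows "right_module R (twist s N)"
proof -
 interpret N: left_module R N by (rule N)
 have "abelian_group (twist s N)" by (rule abelian_group_cong[OF N.M.abelian_group_axioms]) (simp_all add: fun_eq_iff)
 then show ?thesis unfolding right_module_def right_module_axioms_def
  using N.R.ring_axioms by (simp add: s N.smult_closed N.smult_l_distr N.smult_r_distr N.smult_one N.smult_assoc)
qed

definition "swap N = tensor_lift (tensor_group R (twist s N) L) (\<lambda>m n. tensor R (twist s N) L n (\<theta>' m))"

lemma swap:
 assumes N: "left_module R N"
 shows "swap N \<in> additive_maps (tensor_group R M N) (tensor_group R (twist s N) L)"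
  and "\<And>m n. [|m \<in> carrier M; n \<in> carrier N|] ==> swap N (tensor R M N m n) = tensor R (twist s N) L n (\<theta>' m)"
  and "bij_betw (swap N) (carrier (tensor_group R M N)) (carrier (tensor_group R (twist s N) L))"
proof -
 interpret A: tensor_pair R M N by (rule tensor_pair.intro[OF M N])
 interpret C: tensor_pair R "twist s N" L by (rule tensor_pair.intro[OF twist_right[OF N] L])
 interpret L: left_module R L by (rule L)
 interpret M: right_module R M by (rule M)
 interpret N: left_module R N by (rule N)
 note \<theta>c = additive_map_closed[OF \<theta>(1)] additive_map_closed[OF \<theta>(2)]
 have \<theta>': "\<theta>' (r \<odot>\<^bsub>M\<^esub> y) = s r \<odot>\<^bsub>L\<^esub> \<theta>' y" if "r \<in> carrier R" "y \<in> carrier M" for r y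
  using \<theta>(5)[of "s r" "\<theta>' y"] \<theta>(3)[of "s r \<odot>\<^bsub>L\<^esub> \<theta>' y"] that by (simp add: s \<theta>(4) \<theta>c L.smult_closed)
 have b: "bilinear_balanced R M N C.MN (\<lambda>m n. tensor R (twist s N) L n (\<theta>' m))"
  by (intro bilinear_balancedI)
   (simp_all add: C.tensor_closed C.tensor_add_left[simplified] C.tensor_add_right additive_map_add[OF \<theta>(2)] \<theta>c \<theta>' s
    C.tensor_balanced[symmetric])
 have b': "bilinear_balanced R (twist s N) L A.MN (\<lambda>n x. tensor R M N (\<theta> x) n)"
  by (intro bilinear_balancedI)
   (simp_all add: A.tensor_closed A.tensor_add_left A.tensor_add_right additive_map_add[OF \<theta>(1)] \<theta>c \<theta>(5) s A.tensor_balanced)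
 note l = C.tensor_lift_additive[OF A.tensor_group_abelian b'] C.tensor_lift_tensor[OF A.tensor_group_abelian b']
 show add: "swap N \<in> additive_maps A.MN C.MN"
  unfolding swap_def by (rule A.tensor_lift_additive[OF C.tensor_group_abelian b])
 show t: "swap N (tensor R M N m n) = tensor R (twist s N) L n (\<theta>' m)" if "m \<in> carrier M" "n \<in> carrier N" for m n
  unfolding swap_def by (rule A.tensor_lift_tensor[OF C.tensor_group_abelian b that])
 let ?w = "tensor_lift A.MN (\<lambda>n x. tensor R M N (\<theta> x) n)"
 have "?w (swap N U) = U" if U: "U \<in> carrier A.MN" for U
  by (rule A.tensor_maps_eqI[OF A.tensor_group_abelian additive_map_compose[OF add l(1)] _ _ U, of "\<lambda>U. U"])
   (simp_all add: t l(2) \<theta>c \<theta>(4) hom_def)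
 moreover have "swap N (?w U) = U" if U: "U \<in> carrier C.MN" for U
  by (rule C.tensor_maps_eqI[OF C.tensor_group_abelian additive_map_compose[OF l(1) add] _ _ U, of "\<lambda>U. U"])
   (simp_all add: t l(2) \<theta>c \<theta>(3) hom_def)
 ultimately show "bij_betw (swap N) (carrier A.MN) (carrier C.MN)"
  using additive_map_closed[OF add] additive_map_closed[OF l(1)] by (intro bij_betw_byWitness[of _ ?w]) auto
qed

lemma faithfully_flat_right:
 assumes "faithfully_flat_left TYPE('n1) TYPE('n2) TYPE('n3) R L"
 shows "faithfully_flat_right TYPE('n1) TYPE('n2) TYPE('n3) R M"
 unfolding faithfully_flat_right_def
proof (intro conjI allI impI M, elim conjE)
 fix N1 :: "('r, 'n1) module" and N2 :: "('r, 'n2) module" and N3 :: "('r, 'n3) module" and f g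
 assume N: "left_module R N1" "left_module R N2" "left_module R N3"
  and f: "f \<in> linear_maps N1 N2 (carrier R)" and g: "g \<in> linear_maps N2 N3 (carrier R)"
 have f': "f \<in> linear_maps (twist s N1) (twist s N2) (carrier R)" and g': "g \<in> linear_maps (twist s N2) (twist s N3) (carrier R)"
  using linear_mapsD[OF f] linear_mapsD[OF g] s(1)
  by (intro linear_mapsI additive_mapsI; simp add: additive_map_closed additive_map_add)+
 have nat: "tensor_map R (twist s K') L h id (swap K U) = swap K' (tensor_map R M K' id h U)
   \<and> tensor_map R M K' id h U \<in> carrier (tensor_group R M K')"
  if K: "left_module R K" "left_module R K'" and h: "h \<in> linear_maps K K' (carrier R)"
   and h': "h \<in> linear_maps (twist s K) (twist s K') (carrier R)" and U: "U \<in> carrier (tensor_group R M K)"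
  for K :: "('r, 'x) module" and K' :: "('r, 'y) module" and h U
 proof -
  interpret A: tensor_pairs2 R M K M K' by (intro tensor_pairs2.intro tensor_pair.intro K M)
  interpret C: tensor_pairs2 R "twist s K" L "twist s K'" L by (intro tensor_pairs2.intro tensor_pair.intro twist_right K L)
  note ma = A.tensor_map_additive[OF linear_map_id h] and mc = C.tensor_map_additive[OF h' linear_map_id]
  have "tensor_map R (twist s K') L h id (swap K U) = swap K' (tensor_map R M K' id h U)"
  proof (rule A.A.tensor_maps_eqI[OF C.B.tensor_group_abelian additive_map_compose[OF swap(1)[OF K(1)] mc]
     additive_map_compose[OF ma swap(1)[OF K(2)]] _ U])
   fix m n assume mn: "m \<in> carrier M" "n \<in> carrier K"
   have n': "n \<in> carrier (twist s K)" "h n \<in> carrier K'" "\<theta>' m \<in> carrier L"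
    using mn additive_map_closed[OF linear_mapsD(1)[OF h]] additive_map_closed[OF \<theta>(2)] by simp_all
   show "tensor_map R (twist s K') L h id (swap K (tensor R M K m n)) = swap K' (tensor_map R M K' id h (tensor R M K m n))"
    unfolding swap(2)[OF K(1) mn] A.tensor_map_tensor[OF linear_map_id h mn] id_apply
     C.tensor_map_tensor[OF h' linear_map_id n'(1,3)] swap(2)[OF K(2) mn(1) n'(2)] ..
  qed
  then show ?thesis using additive_map_closed[OF ma U] by blast
 qed
 have g0: "tensor_map R (twist s N3) L g id (swap N2 U) = \<zero>\<^bsub>tensor_group R (twist s N3) L\<^esub> \<longleftrightarrow>
   tensor_map R M N3 id g U = \<zero>\<^bsub>tensor_group R M N3\<^esub>" if U: "U \<in> carrier (tensor_group R M N2)" for U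
 proof -
  interpret A: tensor_pair R M N3 by (rule tensor_pair.intro[OF M N(3)])
  interpret C: tensor_pair R "twist s N3" L by (rule tensor_pair.intro[OF twist_right[OF N(3)] L])
  interpret Z: abelian_group A.MN by (rule A.tensor_group_abelian)
  note n = nat[OF N(2,3) g g' U]
  have z: "swap N3 \<zero>\<^bsub>A.MN\<^esub> = \<zero>\<^bsub>C.MN\<^esub>"
   by (rule additive_map_zero[OF A.tensor_group_abelian C.tensor_group_abelian swap(1)[OF N(3)]])
  show ?thesis unfolding conjunct1[OF n] z[symmetric]
   by (rule inj_on_eq_iff[OF bij_betw_imp_inj_on[OF swap(3)[OF N(3)]] conjunct2[OF n] Z.zero_closed])
 qed
 have "exact_pair N1 N2 N3 f g \<longleftrightarrow> exact_pair (twist s N1) (twist s N2) (twist s N3) f g"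
  by (simp add: exact_pair_def)
 also have "\<dots> \<longleftrightarrow> exact_pair (tensor_group R (twist s N1) L) (tensor_group R (twist s N2) L) (tensor_group R (twist s N3) L)
   (tensor_map R (twist s N2) L f id) (tensor_map R (twist s N3) L g id)"
  using assms twist_right[OF N(1)] twist_right[OF N(2)] twist_right[OF N(3)] f' g' unfolding faithfully_flat_left_def by blast
 also have "\<dots> \<longleftrightarrow> exact_pair (tensor_group R M N1) (tensor_group R M N2) (tensor_group R M N3)
   (tensor_map R M N2 id f) (tensor_map R M N3 id g)"
 proof (rule exact_pair_transport[symmetric])
  fix U assume "U \<in> carrier (tensor_group R M N1)"
  note n = nat[OF N(1,2) f f' this]
  show "tensor_map R M N2 id f U \<in> carrier (tensor_group R M N2) \<and>
    tensor_map R (twist s N2) L f id (swap N1 U) = swap N2 (tensor_map R M N2 id f U)"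
   by (rule conjI[OF conjunct2[OF n] conjunct1[OF n]])
 qed (rule swap(3)[OF N(1)] swap(3)[OF N(2)] | rule g0, assumption)+
 finally show "exact_pair N1 N2 N3 f g \<longleftrightarrow> exact_pair (tensor_group R M N1) (tensor_group R M N2) (tensor_group R M N3)
   (tensor_map R M N2 id f) (tensor_map R M N3 id g)" .
qed

end

section \<open>Faithful flatness over the sphere\<close>

lemma nc_vector_space: "vector_space (\<lambda>c (f :: 'g ncpoly). nc_const c * f)"
 by unfold_locales (simp_all add: nc_const_simps algebra_simps)

lemma finite_rank_finsum:
 assumes "abelian_group N" "finite J" "\<And>j. j \<in> J ==> c j \<in> linear_maps N (left_regular R) (carrier R)"
  and "\<And>j. j \<in> J ==> e j \<in> carrier N" "\<And>j p. j \<in> J ==> p \<in> carrier N ==> c j p \<odot>\<^bsub>N\<^esub> e j \<in> carrier N"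
 shows "\<exists>u\<in>finite_rank R N. \<forall>p\<in>carrier N. u p = (\<Oplus>\<^bsub>N\<^esub>j\<in>J. c j p \<odot>\<^bsub>N\<^esub> e j)"
 using assms(2-)
proof (induct J rule: finite_induct)
 interpret abelian_group N by fact
 case empty
 show ?case by (rule bexI[OF _ finite_rank.zero]) simp
next
 interpret abelian_group N by fact
 case (insert i J)
 then obtain u where u: "u \<in> finite_rank R N" "\<forall>p\<in>carrier N. u p = (\<Oplus>\<^bsub>N\<^esub>j\<in>J. c j p \<odot>\<^bsub>N\<^esub> e j)" by auto
 have "(\<lambda>p. c i p \<odot>\<^bsub>N\<^esub> e i \<oplus>\<^bsub>N\<^esub> u p) \<in> finite_rank R N"
  by (intro finite_rank.sum finite_rank.single u(1)) (use insert in auto)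
 then show ?case
 proof (rule bexI[rotated], intro ballI)
  show "c i p \<odot>\<^bsub>N\<^esub> e i \<oplus>\<^bsub>N\<^esub> u p = (\<Oplus>\<^bsub>N\<^esub>j\<in>insert i J. c j p \<odot>\<^bsub>N\<^esub> e j)" if "p \<in> carrier N" for p
   using insert that u(2) by (simp add: Pi_def)
 qed
qed

context spq
begin

text \<open>Vector spaces have bases. A basis of the kernel of the projection from the free algebra
 extends to a basis of the free algebra; the coordinates at the new basis vectors descend to
 the quotient.\<close>

lemma H_local_identities: "local_identities complex_algebra H"
 unfolding local_identities_def
proof (intro allI impI)
 fix F :: "spq set set" assume F: "finite F" "F \<subseteq> carrier H"
 interpret V: vector_space "\<lambda>c (f :: (nat \<times> nat) ncpoly). nc_const c * f" by (rule nc_vector_space)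
 define p where "p = (\<lambda>y. pr (I +>\<^bsub>FT\<^esub> y))"
 have p: "p \<in> algebra_maps FT H" unfolding p_def by (rule alg_map_compose[OF proj_P pr_hom])
 note pD = algebra_mapsD[OF p, unfolded FT_simps]
 have FT_cl: "0 \<in> carrier FT" "\<And>x y. x \<in> carrier FT ==> y \<in> carrier FT ==> x + y \<in> carrier FT"
  "\<And>x y. x \<in> carrier FT ==> y \<in> carrier FT ==> x - y \<in> carrier FT"
  "\<And>c x. x \<in> carrier FT ==> nc_const c * x \<in> carrier FT"
  unfolding FT_def by (auto intro: free_carrier_closed)
 have p0: "p 0 = \<zero>\<^bsub>H\<^esub>" using pD(5)[of 0 0] FT_cl(1) pD(1) by (simp add: nc_const_simps)
 have p_diff: "p (x - y) \<oplus>\<^bsub>H\<^esub> p y = p x" if "x \<in> carrier FT" "y \<in> carrier FT" for x y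
  using pD(3)[of "x - y" y] that FT_cl by simp
 let ?K = "{y \<in> carrier FT. p y = \<zero>\<^bsub>H\<^esub>}"
 obtain BK where BK: "BK \<subseteq> ?K" "V.independent BK" "?K \<subseteq> V.span BK"
  using V.maximal_independent_subset[of ?K] by blast
 have "BK \<subseteq> carrier FT" using BK(1) by blast
 then obtain BF where BF: "BK \<subseteq> BF" "BF \<subseteq> carrier FT" "V.independent BF" "carrier FT \<subseteq> V.span BF"
  using V.maximal_independent_subset_extend[OF _ BK(2)] by blast
 let ?rep = "V.representation BF"
 define lift where "lift h = (SOME y. y \<in> carrier FT \<and> p y = h)" for h
 have lift: "lift h \<in> carrier FT \<and> p (lift h) = h" if h: "h \<in> carrier H" for h
  unfolding lift_def
 proof (rule someI_ex)
  obtain x where x: "x \<in> carrier P" "h = pr x" using H_surj[OF h] by blast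
  obtain y where "y \<in> carrier FT" "x = I +>\<^bsub>FT\<^esub> y" using x(1) FT.quotient_simps(1) unfolding P_eq by auto
  then show "\<exists>y. y \<in> carrier FT \<and> p y = h" using x(2) by (auto simp: p_def)
 qed
 have rep_K: "?rep y b = 0" if "y \<in> ?K" "b \<notin> BK" for y b
 proof -
  have y: "y \<in> V.span BK" using BK(3) that by blast
  have "?rep y b = V.representation BK y b"
   using V.representation_extend[OF BF(3) y BF(1)] by simp
  then show ?thesis using V.representation_ne_zero[of BK y b] that(2) by metis
 qed
 have rep_eq: "?rep x b = ?rep y b" if "x \<in> carrier FT" "y \<in> carrier FT" "p x = p y" "b \<notin> BK" for x y b
 proof -
  have "p (x - y) \<oplus>\<^bsub>H\<^esub> p y = \<zero>\<^bsub>H\<^esub> \<oplus>\<^bsub>H\<^esub> p y" using p_diff[OF that(1,2)] that(3) pD(1)[OF that(2)] by simp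
  then have "x - y \<in> ?K" using FT_cl(3)[OF that(1,2)] pD(1) that(2) H.add.r_cancel[of "p y" "p (x - y)" "\<zero>\<^bsub>H\<^esub>"] by simp
  then have "?rep (x - y) b = 0" using rep_K that(4) by blast
  moreover have "x \<in> V.span BF" "y \<in> V.span BF" using BF(4) that by blast+
  ultimately show ?thesis using V.representation_diff[OF BF(3)] by (simp add: fun_eq_iff)
 qed
 define c where "c b h = (if b \<in> BK then 0 else ?rep (lift h) b)" for b h
 have c_lin: "c b \<in> linear_maps H (left_regular complex_algebra) (carrier complex_algebra)" for b
 proof (intro linear_mapsI additive_mapsI)
  fix h h' assume hh: "h \<in> carrier H" "h' \<in> carrier H"
  note l = lift[OF hh(1)] lift[OF hh(2)] lift[OF H.a_closed[OF hh]]
  have "?rep (lift (h \<oplus>\<^bsub>H\<^esub> h')) b = ?rep (lift h + lift h') b" if "b \<notin> BK"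
   by (rule rep_eq) (use l FT_cl pD(3) that in auto)
  moreover have "lift h \<in> V.span BF" "lift h' \<in> V.span BF" using BF(4) l by blast+
  ultimately show "c b (h \<oplus>\<^bsub>H\<^esub> h') = c b h \<oplus>\<^bsub>left_regular complex_algebra\<^esub> c b h'"
   using V.representation_add[OF BF(3)] by (simp add: c_def fun_eq_iff)
 next
  fix r h assume "r \<in> carrier complex_algebra" and h: "h \<in> carrier H"
  note l = lift[OF h] lift[OF H.smult_closed[OF h, of r]]
  have "?rep (lift (r \<odot>\<^bsub>H\<^esub> h)) b = ?rep (nc_const r * lift h) b" if "b \<notin> BK"
   by (rule rep_eq) (use l FT_cl pD(5) that in auto)
  moreover have "lift h \<in> V.span BF" using BF(4) l by blast
  ultimately show "c b (r \<odot>\<^bsub>H\<^esub> h) = r \<odot>\<^bsub>left_regular complex_algebra\<^esub> c b h"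
   using V.representation_scale[OF BF(3)] by (simp add: c_def fun_eq_iff)
 qed simp
 define J where "J = (\<Union>h\<in>F. {b. ?rep (lift h) b \<noteq> 0})"
 have J: "finite J" unfolding J_def by (rule finite_UN_I[OF F(1) V.finite_representation])
 have JF: "b \<in> BF" if bJ: "b \<in> J" for b
 proof -
  obtain h where "b \<in> {b. ?rep (lift h) b \<noteq> 0}" using bJ unfolding J_def by (rule UN_E)
  then have "?rep (lift h) b \<noteq> 0" by (rule CollectD)
  then show ?thesis by (rule V.representation_ne_zero)
 qed
 have pJ: "p b \<in> carrier H" if "b \<in> J" for b using subsetD[OF BF(2) JF[OF that]] by (rule pD(1))
 have "\<exists>u\<in>finite_rank complex_algebra H.
   \<forall>h\<in>carrier H. u h = (\<Oplus>\<^bsub>H\<^esub>b\<in>J. c b h \<odot>\<^bsub>H\<^esub> p b)"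
  by (rule finite_rank_finsum[where c = c and e = p, OF H.abelian_group_axioms J c_lin pJ H.smult_closed[OF pJ]])
 then obtain u where u: "u \<in> finite_rank complex_algebra H"
  "\<forall>h\<in>carrier H. u h = (\<Oplus>\<^bsub>H\<^esub>b\<in>J. c b h \<odot>\<^bsub>H\<^esub> p b)"
  by (rule bexE)
 have "u h = h" if h: "h \<in> F" for h
 proof -
  have hH: "h \<in> carrier H" using F(2) h by blast
  note l = lift[OF hH]
  have p_sum: "p (\<Sum>b\<in>G. f b) = (\<Oplus>\<^bsub>H\<^esub>b\<in>G. p (f b)) \<and> (\<Sum>b\<in>G. f b) \<in> carrier FT"
   if "finite G" "\<And>b. b \<in> G ==> f b \<in> carrier FT" for G and f :: "(nat \<times> nat) ncpoly \<Rightarrow> (nat \<times> nat) ncpoly"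
   using that
  proof (induct G rule: finite_induct)
   case (insert b G) then show ?case by (simp add: pD FT_cl Pi_def)
  qed (simp add: p0 FT_cl)
  have "lift h = (\<Sum>b | ?rep (lift h) b \<noteq> 0. nc_const (?rep (lift h) b) * b)"
   using V.sum_nonzero_representation_eq[OF BF(3)] BF(4) l by auto
  also have "\<dots> = (\<Sum>b\<in>J. nc_const (?rep (lift h) b) * b)"
   by (rule sum.mono_neutral_left[OF J]) (use h in \<open>auto simp: J_def nc_const_simps\<close>)
  finally have "p (lift h) = p (\<Sum>b\<in>J. nc_const (?rep (lift h) b) * b)" by (rule arg_cong)
  then have "h = p (\<Sum>b\<in>J. nc_const (?rep (lift h) b) * b)" unfolding conjunct2[OF l] .
  also have "\<dots> = (\<Oplus>\<^bsub>H\<^esub>b\<in>J. p (nc_const (?rep (lift h) b) * b))"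
   by (rule conjunct1[OF p_sum[OF J]], rule FT_cl(4), rule subsetD[OF BF(2) JF])
  also have "\<dots> = (\<Oplus>\<^bsub>H\<^esub>b\<in>J. c b h \<odot>\<^bsub>H\<^esub> p b)"
  proof (rule H.finsum_cong')
   fix b assume b: "b \<in> J"
   have bF: "b \<in> carrier FT" by (rule subsetD[OF BF(2) JF[OF b]])
   have "p b = \<zero>\<^bsub>H\<^esub>" if "b \<in> BK" using subsetD[OF BK(1) that] by simp
   then show "p (nc_const (?rep (lift h) b) * b) = c b h \<odot>\<^bsub>H\<^esub> p b"
    using pD(5)[OF bF] pJ[OF b] by (simp add: c_def)
  qed (use pJ in auto)
  finally show ?thesis using u(2) hH by simp
 qed
 then show "\<exists>u\<in>finite_rank complex_algebra H. \<forall>h\<in>F. u h = h"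
  by (intro bexI[OF _ u(1)] ballI)
qed

text \<open>Multiplication after projecting the first factor; it recovers \<open>p\<close> from \<open>1 \<otimes>\<^sub>B p\<close>.\<close>

definition Emul :: "(spq \<times> spq \<Rightarrow>\<^sub>0 int) set \<Rightarrow> spq" where
 "Emul = tensor_lift P (\<lambda>x y. E x \<cdot> y)"

lemma Emul_additive: "Emul \<in> additive_maps M P"
 and Emul_tb: "[|x \<in> carrier P; y \<in> carrier P|] ==> Emul (x \<otimes>\<^sub>B y) = E x \<cdot> y"
 unfolding Emul_def
 by (rule tb_lift[OF P.abelian_group_axioms];
   simp add: additive_map_add[OF E_additive] P.l_distr P.r_distr E_linear P.m_assoc B_carrier)+

text \<open>If \<open>p\<close> is coinvariant then \<open>p \<otimes>\<^sub>B 1\<close> and \<open>1 \<otimes>\<^sub>B p\<close> have the same image under the canonical map, so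
 they are equal; projecting the first factor gives \<open>p = E p\<close>.\<close>

lemma coinvariants_eq: "coinvariants P H co = B"
proof
 show "B \<subseteq> coinvariants P H co" using coaction_B B_carrier by (auto simp: coinvariants_def)
 show "coinvariants P H co \<subseteq> B"
 proof
  fix p assume "p \<in> coinvariants P H co"
  then have p: "p \<in> carrier P" "co p = ctensor P H p \<one>\<^bsub>H\<^esub>" by (auto simp: coinvariants_def)
  have "\<psi> (ctensor P H p \<one>\<^bsub>H\<^esub>) = p \<otimes>\<^sub>B \<^bold>1"
   using \<psi>_tensor[OF p(1) P.one_closed] p(1) by (simp add: algebra_mapsD[OF pr_hom] transl_one lm_tb)
  then have "\<^bold>1 \<otimes>\<^sub>B p = p \<otimes>\<^sub>B \<^bold>1" using \<psi>_coaction[OF p(1)] p(2) by simp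
  then have "E \<^bold>1 \<cdot> p = E p \<cdot> \<^bold>1" using Emul_tb p(1) by (metis P.one_closed)
  then have "p = E p" using p(1) by (simp add: E_B AS7_closed)
  then show "p \<in> B" using E_split(2)[OF p(1)] by simp
 qed
qed

lemma Emul_finite_rank:
 assumes s: "s \<in> additive_maps P P" "\<And>b p. b \<in> B ==> p \<in> carrier P ==> s (b \<cdot> p) = b \<cdot> s p" and m: "m \<in> carrier M"
 shows "(\<lambda>p. Emul (lm (s p) m)) \<in> finite_rank BR LP"
 using m
proof (induction m rule: TM.tensor_induct)
 case zero
 show ?case
 proof (rule finite_rank.cong[OF finite_rank.zero])
  fix p assume "p \<in> carrier LP"
  then show "Emul (lm (s p) \<zero>\<^bsub>M\<^esub>) = \<zero>\<^bsub>LP\<^esub>"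
   using additive_map_closed[OF s(1)] additive_map_zero[OF M_group M_group lm_additive]
    additive_map_zero[OF M_group P.abelian_group_axioms Emul_additive] by simp
 qed
next
 case (tensor l r)
 then have lr: "l \<in> carrier P" "r \<in> carrier P" by simp_all
 have h: "(\<lambda>p. E (s p \<cdot> l)) \<in> linear_maps LP (left_regular BR) (carrier BR)"
  using lr additive_map_closed[OF s(1)]
  by (intro linear_mapsI additive_mapsI)
   (simp_all add: E_split(2) additive_map_add[OF s(1)] P.l_distr additive_map_add[OF E_additive] s(2) P.m_assoc B_carrier E_linear)
 show ?case
 proof (rule finite_rank.cong[OF finite_rank.single[OF h, of r]])
  fix p assume "p \<in> carrier LP"
  then show "Emul (lm (s p) (l \<otimes>\<^sub>B r)) = E (s p \<cdot> l) \<odot>\<^bsub>LP\<^esub> r"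
   using lr additive_map_closed[OF s(1)] by (simp add: lm_tb Emul_tb)
 qed (use lr in simp)
next
 case (add V W)
 show ?case
 proof (rule finite_rank.cong[OF finite_rank.sum[OF add(3,4)]])
  fix p assume "p \<in> carrier LP"
  then show "Emul (lm (s p) (V \<oplus>\<^bsub>M\<^esub> W)) = Emul (lm (s p) V) \<oplus>\<^bsub>LP\<^esub> Emul (lm (s p) W)"
   using add(1,2) additive_map_closed[OF s(1)]
   by (simp add: additive_map_add[OF lm_additive] additive_map_add[OF Emul_additive] lm_closed)
 qed
qed

lemma coaction_left: "b \<in> B ==> p \<in> carrier P ==> co (b \<cdot> p) = ctensor P H b \<one>\<^bsub>H\<^esub> \<otimes>\<^bsub>PH.AB\<^esub> co p"
 by (simp add: algebra_mapsD[OF coaction_hom] B_carrier coaction_B)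

text \<open>The translation map turns functionals on \<open>A(Sp\<^sub>q(1))\<close> into \<open>B\<close>-linear functionals: for
 \<open>u = c(-) e\<close> with \<open>\<tau>(e) = \<Sum> l \<otimes>\<^sub>B r\<close> the map is \<open>p \<mapsto> \<Sum> E(p\<^sub>0 c(p\<^sub>1) l) r\<close>.\<close>

lemma transported_finite_rank:
 assumes "u \<in> finite_rank complex_algebra H"
 shows "(\<lambda>p. Emul (\<psi> (ctensor_map P H id u (co p)))) \<in> finite_rank BR LP"
 using assms
proof induction
 interpret S: tensor_pairs2 complex_algebra P H P H by (rule PH.tp.tensor_self)
 note lin = finite_rank_linear_left[OF H.left_module_complex]
 have coM: "co p \<in> carrier PH.tp.MN" if "p \<in> carrier P" for p
  using algebra_mapsD(1)[OF coaction_hom that] by (simp add: PH.tensor_algebra_simps)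
 note MNg = PH.tp.tensor_group_abelian
 interpret MN: abelian_group PH.tp.MN by (rule MNg)
 have psi: "\<psi> \<in> additive_maps PH.tp.MN M" using \<psi>_additive unfolding PH.additive_maps_AB .
 note full = additive_map_compose[OF psi Emul_additive]
 {
  case zero
  show ?case
  proof (rule finite_rank.cong[OF finite_rank.zero])
   fix p assume "p \<in> carrier LP"
   then have U: "co p \<in> carrier PH.tp.MN" using coM by simp
   have "ctensor_map P H id (\<lambda>p. \<zero>\<^bsub>H\<^esub>) (co p) = \<zero>\<^bsub>PH.tp.MN\<^esub>"
   proof (rule PH.tp.tensor_maps_eqI[OF MNg S.tensor_map_additive[OF linear_map_id lin[OF finite_rank.zero]] _ _ U])
    show "(\<lambda>_. \<zero>\<^bsub>PH.tp.MN\<^esub>) \<in> additive_maps PH.tp.MN PH.tp.MN" by (intro additive_mapsI) simp_all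
   qed (simp add: S.tensor_map_tensor[OF linear_map_id lin[OF finite_rank.zero]] PH.tensor_algebra_simps(2))
   then show "Emul (\<psi> (ctensor_map P H id (\<lambda>p. \<zero>\<^bsub>H\<^esub>) (co p))) = \<zero>\<^bsub>LP\<^esub>"
    using additive_map_zero[OF MNg P.abelian_group_axioms full] by (simp only: regular_simps)
  qed
 next
  case (single c e)
  note sl = PH.tp.slice_right[OF single(1)]
  let ?s = "\<lambda>p. tensor_lift P (\<lambda>x y. c y \<^bold>* x) (co p)"
  obtain z where z: "z \<in> carrier P" "e = pr z" using H_surj[OF single(2)] by blast
  have s_add: "?s \<in> additive_maps P P"
   by (rule additive_map_compose[OF alg_map_additive[OF coaction_hom]])
    (unfold PH.additive_maps_AB, rule sl(1))
  have s_lin: "?s (b \<cdot> p) = b \<cdot> ?s p" if bp: "b \<in> B" "p \<in> carrier P" for b p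
  proof -
   have bc: "ctensor P H b \<one>\<^bsub>H\<^esub> \<in> carrier PH.AB" using bp B_carrier by simp
   have sl1: "tensor_lift P (\<lambda>x y. c y \<^bold>* x) \<in> additive_maps PH.AB P"
    unfolding PH.additive_maps_AB by (rule sl(1))
   show ?thesis unfolding coaction_left[OF bp]
    by (rule PH.AB_maps_eqI[OF P.abelian_group_axioms additive_map_compose[OF PH.AB_mult_additive_right[OF bc] sl1]
      additive_map_compose[OF sl1 P.mult_left_additive[OF B_carrier[OF bp(1)]]] _ algebra_mapsD(1)[OF coaction_hom bp(2)]])
     (use bp in \<open>simp add: sl(2) B_carrier P.smult_mult_right\<close>)
  qed
  show ?case
  proof (rule finite_rank.cong[OF Emul_finite_rank[OF s_add s_lin transl_closed[OF z(1)]]])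
   fix p assume "p \<in> carrier LP"
   then have p: "p \<in> carrier P" and U: "co p \<in> carrier PH.tp.MN" using coM by simp_all
   note l = lin[OF finite_rank.single[OF single]]
   have "ctensor_map P H id (\<lambda>p. c p \<odot>\<^bsub>H\<^esub> e) (co p) = ctensor P H (?s p) e"
   proof (rule PH.tp.tensor_maps_eqI[OF MNg S.tensor_map_additive[OF linear_map_id l] _ _ U])
    show "(\<lambda>U. ctensor P H (tensor_lift P (\<lambda>x y. c y \<^bold>* x) U) e) \<in> additive_maps PH.tp.MN PH.tp.MN"
     by (rule additive_map_compose[OF sl(1) PH.tp.tensor_map_left[OF single(2)]])
    fix x y assume "x \<in> carrier P" "y \<in> carrier H"
    then show "ctensor_map P H id (\<lambda>p. c p \<odot>\<^bsub>H\<^esub> e) (ctensor P H x y) = ctensor P H (tensor_lift P (\<lambda>x y. c y \<^bold>* x) (ctensor P H x y)) e"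
     using single(2) by (simp add: S.tensor_map_tensor[OF linear_map_id l] sl(2) PH.AB_balanced)
   qed
   then show "Emul (\<psi> (ctensor_map P H id (\<lambda>p. c p \<odot>\<^bsub>H\<^esub> e) (co p))) = Emul (lm (?s p) (transl z))"
    using \<psi>_tensor[OF additive_map_closed[OF s_add p] z(1)] z(2) by (simp only:)
  qed
 next
  case (sum u w)
  note lu = lin[OF sum(1)] and lw = lin[OF sum(2)] and ls = lin[OF finite_rank.sum[OF sum(1,2)]]
  note hc = additive_map_closed[OF linear_mapsD(1)]
  show ?case
  proof (rule finite_rank.cong[OF finite_rank.sum[OF sum(3,4)]])
   fix p assume "p \<in> carrier LP"
   then have U: "co p \<in> carrier PH.tp.MN" using coM by simp
   have "ctensor_map P H id (\<lambda>p. u p \<oplus>\<^bsub>H\<^esub> w p) (co p) = ctensor_map P H id u (co p) \<oplus>\<^bsub>PH.tp.MN\<^esub> ctensor_map P H id w (co p)"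
    by (rule PH.tp.tensor_maps_eqI[OF MNg S.tensor_map_additive[OF linear_map_id ls]
       additive_map_sum[OF MNg S.tensor_map_additive[OF linear_map_id lu] S.tensor_map_additive[OF linear_map_id lw]] _ U])
     (simp add: S.tensor_map_tensor[OF linear_map_id ls] S.tensor_map_tensor[OF linear_map_id lu]
       S.tensor_map_tensor[OF linear_map_id lw] PH.tp.tensor_add_right hc[OF lu] hc[OF lw])
   then show "Emul (\<psi> (ctensor_map P H id (\<lambda>p. u p \<oplus>\<^bsub>H\<^esub> w p) (co p))) =
     Emul (\<psi> (ctensor_map P H id u (co p))) \<oplus>\<^bsub>LP\<^esub> Emul (\<psi> (ctensor_map P H id w (co p)))"
    using additive_map_add[OF full additive_map_closed[OF S.tensor_map_additive[OF linear_map_id lu] U]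
      additive_map_closed[OF S.tensor_map_additive[OF linear_map_id lw] U]] by (simp only: regular_simps)
  qed
 next
  case (cong u w)
  have w: "w \<in> finite_rank complex_algebra H"
   by (rule finite_rank.cong[OF cong(1)]) (rule cong(2))
  show ?case
  proof (rule finite_rank.cong[OF cong(3)])
   fix p assume "p \<in> carrier LP"
   then have U: "co p \<in> carrier PH.tp.MN" using coM by simp
   have "ctensor_map P H id w (co p) = ctensor_map P H id u (co p)"
   proof (rule PH.tp.tensor_maps_eqI[OF MNg S.tensor_map_additive[OF linear_map_id lin[OF w]] S.tensor_map_additive[OF linear_map_id lin[OF cong(1)]] _ U])
    fix x y assume xy: "x \<in> carrier P" "y \<in> carrier H"
    show "ctensor_map P H id w (ctensor P H x y) = ctensor_map P H id u (ctensor P H x y)"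
     unfolding S.tensor_map_tensor[OF linear_map_id lin[OF w] xy] S.tensor_map_tensor[OF linear_map_id lin[OF cong(1)] xy] cong(2)[OF xy(2)] ..
   qed
   then show "Emul (\<psi> (ctensor_map P H id w (co p))) = Emul (\<psi> (ctensor_map P H id u (co p)))" by (simp only:)
  qed
 }
qed

text \<open>If \<open>u\<close> fixes the coactions of finitely many \<open>p\<close> then the transported map sends \<open>p\<close> to
 \<open>E(1) p = p\<close>, by \<open>\<psi> (co p) = 1 \<otimes>\<^sub>B p\<close>.\<close>

lemma LP_local_identities: "local_identities BR LP"
 unfolding local_identities_def
proof (intro allI impI)
 fix F assume F: "finite F" "F \<subseteq> carrier LP"
 have co_cl: "co ` F \<subseteq> carrier PH.tp.MN"
  using F(2) algebra_mapsD(1)[OF coaction_hom] by (auto simp: PH.tensor_algebra_simps)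
 obtain u where u: "u \<in> finite_rank complex_algebra H"
  "\<forall>U\<in>co ` F. ctensor_map P H id u U = U"
  using PH.tp.local_identity_right[OF finite_imageI[OF F(1)] co_cl H_local_identities] by blast
 have "Emul (\<psi> (ctensor_map P H id u (co p))) = p" if p: "p \<in> F" for p
 proof -
  have pP: "p \<in> carrier P" using F(2) p by auto
  have "ctensor_map P H id u (co p) = co p" using u(2) p by blast
  then have "Emul (\<psi> (ctensor_map P H id u (co p))) = E \<^bold>1 \<cdot> p"
   using \<psi>_coaction[OF pP] Emul_tb[OF P.one_closed pP] by (simp only:)
  then show ?thesis using pP by (simp add: E_B AS7_closed)
 qed
 then show "\<exists>u\<in>finite_rank BR LP. \<forall>p\<in>F. u p = p"
  by (intro bexI[OF _ transported_finite_rank[OF u(1)]] ballI)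
qed

text \<open>The antiinvolution preserves \<open>B\<close> and exchanges the two module structures.\<close>

lemma conjugation_star: "conjugation BR star LP RP star star"
 using P.regular_modules[OF B_subring]
 by (intro conjugation.intro additive_mapsI) (simp_all add: star_props star_star star_B B_carrier)

lemma flatness_left: "faithfully_flat_left TYPE('n1) TYPE('n2) TYPE('n3) BR LP"
proof (rule faithfully_flat_leftI[OF P.regular_modules(1)[OF B_subring] LP_local_identities])
 show "E \<in> linear_maps LP (left_regular BR) (carrier BR)"
  by (intro linear_mapsI additive_mapsI) (simp_all add: E_split(2) E_linear additive_map_add[OF E_additive])
 show "\<^bold>1 \<in> carrier LP" "E \<^bold>1 = \<one>\<^bsub>BR\<^esub>" by (simp_all add: E_B AS7_closed)
qed

lemma hopf_galois_S7: "hopf_galois B P H \<Delta>H \<epsilon>H SH co"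
 unfolding hopf_galois_def
 using hopf_algebra_H comodule_algebra_P coinvariants_eq canonical_map_bij by simp

end

theorem proposition6:
  fixes q :: real
  assumes "q \<noteq> 0"
  shows "(\<forall>i\<in>{1..4}. \<forall>j\<in>{1..4}. coaction q (Tmat q i j) =
           (\<Oplus>\<^bsub>tensor_algebra (ASp2 q) (ASp1 q)\<^esub>k\<in>{1..4}.
              ctensor (ASp2 q) (ASp1 q) (Tmat q i k) (Tmat1 q k j)))
       \<and> hopf_galois (AS7 q) (ASp2 q) (ASp1 q) (comult1 q) (counit1 q) (antipode1 q) (coaction q)
       \<and> faithfully_flat_left TYPE('n1) TYPE('n2) TYPE('n3)
           (ASp2 q\<lparr>carrier := AS7 q\<rparr>) (left_regular (ASp2 q))
       \<and> faithfully_flat_right TYPE('n1) TYPE('n2) TYPE('n3)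
           (ASp2 q\<lparr>carrier := AS7 q\<rparr>) (right_regular (ASp2 q))"
proof -
  interpret spq q by (rule spq.intro) (rule assms)
  show ?thesis using coaction_T hopf_galois_S7 flatness_left conjugation.faithfully_flat_right[OF conjugation_star flatness_left]
    by blast
qed

end
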